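(* There exist a Banach function space $X$ and a sectorial operator $A$ on $X$ such that both $A$ and its adjoint $A^*$ (on $X^*$) are $R$-sectorial and have a bounded $H^\infty$-calculus of angle $0$, but neither $A$ nor $A^*$ has maximal $L^p$-regularity on any bounded interval $(0,T)$, $T\in(0,\infty)$, or on $\mathbb R_+$, for any $p\in(1,\infty)$.
   Context: All Banach spaces are complex; $\mathbb R_+=(0,\infty)$; Rademacher variables are complex (Steinhaus, i.e. uniformly distributed on the unit circle), and $(\varepsilon_n)$ denotes an independent sequence of them. A Banach function space over a $\sigma$-finite measure space $(S,\Sigma,\mu)$ is a Banach space $X$ of (classes of) measurable functions on $S$ such that (ideal property) $f\in X$, $g$ measurable, $|g|\le|f|$ a.e. imply $g\in X$, $\|g\|\le\|f\|$, and (saturation) every measurable set of positive measure contains a measurable set $F$ of positive measure with $\mathbf 1_F\in X$. For $\sigma\in(0,\pi)$ let $\Sigma_\sigma=\{z\in\mathbb C\setminus\{0\}:|\arg z|<\sigma\}$, $R(\lambda,A)=(\lambda-A)^{-1}$. $A$ is sectorial if for some $\sigma\in(0,\pi)$ its spectrum lies in $\overline{\Sigma_\sigma}$ and $\{\lambda R(\lambda,A):\lambda\notin\overline{\Sigma_\sigma}\}$ is uniformly bounded; $\omega(A)$ is the infimum of such $\sigma$. Sectorial operators are assumed densely defined. $A$ is $R$-sectorial if, for some $\sigma$, this family is moreover $R$-bounded. A family $\mathscr T$ of bounded operators from $E$ to $F$ is $R$-bounded if there is $C$ with $(\mathbb E\|\sum_{n=1}^N\varepsilon_nT_nx_n\|^2)^{1/2}\le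 C(\mathbb E\|\sum_{n=1}^N\varepsilon_nx_n\|^2)^{1/2}$ for all $N\ge1$, $T_n\in\mathscr T$, $x_n\in E$. $A$ has a bounded $H^\infty(\Sigma_\sigma)$-calculus, $\sigma\in(\omega(A),\pi)$, if there is $C$ with $\|\varphi(A)\|\le C\sup_{\Sigma_\sigma}|\varphi|$ for all $\varphi\in H^1(\Sigma_\sigma)\cap H^\infty(\Sigma_\sigma)$, where $\varphi(A)=\frac1{2\pi i}\int_{\partial\Sigma_\nu}\varphi(z)R(z,A)\,dz$, $\nu\in(\omega(A),\sigma)$, and $H^1(\Sigma_\sigma)$ is the space of holomorphic $\varphi$ with $\sup_{|\nu|<\sigma}\int_0^\infty|\varphi(e^{i\nu}t)|\frac{dt}t<\infty$. The angle of the calculus is the infimum of such $\sigma$. Maximal $L^p$-regularity on $I=(0,T)$ or $I=\mathbb R_+$: let $A$ be a densely defined sectorial operator on a Banach space $Y$ such that $-A$ generates an analytic $C_0$-semigroup $(S(t))_{t\ge0}$. For $f\in L^1_{\rm loc}(\overline I;Y)$ put $u_f(t):=\int_0^tS(t-s)f(s)\,ds$. $A$ has maximal $L^p$-regularity on $I$ if there is $C$ such that for all $f\in L^p(I;Y)$ one has $u_f(t)\in\mathsf D(A)$ for almost all $t\in I$ and $\|Au_f\|_{L^p(I;Y)}\le C\|f\|_{L^p(I;Y)}$. *)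

theory Defs
  imports "HOL-Probability.Probability" "HOL-Algebra.Module"
begin

section \<open>Complex Banach spaces on carriers\<close>

text \<open>
  The space in the theorem is existentially quantified and its dual occurs as well, so Banach
  spaces are values (module records over the complex field, extended by a norm), not types.
  The fields mult and one that a module record inherits from ring records are never used.
\<close>

definition complex_field :: "complex ring"
  where "complex_field = \<lparr>carrier = UNIV, monoid.mult = (*), one = 1, ring.zero = 0, add = (+)\<rparr>"

record 'v cnormed = "(complex, 'v) module" +
  vnorm :: "'v \<Rightarrow> real"

locale cnormed_space = module complex_field V for V :: "'v cnormed" (structure) +
  assumes vnorm_nonneg: "x \<in> carrier V \<Longrightarrow> 0 \<le> vnorm V x"
    and vnorm_eq_zero: "x \<in> carrier V \<Longrightarrow> vnorm V x = 0 \<longleftrightarrow> x = \<zero>"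
    and vnorm_triangle: "x \<in> carrier V \<Longrightarrow> y \<in> carrier V \<Longrightarrow> vnorm V (x \<oplus> y) \<le> vnorm V x + vnorm V y"
    and vnorm_smult: "x \<in> carrier V \<Longrightarrow> vnorm V (c \<odot> x) = cmod c * vnorm V x"

locale cbanach_space = cnormed_space +
  assumes complete: "\<lbrakk>\<And>n::nat. u n \<in> carrier V;
      \<And>e. 0 < e \<Longrightarrow> \<exists>N. \<forall>m\<ge>N. \<forall>n\<ge>N. vnorm V (u m \<ominus> u n) < e\<rbrakk>
    \<Longrightarrow> \<exists>l\<in>carrier V. (\<lambda>n. vnorm V (u n \<ominus> l)) \<longlonglongrightarrow> 0"

definition complex_space :: "complex cnormed"
  where "complex_space = \<lparr>carrier = UNIV, monoid.mult = (*), one = 1, ring.zero = 0, add = (+),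
    smult = (*), vnorm = cmod\<rparr>"

text \<open>
  Bounded linear operators with the operator norm.  An operator is a function that is
  \<^const>\<open>undefined\<close> off the carrier, so that equality of operators is equality of functions.
\<close>

definition bounded_ops :: "'v cnormed \<Rightarrow> 'w cnormed \<Rightarrow> ('v \<Rightarrow> 'w) cnormed"
  where "bounded_ops V W = \<lparr>
    carrier = {T \<in> carrier V \<rightarrow>\<^sub>E carrier W.
      (\<forall>x\<in>carrier V. \<forall>y\<in>carrier V. T (x \<oplus>\<^bsub>V\<^esub> y) = T x \<oplus>\<^bsub>W\<^esub> T y) \<and>
      (\<forall>c. \<forall>x\<in>carrier V. T (c \<odot>\<^bsub>V\<^esub> x) = c \<odot>\<^bsub>W\<^esub> T x) \<and>
      (\<exists>C. \<forall>x\<in>carrier V. vnorm W (T x) \<le> C * vnorm V x)},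
    monoid.mult = undefined,
    one = undefined,
    ring.zero = (\<lambda>x\<in>carrier V. \<zero>\<^bsub>W\<^esub>),
    add = (\<lambda>S T. \<lambda>x\<in>carrier V. S x \<oplus>\<^bsub>W\<^esub> T x),
    smult = (\<lambda>c T. \<lambda>x\<in>carrier V. c \<odot>\<^bsub>W\<^esub> T x),
    vnorm = (\<lambda>T. SUP x\<in>{x \<in> carrier V. vnorm V x \<le> 1}. vnorm W (T x))\<rparr>"

definition dual :: "'v cnormed \<Rightarrow> ('v \<Rightarrow> complex) cnormed"
  where "dual V = bounded_ops V complex_space"


section \<open>Banach function spaces\<close>

definition ae_class :: "'s measure \<Rightarrow> ('s \<Rightarrow> complex) \<Rightarrow> ('s \<Rightarrow> complex) set"
  where "ae_class M f = {g \<in> borel_measurable M. AE s in M. g s = f s}"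

definition banach_function_space :: "'s measure \<Rightarrow> ('s \<Rightarrow> complex) set cnormed \<Rightarrow> bool"
  where "banach_function_space M X \<longleftrightarrow>
    sigma_finite_measure M \<and>
    cbanach_space X \<and>
    carrier X \<subseteq> ae_class M ` borel_measurable M \<and>
    (\<forall>f\<in>borel_measurable M. \<forall>g\<in>borel_measurable M.
      ae_class M f \<in> carrier X \<longrightarrow> ae_class M g \<in> carrier X \<longrightarrow>
      ae_class M f \<oplus>\<^bsub>X\<^esub> ae_class M g = ae_class M (\<lambda>s. f s + g s)) \<and>
    (\<forall>c. \<forall>f\<in>borel_measurable M. ae_class M f \<in> carrier X \<longrightarrow>
      c \<odot>\<^bsub>X\<^esub> ae_class M f = ae_class M (\<lambda>s. c * f s)) \<and>
    (\<forall>f\<in>borel_measurable M. \<forall>g\<in>borel_measurable M.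
      ae_class M f \<in> carrier X \<longrightarrow> (AE s in M. cmod (g s) \<le> cmod (f s)) \<longrightarrow>
      ae_class M g \<in> carrier X \<and> vnorm X (ae_class M g) \<le> vnorm X (ae_class M f)) \<and>
    (\<forall>E\<in>sets M. emeasure M E > 0 \<longrightarrow>
      (\<exists>F\<in>sets M. F \<subseteq> E \<and> emeasure M F > 0 \<and> ae_class M (indicator F) \<in> carrier X))"


section \<open>Bochner integration\<close>

text \<open>
  The library's Bochner integral is tied to types of class second-countable Banach; its
  definition is repeated here for carriers.
\<close>

definition simple_fun :: "'v cnormed \<Rightarrow> 'b measure \<Rightarrow> ('b \<Rightarrow> 'v) \<Rightarrow> bool"
  where "simple_fun V M s \<longleftrightarrow> simple_function M s \<and> s \<in> space M \<rightarrow> carrier V"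

definition strongly_measurable :: "'v cnormed \<Rightarrow> 'b measure \<Rightarrow> ('b \<Rightarrow> 'v) \<Rightarrow> bool"
  where "strongly_measurable V M f \<longleftrightarrow>
    (AE t in M. f t \<in> carrier V) \<and>
    (\<exists>s::nat \<Rightarrow> 'b \<Rightarrow> 'v. (\<forall>i. simple_fun V M (s i)) \<and>
      (AE t in M. (\<lambda>i. vnorm V (s i t \<ominus>\<^bsub>V\<^esub> f t)) \<longlonglongrightarrow> 0))"

definition simple_integral_in :: "'v cnormed \<Rightarrow> 'b measure \<Rightarrow> ('b \<Rightarrow> 'v) \<Rightarrow> 'v"
  where "simple_integral_in V M s =
    finsum V (\<lambda>y. of_real (measure M {t \<in> space M. s t = y}) \<odot>\<^bsub>V\<^esub> y) (s ` space M)"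

definition has_bochner_integral_in :: "'v cnormed \<Rightarrow> 'b measure \<Rightarrow> ('b \<Rightarrow> 'v) \<Rightarrow> 'v \<Rightarrow> bool"
  where "has_bochner_integral_in V M f x \<longleftrightarrow>
    x \<in> carrier V \<and> strongly_measurable V M f \<and>
    (\<exists>s::nat \<Rightarrow> 'b \<Rightarrow> 'v.
      (\<forall>i. simple_fun V M (s i) \<and> emeasure M {t \<in> space M. s i t \<noteq> \<zero>\<^bsub>V\<^esub>} \<noteq> \<infinity>) \<and>
      (\<lambda>i. \<integral>\<^sup>+ t. ennreal (vnorm V (f t \<ominus>\<^bsub>V\<^esub> s i t)) \<partial>M) \<longlonglongrightarrow> 0 \<and>
      (\<lambda>i. vnorm V (simple_integral_in V M (s i) \<ominus>\<^bsub>V\<^esub> x)) \<longlonglongrightarrow> 0)"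

definition bochner_integral_in :: "'v cnormed \<Rightarrow> 'b measure \<Rightarrow> ('b \<Rightarrow> 'v) \<Rightarrow> 'v"
  where "bochner_integral_in V M f =
    (if \<exists>x. has_bochner_integral_in V M f x then THE x. has_bochner_integral_in V M f x else \<zero>\<^bsub>V\<^esub>)"

definition Lp :: "'v cnormed \<Rightarrow> real \<Rightarrow> real set \<Rightarrow> (real \<Rightarrow> 'v) set"
  where "Lp V p I = {f. strongly_measurable V (restrict_space lborel I) f \<and>
    (\<integral>\<^sup>+ t. ennreal (vnorm V (f t) powr p) \<partial>restrict_space lborel I) < \<infinity>}"

definition Lp_norm :: "'v cnormed \<Rightarrow> real \<Rightarrow> real set \<Rightarrow> (real \<Rightarrow> 'v) \<Rightarrow> real"
  where "Lp_norm V p I f =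
    enn2real (\<integral>\<^sup>+ t. ennreal (vnorm V (f t) powr p) \<partial>restrict_space lborel I) powr (1 / p)"


section \<open>Unbounded operators and sectoriality\<close>

text \<open>
  An unbounded operator is identified with its graph; its domain is \<^const>\<open>Domain\<close> of the graph.
\<close>

definition linear_operator :: "'v cnormed \<Rightarrow> ('v \<times> 'v) set \<Rightarrow> bool"
  where "linear_operator V A \<longleftrightarrow>
    A \<subseteq> carrier V \<times> carrier V \<and> single_valued A \<and> (\<zero>\<^bsub>V\<^esub>, \<zero>\<^bsub>V\<^esub>) \<in> A \<and>
    (\<forall>(x, y)\<in>A. \<forall>(x', y')\<in>A. (x \<oplus>\<^bsub>V\<^esub> x', y \<oplus>\<^bsub>V\<^esub> y') \<in> A) \<and>
    (\<forall>c. \<forall>(x, y)\<in>A. (c \<odot>\<^bsub>V\<^esub> x, c \<odot>\<^bsub>V\<^esub> y) \<in> A)"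

definition op_apply :: "('v \<times> 'v) set \<Rightarrow> 'v \<Rightarrow> 'v"
  where "op_apply A x = (THE y. (x, y) \<in> A)"

definition densely_defined :: "'v cnormed \<Rightarrow> ('v \<times> 'v) set \<Rightarrow> bool"
  where "densely_defined V A \<longleftrightarrow>
    (\<forall>x\<in>carrier V. \<forall>e>0. \<exists>y\<in>Domain A. vnorm V (x \<ominus>\<^bsub>V\<^esub> y) < e)"

definition adjoint_op :: "'v cnormed \<Rightarrow> ('v \<times> 'v) set \<Rightarrow> (('v \<Rightarrow> complex) \<times> ('v \<Rightarrow> complex)) set"
  where "adjoint_op V A = {(f, g). f \<in> carrier (dual V) \<and> g \<in> carrier (dual V) \<and>
    (\<forall>(x, y)\<in>A. f y = g x)}"

definition resolvent :: "'v cnormed \<Rightarrow> ('v \<times> 'v) set \<Rightarrow> complex \<Rightarrow> 'v \<Rightarrow> 'v"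
  where "resolvent V A z =
    (\<lambda>y\<in>carrier V. THE x. x \<in> Domain A \<and> (z \<odot>\<^bsub>V\<^esub> x) \<ominus>\<^bsub>V\<^esub> op_apply A x = y)"

definition resolvent_set :: "'v cnormed \<Rightarrow> ('v \<times> 'v) set \<Rightarrow> complex set"
  where "resolvent_set V A = {z.
    (\<forall>y\<in>carrier V. \<exists>!x. x \<in> Domain A \<and> (z \<odot>\<^bsub>V\<^esub> x) \<ominus>\<^bsub>V\<^esub> op_apply A x = y) \<and>
    resolvent V A z \<in> carrier (bounded_ops V V)}"

definition spectrum :: "'v cnormed \<Rightarrow> ('v \<times> 'v) set \<Rightarrow> complex set"
  where "spectrum V A = - resolvent_set V A"

definition sector :: "real \<Rightarrow> complex set"
  where "sector \<sigma> = {z. z \<noteq> 0 \<and> \<bar>Arg z\<bar> < \<sigma>}"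

definition sectorial_family :: "'v cnormed \<Rightarrow> ('v \<times> 'v) set \<Rightarrow> real \<Rightarrow> ('v \<Rightarrow> 'v) set"
  where "sectorial_family V A \<sigma> =
    {z \<odot>\<^bsub>bounded_ops V V\<^esub> resolvent V A z | z. z \<notin> closure (sector \<sigma>)}"

definition sectorial_angles :: "'v cnormed \<Rightarrow> ('v \<times> 'v) set \<Rightarrow> real set"
  where "sectorial_angles V A = {\<sigma>. 0 < \<sigma> \<and> \<sigma> < pi \<and> spectrum V A \<subseteq> closure (sector \<sigma>) \<and>
    (\<exists>C. \<forall>T\<in>sectorial_family V A \<sigma>. vnorm (bounded_ops V V) T \<le> C)}"

definition sectorial :: "'v cnormed \<Rightarrow> ('v \<times> 'v) set \<Rightarrow> bool"
  where "sectorial V A \<longleftrightarrow>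
    linear_operator V A \<and> densely_defined V A \<and> sectorial_angles V A \<noteq> {}"

definition sectoriality_angle :: "'v cnormed \<Rightarrow> ('v \<times> 'v) set \<Rightarrow> real"
  where "sectoriality_angle V A = Inf (sectorial_angles V A)"


section \<open>R-boundedness\<close>

definition steinhaus :: "complex measure"
  where "steinhaus = distr (uniform_measure lborel {0..2 * pi}) borel cis"

text \<open>
  The Rademacher sequence consists of the coordinates on the infinite product of the Steinhaus
  distribution; \<open>rademacher_norm V N x\<close> is the square root of the second moment of the norm of
  the random sum over n < N.
\<close>

definition rademacher_norm :: "'v cnormed \<Rightarrow> nat \<Rightarrow> (nat \<Rightarrow> 'v) \<Rightarrow> real"
  where "rademacher_norm V N x = sqrt (\<integral>\<epsilon>. (vnorm V (finsum V (\<lambda>n. \<epsilon> n \<odot>\<^bsub>V\<^esub> x n) {..<N}))\<^sup>2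
    \<partial>(\<Pi>\<^sub>M n\<in>(UNIV :: nat set). steinhaus))"

definition R_bounded :: "'v cnormed \<Rightarrow> 'w cnormed \<Rightarrow> ('v \<Rightarrow> 'w) set \<Rightarrow> bool"
  where "R_bounded V W \<T> \<longleftrightarrow>
    \<T> \<subseteq> carrier (bounded_ops V W) \<and>
    (\<exists>C. \<forall>N\<ge>1. \<forall>T x. (\<forall>n<N. T n \<in> \<T> \<and> x n \<in> carrier V) \<longrightarrow>
      rademacher_norm W N (\<lambda>n. T n (x n)) \<le> C * rademacher_norm V N x)"

definition R_sectorial :: "'v cnormed \<Rightarrow> ('v \<times> 'v) set \<Rightarrow> bool"
  where "R_sectorial V A \<longleftrightarrow> sectorial V A \<and>
    (\<exists>\<sigma>\<in>sectorial_angles V A. R_bounded V V (sectorial_family V A \<sigma>))"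


section \<open>The bounded holomorphic functional calculus\<close>

definition H_infty :: "real \<Rightarrow> (complex \<Rightarrow> complex) set"
  where "H_infty \<sigma> = {\<phi>. \<phi> holomorphic_on sector \<sigma> \<and> bounded (\<phi> ` sector \<sigma>)}"

definition H_one :: "real \<Rightarrow> (complex \<Rightarrow> complex) set"
  where "H_one \<sigma> = {\<phi>. \<phi> holomorphic_on sector \<sigma> \<and>
    (SUP \<nu>\<in>{-\<sigma><..<\<sigma>}. \<integral>\<^sup>+ t. ennreal (cmod (\<phi> (cis \<nu> * of_real t)) / t)
      \<partial>restrict_space lborel {0<..}) < \<infinity>}"

definition has_ray_integral ::
    "'v cnormed \<Rightarrow> ('v \<times> 'v) set \<Rightarrow> real \<Rightarrow> (complex \<Rightarrow> complex) \<Rightarrow> ('v \<Rightarrow> 'v) \<Rightarrow> bool"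
  where "has_ray_integral V A \<theta> \<phi> \<Phi> \<longleftrightarrow>
    has_bochner_integral_in (bounded_ops V V) (restrict_space lborel {0<..})
      (\<lambda>t. (\<phi> (cis \<theta> * of_real t) * cis \<theta>) \<odot>\<^bsub>bounded_ops V V\<^esub> resolvent V A (cis \<theta> * of_real t)) \<Phi>"

text \<open>
  The boundary of the sector is positively oriented: outwards along the ray with angle -nu,
  inwards along the ray with angle nu.
\<close>

definition has_functional_calculus_value ::
    "'v cnormed \<Rightarrow> ('v \<times> 'v) set \<Rightarrow> real \<Rightarrow> (complex \<Rightarrow> complex) \<Rightarrow> ('v \<Rightarrow> 'v) \<Rightarrow> bool"
  where "has_functional_calculus_value V A \<nu> \<phi> \<Phi> \<longleftrightarrow>
    (\<exists>\<Phi>\<^sub>1 \<Phi>\<^sub>2. has_ray_integral V A (-\<nu>) \<phi> \<Phi>\<^sub>1 \<and> has_ray_integral V A \<nu> \<phi> \<Phi>\<^sub>2 \<and>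
      \<Phi> = (1 / (2 * of_real pi * \<i>)) \<odot>\<^bsub>bounded_ops V V\<^esub> (\<Phi>\<^sub>1 \<ominus>\<^bsub>bounded_ops V V\<^esub> \<Phi>\<^sub>2))"

text \<open>The value does not depend on nu, by Cauchy's theorem; the bound is required for every nu.\<close>

definition H_infty_angles :: "'v cnormed \<Rightarrow> ('v \<times> 'v) set \<Rightarrow> real set"
  where "H_infty_angles V A = {\<sigma>. sectoriality_angle V A < \<sigma> \<and> \<sigma> < pi \<and>
    (\<exists>C. \<forall>\<phi>\<in>H_one \<sigma> \<inter> H_infty \<sigma>. \<forall>\<nu>. sectoriality_angle V A < \<nu> \<longrightarrow> \<nu> < \<sigma> \<longrightarrow>
      (\<exists>\<Phi>. has_functional_calculus_value V A \<nu> \<phi> \<Phi> \<and>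
        vnorm (bounded_ops V V) \<Phi> \<le> C * (SUP z\<in>sector \<sigma>. cmod (\<phi> z))))}"

definition has_bounded_H_infty_calculus_of_angle :: "'v cnormed \<Rightarrow> ('v \<times> 'v) set \<Rightarrow> real \<Rightarrow> bool"
  where "has_bounded_H_infty_calculus_of_angle V A \<omega> \<longleftrightarrow>
    sectorial V A \<and> H_infty_angles V A \<noteq> {} \<and> Inf (H_infty_angles V A) = \<omega>"


section \<open>Analytic semigroups and maximal regularity\<close>

definition C0_semigroup :: "'v cnormed \<Rightarrow> (real \<Rightarrow> 'v \<Rightarrow> 'v) \<Rightarrow> bool"
  where "C0_semigroup V S \<longleftrightarrow>
    (\<forall>t\<ge>0. S t \<in> carrier (bounded_ops V V)) \<and>
    S 0 = (\<lambda>x\<in>carrier V. x) \<and>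
    (\<forall>s\<ge>0. \<forall>t\<ge>0. \<forall>x\<in>carrier V. S (s + t) x = S s (S t x)) \<and>
    (\<forall>x\<in>carrier V. ((\<lambda>t. vnorm V (S t x \<ominus>\<^bsub>V\<^esub> x)) \<longlongrightarrow> 0) (at_right 0))"

definition generator :: "'v cnormed \<Rightarrow> (real \<Rightarrow> 'v \<Rightarrow> 'v) \<Rightarrow> ('v \<times> 'v) set"
  where "generator V S = {(x, y). x \<in> carrier V \<and> y \<in> carrier V \<and>
    ((\<lambda>t. vnorm V ((of_real (1 / t) \<odot>\<^bsub>V\<^esub> (S t x \<ominus>\<^bsub>V\<^esub> x)) \<ominus>\<^bsub>V\<^esub> y)) \<longlongrightarrow> 0) (at_right 0)}"

definition holomorphic_into :: "'v cnormed \<Rightarrow> complex set \<Rightarrow> (complex \<Rightarrow> 'v) \<Rightarrow> bool"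
  where "holomorphic_into V U F \<longleftrightarrow>
    (\<forall>z\<in>U. F z \<in> carrier V) \<and>
    (\<forall>z\<in>U. \<exists>D\<in>carrier V.
      ((\<lambda>w. vnorm V (((1 / (w - z)) \<odot>\<^bsub>V\<^esub> (F w \<ominus>\<^bsub>V\<^esub> F z)) \<ominus>\<^bsub>V\<^esub> D)) \<longlongrightarrow> 0) (at z within U))"

definition analytic_C0_semigroup :: "'v cnormed \<Rightarrow> (real \<Rightarrow> 'v \<Rightarrow> 'v) \<Rightarrow> bool"
  where "analytic_C0_semigroup V S \<longleftrightarrow> C0_semigroup V S \<and>
    (\<exists>\<theta> T. 0 < \<theta> \<and> \<theta> \<le> pi / 2 \<and>
      (\<forall>t>0. T (of_real t) = S t) \<and>
      holomorphic_into (bounded_ops V V) (sector \<theta>) T \<and>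
      (\<forall>z\<in>sector \<theta>. \<forall>w\<in>sector \<theta>. \<forall>x\<in>carrier V. T (z + w) x = T z (T w x)) \<and>
      (\<forall>\<theta>'. 0 < \<theta>' \<longrightarrow> \<theta>' < \<theta> \<longrightarrow> (\<forall>x\<in>carrier V.
        ((\<lambda>z. vnorm V (T z x \<ominus>\<^bsub>V\<^esub> x)) \<longlongrightarrow> 0) (at 0 within sector \<theta>'))))"

definition neg_op :: "'v cnormed \<Rightarrow> ('v \<times> 'v) set \<Rightarrow> ('v \<times> 'v) set"
  where "neg_op V A = {(x, \<ominus>\<^bsub>V\<^esub> y) | x y. (x, y) \<in> A}"

definition mild_solution :: "'v cnormed \<Rightarrow> (real \<Rightarrow> 'v \<Rightarrow> 'v) \<Rightarrow> (real \<Rightarrow> 'v) \<Rightarrow> real \<Rightarrow> 'v"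
  where "mild_solution V S f t =
    bochner_integral_in V (restrict_space lborel {0<..<t}) (\<lambda>s. S (t - s) (f s))"

text \<open>
  The standing assumption of maximal regularity: a densely defined sectorial operator whose
  negative generates an analytic semigroup.
\<close>

definition neg_generates_analytic :: "'v cnormed \<Rightarrow> ('v \<times> 'v) set \<Rightarrow> (real \<Rightarrow> 'v \<Rightarrow> 'v) \<Rightarrow> bool"
  where "neg_generates_analytic V A S \<longleftrightarrow>
    sectorial V A \<and> analytic_C0_semigroup V S \<and> generator V S = neg_op V A"

text \<open>
  The semigroup S generated by -A is unique for nonnegative times, so quantifying over S only names
  it.  For operators outside the standing assumption the predicate is vacuously true; hence its
  negation includes that -A generates an analytic semigroup.
\<close>

definition maximal_regularity :: "'v cnormed \<Rightarrow> ('v \<times> 'v) set \<Rightarrow> real \<Rightarrow> real set \<Rightarrow> bool"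
  where "maximal_regularity V A p I \<longleftrightarrow>
    (\<forall>S. neg_generates_analytic V A S \<longrightarrow>
      (\<exists>C. \<forall>f\<in>Lp V p I.
        (AE t in restrict_space lborel I. mild_solution V S f t \<in> Domain A) \<and>
        (\<lambda>t. op_apply A (mild_solution V S f t)) \<in> Lp V p I \<and>
        Lp_norm V p I (\<lambda>t. op_apply A (mild_solution V S f t)) \<le> C * Lp_norm V p I f))"

end

theory Submission
  imports Defs "HOL-Complex_Analysis.Complex_Analysis"
begin

text \<open>
  Number the nodes of a binary tree like a heap, the children of \<open>k\<close> being \<open>2 * k\<close> and \<open>2 * k + 1\<close>. On the
  subtrees a gauge is defined from the bottom up: the gauges of the two children are added
  (an \<open>\<ell>\<^sup>1\<close>-sum) and combined with the value at the node by an \<open>\<ell>\<^sup>2\<close>-sum. The space \<open>X\<close> carries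
  the square root of the gauge of \<open>|x|\<^sup>2\<close>, and \<open>A\<close> is multiplication by \<open>k\<close>. Multipliers are bounded by
  their supremum, which gives sectoriality and the functional calculus with angle 0; the norm of a
  Rademacher sum is equivalent to the norm of the square function, which gives R-sectoriality. The
  dual norm comes from an analogous gauge, and \<open>A\<^sup>*\<close> is again multiplication by \<open>k\<close>.

  For \<open>t\<close> in \<open>(0, 1)\<close> let \<open>node d t\<close> be the node of level \<open>d\<close> whose dyadic interval contains \<open>t\<close>. The
  right-hand side \<open>f(t) = \<Sum> e\<^sub>k\<close>, summed over the even nodes \<open>k = node d t\<close> with \<open>d\<close> in a window of length
  \<open>n\<close>, is supported on a branch, so its norm is at most \<open>n powr (1 / 4)\<close>. The kernel \<open>k * exp (- k * s)\<close>
  lives on the scale of the interval of \<open>k\<close> and carries mass on to the right sibling. Hence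
  \<open>A u\<^sub>f(t)\<close> is bounded below by a multiple of \<open>\<Sum> e\<^sub>k\<close> over the left siblings \<open>k\<close> of the odd nodes
  \<open>node d t\<close>. These hang off a branch and span an \<open>\<ell>\<^sup>1\<close>-sum in the gauge, so the norm is of order \<open>n powr (1 / 2)\<close>.
  In the dual branches are large and siblings small, and the shifted test function, on the right
  siblings of the even nodes, is mapped to the branch.
\<close>

section \<open>The gauge of a binary tree and its dual\<close>

text \<open>Without the squares \<open>X\<close> is an iterated sum: siblings are joined by an
  l^2-sum, and a node is joined to what lies below it by an l^4-sum. So \<open>X\<close> behaves
  like l^4 on a branch and like l^2 on the nodes hanging off a branch; the dual behaves like l^(4/3)
  and l^2. This gap of exponents, a factor \<open>n powr (1 / 4)\<close> in both spaces, is the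
  whole effect. On a UMD space R-sectoriality of angle below pi / 2 implies maximal regularity
  (Weis), which rules out every l^p with 1 < p < \<infinity>. Multipliers never leave a coordinate,
  so resolvents and functional calculus see only absolute values and cannot feel the gap. Maximal
  regularity compares different times, and time selects the branch. The kernel is causal: mass moves
  only forward in time, from a left child to its right sibling. This is why the parity of node
  numbers occurs throughout. About half of the levels are odd at a typical time, which follows from
  reflecting the time interval. A window of levels below an arbitrary level \<open>m\<close> places
  the test in the time interval from 0 to 2^-m with constants independent of \<open>m\<close>, so
  that all \<open>T\<close> are treated at once.\<close>

primrec tree_gauge :: "nat \<Rightarrow> (nat \<Rightarrow> real) \<Rightarrow> nat \<Rightarrow> real" where
  "tree_gauge 0 a h = 0"
| "tree_gauge (Suc d) a h =
    sqrt ((a h)\<^sup>2 + (tree_gauge d a (2 * h) + tree_gauge d a (2 * h + 1))\<^sup>2)"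

text \<open>The infimum of \<open>A / c + B / s\<close> over the positive points \<open>(c, s)\<close> of the unit circle.\<close>

definition cogauge2 :: "real \<Rightarrow> real \<Rightarrow> real" where
  "cogauge2 A B = sqrt (((root 3 A)\<^sup>2 + (root 3 B)\<^sup>2) ^ 3)"

primrec tree_cogauge :: "nat \<Rightarrow> (nat \<Rightarrow> real) \<Rightarrow> nat \<Rightarrow> real" where
  "tree_cogauge 0 b h = 0"
| "tree_cogauge (Suc d) b h =
    cogauge2 (b h) (tree_cogauge d b (2 * h) + tree_cogauge d b (2 * h + 1))"

primrec tree_sum :: "nat \<Rightarrow> (nat \<Rightarrow> real) \<Rightarrow> nat \<Rightarrow> real" where
  "tree_sum 0 f h = 0"
| "tree_sum (Suc d) f h = f h + (tree_sum d f (2 * h) + tree_sum d f (2 * h + 1))"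

section \<open>Monotonicity, locality and convexity of the gauge\<close>

lemma tree_gauge_nonneg [simp]: "0 \<le> tree_gauge d a h"
  by (cases d) auto

lemma tree_gauge_mono:
  assumes "\<And>k. 0 \<le> a k" "\<And>k. a k \<le> b k"
  shows "tree_gauge d a h \<le> tree_gauge d b h"
proof (induction d arbitrary: h)
  case (Suc d)
  show ?case unfolding tree_gauge.simps
    by (intro real_sqrt_le_mono add_mono power_mono Suc.IH assms add_nonneg_nonneg tree_gauge_nonneg)
qed simp

lemma tree_gauge_depth_mono: "tree_gauge d a h \<le> tree_gauge (Suc d) a h"
proof (induction d arbitrary: h)
  case (Suc d)
  show ?case unfolding tree_gauge.simps(2)[of d a h] tree_gauge.simps(2)[of "Suc d" a h]
    by (intro real_sqrt_le_mono add_left_mono power_mono add_mono Suc.IH add_nonneg_nonneg tree_gauge_nonneg)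
qed simp

definition subtree :: "nat \<Rightarrow> nat set" where
  "subtree h = {k. \<exists>j. k div 2 ^ j = h}"

lemma subtree_self [simp]: "h \<in> subtree h"
  by (auto simp: subtree_def intro!: exI[of _ 0])

lemma subtree_children: "subtree (2 * h) \<subseteq> subtree h" "subtree (2 * h + 1) \<subseteq> subtree h"
proof -
  have "k div 2 ^ Suc j = h" if "k div 2 ^ j = 2 * h \<or> k div 2 ^ j = 2 * h + 1" for k j
  proof -
    have "k div 2 ^ Suc j = (k div 2 ^ j) div 2" by (metis div_mult2_eq mult.commute power_Suc)
    then show ?thesis using that by auto
  qed
  then show "subtree (2 * h) \<subseteq> subtree h" "subtree (2 * h + 1) \<subseteq> subtree h"
    unfolding subtree_def by blast+
qed

lemma subtree_le: "k \<in> subtree h \<Longrightarrow> h \<le> k"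
  by (auto simp: subtree_def)

text \<open>Of two ancestors of \<open>k\<close>, the one reached by more halvings is at most half
  of the other, which is impossible for \<open>2 * h\<close> and \<open>2 * h + 1\<close>. The root
  0 must be excluded: it is its own left child.\<close>

lemma subtree_disjoint:
  assumes "1 \<le> h" "k \<in> subtree (2 * h)" "k \<in> subtree (2 * h + 1)"
  shows False
proof -
  obtain i j where ij: "k div 2 ^ i = 2 * h" "k div 2 ^ j = 2 * h + 1"
    using assms by (auto simp: subtree_def)
  have shift: "k div 2 ^ m \<le> (k div 2 ^ n) div 2" if "n < m" for m n
  proof -
    have "k div 2 ^ m = k div (2 ^ n * 2 ^ (m - n))" using that by (simp flip: power_add)
    also have "\<dots> = (k div 2 ^ n) div 2 ^ (m - n)" by (rule div_mult2_eq)
    also have "\<dots> \<le> (k div 2 ^ n) div 2 ^ 1" using that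
      by (intro div_le_mono2) (auto intro: power_increasing[of 1, simplified])
    finally show ?thesis by simp
  qed
  have "i \<noteq> j" using ij by auto
  then consider "i < j" | "j < i" by linarith
  then show False
  proof cases
    case 1 then show False using shift[of i j] ij by simp
  next
    case 2 then show False using shift[of j i] ij assms(1) by simp
  qed
qed

lemma tree_gauge_cong:
  assumes "\<And>k. k \<in> subtree h \<Longrightarrow> a k = b k"
  shows "tree_gauge d a h = tree_gauge d b h"
  using assms
proof (induction d arbitrary: h)
  case (Suc d)
  show ?case using Suc.IH[of "2 * h"] Suc.IH[of "2 * h + 1"] Suc.prems subtree_children[of h]
    by (simp add: subset_iff)
qed simp

lemma tree_gauge_cong_root:
  assumes "\<And>k. 1 \<le> k \<Longrightarrow> k < 2 ^ d \<Longrightarrow> a k = b k"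
  shows "tree_gauge d a 1 = tree_gauge d b 1"
proof -
  \<comment> \<open>The bound is \<open>k < 2 ^ (d - 1) * (h + 1)\<close>, the end of the last level
    seen from \<open>h\<close>, doubled so that it makes sense for \<open>d = 0\<close> as
    well.\<close>
  have *: "tree_gauge d a h = tree_gauge d b h"
    if "\<And>k. h \<le> k \<Longrightarrow> 2 * k + 2 \<le> 2 ^ d * (h + 1) \<Longrightarrow> a k = b k" for h
    using that
  proof (induction d arbitrary: h)
    case (Suc d)
    have "a h = b h"
      using mult_le_mono1[of 1 "2 ^ d" "2 * h + 2"] by (intro Suc.prems) auto
    moreover have "tree_gauge d a (2 * h) = tree_gauge d b (2 * h)"
      by (rule Suc.IH, rule Suc.prems) (auto simp: algebra_simps)
    moreover have "tree_gauge d a (2 * h + 1) = tree_gauge d b (2 * h + 1)"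
      by (rule Suc.IH, rule Suc.prems) (auto simp: algebra_simps)
    ultimately show ?case by simp
  qed simp
  show ?thesis
  proof (rule *)
    fix k :: nat assume "1 \<le> k" "2 * k + 2 \<le> 2 ^ d * (1 + 1)"
    then show "a k = b k" using assms[of k] by simp
  qed
qed

lemma tree_gauge_scale: "0 \<le> c \<Longrightarrow> tree_gauge d (\<lambda>k. c * a k) h = c * tree_gauge d a h"
proof (induction d arbitrary: h)
  case (Suc d)
  have "tree_gauge (Suc d) (\<lambda>k. c * a k) h
      = sqrt (c\<^sup>2 * ((a h)\<^sup>2 + (tree_gauge d a (2 * h) + tree_gauge d a (2 * h + 1))\<^sup>2))"
    using Suc by (simp add: power2_eq_square algebra_simps)
  then show ?case using Suc.prems by (simp add: real_sqrt_mult)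
qed simp

lemma tree_gauge_subadditive:
  assumes "\<And>k. 0 \<le> a k" "\<And>k. 0 \<le> b k"
  shows "tree_gauge d (\<lambda>k. a k + b k) h \<le> tree_gauge d a h + tree_gauge d b h"
proof (induction d arbitrary: h)
  case (Suc d)
  let ?A = "tree_gauge d a (2 * h) + tree_gauge d a (2 * h + 1)"
  let ?B = "tree_gauge d b (2 * h) + tree_gauge d b (2 * h + 1)"
  have "tree_gauge (Suc d) (\<lambda>k. a k + b k) h \<le> sqrt ((a h + b h)\<^sup>2 + (?A + ?B)\<^sup>2)"
    unfolding tree_gauge.simps
    using Suc.IH[of "2 * h"] Suc.IH[of "2 * h + 1"]
    by (intro real_sqrt_le_mono add_left_mono power_mono) (linarith, simp)
  also have "\<dots> \<le> sqrt ((a h)\<^sup>2 + ?A\<^sup>2) + sqrt ((b h)\<^sup>2 + ?B\<^sup>2)"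
    by (rule real_sqrt_sum_squares_triangle_ineq)
  finally show ?case by simp
qed simp

text \<open>A lower 2-estimate. It makes tails small in \<open>X\<close>: a head that carries nearly
  the whole gauge leaves little for the rest. The l^1-sum of the children is handled by the triangle
  inequality in the plane for the vectors \<open>(P, P')\<close> and \<open>(Q, Q')\<close>.\<close>

lemma tree_gauge_sq_superadditive:
  assumes "\<And>k. 0 \<le> a k" "\<And>k. 0 \<le> b k"
  shows "(tree_gauge d a h)\<^sup>2 + (tree_gauge d b h)\<^sup>2 \<le> (tree_gauge d (\<lambda>k. a k + b k) h)\<^sup>2"
proof (induction d arbitrary: h)
  case (Suc d)
  define P where "P = tree_gauge d a (2 * h)"
  define Q where "Q = tree_gauge d a (2 * h + 1)"
  define P' where "P' = tree_gauge d b (2 * h)"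
  define Q' where "Q' = tree_gauge d b (2 * h + 1)"
  define R where "R = tree_gauge d (\<lambda>k. a k + b k) (2 * h)"
  define S where "S = tree_gauge d (\<lambda>k. a k + b k) (2 * h + 1)"
  have pos: "P \<ge> 0" "Q \<ge> 0" "P' \<ge> 0" "Q' \<ge> 0" "R \<ge> 0" "S \<ge> 0"
    by (auto simp: P_def Q_def P'_def Q'_def R_def S_def)
  have R: "P\<^sup>2 + P'\<^sup>2 \<le> R\<^sup>2" and S: "Q\<^sup>2 + Q'\<^sup>2 \<le> S\<^sup>2"
    unfolding P_def Q_def P'_def Q'_def R_def S_def by (rule Suc.IH)+
  have "sqrt ((P + Q)\<^sup>2 + (P' + Q')\<^sup>2) \<le> sqrt (P\<^sup>2 + P'\<^sup>2) + sqrt (Q\<^sup>2 + Q'\<^sup>2)"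
    by (rule real_sqrt_sum_squares_triangle_ineq)
  also have "\<dots> \<le> R + S"
    using R S pos by (intro add_mono real_le_lsqrt) auto
  finally have "(P + Q)\<^sup>2 + (P' + Q')\<^sup>2 \<le> (R + S)\<^sup>2"
    by (rule sqrt_le_D)
  moreover have "(a h)\<^sup>2 + (b h)\<^sup>2 \<le> (a h + b h)\<^sup>2"
    using assms[of h] by (simp add: power2_sum)
  ultimately show ?case
    by (simp add: P_def Q_def P'_def Q'_def R_def S_def)
qed simp

lemma tree_gauge_ge_children:
  "tree_gauge d a (2 * h) + tree_gauge d a (2 * h + 1) \<le> tree_gauge (Suc d) a h"
  by (simp add: real_le_rsqrt)

lemma tree_gauge_ge_node: "a h \<le> tree_gauge (Suc d) a h"
  by (simp add: real_le_rsqrt)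

lemma tree_gauge_ge_coord:
  assumes "1 \<le> k" "k < 2 ^ d"
  shows "a k \<le> tree_gauge d a 1"
proof -
  have *: "a k \<le> tree_gauge d a h" if "h = k div 2 ^ j" "j < d" "h \<ge> 1" for h j
    using that
  proof (induction j arbitrary: h d)
    case 0
    then show ?case using tree_gauge_ge_node[of a h "d - 1"] by (cases d) auto
  next
    case (Suc j)
    obtain d' where d: "d = Suc d'" using Suc.prems by (cases d) auto
    define g where "g = k div 2 ^ j"
    have "g div 2 = h" unfolding g_def using Suc.prems by (metis div_mult2_eq mult.commute power_Suc)
    then have g: "g = 2 * h \<or> g = 2 * h + 1" by presburger
    moreover have "a k \<le> tree_gauge d' a g"
      using Suc.prems d g by (intro Suc.IH) (auto simp: g_def)
    ultimately have "a k \<le> tree_gauge d' a (2 * h) + tree_gauge d' a (2 * h + 1)"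
      using tree_gauge_nonneg[of d' a "2 * h"] tree_gauge_nonneg[of d' a "2 * h + 1"]
      by (auto intro: order_trans)
    then show ?case using tree_gauge_ge_children[of d' a h] unfolding d by (rule order_trans)
  qed
  obtain j where j: "2 ^ j \<le> k" "k < 2 ^ (Suc j)"
    using ex_power_ivl1[of 2 k] assms by auto
  have "k div 2 ^ j = 1"
    by (rule div_nat_eqI) (use j in auto)
  then have "1 = k div 2 ^ j" by simp
  moreover have "j < d"
    using j(1) assms(2) by (metis le_less_trans power_less_imp_less_exp one_less_numeral_iff semiring_norm(76))
  ultimately show ?thesis using * by auto
qed

section \<open>The two-term cogauge as a concave function\<close>

lemma cogauge2_nonneg [simp]: "0 \<le> cogauge2 A B"
  by (simp add: cogauge2_def)

lemma cogauge2_zero [simp]: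
  "0 \<le> A \<Longrightarrow> cogauge2 A 0 = A" "0 \<le> B \<Longrightarrow> cogauge2 0 B = B"
proof -
  have "sqrt ((x\<^sup>2) ^ 3) = x ^ 3" if "x \<ge> 0" for x :: real
    proof -
    have "(x\<^sup>2) ^ 3 = (x ^ 3)\<^sup>2" by (simp flip: power_mult)
    then show ?thesis using that by (simp only: real_sqrt_abs) simp
  qed
  then show "0 \<le> A \<Longrightarrow> cogauge2 A 0 = A" "0 \<le> B \<Longrightarrow> cogauge2 0 B = B"
    by (simp_all add: cogauge2_def odd_real_root_pow)
qed

text \<open>Two estimates of Cauchy-Schwarz type through \<open>v\<close>, namely
  \<open>r ^ 2 \<le> w * v\<close> and \<open>v ^ 2 \<le> r\<close>. Eliminating \<open>v\<close>
  gives \<open>r ^ 3 \<le> w ^ 2\<close>, and the cogauge is the square root of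
  \<open>r ^ 3\<close>.\<close>

lemma cogauge2_le:
  assumes "0 \<le> A" "0 \<le> B" "0 < c" "0 < s" "c\<^sup>2 + s\<^sup>2 \<le> 1"
  shows "cogauge2 A B \<le> A / c + B / s"
proof -
  define \<alpha> where "\<alpha> = root 3 A"
  define \<beta> where "\<beta> = root 3 B"
  have A: "A = \<alpha> ^ 3" "B = \<beta> ^ 3" by (simp_all add: \<alpha>_def \<beta>_def odd_real_root_pow)
  have pos: "\<alpha> \<ge> 0" "\<beta> \<ge> 0" using assms by (simp_all add: \<alpha>_def \<beta>_def)
  define r where "r = \<alpha>\<^sup>2 + \<beta>\<^sup>2"
  define w where "w = A / c + B / s"
  define v where "v = \<alpha> * c + \<beta> * s"
  have w0: "w \<ge> 0" using assms by (simp add: w_def)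
  have "r\<^sup>2 \<le> w * v"
  proof -
    have "w * v - r\<^sup>2 = \<alpha> ^ 3 * \<beta> * s / c + \<beta> ^ 3 * \<alpha> * c / s - 2 * \<alpha>\<^sup>2 * \<beta>\<^sup>2"
      using assms by (simp add: w_def v_def r_def A field_simps power2_eq_square power3_eq_cube)
    also have "\<dots> = \<alpha> * \<beta> * (\<alpha> * s - \<beta> * c)\<^sup>2 / (c * s)"
      using assms by (simp add: field_simps power2_eq_square power3_eq_cube)
    also have "\<dots> \<ge> 0" using assms pos by simp
    finally show ?thesis by simp
  qed
  then have "(r\<^sup>2)\<^sup>2 \<le> (w * v)\<^sup>2" by (rule power_mono) simp
  also have "\<dots> = w\<^sup>2 * v\<^sup>2" by (simp add: power_mult_distrib)
  also have "v\<^sup>2 \<le> r"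
  proof -
    have "v\<^sup>2 \<le> r * (c\<^sup>2 + s\<^sup>2)"
    proof -
      have "r * (c\<^sup>2 + s\<^sup>2) - v\<^sup>2 = (\<alpha> * s - \<beta> * c)\<^sup>2"
        by (simp add: r_def v_def power2_eq_square algebra_simps)
      then show ?thesis using zero_le_power2[of "\<alpha> * s - \<beta> * c"] by linarith
    qed
    also have "\<dots> \<le> r * 1" using assms by (intro mult_left_mono) (auto simp: r_def)
    finally show ?thesis by simp
  qed
  finally have "(r\<^sup>2)\<^sup>2 \<le> w\<^sup>2 * r" by (simp add: mult_left_mono)
  then have "r * r ^ 3 \<le> r * w\<^sup>2"
    by (simp add: power2_eq_square power3_eq_cube algebra_simps)
  then have "r ^ 3 \<le> w\<^sup>2"
  proof (cases "r = 0")
    case False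
    moreover have "r \<ge> 0" by (simp add: r_def)
    ultimately have "r > 0" by simp
    then show ?thesis using \<open>r * r ^ 3 \<le> r * w\<^sup>2\<close> by simp
  qed simp
  then show ?thesis using w0 unfolding cogauge2_def w_def[symmetric] \<alpha>_def[symmetric] \<beta>_def[symmetric] r_def[symmetric]
    by (intro real_le_lsqrt) (auto simp: r_def)
qed

text \<open>The optimal point is \<open>(\<alpha>, \<beta>) / r\<close>. The second expression, a
  Euclidean length at the same point, serves \<open>tree_cogauge_extremal\<close>: there it is the
  gauge of the norming vector, while the first one is its pairing.\<close>

lemma cogauge2_attained:
  assumes "0 < A" "0 < B"
  obtains c s where "0 < c" "0 < s" "c\<^sup>2 + s\<^sup>2 = 1" "cogauge2 A B = A / c + B / s"
    "cogauge2 A B = sqrt ((A / c\<^sup>2)\<^sup>2 + (B / s\<^sup>2)\<^sup>2)"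
proof -
  define \<alpha> where "\<alpha> = root 3 A"
  define \<beta> where "\<beta> = root 3 B"
  have A: "A = \<alpha> ^ 3" "B = \<beta> ^ 3" by (simp_all add: \<alpha>_def \<beta>_def odd_real_root_pow)
  have pos: "\<alpha> > 0" "\<beta> > 0" using assms by (simp_all add: \<alpha>_def \<beta>_def)
  define r where "r = sqrt (\<alpha>\<^sup>2 + \<beta>\<^sup>2)"
  have r2: "r\<^sup>2 = \<alpha>\<^sup>2 + \<beta>\<^sup>2" by (simp add: r_def)
  have r: "r > 0" using pos unfolding r_def by (intro real_sqrt_gt_zero) (simp add: sum_power2_gt_zero_iff)
  have G: "cogauge2 A B = r ^ 3"
    unfolding cogauge2_def \<alpha>_def[symmetric] \<beta>_def[symmetric] r_def by (simp add: real_sqrt_power)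
  show ?thesis
  proof (rule that[of "\<alpha> / r" "\<beta> / r"])
    show "(\<alpha> / r)\<^sup>2 + (\<beta> / r)\<^sup>2 = 1"
      using r by (simp add: power_divide flip: add_divide_distrib r2)
    have "A / (\<alpha> / r) + B / (\<beta> / r) = r * (\<alpha>\<^sup>2 + \<beta>\<^sup>2)"
      using r pos by (simp add: A field_simps power2_eq_square power3_eq_cube)
    then show "cogauge2 A B = A / (\<alpha> / r) + B / (\<beta> / r)"
      unfolding G r2[symmetric] by (simp add: power2_eq_square power3_eq_cube)
    have "(A / (\<alpha> / r)\<^sup>2)\<^sup>2 + (B / (\<beta> / r)\<^sup>2)\<^sup>2 = (r ^ 2)\<^sup>2 * (\<alpha>\<^sup>2 + \<beta>\<^sup>2)"
      using r pos by (simp add: A field_simps power2_eq_square power3_eq_cube)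
    also have "\<dots> = (r ^ 3)\<^sup>2" unfolding r2[symmetric] by (simp add: power2_eq_square power3_eq_cube)
    finally have *: "(A / (\<alpha> / r)\<^sup>2)\<^sup>2 + (B / (\<beta> / r)\<^sup>2)\<^sup>2 = (r ^ 3)\<^sup>2" .
    show "cogauge2 A B = sqrt ((A / (\<alpha> / r)\<^sup>2)\<^sup>2 + (B / (\<beta> / r)\<^sup>2)\<^sup>2)"
      unfolding G * real_sqrt_abs using r by simp
  qed (use pos r in auto)
qed

text \<open>An infimum of linear functions is superadditive. The degenerate cases are split off
  because the infimum is then not attained at positive \<open>c\<close> and
  \<open>s\<close>.\<close>

lemma cogauge2_superadditive:
  assumes "0 \<le> A" "0 \<le> B" "0 \<le> A'" "0 \<le> B'"
  shows "cogauge2 A B + cogauge2 A' B' \<le> cogauge2 (A + A') (B + B')"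
proof -
  consider "A + A' = 0" | "B + B' = 0" | "A + A' > 0" "B + B' > 0"
    using assms by linarith
  then show ?thesis
  proof cases
    case 1
    then have "A = 0" "A' = 0" using assms by auto
    then show ?thesis using assms by simp
  next
    case 2
    then have "B = 0" "B' = 0" using assms by auto
    then show ?thesis using assms by simp
  next
    case 3
    then obtain c s where c: "0 < c" "0 < s" "c\<^sup>2 + s\<^sup>2 = 1"
      "cogauge2 (A + A') (B + B') = (A + A') / c + (B + B') / s"
      using cogauge2_attained by metis
    have "cogauge2 A B \<le> A / c + B / s" "cogauge2 A' B' \<le> A' / c + B' / s"
      using c assms by (auto intro!: cogauge2_le)
    then show ?thesis by (simp add: c(4) add_divide_distrib)
  qed
qed

lemma cogauge2_mono:
  "0 \<le> A \<Longrightarrow> A \<le> A' \<Longrightarrow> 0 \<le> B \<Longrightarrow> B \<le> B' \<Longrightarrow> cogauge2 A B \<le> cogauge2 A' B'"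
  unfolding cogauge2_def
  by (intro real_sqrt_le_mono power_mono add_mono) auto

text \<open>Hoelder's inequality with exponents 4 and 4/3 for the square roots, as two applications
  of Cauchy-Schwarz. It explains the cube roots: the dual of an l^4-sum is an l^(4/3)-sum, so
  squared norms are combined by the l^(2/3)-expression \<open>cogauge2\<close>.\<close>

lemma sqrt_sum_le_cogauge2:
  assumes "0 \<le> A" "0 \<le> A'" "0 \<le> B" "0 \<le> B'"
  shows "sqrt (A * B) + sqrt (A' * B') \<le> sqrt (sqrt (A\<^sup>2 + A'\<^sup>2) * cogauge2 B B')"
proof -
  define \<beta> where "\<beta> = root 3 B"
  define \<gamma> where "\<gamma> = root 3 B'"
  have B: "B = \<beta> ^ 3" "B' = \<gamma> ^ 3" by (simp_all add: \<gamma>_def \<beta>_def odd_real_root_pow)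
  have pos: "\<beta> \<ge> 0" "\<gamma> \<ge> 0" using assms by (simp_all add: \<gamma>_def \<beta>_def)
  have e: "sqrt (x * y ^ 3) = sqrt (x * y) * y" if "y \<ge> 0" for x y :: real
    using that by (simp add: power3_eq_cube real_sqrt_mult)
  have "sqrt (A * B) + sqrt (A' * B') = sqrt (A * \<beta>) * \<beta> + sqrt (A' * \<gamma>) * \<gamma>"
    using pos by (simp add: B e)
  also have "\<dots> \<le> sqrt ((sqrt (A * \<beta>))\<^sup>2 + (sqrt (A' * \<gamma>))\<^sup>2) * sqrt (\<beta>\<^sup>2 + \<gamma>\<^sup>2)"
    using Cauchy_Schwarz_ineq2[of "(sqrt (A * \<beta>), sqrt (A' * \<gamma>))" "(\<beta>, \<gamma>)"]
    by (simp add: norm_Pair)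
  also have "\<dots> = sqrt (A * \<beta> + A' * \<gamma>) * sqrt (\<beta>\<^sup>2 + \<gamma>\<^sup>2)"
    using pos assms by simp
  also have "\<dots> \<le> sqrt (sqrt (A\<^sup>2 + A'\<^sup>2) * sqrt (\<beta>\<^sup>2 + \<gamma>\<^sup>2)) * sqrt (\<beta>\<^sup>2 + \<gamma>\<^sup>2)"
    using Cauchy_Schwarz_ineq2[of "(A, A')" "(\<beta>, \<gamma>)"]
    by (intro mult_right_mono real_sqrt_le_mono) (auto simp: norm_Pair)
  also have "\<dots> = sqrt (sqrt (A\<^sup>2 + A'\<^sup>2) * cogauge2 B B')"
  proof -
    have "cogauge2 B B' = sqrt (\<beta>\<^sup>2 + \<gamma>\<^sup>2) * (\<beta>\<^sup>2 + \<gamma>\<^sup>2)"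
      unfolding cogauge2_def \<gamma>_def[symmetric] \<beta>_def[symmetric]
      by (simp add: power3_eq_cube real_sqrt_mult)
    then show ?thesis by (simp add: real_sqrt_mult)
  qed
  finally show ?thesis .
qed

lemma tree_cogauge_nonneg [simp]: "0 \<le> tree_cogauge d b h"
  by (cases d) auto

lemma tree_cogauge_mono:
  assumes "\<And>k. 0 \<le> a k" "\<And>k. a k \<le> b k"
  shows "tree_cogauge d a h \<le> tree_cogauge d b h"
proof (induction d arbitrary: h)
  case (Suc d)
  show ?case unfolding tree_cogauge.simps
    by (intro cogauge2_mono add_mono Suc.IH assms add_nonneg_nonneg tree_cogauge_nonneg)
qed simp

lemma tree_cogauge_depth_mono:
  assumes "\<And>k. 0 \<le> b k"
  shows "tree_cogauge d b h \<le> tree_cogauge (Suc d) b h"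
proof (induction d arbitrary: h)
  case (Suc d)
  show ?case unfolding tree_cogauge.simps(2)[of d b h] tree_cogauge.simps(2)[of "Suc d" b h]
    by (intro cogauge2_mono add_mono Suc.IH add_nonneg_nonneg tree_cogauge_nonneg order_refl assms)
qed simp

lemma tree_cogauge_cong_root:
  assumes "\<And>k. 1 \<le> k \<Longrightarrow> k < 2 ^ d \<Longrightarrow> a k = b k"
  shows "tree_cogauge d a 1 = tree_cogauge d b 1"
proof -
  have *: "tree_cogauge d a h = tree_cogauge d b h"
    if "\<And>k. h \<le> k \<Longrightarrow> 2 * k + 2 \<le> 2 ^ d * (h + 1) \<Longrightarrow> a k = b k" for h
    using that
  proof (induction d arbitrary: h)
    case (Suc d)
    have "a h = b h"
      using mult_le_mono1[of 1 "2 ^ d" "2 * h + 2"] by (intro Suc.prems) auto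
    moreover have "tree_cogauge d a (2 * h) = tree_cogauge d b (2 * h)"
      by (rule Suc.IH, rule Suc.prems) (auto simp: algebra_simps)
    moreover have "tree_cogauge d a (2 * h + 1) = tree_cogauge d b (2 * h + 1)"
      by (rule Suc.IH, rule Suc.prems) (auto simp: algebra_simps)
    ultimately show ?case by simp
  qed simp
  show ?thesis
  proof (rule *)
    fix k :: nat assume "1 \<le> k" "2 * k + 2 \<le> 2 ^ d * (1 + 1)"
    then show "a k = b k" using assms[of k] by simp
  qed
qed

lemma tree_cogauge_superadditive:
  assumes "\<And>k. 0 \<le> a k" "\<And>k. 0 \<le> b k"
  shows "tree_cogauge d a h + tree_cogauge d b h \<le> tree_cogauge d (\<lambda>k. a k + b k) h"
proof (induction d arbitrary: h)
  case (Suc d)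
  have "tree_cogauge (Suc d) a h + tree_cogauge (Suc d) b h
     \<le> cogauge2 (a h + b h) ((tree_cogauge d a (2 * h) + tree_cogauge d a (2 * h + 1))
          + (tree_cogauge d b (2 * h) + tree_cogauge d b (2 * h + 1)))"
    unfolding tree_cogauge.simps using assms by (intro cogauge2_superadditive) auto
  also have "\<dots> \<le> tree_cogauge (Suc d) (\<lambda>k. a k + b k) h"
    unfolding tree_cogauge.simps using assms Suc.IH[of "2 * h"] Suc.IH[of "2 * h + 1"]
    by (intro cogauge2_mono) auto
  finally show ?case .
qed simp

section \<open>Sums over the tree and the duality of the two gauges\<close>

lemma sum_lessThan_add: "(\<Sum>i<m + n. f i) = (\<Sum>i<m. f i) + (\<Sum>i<n. f (m + i :: nat) :: real)"
  by (induction n) (simp_all add: add.assoc)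

lemma tree_sum_eq: "tree_sum d f h = (\<Sum>j<d. \<Sum>i<2 ^ j. f (h * 2 ^ j + i))"
proof (induction d arbitrary: h)
  case (Suc d)
  have "(\<Sum>i<2 ^ j. f (2 * h * 2 ^ j + i)) + (\<Sum>i<2 ^ j. f ((2 * h + 1) * 2 ^ j + i))
      = (\<Sum>i<2 ^ Suc j. f (h * 2 ^ Suc j + i))" for j
  proof -
    have "(\<Sum>i<2 ^ Suc j. f (h * 2 ^ Suc j + i))
        = (\<Sum>i<2 ^ j + 2 ^ j. f (h * 2 ^ Suc j + i))" by (simp add: mult_2)
    also have "\<dots> = (\<Sum>i<2 ^ j. f (h * 2 ^ Suc j + i)) + (\<Sum>i<2 ^ j. f (h * 2 ^ Suc j + (2 ^ j + i)))"
      by (rule sum_lessThan_add)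
    finally show ?thesis by (simp add: algebra_simps)
  qed
  then show ?case
    unfolding tree_sum.simps Suc.IH sum.lessThan_Suc_shift[of _ d] by (simp flip: sum.distrib)
qed simp

lemma tree_sum_root: "tree_sum d f 1 = (\<Sum>k\<in>{1..<2 ^ d}. f k)"
proof (induction d)
  case (Suc d)
  have "(\<Sum>i<2 ^ d. f (2 ^ d + i)) = (\<Sum>k\<in>{2 ^ d..<2 ^ Suc d}. f k)"
    by (rule sum.reindex_bij_witness[of _ "\<lambda>k. k - 2 ^ d" "\<lambda>i. 2 ^ d + i"]) auto
  then have "tree_sum (Suc d) f 1 = (\<Sum>k\<in>{1..<2 ^ d}. f k) + (\<Sum>k\<in>{2 ^ d..<2 ^ Suc d}. f k)"
    using Suc by (simp add: tree_sum_eq)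
  also have "\<dots> = (\<Sum>k\<in>{1..<2 ^ Suc d}. f k)"
    by (rule sum.atLeastLessThan_concat) auto
  finally show ?case .
qed simp

lemma tree_sum_cong:
  assumes "\<And>k. k \<in> subtree h \<Longrightarrow> f k = g k"
  shows "tree_sum d f h = tree_sum d g h"
  using assms
proof (induction d arbitrary: h)
  case (Suc d)
  show ?case using Suc.IH[of "2 * h"] Suc.IH[of "2 * h + 1"] Suc.prems subtree_children[of h]
    by (simp add: subset_iff)
qed simp

text \<open>Hoelder's inequality on the tree, one level at a time: Cauchy-Schwarz for the two
  children, then \<open>sqrt_sum_le_cogauge2\<close> for the node. It bounds the dual norm by the
  cogauge.\<close>

lemma tree_sum_sqrt_le:
  assumes "\<And>k. 0 \<le> a k" "\<And>k. 0 \<le> b k"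
  shows "tree_sum d (\<lambda>k. sqrt (a k * b k)) h \<le> sqrt (tree_gauge d a h * tree_cogauge d b h)"
proof (induction d arbitrary: h)
  case (Suc d)
  let ?P = "\<lambda>h. tree_gauge d a h" and ?D = "\<lambda>h. tree_cogauge d b h"
  have 1: "sqrt (?P (2 * h) * ?D (2 * h)) + sqrt (?P (2 * h + 1) * ?D (2 * h + 1))
     \<le> sqrt ((?P (2 * h) + ?P (2 * h + 1)) * (?D (2 * h) + ?D (2 * h + 1)))"
    using Cauchy_Schwarz_ineq2[of "(sqrt (?P (2 * h)), sqrt (?P (2 * h + 1)))"
        "(sqrt (?D (2 * h)), sqrt (?D (2 * h + 1)))"]
    by (simp add: norm_Pair real_sqrt_mult)
  have "tree_sum (Suc d) (\<lambda>k. sqrt (a k * b k)) h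
     \<le> sqrt (a h * b h) + sqrt ((?P (2 * h) + ?P (2 * h + 1)) * (?D (2 * h) + ?D (2 * h + 1)))"
    using Suc.IH[of "2 * h"] Suc.IH[of "2 * h + 1"] 1 by simp
  also have "\<dots> \<le> sqrt (tree_gauge (Suc d) a h * tree_cogauge (Suc d) b h)"
    unfolding tree_gauge.simps tree_cogauge.simps using assms by (intro sqrt_sum_le_cogauge2) auto
  finally show ?case .
qed simp

lemma tree_gauge_eq_0:
  assumes "\<And>k. h \<le> k \<Longrightarrow> a k = 0"
  shows "tree_gauge d a h = 0"
  using assms by (induction d arbitrary: h) auto

lemma tree_gauge_depth_stable:
  assumes "\<And>k. 2 ^ d * h \<le> k \<Longrightarrow> a k = 0"
  shows "tree_gauge (d + j) a h = tree_gauge d a h"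
  using assms
proof (induction d arbitrary: h)
  case 0
  then show ?case by (simp add: tree_gauge_eq_0)
next
  case (Suc d)
  have "tree_gauge (d + j) a (2 * h) = tree_gauge d a (2 * h)"
    by (rule Suc.IH, rule Suc.prems) (simp add: algebra_simps)
  moreover have "tree_gauge (d + j) a (2 * h + 1) = tree_gauge d a (2 * h + 1)"
    by (rule Suc.IH, rule Suc.prems) (simp add: algebra_simps)
  ultimately show ?case by simp
qed

lemma tree_sum_scale: "tree_sum d (\<lambda>k. c * f k) h = c * tree_sum d f h"
  by (simp add: tree_sum_eq sum_distrib_left)

text \<open>The case of equality in \<open>tree_sum_sqrt_le\<close>. Normalising the vector so that
  pairing and gauge both equal the cogauge lets the induction glue the vectors of the two children
  with one common factor \<open>t\<close>, since both quantities then simply add up.\<close>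

lemma tree_cogauge_extremal:
  assumes b: "\<And>k. 0 \<le> b k" and h: "1 \<le> h"
  shows "\<exists>x. (\<forall>k. 0 \<le> x k) \<and> tree_sum d (\<lambda>k. x k * sqrt (b k)) h = tree_cogauge d b h
    \<and> tree_gauge d (\<lambda>k. (x k)\<^sup>2) h = tree_cogauge d b h"
  using h
proof (induction d arbitrary: h)
  case 0
  show ?case by (auto intro: exI[of _ "\<lambda>_. 0"])
next
  case (Suc d)
  obtain y where y: "\<And>k. 0 \<le> y k"
    "tree_sum d (\<lambda>k. y k * sqrt (b k)) (2 * h) = tree_cogauge d b (2 * h)"
    "tree_gauge d (\<lambda>k. (y k)\<^sup>2) (2 * h) = tree_cogauge d b (2 * h)"
    using Suc.IH[of "2 * h"] Suc.prems by auto
  obtain z where z: "\<And>k. 0 \<le> z k"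
    "tree_sum d (\<lambda>k. z k * sqrt (b k)) (2 * h + 1) = tree_cogauge d b (2 * h + 1)"
    "tree_gauge d (\<lambda>k. (z k)\<^sup>2) (2 * h + 1) = tree_cogauge d b (2 * h + 1)"
    using Suc.IH[of "2 * h + 1"] Suc.prems by auto
  define B where "B = tree_cogauge d b (2 * h) + tree_cogauge d b (2 * h + 1)"
  define x where "x t u k = (if k = h then u else t * (if k \<in> subtree (2 * h) then y k else z k))"
    for t u :: real and k
  have "h \<notin> subtree (2 * h)" "h \<notin> subtree (2 * h + 1)"
    using subtree_le[of h "2 * h"] subtree_le[of h "2 * h + 1"] Suc.prems by auto
  then have xy: "x t u k = t * y k" if "k \<in> subtree (2 * h)" for t u k
    using that by (auto simp: x_def)
  have xz: "x t u k = t * z k" if "k \<in> subtree (2 * h + 1)" for t u k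
    using that subtree_disjoint[OF Suc.prems] \<open>h \<notin> subtree (2 * h + 1)\<close> by (auto simp: x_def)
  have xh: "x t u h = u" for t u by (simp add: x_def)
  have sum: "tree_sum (Suc d) (\<lambda>k. x t u k * sqrt (b k)) h = u * sqrt (b h) + t * B" for t u
  proof -
    have "tree_sum d (\<lambda>k. x t u k * sqrt (b k)) (2 * h) = tree_sum d (\<lambda>k. t * (y k * sqrt (b k))) (2 * h)"
      by (rule tree_sum_cong) (simp add: xy)
    moreover have "tree_sum d (\<lambda>k. x t u k * sqrt (b k)) (2 * h + 1) = tree_sum d (\<lambda>k. t * (z k * sqrt (b k))) (2 * h + 1)"
      by (rule tree_sum_cong) (simp add: xz)
    ultimately show ?thesis unfolding tree_sum.simps xh tree_sum_scale y z B_def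
      by (simp add: distrib_left)
  qed
  have gauge: "tree_gauge (Suc d) (\<lambda>k. (x t u k)\<^sup>2) h = sqrt ((u\<^sup>2)\<^sup>2 + (t\<^sup>2 * B)\<^sup>2)" for t u
  proof -
    have "tree_gauge d (\<lambda>k. (x t u k)\<^sup>2) (2 * h) = tree_gauge d (\<lambda>k. t\<^sup>2 * (y k)\<^sup>2) (2 * h)"
      by (rule tree_gauge_cong) (simp add: xy power_mult_distrib)
    moreover have "tree_gauge d (\<lambda>k. (x t u k)\<^sup>2) (2 * h + 1) = tree_gauge d (\<lambda>k. t\<^sup>2 * (z k)\<^sup>2) (2 * h + 1)"
      by (rule tree_gauge_cong) (simp add: xz power_mult_distrib)
    ultimately show ?thesis
      unfolding tree_gauge.simps xh tree_gauge_scale[OF zero_le_power2] y z B_def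
      by (simp add: distrib_left)
  qed
  have B0: "0 \<le> B" by (simp add: B_def)
  \<comment> \<open>In the generic case \<open>u = sqrt (b h) / c\<close> and
    \<open>t = 1 / s\<close> at the optimal point: the pairing becomes
    \<open>b h / c + B / s\<close> and the gauge the length of
    \<open>(b h / c ^ 2, B / s ^ 2)\<close>. If \<open>b h\<close> or \<open>B\<close> vanishes, one
    of the two parts is dropped instead.\<close>
  have "\<exists>t u. 0 \<le> t \<and> 0 \<le> u \<and> u * sqrt (b h) + t * B = cogauge2 (b h) B
     \<and> sqrt ((u\<^sup>2)\<^sup>2 + (t\<^sup>2 * B)\<^sup>2) = cogauge2 (b h) B"
  proof -
    consider "b h = 0" | "B = 0" | "b h > 0" "B > 0" using b[of h] B0 by linarith
    then show ?thesis
    proof cases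
      case 1
      then show ?thesis using B0 by (intro exI[of _ 1] exI[of _ 0]) auto
    next
      case 2
      then show ?thesis using b[of h] by (intro exI[of _ 0] exI[of _ "sqrt (b h)"]) auto
    next
      case 3
      then obtain c s where c: "0 < c" "0 < s" "cogauge2 (b h) B = b h / c + B / s"
        "cogauge2 (b h) B = sqrt ((b h / c\<^sup>2)\<^sup>2 + (B / s\<^sup>2)\<^sup>2)"
        using cogauge2_attained by metis
      have "sqrt (b h) / c * sqrt (b h) + 1 / s * B = cogauge2 (b h) B"
        using 3 c by simp
      moreover have "sqrt ((((sqrt (b h) / c)\<^sup>2)\<^sup>2) + ((1 / s)\<^sup>2 * B)\<^sup>2) = cogauge2 (b h) B"
        using 3 c(4) by (simp add: power_divide)
      ultimately show ?thesis using c 3 by (intro exI[of _ "1 / s"] exI[of _ "sqrt (b h) / c"]) auto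
    qed
  qed
  then obtain t u where tu: "0 \<le> t" "0 \<le> u" "u * sqrt (b h) + t * B = cogauge2 (b h) B"
     "sqrt ((u\<^sup>2)\<^sup>2 + (t\<^sup>2 * B)\<^sup>2) = cogauge2 (b h) B" by blast
  show ?case
    using tu y(1) z(1) sum[of t u] gauge[of t u]
    by (intro exI[of _ "x t u"]) (auto simp: x_def[of t u] B_def)
qed

section \<open>The gauge on a branch and beside it\<close>

text \<open>A node off the branch has no descendant on the branch, and levels occupy disjoint ranges
  of numbers; so nothing of the support is seen from \<open>h\<close>.\<close>

lemma tree_gauge_off_path:
  assumes p: "\<And>i. p (Suc i) div 2 = p i" "\<And>i. 2 ^ i \<le> p i" "\<And>i. p i < 2 ^ Suc i"
    and supp: "\<And>k. a k \<noteq> 0 \<Longrightarrow> k \<in> range p"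
    and h: "2 ^ e \<le> h" "h < 2 ^ Suc e" "h \<noteq> p e"
  shows "tree_gauge d a h = 0"
  using h
proof (induction d arbitrary: h e)
  case (Suc d)
  have "a h = 0"
  proof (rule ccontr)
    assume "a h \<noteq> 0"
    then obtain i where i: "h = p i" using supp by auto
    have "i = e"
    proof (rule ccontr)
      assume "i \<noteq> e"
      then consider "Suc i \<le> e" | "Suc e \<le> i" by linarith
      then show False
      proof cases
        case 1
        then have "(2::nat) ^ Suc i \<le> 2 ^ e" by (rule power_increasing) simp
        then show False using p(3)[of i] i Suc.prems by linarith
      next
        case 2
        then have "(2::nat) ^ Suc e \<le> 2 ^ i" by (rule power_increasing) simp
        then show False using p(2)[of i] i Suc.prems by linarith
      qed
    qed
    then show False using i Suc.prems by simp
  qed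
  moreover have "tree_gauge d a (2 * h) = 0" "tree_gauge d a (2 * h + 1) = 0"
    using Suc.prems p(1)[of e] by (auto intro!: Suc.IH[of "Suc e"])
  ultimately show ?case by simp
qed simp

text \<open>In each l^1-sum only the child on the branch contributes, so only the l^2-sums remain.
  This is why branches are cheap in \<open>X\<close>.\<close>

lemma tree_gauge_path:
  assumes p: "\<And>i. p (Suc i) div 2 = p i" "\<And>i. 2 ^ i \<le> p i" "\<And>i. p i < 2 ^ Suc i"
    and supp: "\<And>k. a k \<noteq> 0 \<Longrightarrow> k \<in> range p"
  shows "(tree_gauge d a (p e))\<^sup>2 = (\<Sum>i\<in>{e..<e + d}. (a (p i))\<^sup>2)"
proof (induction d arbitrary: e)
  case (Suc d)
  define q where "q = p (Suc e)"
  have "q = 2 * p e \<or> q = 2 * p e + 1" using p(1)[of e] unfolding q_def by presburger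
  then have "tree_gauge d a (2 * p e) + tree_gauge d a (2 * p e + 1) = tree_gauge d a (p (Suc e))"
    using p(2)[of e] p(3)[of e]
    by (auto simp: q_def intro!: tree_gauge_off_path[where p = p and e = "Suc e"] assms)
  then have "(tree_gauge (Suc d) a (p e))\<^sup>2 = (a (p e))\<^sup>2 + (tree_gauge d a (p (Suc e)))\<^sup>2"
    by simp
  also have "\<dots> = (a (p e))\<^sup>2 + (\<Sum>i\<in>{Suc e..<e + Suc d}. (a (p i))\<^sup>2)"
    using Suc.IH[of "Suc e"] by simp
  also have "\<dots> = (\<Sum>i\<in>{e..<e + Suc d}. (a (p i))\<^sup>2)"
    by (subst (2) sum.atLeast_Suc_lessThan) auto
  finally show ?case .
qed simp

definition sibling :: "nat \<Rightarrow> nat" where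
  "sibling k = (if even k then k + 1 else k - 1)"

text \<open>Each step down the branch contributes the sibling through the l^1-sum, and discarding
  the node's own entry only decreases the gauge. The siblings start at level \<open>e + 1\<close>,
  the first one inside the subtree of \<open>p e\<close>, and depth \<open>Suc d\<close> is needed
  to see the last of them.\<close>

lemma tree_gauge_ge_siblings:
  assumes p: "\<And>i. p (Suc i) div 2 = p i" 
  shows "(\<Sum>i\<in>{e<..e + d}. a (sibling (p i))) \<le> tree_gauge (Suc d) a (p e)"
proof (induction d arbitrary: e)
  case 0 show ?case using tree_gauge_nonneg[of "Suc 0" a "p e"] by simp
next
  case (Suc d)
  define q where "q = p (Suc e)"
  have "q = 2 * p e \<or> q = 2 * p e + 1" using p[of e] unfolding q_def by presburger
  then have children: "tree_gauge (Suc d) a (2 * p e) + tree_gauge (Suc d) a (2 * p e + 1)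
     = tree_gauge (Suc d) a (sibling q) + tree_gauge (Suc d) a q"
    by (auto simp: sibling_def simp del: tree_gauge.simps)
  have "{e<..e + Suc d} = insert (Suc e) {Suc e<..Suc e + d}" by auto
  then have "(\<Sum>i\<in>{e<..e + Suc d}. a (sibling (p i)))
      = a (sibling q) + (\<Sum>i\<in>{Suc e<..Suc e + d}. a (sibling (p i)))"
    by (simp add: q_def)
  also have "\<dots> \<le> tree_gauge (Suc d) a (sibling q) + tree_gauge (Suc d) a q"
    unfolding q_def by (intro add_mono tree_gauge_ge_node Suc.IH)
  also have "\<dots> \<le> tree_gauge (Suc (Suc d)) a (p e)"
    unfolding children[symmetric] by (rule tree_gauge_ge_children)
  finally show ?case .
qed

section \<open>Complex normed spaces\<close>

lemma complex_field_simps [simp]: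
  "carrier complex_field = UNIV" "x \<otimes>\<^bsub>complex_field\<^esub> y = x * y" "\<one>\<^bsub>complex_field\<^esub> = 1"
  "\<zero>\<^bsub>complex_field\<^esub> = 0" "x \<oplus>\<^bsub>complex_field\<^esub> y = x + y"
  by (simp_all add: complex_field_def)

lemma cring_complex_field: "cring complex_field"
proof (rule cringI)
  show "abelian_group complex_field"
    by (rule abelian_groupI) (auto simp: add.assoc add.commute intro: exI[of _ "- x" for x] ab_left_minus)
  show "comm_monoid complex_field"
    by (rule comm_monoidI) (auto simp: mult.assoc mult.commute)
qed (auto simp: distrib_right)

context cnormed_space
begin

lemma vnorm_zero [simp]: "vnorm V \<zero> = 0"
  using vnorm_eq_zero by blast

lemma smult_closed' [simp, intro]: "x \<in> carrier V \<Longrightarrow> c \<odot> x \<in> carrier V"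
  using smult_closed by simp

lemma neg_eq_smult: "x \<in> carrier V \<Longrightarrow> \<ominus> x = (- 1) \<odot> x"
proof -
  assume x: "x \<in> carrier V"
  have "(- 1) \<odot> x \<oplus> x = ((- 1) + 1) \<odot> x"
    using smult_l_distr[of "- 1" 1 x] smult_one[of x] x by simp
  also have "\<dots> = \<zero>" using smult_l_null[OF x] by simp
  finally show ?thesis using x by (intro minus_equality) auto
qed

lemma vnorm_neg [simp]: "x \<in> carrier V \<Longrightarrow> vnorm V (\<ominus> x) = vnorm V x"
  by (simp add: neg_eq_smult vnorm_smult)

lemma vnorm_minus_commute:
  assumes "x \<in> carrier V" "y \<in> carrier V"
  shows "vnorm V (x \<ominus> y) = vnorm V (y \<ominus> x)"
proof -
  have "y \<ominus> x = \<ominus> (x \<ominus> y)"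
    using assms by (simp add: a_minus_def minus_add a_comm)
  then show ?thesis using assms by simp
qed

lemma vnorm_triangle_sub:
  assumes "x \<in> carrier V" "y \<in> carrier V"
  shows "vnorm V x \<le> vnorm V (x \<ominus> y) + vnorm V y"
proof -
  have "x = (x \<ominus> y) \<oplus> y" using assms by (simp add: a_minus_def a_assoc l_neg)
  then show ?thesis using vnorm_triangle[of "x \<ominus> y" y] assms by simp
qed

end

lemma complex_space_simps [simp]:
  "carrier complex_space = UNIV" "\<zero>\<^bsub>complex_space\<^esub> = 0" "x \<oplus>\<^bsub>complex_space\<^esub> y = x + y"
  "c \<odot>\<^bsub>complex_space\<^esub> x = c * x" "vnorm complex_space = cmod"
  by (simp_all add: complex_space_def)

lemma cnormed_complex_space: "cnormed_space complex_space"
proof (rule cnormed_space.intro)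
  have "abelian_group complex_space"
    by (rule abelian_groupI) (auto simp: add.assoc add.commute intro: exI[of _ "- x" for x] ab_left_minus)
  then show "module complex_field complex_space"
    by (intro moduleI cring_complex_field) (auto simp: algebra_simps)
  show "cnormed_space_axioms complex_space"
    by unfold_locales (auto simp: norm_mult norm_triangle_ineq)
qed

lemma bounded_ops_simps:
  "\<zero>\<^bsub>bounded_ops V W\<^esub> = (\<lambda>x\<in>carrier V. \<zero>\<^bsub>W\<^esub>)"
  "S \<oplus>\<^bsub>bounded_ops V W\<^esub> T = (\<lambda>x\<in>carrier V. S x \<oplus>\<^bsub>W\<^esub> T x)"
  "c \<odot>\<^bsub>bounded_ops V W\<^esub> T = (\<lambda>x\<in>carrier V. c \<odot>\<^bsub>W\<^esub> T x)"
  by (simp_all add: bounded_ops_def)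

lemma bounded_ops_carrier:
  "T \<in> carrier (bounded_ops V W) \<longleftrightarrow> T \<in> carrier V \<rightarrow>\<^sub>E carrier W \<and>
      (\<forall>x\<in>carrier V. \<forall>y\<in>carrier V. T (x \<oplus>\<^bsub>V\<^esub> y) = T x \<oplus>\<^bsub>W\<^esub> T y) \<and>
      (\<forall>c. \<forall>x\<in>carrier V. T (c \<odot>\<^bsub>V\<^esub> x) = c \<odot>\<^bsub>W\<^esub> T x) \<and>
      (\<exists>C. \<forall>x\<in>carrier V. vnorm W (T x) \<le> C * vnorm V x)"
  by (simp add: bounded_ops_def)

lemma op_norm_def: "vnorm (bounded_ops V W) T = (SUP x\<in>{x \<in> carrier V. vnorm V x \<le> 1}. vnorm W (T x))"
  by (simp add: bounded_ops_def)

locale two_cnormed = V: cnormed_space V + W: cnormed_space W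
  for V :: "'v cnormed" and W :: "'w cnormed"
begin

lemma op_norm_le:
  assumes "0 \<le> C" "\<And>x. x \<in> carrier V \<Longrightarrow> vnorm W (T x) \<le> C * vnorm V x"
  shows "vnorm (bounded_ops V W) T \<le> C"
  unfolding op_norm_def
proof (rule cSUP_least)
  have "\<zero>\<^bsub>V\<^esub> \<in> {x \<in> carrier V. vnorm V x \<le> 1}" by simp
  then show "{x \<in> carrier V. vnorm V x \<le> 1} \<noteq> {}" by blast
next
  fix x assume x: "x \<in> {x \<in> carrier V. vnorm V x \<le> 1}"
  then have "vnorm W (T x) \<le> C * vnorm V x" using assms(2) by simp
  also have "\<dots> \<le> C * 1" using x assms(1) by (intro mult_left_mono) auto
  finally show "vnorm W (T x) \<le> C" by simp
qed

lemma op_bdd_above: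
  assumes "T \<in> carrier (bounded_ops V W)"
  shows "bdd_above ((\<lambda>x. vnorm W (T x)) ` {x \<in> carrier V. vnorm V x \<le> 1})"
proof -
  obtain C where C: "\<forall>x\<in>carrier V. vnorm W (T x) \<le> C * vnorm V x"
    using assms by (auto simp: bounded_ops_carrier)
  show ?thesis
  proof (rule bdd_aboveI2)
    fix x assume x: "x \<in> {x \<in> carrier V. vnorm V x \<le> 1}"
    then have "vnorm W (T x) \<le> C * vnorm V x" using C by simp
    also have "\<dots> \<le> \<bar>C\<bar> * 1" using x V.vnorm_nonneg by (intro mult_mono) auto
    finally show "vnorm W (T x) \<le> \<bar>C\<bar>" by simp
  qed
qed

lemma op_in [simp, intro]:
  "T \<in> carrier (bounded_ops V W) \<Longrightarrow> x \<in> carrier V \<Longrightarrow> T x \<in> carrier W"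
  by (auto simp: bounded_ops_carrier)

lemma op_add:
  "T \<in> carrier (bounded_ops V W) \<Longrightarrow> x \<in> carrier V \<Longrightarrow> y \<in> carrier V \<Longrightarrow> T (x \<oplus>\<^bsub>V\<^esub> y) = T x \<oplus>\<^bsub>W\<^esub> T y"
  by (auto simp: bounded_ops_carrier)

lemma op_smult:
  "T \<in> carrier (bounded_ops V W) \<Longrightarrow> x \<in> carrier V \<Longrightarrow> T (c \<odot>\<^bsub>V\<^esub> x) = c \<odot>\<^bsub>W\<^esub> T x"
  by (auto simp: bounded_ops_carrier)

lemma op_zero: "T \<in> carrier (bounded_ops V W) \<Longrightarrow> T \<zero>\<^bsub>V\<^esub> = \<zero>\<^bsub>W\<^esub>"
  using op_smult[of T "\<zero>\<^bsub>V\<^esub>" 0] V.smult_l_null[of "\<zero>\<^bsub>V\<^esub>"] W.smult_l_null[of "T \<zero>\<^bsub>V\<^esub>"] by simp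

lemma op_norm_bound:
  assumes T: "T \<in> carrier (bounded_ops V W)" and x: "x \<in> carrier V"
  shows "vnorm W (T x) \<le> vnorm (bounded_ops V W) T * vnorm V x"
proof (cases "x = \<zero>\<^bsub>V\<^esub>")
  case True
  then show ?thesis using op_zero[OF T] by simp
next
  case False
  then have pos: "vnorm V x > 0" using V.vnorm_nonneg[OF x] V.vnorm_eq_zero[OF x] by linarith
  let ?y = "complex_of_real (1 / vnorm V x) \<odot>\<^bsub>V\<^esub> x"
  have y: "?y \<in> carrier V" "vnorm V ?y \<le> 1"
    using x pos by (auto simp: V.vnorm_smult norm_divide)
  have "vnorm W (T ?y) \<le> vnorm (bounded_ops V W) T"
    unfolding op_norm_def by (rule cSUP_upper[OF _ op_bdd_above[OF T]]) (use y in simp)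
  moreover have "vnorm W (T ?y) = vnorm W (T x) / vnorm V x"
    using x T pos by (simp add: op_smult W.vnorm_smult norm_divide)
  ultimately have "vnorm W (T x) / vnorm V x \<le> vnorm (bounded_ops V W) T" by simp
  then show ?thesis using pos by (simp only: pos_divide_le_eq)
qed

lemma op_norm_nonneg: "T \<in> carrier (bounded_ops V W) \<Longrightarrow> 0 \<le> vnorm (bounded_ops V W) T"
proof -
  assume T: "T \<in> carrier (bounded_ops V W)"
  have "vnorm W (T \<zero>\<^bsub>V\<^esub>) \<le> vnorm (bounded_ops V W) T"
    unfolding op_norm_def by (rule cSUP_upper[OF _ op_bdd_above[OF T]]) simp
  then show ?thesis using op_zero[OF T] by simp
qed

lemma op_add_closed:
  assumes S: "S \<in> carrier (bounded_ops V W)" and T: "T \<in> carrier (bounded_ops V W)"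
  shows "S \<oplus>\<^bsub>bounded_ops V W\<^esub> T \<in> carrier (bounded_ops V W)"
  unfolding bounded_ops_carrier
proof (intro conjI ballI allI exI[of _ "vnorm (bounded_ops V W) S + vnorm (bounded_ops V W) T"])
  show "S \<oplus>\<^bsub>bounded_ops V W\<^esub> T \<in> carrier V \<rightarrow>\<^sub>E carrier W"
    using S T by (auto simp: bounded_ops_simps)
  fix x assume x: "x \<in> carrier V"
  show "(S \<oplus>\<^bsub>bounded_ops V W\<^esub> T) (c \<odot>\<^bsub>V\<^esub> x) = c \<odot>\<^bsub>W\<^esub> (S \<oplus>\<^bsub>bounded_ops V W\<^esub> T) x" for c
    using S T x W.smult_r_distr[of c "S x" "T x"] by (simp add: bounded_ops_simps op_smult)
  show "(S \<oplus>\<^bsub>bounded_ops V W\<^esub> T) (x \<oplus>\<^bsub>V\<^esub> y)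
      = (S \<oplus>\<^bsub>bounded_ops V W\<^esub> T) x \<oplus>\<^bsub>W\<^esub> (S \<oplus>\<^bsub>bounded_ops V W\<^esub> T) y" if "y \<in> carrier V" for y
    using S T x that by (simp add: bounded_ops_simps op_add W.a_ac)
  have "vnorm W (S x \<oplus>\<^bsub>W\<^esub> T x) \<le> vnorm W (S x) + vnorm W (T x)"
    using S T x by (intro W.vnorm_triangle) auto
  also have "\<dots> \<le> (vnorm (bounded_ops V W) S + vnorm (bounded_ops V W) T) * vnorm V x"
    using op_norm_bound[OF S x] op_norm_bound[OF T x] by (simp add: distrib_right)
  finally show "vnorm W ((S \<oplus>\<^bsub>bounded_ops V W\<^esub> T) x)
      \<le> (vnorm (bounded_ops V W) S + vnorm (bounded_ops V W) T) * vnorm V x"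
    using x by (simp add: bounded_ops_simps)
qed

lemma op_smult_closed:
  assumes T: "T \<in> carrier (bounded_ops V W)"
  shows "c \<odot>\<^bsub>bounded_ops V W\<^esub> T \<in> carrier (bounded_ops V W)"
  unfolding bounded_ops_carrier
proof (intro conjI ballI allI exI[of _ "cmod c * vnorm (bounded_ops V W) T"])
  show "c \<odot>\<^bsub>bounded_ops V W\<^esub> T \<in> carrier V \<rightarrow>\<^sub>E carrier W"
    using T by (auto simp: bounded_ops_simps)
  fix x assume x: "x \<in> carrier V"
  show "(c \<odot>\<^bsub>bounded_ops V W\<^esub> T) (a \<odot>\<^bsub>V\<^esub> x) = a \<odot>\<^bsub>W\<^esub> (c \<odot>\<^bsub>bounded_ops V W\<^esub> T) x" for a
    using T x W.smult_assoc1[of c a "T x"] W.smult_assoc1[of a c "T x"]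
    by (simp add: bounded_ops_simps op_smult mult.commute)
  show "(c \<odot>\<^bsub>bounded_ops V W\<^esub> T) (x \<oplus>\<^bsub>V\<^esub> y)
      = (c \<odot>\<^bsub>bounded_ops V W\<^esub> T) x \<oplus>\<^bsub>W\<^esub> (c \<odot>\<^bsub>bounded_ops V W\<^esub> T) y" if "y \<in> carrier V" for y
    using T x that W.smult_r_distr[of c "T x" "T y"] by (simp add: bounded_ops_simps op_add)
  show "vnorm W ((c \<odot>\<^bsub>bounded_ops V W\<^esub> T) x) \<le> cmod c * vnorm (bounded_ops V W) T * vnorm V x"
    using x T op_norm_bound[OF T x] by (simp add: bounded_ops_simps W.vnorm_smult mult.assoc mult_left_mono)
qed

lemma op_zero_closed: "\<zero>\<^bsub>bounded_ops V W\<^esub> \<in> carrier (bounded_ops V W)"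
  unfolding bounded_ops_carrier using V.vnorm_nonneg W.smult_r_null
  by (auto simp: bounded_ops_simps intro!: exI[of _ 0])

lemma abelian_group_bounded_ops: "abelian_group (bounded_ops V W)"
proof (rule abelian_groupI)
  note [simp] = bounded_ops_simps
  show "\<zero>\<^bsub>bounded_ops V W\<^esub> \<oplus>\<^bsub>bounded_ops V W\<^esub> S = S" if "S \<in> carrier (bounded_ops V W)" for S
    using that by (auto simp: bounded_ops_carrier fun_eq_iff PiE_iff extensional_def)
  fix S assume S: "S \<in> carrier (bounded_ops V W)"
  have "(- 1) \<odot>\<^bsub>bounded_ops V W\<^esub> S \<oplus>\<^bsub>bounded_ops V W\<^esub> S = \<zero>\<^bsub>bounded_ops V W\<^esub>"
    using S by (auto simp: fun_eq_iff restrict_def W.neg_eq_smult[symmetric] W.l_neg)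
  then show "\<exists>y\<in>carrier (bounded_ops V W). y \<oplus>\<^bsub>bounded_ops V W\<^esub> S = \<zero>\<^bsub>bounded_ops V W\<^esub>"
    using op_smult_closed[OF S, of "- 1"] by blast
qed (auto simp: bounded_ops_simps fun_eq_iff restrict_def op_in W.a_ac
      intro!: op_add_closed[unfolded bounded_ops_simps restrict_def] op_zero_closed[unfolded bounded_ops_simps restrict_def])

lemma cnormed_bounded_ops: "cnormed_space (bounded_ops V W)"
proof (rule cnormed_space.intro)
  note [simp] = bounded_ops_simps
  show "module complex_field (bounded_ops V W)"
  proof (rule moduleI[OF cring_complex_field abelian_group_bounded_ops])
    fix T assume T: "T \<in> carrier (bounded_ops V W)"
    show "c \<odot>\<^bsub>bounded_ops V W\<^esub> T \<in> carrier (bounded_ops V W)" for c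
      by (rule op_smult_closed[OF T])
    show "(a \<oplus>\<^bsub>complex_field\<^esub> b) \<odot>\<^bsub>bounded_ops V W\<^esub> T
        = a \<odot>\<^bsub>bounded_ops V W\<^esub> T \<oplus>\<^bsub>bounded_ops V W\<^esub> b \<odot>\<^bsub>bounded_ops V W\<^esub> T" for a b
      using T W.smult_l_distr[of a b] by (auto simp: fun_eq_iff)
    show "(a \<otimes>\<^bsub>complex_field\<^esub> b) \<odot>\<^bsub>bounded_ops V W\<^esub> T
        = a \<odot>\<^bsub>bounded_ops V W\<^esub> (b \<odot>\<^bsub>bounded_ops V W\<^esub> T)" for a b
      using T W.smult_assoc1[of a b] by (auto simp: fun_eq_iff)
    show "\<one>\<^bsub>complex_field\<^esub> \<odot>\<^bsub>bounded_ops V W\<^esub> T = T"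
      using T W.smult_one by (auto simp: fun_eq_iff bounded_ops_carrier PiE_iff extensional_def)
    fix S assume S: "S \<in> carrier (bounded_ops V W)"
    show "a \<odot>\<^bsub>bounded_ops V W\<^esub> (T \<oplus>\<^bsub>bounded_ops V W\<^esub> S)
        = a \<odot>\<^bsub>bounded_ops V W\<^esub> T \<oplus>\<^bsub>bounded_ops V W\<^esub> a \<odot>\<^bsub>bounded_ops V W\<^esub> S" for a
      using T S W.smult_r_distr[of a] by (auto simp: fun_eq_iff)
  qed
  show "cnormed_space_axioms (bounded_ops V W)"
  proof
    fix T assume T: "T \<in> carrier (bounded_ops V W)"
    show "0 \<le> vnorm (bounded_ops V W) T" by (rule op_norm_nonneg[OF T])
    show "vnorm (bounded_ops V W) T = 0 \<longleftrightarrow> T = \<zero>\<^bsub>bounded_ops V W\<^esub>"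
    proof
      assume *: "vnorm (bounded_ops V W) T = 0"
      have "T x = \<zero>\<^bsub>W\<^esub>" if "x \<in> carrier V" for x
        using op_norm_bound[OF T that] * W.vnorm_nonneg[of "T x"] W.vnorm_eq_zero[of "T x"] T that by auto
      then show "T = \<zero>\<^bsub>bounded_ops V W\<^esub>"
        using T by (auto simp: fun_eq_iff bounded_ops_carrier PiE_iff extensional_def)
    next
      assume "T = \<zero>\<^bsub>bounded_ops V W\<^esub>"
      then have "vnorm (bounded_ops V W) T \<le> 0" by (intro op_norm_le) auto
      then show "vnorm (bounded_ops V W) T = 0" using op_norm_nonneg[OF T] by simp
    qed
    show "vnorm (bounded_ops V W) (c \<odot>\<^bsub>bounded_ops V W\<^esub> T) = cmod c * vnorm (bounded_ops V W) T" for c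
    proof (rule antisym)
      show "vnorm (bounded_ops V W) (c \<odot>\<^bsub>bounded_ops V W\<^esub> T) \<le> cmod c * vnorm (bounded_ops V W) T"
        using T op_norm_nonneg[OF T] op_norm_bound[OF T]
        by (intro op_norm_le) (auto simp: W.vnorm_smult mult.assoc mult_left_mono)
      show "cmod c * vnorm (bounded_ops V W) T \<le> vnorm (bounded_ops V W) (c \<odot>\<^bsub>bounded_ops V W\<^esub> T)"
      proof (cases "c = 0")
        case True
        then show ?thesis using op_norm_nonneg[OF op_smult_closed[OF T]] by simp
      next
        case False
        have "vnorm (bounded_ops V W) T \<le> vnorm (bounded_ops V W) (c \<odot>\<^bsub>bounded_ops V W\<^esub> T) / cmod c"
        proof (rule op_norm_le)
          show "0 \<le> vnorm (bounded_ops V W) (c \<odot>\<^bsub>bounded_ops V W\<^esub> T) / cmod c"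
            using op_norm_nonneg[OF op_smult_closed[OF T]] by simp
          fix x assume x: "x \<in> carrier V"
          show "vnorm W (T x) \<le> vnorm (bounded_ops V W) (c \<odot>\<^bsub>bounded_ops V W\<^esub> T) / cmod c * vnorm V x"
            using op_norm_bound[OF op_smult_closed[OF T] x, of c] x T False
            by (simp add: W.vnorm_smult field_simps)
        qed
        then show ?thesis using False by (simp add: field_simps)
      qed
    qed
    fix S assume S: "S \<in> carrier (bounded_ops V W)"
    show "vnorm (bounded_ops V W) (T \<oplus>\<^bsub>bounded_ops V W\<^esub> S)
        \<le> vnorm (bounded_ops V W) T + vnorm (bounded_ops V W) S"
    proof (rule op_norm_le)
      fix x assume x: "x \<in> carrier V"
      have "vnorm W (T x \<oplus>\<^bsub>W\<^esub> S x) \<le> vnorm W (T x) + vnorm W (S x)"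
        using S T x by (intro W.vnorm_triangle) auto
      also have "\<dots> \<le> (vnorm (bounded_ops V W) T + vnorm (bounded_ops V W) S) * vnorm V x"
        using op_norm_bound[OF S x] op_norm_bound[OF T x] by (simp add: distrib_right)
      finally show "vnorm W ((T \<oplus>\<^bsub>bounded_ops V W\<^esub> S) x)
          \<le> (vnorm (bounded_ops V W) T + vnorm (bounded_ops V W) S) * vnorm V x"
        using x by simp
    qed (use op_norm_nonneg S T in auto)
  qed
qed

end

section \<open>Diagonal operators on solid sequence spaces\<close>

text \<open>In the left half plane the distance to a nonnegative number is at least
  \<open>cmod z\<close>. In the right half plane the imaginary part already suffices, since the sine
  is increasing up to pi / 2.\<close>

lemma dist_positive_real_ge:
  assumes "z \<noteq> 0" "\<sigma> \<le> \<bar>Arg z\<bar>" "0 < \<sigma>" "\<sigma> < pi" "0 \<le> a"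
  shows "sin \<sigma> * cmod z \<le> cmod (z - of_real a)"
proof (cases "Re z \<le> 0")
  case True
  have "(cmod z)\<^sup>2 \<le> (cmod (z - of_real a))\<^sup>2"
  proof -
    have "(cmod (z - of_real a))\<^sup>2 = (cmod z)\<^sup>2 + a\<^sup>2 - 2 * a * Re z"
      unfolding cmod_power2 by (simp add: power2_eq_square algebra_simps)
    moreover have "a * Re z \<le> 0" using True assms(5) by (simp add: mult_nonneg_nonpos)
    ultimately show ?thesis using zero_le_power2[of a] by linarith
  qed
  then have "cmod z \<le> cmod (z - of_real a)" by (simp add: power2_le_iff_abs_le)
  moreover have "sin \<sigma> * cmod z \<le> 1 * cmod z" by (intro mult_right_mono) auto
  ultimately show ?thesis by simp
next
  case False
  then have "\<bar>Arg z\<bar> < pi / 2" using Arg_Re_pos[of z] by auto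
  then have "sin \<sigma> \<le> sin \<bar>Arg z\<bar>" using assms by (intro sin_monotone_2pi_le) auto
  also have "\<dots> = \<bar>sin (Arg z)\<bar>"
    using \<open>\<bar>Arg z\<bar> < pi / 2\<close> sin_gt_zero[of "\<bar>Arg z\<bar>"] by (cases "Arg z = 0") (auto simp: abs_if)
  finally have "sin \<sigma> * cmod z \<le> \<bar>sin (Arg z)\<bar> * cmod z" by (intro mult_right_mono) auto
  also have "\<dots> = \<bar>Im (z - of_real a)\<bar>" using assms(1) by (simp add: sin_Arg)
  also have "\<dots> \<le> cmod (z - of_real a)" by (rule abs_Im_le_cmod)
  finally show ?thesis .
qed

section \<open>Coordinates, solidity and multipliers\<close>

locale coord_space = cnormed_space V for V :: "'v cnormed" +
  fixes J :: "'v \<Rightarrow> nat \<Rightarrow> complex"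
  assumes J_add: "\<And>x y. x \<in> carrier V \<Longrightarrow> y \<in> carrier V \<Longrightarrow> J (x \<oplus>\<^bsub>V\<^esub> y) = (\<lambda>k. J x k + J y k)"
    and J_smult: "\<And>c x. x \<in> carrier V \<Longrightarrow> J (c \<odot>\<^bsub>V\<^esub> x) = (\<lambda>k. c * J x k)"
begin

lemma J_zero: "J \<zero>\<^bsub>V\<^esub> = (\<lambda>k. 0)"
  using J_smult[of "\<zero>\<^bsub>V\<^esub>" 0] smult_l_null[of "\<zero>\<^bsub>V\<^esub>"] by simp

lemma J_neg: "x \<in> carrier V \<Longrightarrow> J (\<ominus>\<^bsub>V\<^esub> x) = (\<lambda>k. - J x k)"
  by (simp add: neg_eq_smult J_smult)

lemma J_minus: "x \<in> carrier V \<Longrightarrow> y \<in> carrier V \<Longrightarrow> J (x \<ominus>\<^bsub>V\<^esub> y) = (\<lambda>k. J x k - J y k)"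
  by (simp add: a_minus_def J_add J_neg)

lemma J_finsum:
  assumes "finite I" "\<And>i. i \<in> I \<Longrightarrow> f i \<in> carrier V"
  shows "J (finsum V f I) k = (\<Sum>i\<in>I. J (f i) k)"
  using assms
proof (induction I)
  case empty
  then show ?case by (simp add: J_zero)
next
  case (insert i I)
  then have "finsum V f (insert i I) = f i \<oplus>\<^bsub>V\<^esub> finsum V f I"
    by (intro finsum_insert) auto
  then show ?case using insert by (simp add: J_add finsum_closed Pi_iff)
qed

end

text \<open>These are the properties of \<open>X\<close> on which the operator theory rests, chosen
  so that the dual has them too. \<open>J_tail\<close> is order continuity of the norm.
  \<open>J_rademacher\<close> says that all contractive multipliers together are R-bounded, even
  with an individual domination for each summand. Coordinate 0 is forced to vanish because the heap
  numbering starts at 1; thereby 0 belongs to the resolvent set.\<close>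

locale diag_space = coord_space V J for V :: "'v cnormed" and J +
  assumes J_inj: "\<And>x y. x \<in> carrier V \<Longrightarrow> y \<in> carrier V \<Longrightarrow> J x = J y \<Longrightarrow> x = y"
    and J_index0: "\<And>x. x \<in> carrier V \<Longrightarrow> J x 0 = 0"
    and J_solid: "\<And>x g. x \<in> carrier V \<Longrightarrow> (\<And>k. cmod (g k) \<le> cmod (J x k)) \<Longrightarrow>
      \<exists>y\<in>carrier V. J y = g \<and> vnorm V y \<le> vnorm V x"
    and J_unit: "\<And>k. 1 \<le> k \<Longrightarrow> \<exists>e\<in>carrier V. J e = (\<lambda>i. if i = k then 1 else 0)"
    and J_tail: "\<And>x e. x \<in> carrier V \<Longrightarrow> 0 < e \<Longrightarrow>
      \<exists>K. \<forall>y\<in>carrier V. (\<forall>k. J y k = (if k < K then 0 else J x k)) \<longrightarrow> vnorm V y < e"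
    and J_rademacher: "\<exists>C. \<forall>N x y. (\<forall>n<N. x n \<in> carrier V \<and> y n \<in> carrier V \<and>
        (\<forall>k. cmod (J (y n) k) \<le> cmod (J (x n) k))) \<longrightarrow>
      rademacher_norm V N y \<le> C * rademacher_norm V N x"
begin

sublocale VV: two_cnormed V V
  by unfold_locales

definition vec :: "(nat \<Rightarrow> complex) \<Rightarrow> 'v" where
  "vec g = (THE y. y \<in> carrier V \<and> J y = g)"

lemma vec_J: "x \<in> carrier V \<Longrightarrow> vec (J x) = x"
  unfolding vec_def using J_inj by (intro the_equality) auto

lemma J_solid_scaled:
  assumes "x \<in> carrier V" "0 \<le> c" "\<And>k. 1 \<le> k \<Longrightarrow> cmod (g k) \<le> c * cmod (J x k)" "g 0 = 0"
  shows "vec g \<in> carrier V" "J (vec g) = g" "vnorm V (vec g) \<le> c * vnorm V x"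
proof -
  have "cmod (g k) \<le> cmod (J (complex_of_real c \<odot>\<^bsub>V\<^esub> x) k)" for k
    using assms by (cases "k = 0") (auto simp: J_smult norm_mult)
  then obtain y where "y \<in> carrier V" "J y = g" "vnorm V y \<le> vnorm V (complex_of_real c \<odot>\<^bsub>V\<^esub> x)"
    using J_solid[of "complex_of_real c \<odot>\<^bsub>V\<^esub> x" g] assms(1) by auto
  then show "vec g \<in> carrier V" "J (vec g) = g" "vnorm V (vec g) \<le> c * vnorm V x"
    using vec_J[of y] assms by (auto simp: vnorm_smult)
qed

lemma vec_finite:
  assumes "g 0 = 0" "\<And>k. K \<le> k \<Longrightarrow> g k = 0"
  shows "vec g \<in> carrier V" "J (vec g) = g"
proof -
  have "\<exists>y\<in>carrier V. J y = g"
    using assms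
  proof (induction K arbitrary: g)
    case 0
    then have "g = (\<lambda>k. 0)" by auto
    then show ?case using J_zero by blast
  next
    case (Suc K)
    have "(if k = K then 0 else g k) = 0" if "K \<le> k" for k
      using Suc.prems(2)[of k] that by (cases "k = K") auto
    then obtain y where y: "y \<in> carrier V" "J y = (\<lambda>k. if k = K then 0 else g k)"
      using Suc.IH[of "\<lambda>k. if k = K then 0 else g k"] Suc.prems(1) by (cases "K = 0") auto
    show ?case
    proof (cases "K = 0")
      case True
      then show ?thesis using y Suc.prems(1) by (intro bexI[of _ y]) auto
    next
      case False
      then obtain e where e: "e \<in> carrier V" "J e = (\<lambda>i. if i = K then 1 else 0)"
        using J_unit[of K] by auto
      show ?thesis
        using y e by (intro bexI[of _ "y \<oplus>\<^bsub>V\<^esub> g K \<odot>\<^bsub>V\<^esub> e"]) (auto simp: J_add J_smult)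
    qed
  qed
  then show "vec g \<in> carrier V" "J (vec g) = g" using vec_J by auto
qed

text \<open>By solidity the component of \<open>x\<close> along the k-th unit vector has at most the
  norm of \<open>x\<close>; the constant is the reciprocal norm of that unit vector.\<close>

lemma J_cmod_le:
  assumes "1 \<le> k"
  obtains c where "0 < c" "\<And>x. x \<in> carrier V \<Longrightarrow> cmod (J x k) \<le> c * vnorm V x"
proof -
  obtain e where e: "e \<in> carrier V" "J e = (\<lambda>i. if i = k then 1 else 0)"
    using J_unit[OF assms] by auto
  have "e \<noteq> \<zero>\<^bsub>V\<^esub>" using e(2) J_zero by (metis zero_neq_one)
  then have pos: "vnorm V e > 0" using e vnorm_nonneg[of e] vnorm_eq_zero[of e] by linarith
  have "cmod (J x k) \<le> 1 / vnorm V e * vnorm V x" if "x \<in> carrier V" for x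
  proof -
    have "cmod (J (J x k \<odot>\<^bsub>V\<^esub> e) i) \<le> cmod (J x i)" for i
      using e by (simp add: J_smult)
    then obtain y where "y \<in> carrier V" "J y = J (J x k \<odot>\<^bsub>V\<^esub> e)" "vnorm V y \<le> vnorm V x"
      using J_solid[OF \<open>x \<in> carrier V\<close>] by blast
    then have "cmod (J x k) * vnorm V e \<le> vnorm V x"
      using J_inj[of y "J x k \<odot>\<^bsub>V\<^esub> e"] e by (auto simp: vnorm_smult)
    then show ?thesis using pos by (simp add: field_simps)
  qed
  then show ?thesis using pos by (intro that[of "1 / vnorm V e"]) auto
qed

lemma vnorm_mono:
  assumes "x \<in> carrier V" "y \<in> carrier V" "\<And>k. cmod (J y k) \<le> cmod (J x k)"
  shows "vnorm V y \<le> vnorm V x"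
  using J_solid[OF assms(1), of "J y"] assms(2,3) J_inj by blast

definition Mult :: "(nat \<Rightarrow> complex) \<Rightarrow> 'v \<Rightarrow> 'v" where
  "Mult m = (\<lambda>x\<in>carrier V. vec (\<lambda>k. m k * J x k))"

lemma
  assumes "\<And>k. 1 \<le> k \<Longrightarrow> cmod (m k) \<le> c" "x \<in> carrier V"
  shows Mult_in: "Mult m x \<in> carrier V"
    and J_Mult: "J (Mult m x) = (\<lambda>k. m k * J x k)"
    and vnorm_Mult_le: "vnorm V (Mult m x) \<le> c * vnorm V x"
proof -
  have c: "0 \<le> c" using assms(1)[of 1] norm_ge_zero[of "m 1"] by linarith
  show "Mult m x \<in> carrier V" "J (Mult m x) = (\<lambda>k. m k * J x k)" "vnorm V (Mult m x) \<le> c * vnorm V x"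
    using J_solid_scaled[OF assms(2) c, of "\<lambda>k. m k * J x k"] assms
    by (auto simp: Mult_def norm_mult mult_right_mono J_index0)
qed

lemma
  assumes "\<And>k. 1 \<le> k \<Longrightarrow> cmod (m k) \<le> c"
  shows Mult_carrier: "Mult m \<in> carrier (bounded_ops V V)"
    and norm_Mult_le: "vnorm (bounded_ops V V) (Mult m) \<le> c"
proof -
  have c: "0 \<le> c" using assms[of 1] norm_ge_zero[of "m 1"] by linarith
  show "vnorm (bounded_ops V V) (Mult m) \<le> c"
    using vnorm_Mult_le[OF assms] c by (intro VV.op_norm_le) auto
  show "Mult m \<in> carrier (bounded_ops V V)"
    unfolding bounded_ops_carrier
  proof (intro conjI ballI allI exI[of _ c])
    show "Mult m \<in> carrier V \<rightarrow>\<^sub>E carrier V" using Mult_in[OF assms] by (auto simp: Mult_def)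
    fix x assume x: "x \<in> carrier V"
    show "vnorm V (Mult m x) \<le> c * vnorm V x" by (rule vnorm_Mult_le[OF assms x])
    show "Mult m (a \<odot>\<^bsub>V\<^esub> x) = a \<odot>\<^bsub>V\<^esub> Mult m x" for a
      using x by (intro J_inj) (auto simp: J_Mult[OF assms] Mult_in[OF assms] J_smult)
    show "Mult m (x \<oplus>\<^bsub>V\<^esub> y) = Mult m x \<oplus>\<^bsub>V\<^esub> Mult m y" if "y \<in> carrier V" for y
      using x that by (intro J_inj) (auto simp: J_Mult[OF assms] Mult_in[OF assms] J_add algebra_simps)
  qed
qed

lemma op_eqI:
  assumes "S \<in> carrier (bounded_ops V V)" "T \<in> carrier (bounded_ops V V)"
    "\<And>x k. x \<in> carrier V \<Longrightarrow> 1 \<le> k \<Longrightarrow> J (S x) k = J (T x) k"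
  shows "S = T"
proof
  fix x show "S x = T x"
  proof (cases "x \<in> carrier V")
    case True
    then have "J (S x) k = J (T x) k" for k
      using assms by (cases "k = 0") (auto simp: J_index0)
    then show ?thesis using True assms by (intro J_inj) auto
  next
    case False
    then show ?thesis using assms(1,2) by (auto simp: bounded_ops_carrier PiE_iff extensional_def)
  qed
qed

lemma J_op_minus:
  assumes "S \<in> carrier (bounded_ops V V)" "T \<in> carrier (bounded_ops V V)" "x \<in> carrier V"
  shows "J ((S \<ominus>\<^bsub>bounded_ops V V\<^esub> T) x) k = J (S x) k - J (T x) k"
proof -
  interpret BO: cnormed_space "bounded_ops V V" by (rule VV.cnormed_bounded_ops)
  have "S \<ominus>\<^bsub>bounded_ops V V\<^esub> T = S \<oplus>\<^bsub>bounded_ops V V\<^esub> (- 1) \<odot>\<^bsub>bounded_ops V V\<^esub> T"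
    using assms by (simp add: a_minus_def BO.neg_eq_smult)
  then show ?thesis using assms by (simp add: bounded_ops_simps J_add J_smult)
qed

lemma Mult_minus:
  assumes "\<And>k. 1 \<le> k \<Longrightarrow> cmod (m k) \<le> c" "\<And>k. 1 \<le> k \<Longrightarrow> cmod (n k) \<le> d"
  shows "Mult m \<ominus>\<^bsub>bounded_ops V V\<^esub> Mult n = Mult (\<lambda>k. m k - n k)"
proof (rule op_eqI)
  interpret BO: cnormed_space "bounded_ops V V" by (rule VV.cnormed_bounded_ops)
  have b: "cmod (m k - n k) \<le> c + d" if "1 \<le> k" for k
    using norm_triangle_ineq4[of "m k" "n k"] assms(1,2)[OF that] by linarith
  show "Mult m \<ominus>\<^bsub>bounded_ops V V\<^esub> Mult n \<in> carrier (bounded_ops V V)"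
    using Mult_carrier[of m, OF assms(1)] Mult_carrier[of n, OF assms(2)] by simp
  show "Mult (\<lambda>k. m k - n k) \<in> carrier (bounded_ops V V)" by (rule Mult_carrier[OF b])
  fix x k assume "x \<in> carrier V"
  then show "J ((Mult m \<ominus>\<^bsub>bounded_ops V V\<^esub> Mult n) x) k = J (Mult (\<lambda>k. m k - n k) x) k"
    using Mult_carrier[of m, OF assms(1)] Mult_carrier[of n, OF assms(2)]
    by (simp add: J_op_minus J_Mult[of m, OF assms(1)] J_Mult[of n, OF assms(2)] J_Mult[OF b] algebra_simps)
qed

lemma Mult_smult:
  assumes "\<And>k. 1 \<le> k \<Longrightarrow> cmod (m k) \<le> c"
  shows "a \<odot>\<^bsub>bounded_ops V V\<^esub> Mult m = Mult (\<lambda>k. a * m k)"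
proof (rule op_eqI)
  have b: "cmod (a * m k) \<le> cmod a * c" if "1 \<le> k" for k
    using assms[OF that] by (simp add: norm_mult mult_left_mono)
  show "a \<odot>\<^bsub>bounded_ops V V\<^esub> Mult m \<in> carrier (bounded_ops V V)"
    by (rule VV.op_smult_closed[OF Mult_carrier[OF assms]])
  show "Mult (\<lambda>k. a * m k) \<in> carrier (bounded_ops V V)" by (rule Mult_carrier[OF b])
  fix x k assume x: "x \<in> carrier V"
  then show "J ((a \<odot>\<^bsub>bounded_ops V V\<^esub> Mult m) x) k = J (Mult (\<lambda>k. a * m k) x) k"
    using Mult_in[OF assms x]
    by (simp add: bounded_ops_simps J_smult J_Mult[OF assms x] J_Mult[OF b x])
qed

lemma Mult_cong: "(\<And>k. 1 \<le> k \<Longrightarrow> m k = n k) \<Longrightarrow> Mult m = Mult n"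
proof -
  assume *: "\<And>k. 1 \<le> k \<Longrightarrow> m k = n k"
  have "m k * J x k = n k * J x k" if "x \<in> carrier V" for x k
    using * that by (cases "k = 0") (auto simp: J_index0)
  then have eq: "(\<lambda>k. m k * J x k) = (\<lambda>k. n k * J x k)" if "x \<in> carrier V" for x
    using that by blast
  show ?thesis unfolding Mult_def by (rule restrict_ext) (simp only: eq)
qed

section \<open>Multiplication by the index and its resolvent\<close>

definition diag_op :: "('v \<times> 'v) set" where
  "diag_op = {(x, y). x \<in> carrier V \<and> y \<in> carrier V \<and> (\<forall>k. J y k = of_nat k * J x k)}"

lemma single_valued_diag_op: "single_valued diag_op"
  unfolding single_valued_def diag_op_def using J_inj by (auto simp: fun_eq_iff intro!: J_inj)

lemma op_apply_diag_op: "(x, y) \<in> diag_op \<Longrightarrow> op_apply diag_op x = y"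
  unfolding op_apply_def using single_valued_diag_op by (intro the_equality) (auto dest: single_valuedD)

lemma linear_operator_diag_op: "linear_operator V diag_op"
  unfolding linear_operator_def using single_valued_diag_op
  by (auto simp: diag_op_def J_zero J_add J_smult algebra_simps)

lemma head_in_domain:
  assumes "x \<in> carrier V" and y_def: "y = vec (\<lambda>k. if k < K then J x k else 0)"
  shows "y \<in> Domain diag_op" "y \<in> carrier V" "J y = (\<lambda>k. if k < K then J x k else 0)"
proof -
  show y: "y \<in> carrier V" "J y = (\<lambda>k. if k < K then J x k else 0)"
    unfolding y_def using J_index0[OF assms(1)] by (auto intro!: vec_finite[of _ K])
  let ?z = "vec (\<lambda>k. if k < K then of_nat k * J x k else 0)"
  have "?z \<in> carrier V" "J ?z = (\<lambda>k. if k < K then of_nat k * J x k else 0)"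
    using J_index0[OF assms(1)] by (auto intro!: vec_finite[of _ K])
  then have "(y, ?z) \<in> diag_op" using y by (auto simp: diag_op_def)
  then show "y \<in> Domain diag_op" by blast
qed

lemma tail_small:
  assumes "x \<in> carrier V" "0 < e"
  obtains y K where "y \<in> Domain diag_op" "y \<in> carrier V" "vnorm V (x \<ominus>\<^bsub>V\<^esub> y) < e"
    "J y = (\<lambda>k. if k < K then J x k else 0)"
proof -
  obtain K where K: "\<forall>y\<in>carrier V. (\<forall>k. J y k = (if k < K then 0 else J x k)) \<longrightarrow> vnorm V y < e"
    using J_tail[OF assms] by auto
  let ?y = "vec (\<lambda>k. if k < K then J x k else 0)"
  note y = head_in_domain[OF assms(1) refl, of K]
  have "vnorm V (x \<ominus>\<^bsub>V\<^esub> ?y) < e"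
    using y assms K by (auto simp: J_minus)
  then show ?thesis using y that by blast
qed

lemma densely_defined_diag_op: "densely_defined V diag_op"
  unfolding densely_defined_def using tail_small by metis

lemma resolvent_diag_op:
  assumes "\<And>k. 1 \<le> k \<Longrightarrow> z \<noteq> of_nat k" and c': "\<And>k. 1 \<le> k \<Longrightarrow> cmod (1 / (z - of_nat k)) \<le> c"
  shows "resolvent V diag_op z = Mult (\<lambda>k. 1 / (z - of_nat k))" "z \<in> resolvent_set V diag_op"
proof -
  define m where "m k = 1 / (z - of_nat k)" for k
  \<comment> \<open>The symbol of the operator times its resolvent. It is bounded because it equals
    \<open>z * m k - 1\<close>, so the resolvent maps into the domain.\<close>
  define n where "n k = of_nat k * m k" for k
  have c: "cmod (m k) \<le> c" if "1 \<le> k" for k using c'[OF that] by (simp add: m_def)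
  have ex: "Mult m y \<in> Domain diag_op \<and> (z \<odot>\<^bsub>V\<^esub> Mult m y) \<ominus>\<^bsub>V\<^esub> op_apply diag_op (Mult m y) = y"
    if y: "y \<in> carrier V" for y
  proof -
    have b: "cmod (n k) \<le> 1 + cmod z * c" if "1 \<le> k" for k
    proof -
      have "n k = z * m k - 1" using assms(1)[OF that] by (simp add: n_def m_def field_simps)
      then have "cmod (n k) \<le> cmod (z * m k) + 1" by (metis norm_triangle_ineq4 norm_one)
      also have "cmod (z * m k) \<le> cmod z * c" using c[OF that] unfolding norm_mult by (intro mult_left_mono) auto
      finally show ?thesis by simp
    qed
    have JM: "J (Mult m y) k = m k * J y k"
      "J (Mult n y) k = n k * J y k" for k
      by (simp_all only: J_Mult[of m, OF c y] J_Mult[of n, OF b y])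
    have A: "(Mult m y, Mult n y) \<in> diag_op"
      unfolding diag_op_def mem_Collect_eq case_prod_conv JM
      using Mult_in[of m, OF c y] Mult_in[of n, OF b y] by (simp add: n_def)
    moreover have "(z \<odot>\<^bsub>V\<^esub> Mult m y) \<ominus>\<^bsub>V\<^esub> Mult n y = y"
    proof (rule J_inj)
      show "J ((z \<odot>\<^bsub>V\<^esub> Mult m y) \<ominus>\<^bsub>V\<^esub> Mult n y) = J y"
      proof
        fix k
        show "J ((z \<odot>\<^bsub>V\<^esub> Mult m y) \<ominus>\<^bsub>V\<^esub> Mult n y) k = J y k"
        proof (cases "k = 0")
          case True
          then show ?thesis using Mult_in[of m, OF c y] Mult_in[of n, OF b y] y by (simp add: J_index0)
        next
          case False
          then have "z \<noteq> of_nat k" using assms(1)[of k] by simp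
          have "J ((z \<odot>\<^bsub>V\<^esub> Mult m y) \<ominus>\<^bsub>V\<^esub> Mult n y) k
              = z * (m k * J y k) - n k * J y k"
            using Mult_in[of m, OF c y] Mult_in[of n, OF b y] by (simp add: J_minus J_smult JM)
          also have "\<dots> = ((z - of_nat k) * m k) * J y k"
            by (simp only: n_def left_diff_distrib mult.assoc)
          finally show ?thesis using \<open>z \<noteq> of_nat k\<close> by (simp add: m_def)
        qed
      qed
    qed (use Mult_in[of m, OF c y] Mult_in[of n, OF b y] y in auto)
    ultimately show ?thesis using op_apply_diag_op[OF A] by auto
  qed
  have uniq: "x = Mult m y"
    if y: "y \<in> carrier V" and x: "x \<in> Domain diag_op" "(z \<odot>\<^bsub>V\<^esub> x) \<ominus>\<^bsub>V\<^esub> op_apply diag_op x = y" for x y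
  proof -
    obtain w where w: "(x, w) \<in> diag_op" using x by auto
    then have xw: "x \<in> carrier V" "w \<in> carrier V" "\<And>k. J w k = of_nat k * J x k" by (auto simp: diag_op_def)
    have "J y k = (z - of_nat k) * J x k" for k
      using x(2) xw op_apply_diag_op[OF w] by (auto simp: J_minus J_smult algebra_simps)
    moreover have "J x 0 = 0" "J y 0 = 0" using xw y J_index0 by auto
    ultimately have "J x k = m k * J y k" for k
      using assms(1)[of k] by (cases "k = 0") (auto simp: m_def)
    then show ?thesis using xw y by (intro J_inj) (auto simp: J_Mult[of m, OF c y] Mult_in[of m, OF c y])
  qed
  have the: "(THE x. x \<in> Domain diag_op \<and> (z \<odot>\<^bsub>V\<^esub> x) \<ominus>\<^bsub>V\<^esub> op_apply diag_op x = y) = Mult m y"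
    if "y \<in> carrier V" for y
    using ex[OF that] uniq[OF that] by (intro the_equality) auto
  have res': "resolvent V diag_op z = Mult m"
    unfolding resolvent_def using the by (auto simp: fun_eq_iff Mult_def)
  then show res: "resolvent V diag_op z = Mult (\<lambda>k. 1 / (z - of_nat k))"
    by (simp add: m_def[abs_def])
  show "z \<in> resolvent_set V diag_op"
    unfolding resolvent_set_def mem_Collect_eq res'
  proof (intro conjI ballI)
    show "Mult m \<in> carrier (bounded_ops V V)" by (rule Mult_carrier[of m, OF c])
    fix y assume y: "y \<in> carrier V"
    show "\<exists>!x. x \<in> Domain diag_op \<and> (z \<odot>\<^bsub>V\<^esub> x) \<ominus>\<^bsub>V\<^esub> op_apply diag_op x = y"
      using ex[OF y] uniq[OF y] by (intro ex1I[of _ "Mult m y"]) auto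
  qed
qed

lemma resolvent_off_sector:
  assumes \<sigma>: "0 < \<sigma>" "\<sigma> < pi" and z: "z \<noteq> 0" "\<sigma> \<le> \<bar>Arg z\<bar>"
  shows "\<And>k::nat. cmod (1 / (z - of_nat k)) \<le> 1 / (sin \<sigma> * cmod z)"
    "\<And>k::nat. cmod (z / (z - of_nat k)) \<le> 1 / sin \<sigma>"
    "resolvent V diag_op z = Mult (\<lambda>k. 1 / (z - of_nat k))" "z \<in> resolvent_set V diag_op"
proof -
  have s: "sin \<sigma> > 0" using \<sigma> by (intro sin_gt_zero) auto
  have d: "sin \<sigma> * cmod z \<le> cmod (z - of_nat k)" for k :: nat
    using dist_positive_real_ge[OF z \<sigma>, of "real k"] by simp
  have pos: "0 < sin \<sigma> * cmod z" using s z by simp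
  then have ne: "z \<noteq> of_nat k" for k :: nat using d[of k] by auto
  show b: "cmod (1 / (z - of_nat k)) \<le> 1 / (sin \<sigma> * cmod z)" for k :: nat
    using d[of k] order_less_le_trans[OF pos d[of k]]
    unfolding norm_divide norm_one by (intro divide_left_mono mult_pos_pos[OF _ pos]) auto
  show "cmod (z / (z - of_nat k)) \<le> 1 / sin \<sigma>" for k :: nat
    using mult_left_mono[OF b[of k], of "cmod z"] z s by (simp add: norm_divide)
  show "resolvent V diag_op z = Mult (\<lambda>k. 1 / (z - of_nat k))" "z \<in> resolvent_set V diag_op"
    using resolvent_diag_op[OF ne b] by auto
qed

lemma sectorial_family_subset:
  assumes \<sigma>: "0 < \<sigma>" "\<sigma> < pi"
  shows "sectorial_family V diag_op \<sigma> \<subseteq> {Mult m | m. \<forall>k\<ge>1. cmod (m k) \<le> 1 / sin \<sigma>}"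
    and "spectrum V diag_op \<subseteq> closure (sector \<sigma>)"
proof -
  \<comment> \<open>The origin has no useful argument and is treated directly: the distance from 0
    to the indices is at least 1.\<close>
  have z0: "resolvent V diag_op 0 = Mult (\<lambda>k. 1 / (0 - of_nat k))" "0 \<in> resolvent_set V diag_op"
    by (rule resolvent_diag_op[of 0 1]; auto simp: norm_divide)+
  have out: "z = 0 \<or> \<sigma> \<le> \<bar>Arg z\<bar>" if "z \<notin> closure (sector \<sigma>)" for z
  proof -
    have "z \<notin> sector \<sigma>" using that closure_subset by blast
    then show ?thesis by (auto simp: sector_def)
  qed
  show "sectorial_family V diag_op \<sigma> \<subseteq> {Mult m | m. \<forall>k\<ge>1. cmod (m k) \<le> 1 / sin \<sigma>}"
  proof
    fix T assume "T \<in> sectorial_family V diag_op \<sigma>"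
    then obtain z where z: "T = z \<odot>\<^bsub>bounded_ops V V\<^esub> resolvent V diag_op z" "z \<notin> closure (sector \<sigma>)"
      by (auto simp: sectorial_family_def)
    have s: "sin \<sigma> > 0" using \<sigma> by (intro sin_gt_zero) auto
    show "T \<in> {Mult m | m. \<forall>k\<ge>1. cmod (m k) \<le> 1 / sin \<sigma>}"
    proof (cases "z = 0")
      case True
      have "T = Mult (\<lambda>k. 0 * (1 / (0 - of_nat k)))"
        unfolding z(1) True z0(1) by (rule Mult_smult[of _ 1]) (auto simp: norm_divide)
      then show ?thesis using s by (auto intro!: exI[of _ "\<lambda>k. 0 * (1 / (0 - of_nat k))"])
    next
      case False
      note r = resolvent_off_sector[OF \<sigma> False]
      have "\<sigma> \<le> \<bar>Arg z\<bar>" using out z False by auto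
      note r = r[OF this]
      have "T = Mult (\<lambda>k. z * (1 / (z - of_nat k)))"
        unfolding z(1) r(3) by (rule Mult_smult[OF r(1)])
      then show ?thesis using r(2) by (auto intro!: exI[of _ "\<lambda>k. z * (1 / (z - of_nat k))"])
    qed
  qed
  show "spectrum V diag_op \<subseteq> closure (sector \<sigma>)"
  proof
    fix z assume z: "z \<in> spectrum V diag_op"
    show "z \<in> closure (sector \<sigma>)"
    proof (rule ccontr)
      assume "z \<notin> closure (sector \<sigma>)"
      then have "z \<in> resolvent_set V diag_op"
        using z0(2) resolvent_off_sector(4)[OF \<sigma>] out[of z] by (cases "z = 0") auto
      then show False using z by (simp add: spectrum_def)
    qed
  qed
qed

lemma sectorial_angles_diag_op: "sectorial_angles V diag_op = {0<..<pi}"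
proof -
  have "spectrum V diag_op \<subseteq> closure (sector \<sigma>) \<and>
    (\<exists>C. \<forall>T\<in>sectorial_family V diag_op \<sigma>. vnorm (bounded_ops V V) T \<le> C)"
    if \<sigma>: "0 < \<sigma>" "\<sigma> < pi" for \<sigma>
  proof (intro conjI exI ballI)
    fix T assume "T \<in> sectorial_family V diag_op \<sigma>"
    then obtain m where m: "T = Mult m" "\<And>k. 1 \<le> k \<Longrightarrow> cmod (m k) \<le> 1 / sin \<sigma>"
      using subsetD[OF sectorial_family_subset(1)[OF \<sigma>]] by auto
    show "vnorm (bounded_ops V V) T \<le> 1 / sin \<sigma>"
      unfolding m(1) by (rule norm_Mult_le[OF m(2)])
  qed (rule sectorial_family_subset(2)[OF \<sigma>])
  then show ?thesis unfolding sectorial_angles_def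
    by (intro subset_antisym subsetI; unfold mem_Collect_eq greaterThanLessThan_iff; blast)
qed

lemma sectoriality_angle_diag_op: "sectoriality_angle V diag_op = 0"
  unfolding sectoriality_angle_def sectorial_angles_diag_op
  by (rule cInf_greaterThanLessThan) (rule pi_gt_zero)

lemma sectorial_diag_op: "sectorial V diag_op"
  unfolding sectorial_def sectorial_angles_diag_op greaterThanLessThan_empty_iff not_le
  by (intro conjI linear_operator_diag_op densely_defined_diag_op pi_gt_zero)

lemma R_sectorial_diag_op: "R_sectorial V diag_op"
proof -
  obtain C where C: "\<And>N x y. (\<forall>n<N. x n \<in> carrier V \<and> y n \<in> carrier V \<and>
        (\<forall>k. cmod (J (y n) k) \<le> cmod (J (x n) k))) \<Longrightarrow>
      rademacher_norm V N y \<le> C * rademacher_norm V N x"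
    using J_rademacher by blast
  \<comment> \<open>At the angle pi / 2 the bound \<open>1 / sin \<sigma>\<close> is 1, so the
    multipliers are contractive and \<open>J_rademacher\<close> applies without rescaling.\<close>
  have sub: "sectorial_family V diag_op (pi / 2) \<subseteq> {Mult m | m. \<forall>k\<ge>1. cmod (m k) \<le> 1}"
    using sectorial_family_subset(1)[of "pi / 2"] by simp
  have "R_bounded V V (sectorial_family V diag_op (pi / 2))"
    unfolding R_bounded_def
  proof (intro conjI exI allI impI)
    show "sectorial_family V diag_op (pi / 2) \<subseteq> carrier (bounded_ops V V)"
      using sub Mult_carrier by blast
    fix N :: nat and T x
    assume *: "\<forall>n<N. T n \<in> sectorial_family V diag_op (pi / 2) \<and> x n \<in> carrier V"
    show "rademacher_norm V N (\<lambda>n. T n (x n)) \<le> C * rademacher_norm V N x"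
    proof (rule C, intro allI impI)
      fix n assume n: "n < N"
      then obtain m where m: "T n = Mult m" "\<And>k. 1 \<le> k \<Longrightarrow> cmod (m k) \<le> 1" using * sub by blast
      have x: "x n \<in> carrier V" using * n by simp
      have "cmod (J (T n (x n)) k) \<le> cmod (J (x n) k)" for k
        using m x J_Mult[OF m(2) x] J_index0[OF x] mult_right_mono[OF m(2)[of k], of "cmod (J (x n) k)"]
        by (cases "k = 0") (auto simp: norm_mult)
      then show "x n \<in> carrier V \<and> T n (x n) \<in> carrier V \<and> (\<forall>k. cmod (J (T n (x n)) k) \<le> cmod (J (x n) k))"
        using x m Mult_in[OF m(2) x] by simp
    qed
  qed
  then show ?thesis
    unfolding R_sectorial_def sectorial_angles_diag_op using sectorial_diag_op
    by (intro conjI bexI[of _ "pi / 2"]) auto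
qed

end

section \<open>Duality of solid sequence spaces\<close>

context diag_space
begin

sublocale functional: two_cnormed V complex_space
  by (intro two_cnormed.intro cnormed_complex_space) unfold_locales

definition unit :: "nat \<Rightarrow> 'v" where
  "unit k = vec (\<lambda>i. if i = k then 1 else 0)"

lemma unit_in: "1 \<le> k \<Longrightarrow> unit k \<in> carrier V" and J_unit_eq: "1 \<le> k \<Longrightarrow> J (unit k) = (\<lambda>i. if i = k then 1 else 0)"
  unfolding unit_def by (rule vec_finite[where K = "Suc k"]; simp)+

definition dual_coord :: "('v \<Rightarrow> complex) \<Rightarrow> nat \<Rightarrow> complex" where
  "dual_coord \<phi> k = (if k = 0 then 0 else \<phi> (unit k))"

lemma functional_finite:
  assumes \<phi>: "\<phi> \<in> carrier (dual V)" and y: "y \<in> carrier V" "\<And>k. K \<le> k \<Longrightarrow> J y k = 0"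
  shows "\<phi> y = (\<Sum>k<K. dual_coord \<phi> k * J y k)"
  using y
proof (induction K arbitrary: y)
  case 0
  then have "y = \<zero>\<^bsub>V\<^esub>" by (intro J_inj) (auto simp: J_zero)
  then show ?case using functional.op_zero[of \<phi>] \<phi> by (simp add: dual_def)
next
  case (Suc K)
  show ?case
  proof (cases "K = 0")
    case True
    then have "J y k = 0" for k using Suc.prems J_index0 by (cases "k = 0") auto
    then have "y = \<zero>\<^bsub>V\<^esub>" using Suc.prems by (intro J_inj) (auto simp: J_zero)
    then show ?thesis using functional.op_zero[of \<phi>] \<phi> by (simp add: dual_def J_zero)
  next
    case False
    define w where "w = J y K \<odot>\<^bsub>V\<^esub> unit K"
    have w: "w \<in> carrier V" "J w = (\<lambda>k. if k = K then J y K else 0)"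
      unfolding w_def using False unit_in[of K] J_unit_eq[of K] by (auto simp: J_smult)
    have yw: "y \<ominus>\<^bsub>V\<^esub> w \<in> carrier V" "J (y \<ominus>\<^bsub>V\<^esub> w) = (\<lambda>k. if k = K then 0 else J y k)"
      using Suc.prems(1) w by (auto simp: J_minus)
    have "\<phi> (y \<ominus>\<^bsub>V\<^esub> w) = (\<Sum>k<K. dual_coord \<phi> k * J (y \<ominus>\<^bsub>V\<^esub> w) k)"
    proof (rule Suc.IH[OF yw(1)])
      fix k assume "K \<le> k"
      then show "J (y \<ominus>\<^bsub>V\<^esub> w) k = 0" using Suc.prems(2)[of k] unfolding yw(2) by (cases "k = K") auto
    qed
    also have "\<dots> = (\<Sum>k<K. dual_coord \<phi> k * J y k)" unfolding yw(2) by (intro sum.cong) auto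
    finally have "\<phi> (y \<ominus>\<^bsub>V\<^esub> w) = (\<Sum>k<K. dual_coord \<phi> k * J y k)" .
    moreover have "y = (y \<ominus>\<^bsub>V\<^esub> w) \<oplus>\<^bsub>V\<^esub> w" using Suc.prems(1) w(1) yw(1) by (intro J_inj) (auto simp: J_add J_minus)
    then have "\<phi> y = \<phi> (y \<ominus>\<^bsub>V\<^esub> w) + \<phi> w"
      using functional.op_add[of \<phi> "y \<ominus>\<^bsub>V\<^esub> w" w] \<phi> w(1) yw(1) by (simp add: dual_def)
    moreover have "\<phi> w = dual_coord \<phi> K * J y K"
      unfolding w_def dual_coord_def using functional.op_smult[of \<phi> "unit K" "J y K"] \<phi> False unit_in[of K]
      by (simp add: dual_def)
    ultimately show ?thesis by simp
  qed
qed

text \<open>Small tails mean that the heads of \<open>x\<close> converge to \<open>x\<close> in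
  norm. Hence a functional is determined by its values on unit vectors, and the dual is again a
  space of sequences.\<close>

lemma functional_LIMSEQ:
  assumes \<phi>: "\<phi> \<in> carrier (dual V)" and x: "x \<in> carrier V"
  shows "(\<lambda>K. \<Sum>k<K. dual_coord \<phi> k * J x k) \<longlonglongrightarrow> \<phi> x"
proof (rule LIMSEQ_I)
  have \<phi>': "\<phi> \<in> carrier (bounded_ops V complex_space)" using \<phi> by (simp add: dual_def)
  fix r :: real assume r: "0 < r"
  define C where "C = vnorm (bounded_ops V complex_space) \<phi> + 1"
  have C: "0 < C" using functional.op_norm_nonneg[OF \<phi>'] by (simp add: C_def)
  obtain y N where y: "y \<in> carrier V" "vnorm V (x \<ominus>\<^bsub>V\<^esub> y) < r / C" "J y = (\<lambda>k. if k < N then J x k else 0)"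
    using tail_small[OF x divide_pos_pos[OF r C]] by metis
  show "\<exists>N. \<forall>K\<ge>N. norm ((\<Sum>k<K. dual_coord \<phi> k * J x k) - \<phi> x) < r"
  proof (intro exI allI impI)
    fix K assume K: "N \<le> K"
    define h where "h = vec (\<lambda>k. if k < K then J x k else 0)"
    note h = head_in_domain(2,3)[OF x h_def]
    have xh: "x \<ominus>\<^bsub>V\<^esub> h \<in> carrier V" using x h(1) by simp
    have "\<phi> h = (\<Sum>k<K. dual_coord \<phi> k * J h k)" by (rule functional_finite[OF \<phi> h(1)]) (simp add: h(2))
    also have "\<dots> = (\<Sum>k<K. dual_coord \<phi> k * J x k)" unfolding h(2) by (intro sum.cong) auto
    finally have "(\<Sum>k<K. dual_coord \<phi> k * J x k) = \<phi> h" ..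
    moreover have "\<phi> x = \<phi> (x \<ominus>\<^bsub>V\<^esub> h) + \<phi> h"
    proof -
      have "x = (x \<ominus>\<^bsub>V\<^esub> h) \<oplus>\<^bsub>V\<^esub> h" using x h(1) xh by (intro J_inj) (auto simp: J_add J_minus)
      then show ?thesis using functional.op_add[OF \<phi>' xh h(1)] by simp
    qed
    ultimately have "norm ((\<Sum>k<K. dual_coord \<phi> k * J x k) - \<phi> x) = cmod (\<phi> (x \<ominus>\<^bsub>V\<^esub> h))" by simp
    also have "\<dots> \<le> vnorm (bounded_ops V complex_space) \<phi> * vnorm V (x \<ominus>\<^bsub>V\<^esub> h)"
      using functional.op_norm_bound[OF \<phi>' xh] by simp
    also have "\<dots> \<le> C * vnorm V (x \<ominus>\<^bsub>V\<^esub> y)"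
    proof (rule mult_mono)
      \<comment> \<open>The head \<open>h\<close> is longer than \<open>y\<close>, so it leaves a
        coordinatewise smaller remainder.\<close>
      show "vnorm V (x \<ominus>\<^bsub>V\<^esub> h) \<le> vnorm V (x \<ominus>\<^bsub>V\<^esub> y)"
        using x h y K by (intro vnorm_mono) (auto simp: J_minus)
    qed (use C xh vnorm_nonneg in \<open>auto simp: C_def\<close>)
    also have "\<dots> < C * (r / C)" using y(2) C by (intro mult_strict_left_mono)
    also have "\<dots> = r" using C by simp
    finally show "norm ((\<Sum>k<K. dual_coord \<phi> k * J x k) - \<phi> x) < r" .
  qed
qed

lemma coord_space_dual: "coord_space (dual V) dual_coord"
proof -
  interpret D: cnormed_space "dual V" unfolding dual_def by (rule functional.cnormed_bounded_ops)
  show ?thesis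
    by unfold_locales (auto simp: fun_eq_iff dual_coord_def dual_def bounded_ops_simps unit_in)
qed

lemma dual_coord_inj:
  assumes "\<phi> \<in> carrier (dual V)" "\<psi> \<in> carrier (dual V)" "dual_coord \<phi> = dual_coord \<psi>"
  shows "\<phi> = \<psi>"
proof
  fix x show "\<phi> x = \<psi> x"
  proof (cases "x \<in> carrier V")
    case True
    show ?thesis
      using functional_LIMSEQ[OF assms(1) True] functional_LIMSEQ[OF assms(2) True]
      unfolding assms(3) by (rule LIMSEQ_unique)
  next
    case False
    then show ?thesis using assms(1,2) by (auto simp: dual_def bounded_ops_carrier PiE_iff extensional_def)
  qed
qed

text \<open>Compose \<phi> with the multiplier \<open>g / dual_coord \<phi>\<close>, which is
  contractive by assumption. Division by zero does no harm, because \<open>g\<close> vanishes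
  wherever \<open>dual_coord \<phi>\<close> does.\<close>

lemma dual_solid:
  assumes \<phi>: "\<phi> \<in> carrier (dual V)" and g: "\<And>k. cmod (g k) \<le> cmod (dual_coord \<phi> k)"
  shows "\<exists>\<psi>\<in>carrier (dual V). dual_coord \<psi> = g \<and> vnorm (dual V) \<psi> \<le> vnorm (dual V) \<phi>"
proof -
  have \<phi>': "\<phi> \<in> carrier (bounded_ops V complex_space)" using \<phi> by (simp add: dual_def)
  define m where "m k = g k / dual_coord \<phi> k" for k
  have m: "cmod (m k) \<le> 1" for k using g[of k] by (simp add: m_def norm_divide divide_le_eq_1)
  have mg: "m k * dual_coord \<phi> k = g k" for k using g[of k] by (cases "dual_coord \<phi> k = 0") (auto simp: m_def)
  define \<psi> where "\<psi> = (\<lambda>x\<in>carrier V. \<phi> (Mult m x))"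
  note M_in = Mult_in[of m, OF m] and J_M = J_Mult[of m, OF m]
  have bound: "cmod (\<psi> x) \<le> vnorm (dual V) \<phi> * vnorm V x" if x: "x \<in> carrier V" for x
  proof -
    have "cmod (\<phi> (Mult m x)) \<le> vnorm (dual V) \<phi> * vnorm V (Mult m x)"
      using functional.op_norm_bound[OF \<phi>' M_in[OF x]] by (simp add: dual_def)
    also have "\<dots> \<le> vnorm (dual V) \<phi> * vnorm V x"
      using vnorm_Mult_le[of m, OF m x] functional.op_norm_nonneg[OF \<phi>'] by (intro mult_left_mono) (auto simp: dual_def)
    finally show ?thesis using x by (simp add: \<psi>_def)
  qed
  have "\<psi> \<in> carrier (dual V)"
    unfolding dual_def bounded_ops_carrier
  proof (intro conjI ballI allI exI[of _ "vnorm (dual V) \<phi>"])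
    show "\<psi> \<in> carrier V \<rightarrow>\<^sub>E carrier complex_space" by (simp add: \<psi>_def)
    fix x assume x: "x \<in> carrier V"
    show "vnorm complex_space (\<psi> x) \<le> vnorm (dual V) \<phi> * vnorm V x" using bound[OF x] by simp
    show "\<psi> (c \<odot>\<^bsub>V\<^esub> x) = c \<odot>\<^bsub>complex_space\<^esub> \<psi> x" for c
    proof -
      have "Mult m (c \<odot>\<^bsub>V\<^esub> x) = c \<odot>\<^bsub>V\<^esub> Mult m x"
        using x by (intro J_inj) (auto simp: M_in J_M J_smult)
      then show ?thesis using x functional.op_smult[OF \<phi>' M_in[OF x]] by (simp add: \<psi>_def)
    qed
    show "\<psi> (x \<oplus>\<^bsub>V\<^esub> y) = \<psi> x \<oplus>\<^bsub>complex_space\<^esub> \<psi> y" if y: "y \<in> carrier V" for y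
    proof -
      have "Mult m (x \<oplus>\<^bsub>V\<^esub> y) = Mult m x \<oplus>\<^bsub>V\<^esub> Mult m y"
        using x y by (intro J_inj) (auto simp: M_in J_M J_add algebra_simps)
      then show ?thesis using x y functional.op_add[OF \<phi>' M_in[OF x] M_in[OF y]] by (simp add: \<psi>_def)
    qed
  qed
  moreover have "dual_coord \<psi> k = g k" for k
  proof (cases "k = 0")
    case False
    then have u: "unit k \<in> carrier V" using unit_in by simp
    have "Mult m (unit k) = m k \<odot>\<^bsub>V\<^esub> unit k"
      using u J_unit_eq[of k] False by (intro J_inj) (auto simp: M_in J_M J_smult)
    then have "\<phi> (Mult m (unit k)) = m k * dual_coord \<phi> k"
      using functional.op_smult[OF \<phi>' u] False by (simp add: dual_coord_def)
    then show ?thesis using u False mg[of k] by (simp add: dual_coord_def \<psi>_def)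
  qed (use g[of 0] in \<open>simp add: dual_coord_def\<close>)
  moreover have "vnorm (dual V) \<psi> \<le> vnorm (dual V) \<phi>"
    unfolding dual_def
    by (rule functional.op_norm_le) (use bound functional.op_norm_nonneg[OF \<phi>'] in \<open>auto simp: dual_def\<close>)
  ultimately show ?thesis by auto
qed

lemma dual_unit:
  assumes "1 \<le> k"
  shows "\<exists>\<phi>\<in>carrier (dual V). dual_coord \<phi> = (\<lambda>i. if i = k then 1 else 0)"
proof -
  obtain c where c: "0 < c" "\<And>x. x \<in> carrier V \<Longrightarrow> cmod (J x k) \<le> c * vnorm V x" using J_cmod_le[OF assms] by blast
  have "(\<lambda>x\<in>carrier V. J x k) \<in> carrier (dual V)"
    unfolding dual_def bounded_ops_carrier
    by (intro conjI ballI allI exI[of _ c]) (auto simp: J_add J_smult c(2))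
  moreover have "dual_coord (\<lambda>x\<in>carrier V. J x k) = (\<lambda>i. if i = k then 1 else 0)"
    using assms by (auto simp: fun_eq_iff dual_coord_def unit_in J_unit_eq)
  ultimately show ?thesis by blast
qed

text \<open>One direction tests the adjoint relation on unit vectors, the other compares the two
  series from \<open>functional_LIMSEQ\<close> term by term. As graphs are compared, the domains
  agree as well, and the adjoint is literally the diagonal operator of the dual.\<close>

lemma adjoint_diag_op:
  "adjoint_op V diag_op = {(\<phi>, \<psi>). \<phi> \<in> carrier (dual V) \<and> \<psi> \<in> carrier (dual V) \<and>
     (\<forall>k. dual_coord \<psi> k = of_nat k * dual_coord \<phi> k)}"
proof -
  have "(\<forall>(x, y)\<in>diag_op. \<phi> y = \<psi> x) \<longleftrightarrow> (\<forall>k. dual_coord \<psi> k = of_nat k * dual_coord \<phi> k)"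
    if \<phi>: "\<phi> \<in> carrier (dual V)" and \<psi>: "\<psi> \<in> carrier (dual V)" for \<phi> \<psi>
  proof
    assume adj: "\<forall>(x, y)\<in>diag_op. \<phi> y = \<psi> x"
    show "\<forall>k. dual_coord \<psi> k = of_nat k * dual_coord \<phi> k"
    proof
      fix k
      show "dual_coord \<psi> k = of_nat k * dual_coord \<phi> k"
      proof (cases "k = 0")
        case False
        then have u: "unit k \<in> carrier V" using unit_in by simp
        have "(unit k, of_nat k \<odot>\<^bsub>V\<^esub> unit k) \<in> diag_op"
          using u J_unit_eq[of k] False by (auto simp: diag_op_def J_smult)
        then have "\<phi> (of_nat k \<odot>\<^bsub>V\<^esub> unit k) = \<psi> (unit k)" using adj by auto
        then show ?thesis
          using functional.op_smult[of \<phi> "unit k" "of_nat k"] \<phi> u False by (simp add: dual_coord_def dual_def)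
      qed (simp add: dual_coord_def)
    qed
  next
    assume eq: "\<forall>k. dual_coord \<psi> k = of_nat k * dual_coord \<phi> k"
    show "\<forall>(x, y)\<in>diag_op. \<phi> y = \<psi> x"
    proof (clarify)
      fix x y assume "(x, y) \<in> diag_op"
      then have xy: "x \<in> carrier V" "y \<in> carrier V" "\<And>k. J y k = of_nat k * J x k" by (auto simp: diag_op_def)
      have "(\<lambda>K. \<Sum>k<K. dual_coord \<phi> k * J y k) = (\<lambda>K. \<Sum>k<K. dual_coord \<psi> k * J x k)"
        by (simp add: xy(3) eq mult_ac)
      then show "\<phi> y = \<psi> x"
        using LIMSEQ_unique functional_LIMSEQ[OF \<phi> xy(2)] functional_LIMSEQ[OF \<psi> xy(1)] by metis
    qed
  qed
  then show ?thesis
    unfolding adjoint_op_def by (simp add: set_eq_iff case_prod_beta cong: conj_cong)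
qed

end

section \<open>Cauchy integrals along rays\<close>

lemma exp_in_sector: "\<bar>Im w\<bar> < \<sigma> \<Longrightarrow> \<sigma> \<le> pi \<Longrightarrow> exp w \<in> sector \<sigma>"
  by (auto simp: sector_def Arg_exp)

lemma cis_ray_eq_exp: "0 < t \<Longrightarrow> cis \<theta> * of_real t = exp (Complex (ln t) \<theta>)"
  by (simp add: exp_eq_polar)

lemma cis_ray_in_sector:
  "0 < t \<Longrightarrow> \<bar>\<theta>\<bar> < \<sigma> \<Longrightarrow> \<sigma> \<le> pi \<Longrightarrow> cis \<theta> * of_real t \<in> sector \<sigma>"
  using exp_in_sector[of "Complex (ln t) \<theta>" \<sigma>] by (simp add: cis_ray_eq_exp)

text \<open>The substitution \<open>z = exp w\<close> turns the sector into a strip and its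
  truncated boundary into a rectangle, whose winding number is known. In the strip
  \<open>exp w - a\<close> vanishes only at \<open>ln a\<close>; the difference quotient
  \<open>k\<close> is holomorphic without zeros there, so Cauchy's integral formula applies to
  \<open>g * exp / k\<close>.\<close>

lemma strip_cauchy:
  assumes \<nu>: "0 < \<nu>" "\<nu> < \<sigma>" "\<sigma> \<le> pi" and a: "0 < a" "\<bar>ln a\<bar> < X"
    and holo: "g holomorphic_on {w. \<bar>Im w\<bar> < \<sigma>}"
  shows "((\<lambda>w. g w * exp w / (exp w - of_real a)) has_contour_integral
    2 * pi * \<i> * g (of_real (ln a))) (rectpath (Complex (- X) (- \<nu>)) (Complex X \<nu>))"
proof -
  define S where "S = {w. \<bar>Im w\<bar> < \<sigma>}"
  define c where "c = complex_of_real (ln a)"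
  define p where "p = rectpath (Complex (- X) (- \<nu>)) (Complex X \<nu>)"
  have S_eq: "S = {w. Im w < \<sigma>} \<inter> {w. Im w > - \<sigma>}" by (auto simp: S_def)
  have S: "open S" "convex S" unfolding S_eq
    by (intro open_Int open_halfspace_Im_lt open_halfspace_Im_gt convex_Int
        convex_halfspace_Im_lt convex_halfspace_Im_gt)+
  have c: "c \<in> S" "exp c = of_real a" using \<nu> a by (auto simp: S_def c_def exp_of_real)
  define k where "k = (\<lambda>z. if z = c then deriv exp c else (exp z - exp c) / (z - c))"
  have k: "k holomorphic_on S" unfolding k_def
    by (rule pole_lemma_open) (auto intro: holomorphic_intros S)
  \<comment> \<open>Logarithms of \<open>a\<close> differ by multiples of 2 pi in the imaginary
    part, and the strip reaches at most pi from the real axis.\<close>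
  have inj: "w = c" if w: "w \<in> S" "exp w = exp c" for w
  proof -
    obtain n :: int where n: "w = c + (of_int (2 * n) * pi) * \<i>"
      using w(2) by (auto simp: exp_eq)
    then have "\<bar>of_int (2 * n) * pi\<bar> < pi" using w(1) \<nu> by (simp add: S_def c_def)
    then have "\<bar>of_int (2 * n)\<bar> < (1 :: real)" by (simp add: abs_mult)
    then have "n = 0" by linarith
    then show ?thesis using n by simp
  qed
  have k0: "k w \<noteq> 0" if "w \<in> S" for w
    using inj[OF that] by (auto simp: k_def DERIV_imp_deriv[OF DERIV_exp])
  have "((\<lambda>w. g w * exp w / k w / (w - c)) has_contour_integral
      (2 * pi * \<i> * winding_number p c * (g c * exp c / k c))) p"
  proof (rule Cauchy_integral_formula_convex_simple[OF S(2)])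
    show "(\<lambda>w. g w * exp w / k w) holomorphic_on S"
      using holo k k0 unfolding S_def by (intro holomorphic_intros) auto
    show "c \<in> interior S" using S c by (simp add: interior_open)
    have "path_image p \<subseteq> S"
    proof -
      have "path_image p \<subseteq> cbox (Complex (- X) (- \<nu>)) (Complex X \<nu>)"
        unfolding p_def using \<nu> a by (intro path_image_rectpath_subset_cbox) auto
      also have "\<dots> \<subseteq> S" using \<nu> by (auto simp: in_cbox_complex_iff S_def)
      finally show ?thesis .
    qed
    moreover have "c \<notin> path_image p"
    proof -
      have "c \<in> box (Complex (- X) (- \<nu>)) (Complex X \<nu>)"
        using a \<nu> by (auto simp: in_box_complex_iff c_def)
      then show ?thesis unfolding p_def using \<nu> a by (subst path_image_rectpath_cbox_minus_box) auto
    qed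
    ultimately show "path_image p \<subseteq> S - {c}" by blast
  qed (auto simp: p_def)
  moreover have "winding_number p c = 1" unfolding p_def
    by (rule winding_number_rectpath) (use a \<nu> in \<open>auto simp: in_box_complex_iff c_def\<close>)
  moreover have "k c = exp c" by (simp add: k_def DERIV_imp_deriv[OF DERIV_exp])
  ultimately have "((\<lambda>w. g w * exp w / k w / (w - c)) has_contour_integral (2 * pi * \<i> * g c)) p"
    by simp
  moreover have "g w * exp w / k w / (w - c) = g w * exp w / (exp w - of_real a)"
    if "w \<in> path_image p" for w
  proof -
    have "w \<noteq> c"
    proof
      assume "w = c"
      have "c \<in> box (Complex (- X) (- \<nu>)) (Complex X \<nu>)"
        using a \<nu> by (auto simp: in_box_complex_iff c_def)
      moreover have "path_image p = cbox (Complex (- X) (- \<nu>)) (Complex X \<nu>) - box (Complex (- X) (- \<nu>)) (Complex X \<nu>)"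
        unfolding p_def using a \<nu> by (intro path_image_rectpath_cbox_minus_box) auto
      ultimately show False using that \<open>w = c\<close> by auto
    qed
    then show ?thesis by (simp add: k_def c)
  qed
  ultimately show ?thesis unfolding p_def[symmetric] c_def[symmetric]
    by (rule has_contour_integral_eq)
qed

lemma contour_integral_exp_ray:
  assumes X: "0 < X" and cont: "continuous_on {0<..} (\<lambda>t. k (cis \<theta> * of_real t))"
  shows "contour_integral (linepath (Complex (- X) \<theta>) (Complex X \<theta>)) (\<lambda>w. k (exp w) * exp w)
    = integral {exp (- X)..exp X} (\<lambda>t. k (cis \<theta> * of_real t) * cis \<theta>)"
proof (rule contour_integral_unique)
  let ?g = "\<lambda>x. exp (- X + 2 * X * x)"
  have "((\<lambda>x. (2 * X * ?g x) *\<^sub>R (k (cis \<theta> * of_real (?g x)) * cis \<theta>)) has_integral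
      (integral {?g 0..?g 1} (\<lambda>t. k (cis \<theta> * of_real t) * cis \<theta>))) {0..1}"
  proof (rule has_integral_substitution)
    show "?g ` {0..1} \<subseteq> {exp (- X)..exp X}"
      using X mult_left_mono[of _ 1 "2 * X"] by auto
    have "{exp (- X)..exp X} \<subseteq> {0<..}"
    proof
      fix t assume "t \<in> {exp (- X)..exp X}"
      then show "t \<in> {0<..}" using order_less_le_trans[OF exp_gt_zero[of "- X"]] by auto
    qed
    then show "continuous_on {exp (- X)..exp X} (\<lambda>t. k (cis \<theta> * complex_of_real t) * cis \<theta>)"
      by (intro continuous_intros continuous_on_subset[OF cont])
    show "(?g has_field_derivative 2 * X * ?g x) (at x within {0..1})" for x
      by (auto intro!: derivative_eq_intros)
  qed (use X in auto)
  moreover have "linepath (Complex (- X) \<theta>) (Complex X \<theta>) x = Complex (- X + 2 * X * x) \<theta>" for x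
    by (simp add: linepath_def complex_eq_iff algebra_simps)
  moreover have "exp (Complex (- X + 2 * X * x) \<theta>) = cis \<theta> * of_real (?g x)" for x
    by (simp add: exp_eq_polar)
  moreover have "Complex X \<theta> - Complex (- X) \<theta> = of_real (2 * X)" by (simp add: complex_eq_iff)
  ultimately show "((\<lambda>w. k (exp w) * exp w) has_contour_integral
      integral {exp (- X)..exp X} (\<lambda>t. k (cis \<theta> * complex_of_real t) * cis \<theta>))
      (linepath (Complex (- X) \<theta>) (Complex X \<theta>))"
    unfolding has_contour_integral_linepath by (simp add: scaleR_conv_of_real mult_ac)
qed

text \<open>For a merely bounded \<phi> the contribution of the right edge of the rectangle has no
  reason to vanish. The factor \<open>(a + n) / (z + n)\<close> makes it vanish, equals 1 at the
  pole \<open>a\<close> and tends to 1 pointwise; its own pole \<open>- n\<close> lies outside the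
  sector because \<sigma> is at most pi / 2. The same \<open>n\<close> serves as truncation, so a
  single dominated limit recovers the rays.\<close>

lemma cauchy_ray_integrals:
  fixes \<phi> :: "complex \<Rightarrow> complex"
  assumes \<nu>: "0 < \<nu>" "\<nu> < \<sigma>" "\<sigma> \<le> pi / 2" and a: "0 < a"
    and holo: "\<phi> holomorphic_on sector \<sigma>" and bdd: "\<And>z. z \<in> sector \<sigma> \<Longrightarrow> cmod (\<phi> z) \<le> B"
    and int: "\<And>\<theta>. \<theta> = \<nu> \<or> \<theta> = - \<nu> \<Longrightarrow>
      set_integrable lborel {0<..} (\<lambda>t. cmod (\<phi> (cis \<theta> * of_real t)) / t)"
  shows "(LINT t:{0<..}|lborel. \<phi> (cis (- \<nu>) * of_real t) * cis (- \<nu>) / (cis (- \<nu>) * of_real t - of_real a))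
    - (LINT t:{0<..}|lborel. \<phi> (cis \<nu> * of_real t) * cis \<nu> / (cis \<nu> * of_real t - of_real a))
    = 2 * pi * \<i> * \<phi> (of_real a)"
proof -
  define k where "k n z = \<phi> z * (of_real a + of_nat n) / ((z + of_nat n) * (z - of_real a))" for n :: nat and z
  define F where "F \<theta> t = \<phi> (cis \<theta> * of_real t) * cis \<theta> / (cis \<theta> * of_real t - of_real a)" for \<theta> t
  have \<nu>pi: "\<nu> < pi / 2" using \<nu> by linarith
  then have sn: "sin \<nu> > 0" using \<nu> by (intro sin_gt_zero) auto
  have cs: "cos \<nu> > 0" using \<nu> \<nu>pi by (intro cos_gt_zero) auto
  have Re_pos: "Re (exp w) \<ge> 0" if "\<bar>Im w\<bar> \<le> \<nu>" for w
  proof -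
    have "cos (Im w) \<ge> 0" using that \<nu>pi by (intro cos_ge_zero) auto
    then show ?thesis by (simp add: Re_exp)
  qed
  have plus_ge: "cmod (z + of_nat n) \<ge> real n" "cmod (z + of_nat n) \<ge> cmod z" if "Re z \<ge> 0" for z n
  proof -
    show "cmod (z + of_nat n) \<ge> real n"
      using complex_Re_le_cmod[of "z + of_nat n"] that by simp
    have "(cmod (z + of_nat n))\<^sup>2 = (cmod z)\<^sup>2 + (real n)\<^sup>2 + 2 * (Re z * real n)"
      unfolding cmod_power2 by (simp add: power2_eq_square algebra_simps)
    moreover have "Re z * real n \<ge> 0" using that by simp
    moreover have "(real n)\<^sup>2 \<ge> 0" by simp
    ultimately have "(cmod z)\<^sup>2 \<le> (cmod (z + of_nat n))\<^sup>2" by linarith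
    then show "cmod (z + of_nat n) \<ge> cmod z" by (simp add: power2_le_iff_abs_le)
  qed
  have ray: "cis \<theta> * of_real t \<in> sector \<sigma>" "Re (cis \<theta> * of_real t) \<ge> 0"
      "sin \<nu> * t \<le> cmod (cis \<theta> * of_real t - of_real a)" "cis \<theta> * of_real t \<noteq> of_real a"
    if "t > 0" "\<theta> = \<nu> \<or> \<theta> = - \<nu>" for t \<theta>
  proof -
    show "cis \<theta> * of_real t \<in> sector \<sigma>" using that \<nu> by (intro cis_ray_in_sector) auto
    show "Re (cis \<theta> * of_real t) \<ge> 0" using that cs by auto
    have "sin \<nu> * cmod (cis \<theta> * of_real t) \<le> cmod (cis \<theta> * of_real t - of_real a)"
    proof (rule dist_positive_real_ge)
      have "Arg (cis \<theta> * of_real t) = \<theta>"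
        using that \<nu> by (subst cis_ray_eq_exp) (auto simp: Arg_exp)
      then show "\<nu> \<le> \<bar>Arg (cis \<theta> * of_real t)\<bar>" using that by auto
    qed (use that a \<nu> in auto)
    then show "sin \<nu> * t \<le> cmod (cis \<theta> * of_real t - of_real a)" using that by (simp add: norm_mult)
    moreover have "sin \<nu> * t > 0" using sn that by simp
    ultimately show "cis \<theta> * of_real t \<noteq> of_real a" by auto
  qed
  have cont\<phi>: "continuous_on {0<..} (\<lambda>t. \<phi> (cis \<theta> * of_real t))" if "\<theta> = \<nu> \<or> \<theta> = - \<nu>" for \<theta>
    by (rule continuous_on_compose2[OF holomorphic_on_imp_continuous_on[OF holo]])
      (use ray that in \<open>auto intro!: continuous_intros\<close>)
  have plus_ne: "cis \<theta> * of_real t + of_nat n \<noteq> 0" if "t > 0" "\<theta> = \<nu> \<or> \<theta> = - \<nu>" for t \<theta> n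
  proof -
    have "0 < cmod (cis \<theta> * of_real t)" using that by (simp add: norm_mult)
    also have "\<dots> \<le> cmod (cis \<theta> * of_real t + of_nat n)" using ray(2)[OF that] by (rule plus_ge)
    finally show ?thesis by auto
  qed
  have contk: "continuous_on {0<..} (\<lambda>t. k n (cis \<theta> * of_real t))" if "\<theta> = \<nu> \<or> \<theta> = - \<nu>" for \<theta> n
    unfolding k_def using ray(4)[OF _ that] plus_ne[OF _ that] by (auto intro!: continuous_intros cont\<phi> that)
  have contF: "continuous_on {0<..} (F \<theta>)" if "\<theta> = \<nu> \<or> \<theta> = - \<nu>" for \<theta>
    unfolding F_def using ray(4)[OF _ that] by (auto intro!: continuous_intros cont\<phi> that)
  let ?I = "\<lambda>n \<theta>. integral {exp (- real n)..exp (real n)} (\<lambda>t. k n (cis \<theta> * of_real t) * cis \<theta>)"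
  have lim: "(\<lambda>n. ?I n \<theta>) \<longlonglongrightarrow> (LINT t:{0<..}|lborel. F \<theta> t)" if \<theta>: "\<theta> = \<nu> \<or> \<theta> = - \<nu>" for \<theta>
  proof -
    let ?f = "\<lambda>n t. indicator {exp (- real n)..exp (real n)} t *\<^sub>R (k n (cis \<theta> * of_real t) * cis \<theta>)"
    have sub: "{exp (- real n)..exp (real n)} \<subseteq> {0<..}" for n
    proof
      fix t assume "t \<in> {exp (- real n)..exp (real n)}"
      then show "t \<in> {0<..}" using order_less_le_trans[OF exp_gt_zero[of "- real n"]] by auto
    qed
    have eq: "?I n \<theta> = (LINT t|lborel. ?f n t)" for n
    proof -
      have "set_integrable lborel {exp (- real n)..exp (real n)} (\<lambda>t. k n (cis \<theta> * of_real t) * cis \<theta>)"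
        by (intro borel_integrable_atLeastAtMost' continuous_intros continuous_on_subset[OF contk[OF \<theta>]] sub)
      from set_borel_integral_eq_integral(2)[OF this, symmetric] show ?thesis unfolding set_lebesgue_integral_def .
    qed
    have "(\<lambda>n. LINT t|lborel. ?f n t) \<longlonglongrightarrow> (LINT t|lborel. indicator {0<..} t *\<^sub>R F \<theta> t)"
    proof (rule integral_dominated_convergence)
      let ?w = "\<lambda>t. (1 + a) / sin \<nu> * (indicator {0<..} t *\<^sub>R (cmod (\<phi> (cis \<theta> * of_real t)) / t))"
      show "integrable lborel ?w"
        using int[OF \<theta>] unfolding set_integrable_def by (rule integrable_mult_right)
      show "(\<lambda>t. indicator {0<..} t *\<^sub>R F \<theta> t) \<in> borel_measurable lborel"
        using borel_measurable_continuous_on_indicator[OF _ contF[OF \<theta>]] by simp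
      show "?f n \<in> borel_measurable lborel" for n
      proof -
        have "?f n \<in> borel_measurable borel"
          by (rule borel_measurable_continuous_on_indicator)
            (auto intro!: continuous_intros continuous_on_subset[OF contk[OF \<theta>] sub])
        then show ?thesis by simp
      qed
      show "AE t in lborel. (\<lambda>n. ?f n t) \<longlonglongrightarrow> indicator {0<..} t *\<^sub>R F \<theta> t"
      proof (rule AE_I2)
        fix t :: real
        show "(\<lambda>n. ?f n t) \<longlonglongrightarrow> indicator {0<..} t *\<^sub>R F \<theta> t"
        proof (cases "t > 0")
          case False
          then have "?f n t = 0" for n using sub[of n] by (auto simp: indicator_def)
          then have "(\<lambda>n. ?f n t) = (\<lambda>n. 0)" by (rule ext)
          then show ?thesis using False by (simp only:) simp
        next
          case True
          have "(\<lambda>n. (of_real a + of_nat n) / (cis \<theta> * of_real t + of_nat n)) \<longlonglongrightarrow> (1 :: complex)"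
          proof -
            have 1: "(\<lambda>n. (c + of_nat n) / of_nat n) \<longlonglongrightarrow> (1 :: complex)" for c
            proof -
              have "(\<lambda>n. c / of_nat n + 1) \<longlonglongrightarrow> (0 + 1 :: complex)"
                by (intro tendsto_intros lim_const_over_n)
              moreover have "\<forall>\<^sub>F n in sequentially. c / of_nat n + 1 = (c + of_nat n) / of_nat n"
                using eventually_gt_at_top[of 0] by eventually_elim (simp add: field_simps)
              ultimately show ?thesis by (auto dest: Lim_transform_eventually)
            qed
            have A: "(\<lambda>n. ((of_real a + of_nat n) / of_nat n) / ((cis \<theta> * of_real t + of_nat n) / of_nat n)) \<longlonglongrightarrow> (1 / 1 :: complex)"
              by (intro tendsto_divide 1) simp
            have "\<forall>\<^sub>F n in sequentially. ((of_real a + of_nat n) / of_nat n) / ((cis \<theta> * of_real t + of_nat n) / of_nat n)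
                = (of_real a + of_nat n) / (cis \<theta> * of_real t + of_nat n)"
              using eventually_gt_at_top[of 0] by eventually_elim simp
            from Lim_transform_eventually[OF A this] show ?thesis by (simp only: div_by_1)
          qed
          then have A: "(\<lambda>n. F \<theta> t * ((of_real a + of_nat n) / (cis \<theta> * of_real t + of_nat n))) \<longlonglongrightarrow> F \<theta> t * 1"
            by (intro tendsto_intros)
          have "\<forall>\<^sub>F n in sequentially. F \<theta> t * ((of_real a + of_nat n) / (cis \<theta> * of_real t + of_nat n)) = ?f n t"
          proof -
            have "\<forall>\<^sub>F n in sequentially. real n > \<bar>ln t\<bar>"
              by (rule eventually_compose_filterlim[OF eventually_gt_at_top filterlim_real_sequentially])
            then show ?thesis
            proof eventually_elim
              case (elim n)
              have "exp (- real n) \<le> exp (ln t)" "exp (ln t) \<le> exp (real n)"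
                using elim by (auto simp only: exp_le_cancel_iff)
              then have "t \<in> {exp (- real n)..exp (real n)}" using True by simp
              then show ?case by (simp add: F_def k_def mult_ac)
            qed
          qed
          from Lim_transform_eventually[OF A this] show ?thesis using True by simp
        qed
      qed
      show "AE t in lborel. norm (?f n t) \<le> ?w t" for n
      proof (rule AE_I2)
        fix t :: real
        show "norm (?f n t) \<le> ?w t"
        proof (cases "t \<in> {exp (- real n)..exp (real n)}")
          case False
          then show ?thesis using a sn by (auto simp: indicator_def)
        next
          case True
          then have t: "t > 0" using subsetD[OF sub, of t n] by simp
          let ?z = "cis \<theta> * complex_of_real t"
          have "cmod (of_real a + of_nat n) \<le> (1 + a) * cmod (?z + of_nat n)"
          \<comment> \<open>For \<open>n = 0\<close> the truncated interval is the single point 1,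
            and there the bound \<open>1 + a\<close> holds as well; for \<open>n \<ge> 1\<close> it
            comes from \<open>a \<le> a * n\<close>.\<close>
          proof (cases "n = 0")
            case True
            have "exp 0 \<le> t" "t \<le> exp 0" using \<open>t \<in> _\<close> True by auto
            then have "t = 1" by simp
            then show ?thesis using True a by simp
          next
            case False
            have "cmod (of_real a + of_nat n) = a + real n"
              using a by (metis of_real_add of_real_of_nat_eq norm_of_real abs_of_nonneg add_nonneg_nonneg less_imp_le of_nat_0_le_iff)
            also have "\<dots> \<le> (1 + a) * real n" using False a by (simp add: algebra_simps)
            also have "\<dots> \<le> (1 + a) * cmod (?z + of_nat n)"
              using plus_ge(1)[OF ray(2)[OF t \<theta>], of n] a by (intro mult_left_mono) auto
            finally show ?thesis .
          qed
          then have 1: "cmod (of_real a + of_nat n) / cmod (?z + of_nat n) \<le> 1 + a"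
            using plus_ne[OF t \<theta>, of n] by (simp add: pos_divide_le_eq)
          have 2: "cmod (\<phi> ?z) / cmod (?z - of_real a) \<le> cmod (\<phi> ?z) / (sin \<nu> * t)"
            using ray(3,4)[OF t \<theta>] sn t by (intro divide_left_mono) auto
          have "norm (?f n t) = cmod (of_real a + of_nat n) / cmod (?z + of_nat n) * (cmod (\<phi> ?z) / cmod (?z - of_real a))"
            using True by (simp add: k_def norm_mult norm_divide)
          also have "\<dots> \<le> (1 + a) * (cmod (\<phi> ?z) / (sin \<nu> * t))"
            using a by (intro mult_mono 1 2) auto
          also have "\<dots> = ?w t" using t by simp
          finally show ?thesis .
        qed
      qed
    qed
    then show ?thesis unfolding eq set_lebesgue_integral_def .
  qed
  let ?h = "\<lambda>n w. k n (exp w) * exp w"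
  let ?R = "\<lambda>n. contour_integral (linepath (Complex (real n) (- \<nu>)) (Complex (real n) \<nu>)) (?h n)"
  let ?L = "\<lambda>n. contour_integral (linepath (Complex (- real n) \<nu>) (Complex (- real n) (- \<nu>))) (?h n)"
  have ev: "\<forall>\<^sub>F n in sequentially. real n > \<bar>ln a\<bar>"
    by (rule eventually_compose_filterlim[OF eventually_gt_at_top filterlim_real_sequentially])
  have id: "?I n (- \<nu>) + ?R n - ?I n \<nu> + ?L n = 2 * pi * \<i> * \<phi> (of_real a)"
    and R: "cmod (?R n) \<le> B * (a + n) / (exp n - a) * (2 * \<nu>)"
    and L: "cmod (?L n) \<le> B * (a + n) / n * exp (- real n) / (a - exp (- real n)) * (2 * \<nu>)"
    if n: "real n > \<bar>ln a\<bar>" for n :: nat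
  proof -
    have n0: "real n > 0" using n by linarith
    have "exp (ln a) < exp (real n)" "exp (- real n) < exp (ln a)" using n by (auto simp only: exp_less_cancel_iff)
    then have an: "a < exp (real n)" "exp (- real n) < a" using a by auto
    define S where "S = {w. \<bar>Im w\<bar> < \<sigma>}"
    define T where "T = {w. \<bar>Im w\<bar> \<le> \<nu> \<and> exp w \<noteq> of_real a}"
    have plus0: "exp w + of_nat n \<noteq> 0" if "w \<in> S" for w
    proof -
      have "cos (Im w) > 0" using that \<nu> by (intro cos_gt_zero_pi) (auto simp: S_def)
      then have "Re (exp w + of_nat n) > 0" by (simp add: Re_exp add_pos_nonneg)
      then show ?thesis by (metis less_irrefl zero_complex.simps(1))
    qed
    have g: "(\<lambda>w. \<phi> (exp w) * (of_real a + of_nat n) / (exp w + of_nat n)) holomorphic_on S"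
    proof -
      have "(\<phi> \<circ> exp) holomorphic_on S"
        by (rule holomorphic_on_compose_gen[OF _ holo])
          (use \<nu> in \<open>auto intro!: holomorphic_intros exp_in_sector simp: S_def\<close>)
      then have "(\<lambda>w. \<phi> (exp w)) holomorphic_on S" by (simp add: o_def)
      then show ?thesis using plus0 by (intro holomorphic_intros) auto
    qed
    have hc: "continuous_on T (?h n)"
    proof -
      have "T \<subseteq> S" using \<nu> by (auto simp: T_def S_def)
      have "continuous_on T (\<lambda>w. \<phi> (exp w))"
        by (rule continuous_on_compose2[OF holomorphic_on_imp_continuous_on[OF holo]])
          (use \<nu> in \<open>auto intro!: continuous_intros exp_in_sector simp: T_def\<close>)
      then show ?thesis unfolding k_def
        using plus0 \<open>T \<subseteq> S\<close> by (intro continuous_intros) (auto simp: T_def)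
    qed
    have segh: "closed_segment (Complex (- real n) \<theta>) (Complex (real n) \<theta>) \<subseteq> T" if "\<theta> = \<nu> \<or> \<theta> = - \<nu>" for \<theta>
    proof
      fix w assume "w \<in> closed_segment (Complex (- real n) \<theta>) (Complex (real n) \<theta>)"
      then have w: "Im w = \<theta>" by (simp add: closed_segment_same_Im)
      have "exp w = cis \<theta> * of_real (exp (Re w))" by (simp add: exp_eq_polar w)
      then have "exp w \<noteq> of_real a" using ray(4)[OF exp_gt_zero that, of "Re w"] by simp
      then show "w \<in> T" using w that \<nu> by (auto simp: T_def)
    qed
    have segv: "w \<in> T \<and> Re w = c" if "w \<in> closed_segment (Complex c (- \<nu>)) (Complex c \<nu>)" "exp c \<noteq> a" for w c
    proof -
      have w: "Re w = c" "\<bar>Im w\<bar> \<le> \<nu>"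
        using that(1) \<nu> by (auto simp: closed_segment_same_Re closed_segment_eq_real_ivl)
      have "exp w \<noteq> of_real a"
      proof
        assume "exp w = of_real a"
        then have "exp (Re w) = a" using a by (metis norm_exp_eq_Re norm_of_real abs_of_pos)
        then show False using w that(2) by simp
      qed
      then show ?thesis using w by (auto simp: T_def)
    qed
    have vert: "closed_segment (Complex c (- \<nu>)) (Complex c \<nu>) \<subseteq> T" if "exp c \<noteq> a" for c
      using segv that by blast
    have ci: "?h n contour_integrable_on linepath p q" if "closed_segment p q \<subseteq> T" for p q
      by (rule contour_integrable_continuous_linepath) (rule continuous_on_subset[OF hc that])
    let ?a1 = "Complex (- real n) (- \<nu>)" and ?a2 = "Complex (real n) (- \<nu>)"
      and ?a3 = "Complex (real n) \<nu>" and ?a4 = "Complex (- real n) \<nu>"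
    have c1: "?h n contour_integrable_on linepath ?a1 ?a2" by (rule ci, rule segh) simp
    have c2: "?h n contour_integrable_on linepath ?a2 ?a3" by (rule ci, rule vert) (use an in simp)
    have c3: "?h n contour_integrable_on linepath ?a3 ?a4"
      by (rule ci, subst closed_segment_commute, rule segh) simp
    have c4: "?h n contour_integrable_on linepath ?a4 ?a1"
      by (rule ci, subst closed_segment_commute, rule vert) (use an in simp)
    have "((\<lambda>w. \<phi> (exp w) * (of_real a + of_nat n) / (exp w + of_nat n) * exp w / (exp w - of_real a)) has_contour_integral
      2 * pi * \<i> * (\<phi> (exp (of_real (ln a))) * (of_real a + of_nat n) / (exp (of_real (ln a)) + of_nat n)))
      (rectpath ?a1 ?a3)"
      by (rule strip_cauchy[where \<sigma> = \<sigma>]) (use \<nu> a n g in \<open>auto simp: S_def\<close>)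
    moreover have "exp (of_real (ln a)) = complex_of_real a" using a by (simp add: exp_of_real)
    moreover have "complex_of_real a + of_nat n \<noteq> 0"
    proof -
      have "Re (complex_of_real a + of_nat n) > 0" using a by simp
      then show ?thesis by (metis less_irrefl zero_complex.simps(1))
    qed
    moreover have "(\<lambda>w. \<phi> (exp w) * (of_real a + of_nat n) / (exp w + of_nat n) * exp w / (exp w - of_real a)) = ?h n"
      by (auto simp: k_def fun_eq_iff)
    ultimately have "(?h n has_contour_integral 2 * pi * \<i> * \<phi> (of_real a)) (rectpath ?a1 ?a3)"
      by simp
    then have "contour_integral (rectpath ?a1 ?a3) (?h n) = 2 * pi * \<i> * \<phi> (of_real a)"
      by (rule contour_integral_unique)
    moreover have "contour_integral (rectpath ?a1 ?a3) (?h n)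
       = contour_integral (linepath ?a1 ?a2) (?h n) + (contour_integral (linepath ?a2 ?a3) (?h n)
         + (contour_integral (linepath ?a3 ?a4) (?h n) + contour_integral (linepath ?a4 ?a1) (?h n)))"
      unfolding rectpath_def Let_def using c1 c2 c3 c4 by simp
    moreover have "contour_integral (linepath ?a3 ?a4) (?h n) = - contour_integral (linepath ?a4 ?a3) (?h n)"
      by (rule contour_integral_reverse_linepath)
        (subst closed_segment_commute, rule continuous_on_subset[OF hc], rule segh, simp)
    moreover have "contour_integral (linepath ?a1 ?a2) (?h n) = ?I n (- \<nu>)"
      "contour_integral (linepath ?a4 ?a3) (?h n) = ?I n \<nu>"
      by (rule contour_integral_exp_ray[OF n0 contk]; simp)+
    ultimately show "?I n (- \<nu>) + ?R n - ?I n \<nu> + ?L n = 2 * pi * \<i> * \<phi> (of_real a)"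
      by (simp add: algebra_simps)
    have B0: "B \<ge> 0" using order_trans[OF norm_ge_zero bdd[of 1]] \<nu> by (simp add: sector_def)
    have hb: "cmod (?h n w) = cmod (\<phi> (exp w)) * (a + n) / (cmod (exp w + of_nat n) * cmod (exp w - of_real a)) * exp (Re w)" for w
    proof -
      have "cmod (of_real a + of_nat n) = a + real n"
        using a by (metis of_real_add of_real_of_nat_eq norm_of_real abs_of_nonneg add_nonneg_nonneg less_imp_le of_nat_0_le_iff)
      then show ?thesis by (simp add: k_def norm_mult norm_divide)
    qed
    have phib: "cmod (\<phi> (exp w)) \<le> B" if "w \<in> T" for w
      using that \<nu> by (intro bdd exp_in_sector) (auto simp: T_def)
    show "cmod (?R n) \<le> B * (a + n) / (exp n - a) * (2 * \<nu>)"
    proof -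
      have "cmod (?R n) \<le> B * (a + n) / (exp n - a) * cmod (?a3 - ?a2)"
      proof (rule contour_integral_bound_linepath[OF c2])
        show "0 \<le> B * (a + n) / (exp n - a)" using B0 a an by simp
        fix w assume "w \<in> closed_segment ?a2 ?a3"
        then have w: "w \<in> T" "Re w = real n" using segv an by auto
        have 1: "exp (real n) \<le> cmod (exp w + of_nat n)"
          using plus_ge(2)[OF Re_pos, of w n] w by (auto simp: T_def)
        have 2: "exp (real n) - a \<le> cmod (exp w - of_real a)"
          using norm_triangle_ineq2[of "exp w" "of_real a"] w a by simp
        have "cmod (?h n w) \<le> B * (a + n) / (exp (real n) * (exp n - a)) * exp (real n)"
          unfolding hb w(2) using phib[OF w(1)] 1 2 a an B0
          by (intro mult_right_mono frac_le mult_mono) auto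
        then show "cmod (?h n w) \<le> B * (a + n) / (exp n - a)" by simp
      qed
      also have "?a3 - ?a2 = of_real (2 * \<nu>) * \<i>" by (simp add: complex_eq_iff)
      also have "cmod (of_real (2 * \<nu>) * \<i>) = 2 * \<nu>" using \<nu> by (simp add: norm_mult)
      finally show ?thesis .
    qed
    show "cmod (?L n) \<le> B * (a + n) / n * exp (- real n) / (a - exp (- real n)) * (2 * \<nu>)"
    proof -
      have "cmod (?L n) \<le> B * (a + n) / n * exp (- real n) / (a - exp (- real n)) * cmod (?a1 - ?a4)"
      proof (rule contour_integral_bound_linepath[OF c4])
        show "0 \<le> B * (a + n) / n * exp (- real n) / (a - exp (- real n))" using B0 a an by simp
        fix w assume "w \<in> closed_segment ?a4 ?a1"
        then have w: "w \<in> T" "Re w = - real n" using segv[of w "- real n"] an by (auto simp: closed_segment_commute)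
        have 1: "real n \<le> cmod (exp w + of_nat n)"
          using plus_ge(1)[OF Re_pos, of w n] w by (auto simp: T_def)
        have 2: "a - exp (- real n) \<le> cmod (exp w - of_real a)"
          using norm_triangle_ineq2[of "of_real a" "exp w"] w a by (simp add: norm_minus_commute)
        have "cmod (?h n w) \<le> B * (a + n) / (real n * (a - exp (- real n))) * exp (- real n)"
          unfolding hb w(2) using phib[OF w(1)] 1 2 a an B0 n0
          by (intro mult_right_mono frac_le mult_mono) auto
        then show "cmod (?h n w) \<le> B * (a + n) / n * exp (- real n) / (a - exp (- real n))" by simp
      qed
      also have "?a1 - ?a4 = - of_real (2 * \<nu>) * \<i>" by (simp add: complex_eq_iff)
      also have "cmod (- of_real (2 * \<nu>) * \<i>) = 2 * \<nu>" using \<nu> by (simp add: norm_mult)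
      finally show ?thesis .
    qed
  qed
  \<comment> \<open>The right edge is killed by the damping factor, the left edge by the factor
    \<open>exp w\<close> that the substitution produces.\<close>
  have "?R \<longlonglongrightarrow> 0"
  proof (rule Lim_null_comparison)
    show "\<forall>\<^sub>F n in sequentially. norm (?R n) \<le> B * (a + n) / (exp n - a) * (2 * \<nu>)"
      using ev by eventually_elim (rule R)
    show "(\<lambda>n. B * (a + real n) / (exp (real n) - a) * (2 * \<nu>)) \<longlonglongrightarrow> 0" by real_asymp
  qed
  moreover have "?L \<longlonglongrightarrow> 0"
  proof (rule Lim_null_comparison)
    show "\<forall>\<^sub>F n in sequentially. norm (?L n) \<le> B * (a + n) / n * exp (- real n) / (a - exp (- real n)) * (2 * \<nu>)"
      using ev by eventually_elim (rule L)
    show "(\<lambda>n. B * (a + real n) / real n * exp (- real n) / (a - exp (- real n)) * (2 * \<nu>)) \<longlonglongrightarrow> 0"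
      using a by real_asymp
  qed
  ultimately have "(\<lambda>n. ?I n (- \<nu>) + ?R n - ?I n \<nu> + ?L n)
      \<longlonglongrightarrow> (LINT t:{0<..}|lborel. F (- \<nu>) t) + 0 - (LINT t:{0<..}|lborel. F \<nu> t) + 0"
    by (intro tendsto_intros lim) auto
  moreover have "(\<lambda>n. ?I n (- \<nu>) + ?R n - ?I n \<nu> + ?L n) \<longlonglongrightarrow> 2 * pi * \<i> * \<phi> (of_real a)"
    by (rule tendsto_eventually) (use ev in eventually_elim, rule id)
  ultimately show ?thesis unfolding F_def[abs_def] using LIMSEQ_unique by fastforce
qed

section \<open>Bochner integrals of multiplication operators\<close>

lemma simple_integral_in_closed:
  assumes "cnormed_space W" "simple_fun W M s"
  shows "simple_integral_in W M s \<in> carrier W"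
proof -
  interpret cnormed_space W by fact
  show ?thesis using assms(2) unfolding simple_integral_in_def simple_fun_def
    by (intro finsum_closed) auto
qed

text \<open>A simple integral is a finite sum, so linearity alone moves \<open>L\<close> inside. It
  is used with coordinates, of vectors or of \<open>T x\<close> for operators \<open>T\<close>, to
  reduce everything to integrals of complex functions.\<close>

lemma functional_simple_integral_in:
  fixes L :: "'w \<Rightarrow> complex"
  assumes W: "cnormed_space W" and s: "simple_fun W M s"
    and fin: "emeasure M {t \<in> space M. s t \<noteq> \<zero>\<^bsub>W\<^esub>} \<noteq> \<infinity>"
    and add: "\<And>x y. x \<in> carrier W \<Longrightarrow> y \<in> carrier W \<Longrightarrow> L (x \<oplus>\<^bsub>W\<^esub> y) = L x + L y"
    and smult: "\<And>c x. x \<in> carrier W \<Longrightarrow> L (c \<odot>\<^bsub>W\<^esub> x) = c * L x"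
  shows "integrable M (\<lambda>t. L (s t))" "L (simple_integral_in W M s) = (\<integral>t. L (s t) \<partial>M)"
proof -
  interpret cnormed_space W by fact
  have L0: "L \<zero>\<^bsub>W\<^esub> = 0" using smult[of "\<zero>\<^bsub>W\<^esub>" 0] smult_l_null[of "\<zero>\<^bsub>W\<^esub>"] by simp
  have sf: "simple_function M s" and car: "\<And>t. t \<in> space M \<Longrightarrow> s t \<in> carrier W"
    using s by (auto simp: simple_fun_def)
  have finite: "finite (s ` space M)" using sf by (rule simple_functionD(1))
  have meas: "{t \<in> space M. P (s t)} \<in> sets M" for P
  proof -
    have eq: "{t \<in> space M. P (s t)} = s -` {x. P x} \<inter> space M" by auto
    show ?thesis unfolding eq by (rule simple_functionD(2)[OF sf])
  qed
  have sb: "Bochner_Integration.simple_bochner_integrable M (\<lambda>t. L (s t))"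
  proof (rule Bochner_Integration.simple_bochner_integrable.intros)
    show "simple_function M (\<lambda>t. L (s t))" using sf by (rule simple_function_compose1)
    have "emeasure M {t \<in> space M. L (s t) \<noteq> 0} \<le> emeasure M {t \<in> space M. s t \<noteq> \<zero>\<^bsub>W\<^esub>}"
      using L0 by (intro emeasure_mono meas) auto
    then show "emeasure M {t \<in> space M. L (s t) \<noteq> 0} \<noteq> \<infinity>" using fin by (auto simp: top_unique)
  qed
  then show "integrable M (\<lambda>t. L (s t))"
    using has_bochner_integral_simple_bochner_integrable integrable.simps by blast
  have Lsum: "finsum W f A \<in> carrier W \<and> L (finsum W f A) = (\<Sum>a\<in>A. L (f a))"
    if "finite A" "\<And>a. a \<in> A \<Longrightarrow> f a \<in> carrier W" for f and A :: "'w set"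
    using that
  proof (induction A)
    case (insert a A)
    then show ?case by (subst finsum_insert) (auto simp: add)
  qed (simp add: L0)
  have "L (simple_integral_in W M s)
      = (\<Sum>y\<in>s ` space M. L (of_real (measure M {t \<in> space M. s t = y}) \<odot>\<^bsub>W\<^esub> y))"
    unfolding simple_integral_in_def by (rule Lsum[OF finite, THEN conjunct2]) (use car in auto)
  also have "\<dots> = (\<Sum>y\<in>s ` space M. measure M {t \<in> space M. s t = y} *\<^sub>R L y)"
    using car by (intro sum.cong) (auto simp: smult scaleR_conv_of_real)
  also have "\<dots> = Bochner_Integration.simple_bochner_integral M (\<lambda>t. L (s t))"
    by (rule simple_bochner_integral_partition[symmetric, OF sb sf]) auto
  also have "\<dots> = (\<integral>t. L (s t) \<partial>M)" by (rule simple_bochner_integrable_eq_integral[OF sb])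
  finally show "L (simple_integral_in W M s) = (\<integral>t. L (s t) \<partial>M)" .
qed

text \<open>Operator norms of multipliers are at most the supremum of their symbols. So simple
  symbols \<open>n i\<close> that approach \<open>m\<close> up to \<open>d i t\<close>, uniformly in
  \<open>k\<close>, approximate in operator norm, and the limit is identified coordinate by
  coordinate as the multiplier with the integrated symbol.\<close>

lemma (in diag_space) has_bochner_integral_Mult:
  fixes m :: "'b \<Rightarrow> nat \<Rightarrow> complex" and n :: "nat \<Rightarrow> 'b \<Rightarrow> nat \<Rightarrow> complex"
  assumes F: "\<And>t. t \<in> space M \<Longrightarrow> F t = Mult (m t)"
    and m_bdd: "\<And>t k. t \<in> space M \<Longrightarrow> 1 \<le> k \<Longrightarrow> cmod (m t k) \<le> c t"
    and n: "\<And>i. simple_function M (n i)" "\<And>i t k. t \<in> space M \<Longrightarrow> 1 \<le> k \<Longrightarrow> cmod (n i t k) \<le> b i t"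
      "\<And>i. emeasure M {t \<in> space M. n i t \<noteq> (\<lambda>k. 0)} \<noteq> \<infinity>"
    and d: "\<And>i t k. t \<in> space M \<Longrightarrow> 1 \<le> k \<Longrightarrow> cmod (m t k - n i t k) \<le> d i t"
      "\<And>i. integrable M (d i)" "(\<lambda>i. \<integral>t. d i t \<partial>M) \<longlonglongrightarrow> 0" "AE t in M. (\<lambda>i. d i t) \<longlonglongrightarrow> 0"
    and \<mu>: "\<And>k. 1 \<le> k \<Longrightarrow> integrable M (\<lambda>t. m t k)" "\<And>k. 1 \<le> k \<Longrightarrow> cmod (\<integral>t. m t k \<partial>M) \<le> B"
  shows "has_bochner_integral_in (bounded_ops V V) M F (Mult (\<lambda>k. \<integral>t. m t k \<partial>M))"
proof -
  interpret BO: cnormed_space "bounded_ops V V" by (rule VV.cnormed_bounded_ops)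
  note Mn = Mult_carrier[of "n i t" "b i t" for i t, OF n(2)]
  note Mm = Mult_carrier[of "m t" "c t" for t, OF m_bdd]
  have sf: "simple_fun (bounded_ops V V) M (\<lambda>t. Mult (n i t))" for i
    unfolding simple_fun_def using simple_function_compose1[OF n(1)] Mn by auto
  have zero: "Mult (\<lambda>k. 0) = \<zero>\<^bsub>bounded_ops V V\<^esub>"
    by (rule op_eqI[OF Mult_carrier[of _ 0] VV.op_zero_closed])
      (auto simp: bounded_ops_simps J_Mult[of _ 0] J_zero)
  have fin: "emeasure M {t \<in> space M. Mult (n i t) \<noteq> \<zero>\<^bsub>bounded_ops V V\<^esub>} \<noteq> \<infinity>" for i
  proof -
    have eq: "{t \<in> space M. n i t \<noteq> (\<lambda>k. 0)} = n i -` {f. f \<noteq> (\<lambda>k. 0)} \<inter> space M" by auto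
    have "{t \<in> space M. n i t \<noteq> (\<lambda>k. 0)} \<in> sets M" unfolding eq by (rule simple_functionD(2)[OF n(1)])
    then have "emeasure M {t \<in> space M. Mult (n i t) \<noteq> \<zero>\<^bsub>bounded_ops V V\<^esub>}
        \<le> emeasure M {t \<in> space M. n i t \<noteq> (\<lambda>k. 0)}"
      using zero by (intro emeasure_mono) auto
    then show ?thesis using n(3)[of i] by (auto simp: top_unique)
  qed
  have diff: "vnorm (bounded_ops V V) (F t \<ominus>\<^bsub>bounded_ops V V\<^esub> Mult (n i t)) \<le> d i t"
    "vnorm (bounded_ops V V) (Mult (n i t) \<ominus>\<^bsub>bounded_ops V V\<^esub> F t) \<le> d i t" if t: "t \<in> space M" for t i
  proof -
    have "F t \<ominus>\<^bsub>bounded_ops V V\<^esub> Mult (n i t) = Mult (\<lambda>k. m t k - n i t k)"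
      unfolding F[OF t] by (rule Mult_minus[of "m t" "c t" "n i t" "b i t", OF m_bdd[OF t] n(2)[OF t]])
    then show *: "vnorm (bounded_ops V V) (F t \<ominus>\<^bsub>bounded_ops V V\<^esub> Mult (n i t)) \<le> d i t"
      using norm_Mult_le[of "\<lambda>k. m t k - n i t k" "d i t", OF d(1)[OF t]] by simp
    then show "vnorm (bounded_ops V V) (Mult (n i t) \<ominus>\<^bsub>bounded_ops V V\<^esub> F t) \<le> d i t"
      using BO.vnorm_minus_commute[OF Mn[OF t] Mm[OF t]] F[OF t] by simp
  qed
  have int_n: "integrable M (\<lambda>t. n i t k)"
    and Psi: "Mult (\<lambda>k. \<integral>t. n i t k \<partial>M) = simple_integral_in (bounded_ops V V) M (\<lambda>t. Mult (n i t))"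
    and bound: "cmod ((\<integral>t. n i t k \<partial>M) - (\<integral>t. m t k \<partial>M)) \<le> (\<integral>t. d i t \<partial>M)"
    if k: "1 \<le> k" for i k
  proof -
    have int_n: "integrable M (\<lambda>t. n i t k)" for k
    proof -
      have "Bochner_Integration.simple_bochner_integrable M (\<lambda>t. n i t k)"
      proof (rule Bochner_Integration.simple_bochner_integrable.intros)
        show "simple_function M (\<lambda>t. n i t k)" using simple_function_compose1[OF n(1), of "\<lambda>f. f k"] .
        have eq: "{t \<in> space M. n i t \<noteq> (\<lambda>k. 0)} = n i -` {f. f \<noteq> (\<lambda>k. 0)} \<inter> space M" by auto
        have "{t \<in> space M. n i t \<noteq> (\<lambda>k. 0)} \<in> sets M" unfolding eq by (rule simple_functionD(2)[OF n(1)])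
        then have "emeasure M {t \<in> space M. n i t k \<noteq> 0} \<le> emeasure M {t \<in> space M. n i t \<noteq> (\<lambda>k. 0)}"
          by (intro emeasure_mono) auto
        then show "emeasure M {t \<in> space M. n i t k \<noteq> 0} \<noteq> \<infinity>" using n(3)[of i] by (auto simp: top_unique)
      qed
      then show ?thesis using has_bochner_integral_simple_bochner_integrable integrable.simps by blast
    qed
    then show "integrable M (\<lambda>t. n i t k)" .
    have bound: "cmod ((\<integral>t. n i t k \<partial>M) - (\<integral>t. m t k \<partial>M)) \<le> (\<integral>t. d i t \<partial>M)" if k: "1 \<le> k" for k
    proof -
      have "(\<integral>t. n i t k \<partial>M) - (\<integral>t. m t k \<partial>M) = (\<integral>t. n i t k - m t k \<partial>M)"
        using int_n \<mu>(1)[OF k] by simp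
      also have "cmod \<dots> \<le> (\<integral>t. cmod (n i t k - m t k) \<partial>M)" by (rule integral_norm_bound)
      also have "\<dots> \<le> (\<integral>t. d i t \<partial>M)"
        using int_n \<mu>(1)[OF k] d(1)[OF _ k] by (intro integral_mono d(2)) (auto simp: norm_minus_commute)
      finally show ?thesis .
    qed
    then show "cmod ((\<integral>t. n i t k \<partial>M) - (\<integral>t. m t k \<partial>M)) \<le> (\<integral>t. d i t \<partial>M)" using k .
    have bn: "cmod (\<integral>t. n i t k \<partial>M) \<le> B + (\<integral>t. d i t \<partial>M)" if k: "1 \<le> k" for k
      using norm_triangle_ineq2[of "\<integral>t. n i t k \<partial>M" "\<integral>t. m t k \<partial>M"] bound[OF k] \<mu>(2)[OF k] by linarith
    show "Mult (\<lambda>k. \<integral>t. n i t k \<partial>M) = simple_integral_in (bounded_ops V V) M (\<lambda>t. Mult (n i t))"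
    proof (rule op_eqI[OF Mult_carrier[OF bn] simple_integral_in_closed[OF VV.cnormed_bounded_ops sf]])
      fix x k assume x: "x \<in> carrier V" and k: "1 \<le> (k::nat)"
      have "J (simple_integral_in (bounded_ops V V) M (\<lambda>t. Mult (n i t)) x) k = (\<integral>t. J (Mult (n i t) x) k \<partial>M)"
        using x by (intro functional_simple_integral_in(2)[OF VV.cnormed_bounded_ops sf fin, of "\<lambda>T. J (T x) k"])
          (auto simp: bounded_ops_simps J_add J_smult)
      also have "\<dots> = (\<integral>t. n i t k * J x k \<partial>M)"
        using x by (intro Bochner_Integration.integral_cong) (auto simp: J_Mult[OF n(2)])
      also have "\<dots> = J (Mult (\<lambda>k. \<integral>t. n i t k \<partial>M) x) k"
        using x by (simp add: J_Mult[OF bn])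
      finally show "J (Mult (\<lambda>k. \<integral>t. n i t k \<partial>M) x) k
        = J (simple_integral_in (bounded_ops V V) M (\<lambda>t. Mult (n i t)) x) k" ..
    qed
  qed
  have bn: "cmod (\<integral>t. n i t k \<partial>M) \<le> B + (\<integral>t. d i t \<partial>M)" if k: "1 \<le> k" for i k
    using norm_triangle_ineq2[of "\<integral>t. n i t k \<partial>M" "\<integral>t. m t k \<partial>M"] bound[OF k, of i] \<mu>(2)[OF k] by linarith
  have d0: "0 \<le> d i t" if "t \<in> space M" for i t
    using d(1)[OF that, of 1 i] norm_ge_zero[of "m t 1 - n i t 1"] by linarith
  show ?thesis unfolding has_bochner_integral_in_def
  proof (intro conjI exI[of _ "\<lambda>i t. Mult (n i t)"] allI)
    show "Mult (\<lambda>k. \<integral>t. m t k \<partial>M) \<in> carrier (bounded_ops V V)" by (rule Mult_carrier[OF \<mu>(2)])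
    show "simple_fun (bounded_ops V V) M (\<lambda>t. Mult (n i t))" for i by (rule sf)
    show "emeasure M {t \<in> space M. Mult (n i t) \<noteq> \<zero>\<^bsub>bounded_ops V V\<^esub>} \<noteq> \<infinity>" for i by (rule fin)
    show "strongly_measurable (bounded_ops V V) M F"
      unfolding strongly_measurable_def
    proof (intro conjI exI[of _ "\<lambda>i t. Mult (n i t)"] allI sf)
      show "AE t in M. F t \<in> carrier (bounded_ops V V)" using F Mm by (intro AE_I2) auto
      show "AE t in M. (\<lambda>i. vnorm (bounded_ops V V) (Mult (n i t) \<ominus>\<^bsub>bounded_ops V V\<^esub> F t)) \<longlonglongrightarrow> 0"
        using d(4) AE_space
      proof eventually_elim
        case (elim t)
        show ?case
        proof (rule Lim_null_comparison[OF always_eventually elim(1)], intro allI)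
          fix i
          have "Mult (n i t) \<ominus>\<^bsub>bounded_ops V V\<^esub> F t \<in> carrier (bounded_ops V V)"
            using Mn[OF elim(2)] Mm[OF elim(2)] F[OF elim(2)] by simp
          then show "norm (vnorm (bounded_ops V V) (Mult (n i t) \<ominus>\<^bsub>bounded_ops V V\<^esub> F t)) \<le> d i t"
            using diff(2)[OF elim(2)] BO.vnorm_nonneg by simp
        qed
      qed
    qed
    show "(\<lambda>i. \<integral>\<^sup>+ t. ennreal (vnorm (bounded_ops V V) (F t \<ominus>\<^bsub>bounded_ops V V\<^esub> Mult (n i t))) \<partial>M) \<longlonglongrightarrow> 0"
    proof (rule tendsto_sandwich[OF always_eventually always_eventually tendsto_const])
      show "\<forall>i. (\<integral>\<^sup>+ t. ennreal (vnorm (bounded_ops V V) (F t \<ominus>\<^bsub>bounded_ops V V\<^esub> Mult (n i t))) \<partial>M)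
          \<le> ennreal (\<integral>t. d i t \<partial>M)"
      proof
        fix i
        have "(\<integral>\<^sup>+ t. ennreal (vnorm (bounded_ops V V) (F t \<ominus>\<^bsub>bounded_ops V V\<^esub> Mult (n i t))) \<partial>M)
           \<le> (\<integral>\<^sup>+ t. ennreal (d i t) \<partial>M)"
          using diff by (intro nn_integral_mono ennreal_leI) auto
        also have "\<dots> = ennreal (\<integral>t. d i t \<partial>M)"
          using d0 by (intro nn_integral_eq_integral d(2) AE_I2) auto
        finally show "(\<integral>\<^sup>+ t. ennreal (vnorm (bounded_ops V V) (F t \<ominus>\<^bsub>bounded_ops V V\<^esub> Mult (n i t))) \<partial>M)
          \<le> ennreal (\<integral>t. d i t \<partial>M)" .
      qed
      show "(\<lambda>i. ennreal (\<integral>t. d i t \<partial>M)) \<longlonglongrightarrow> 0"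
        using tendsto_ennrealI[OF d(3)] by simp
    qed auto
    show "(\<lambda>i. vnorm (bounded_ops V V) (simple_integral_in (bounded_ops V V) M (\<lambda>t. Mult (n i t))
        \<ominus>\<^bsub>bounded_ops V V\<^esub> Mult (\<lambda>k. \<integral>t. m t k \<partial>M))) \<longlonglongrightarrow> 0"
    proof (rule Lim_null_comparison[OF always_eventually d(3)], intro allI)
      fix i
      have eq: "simple_integral_in (bounded_ops V V) M (\<lambda>t. Mult (n i t)) \<ominus>\<^bsub>bounded_ops V V\<^esub> Mult (\<lambda>k. \<integral>t. m t k \<partial>M)
         = Mult (\<lambda>k. (\<integral>t. n i t k \<partial>M) - (\<integral>t. m t k \<partial>M))"
        unfolding Psi[OF order_refl, symmetric] by (rule Mult_minus[OF bn \<mu>(2)])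
      show "norm (vnorm (bounded_ops V V) (simple_integral_in (bounded_ops V V) M (\<lambda>t. Mult (n i t))
        \<ominus>\<^bsub>bounded_ops V V\<^esub> Mult (\<lambda>k. \<integral>t. m t k \<partial>M))) \<le> (\<integral>t. d i t \<partial>M)"
        unfolding eq using norm_Mult_le[OF bound] BO.vnorm_nonneg[OF Mult_carrier[OF bound]] by simp
    qed
  qed
qed

section \<open>The functional calculus of a diagonal operator\<close>

lemma borel_measurable_lborel_restrict:
  fixes f :: "real \<Rightarrow> 'a::topological_space"
  shows "continuous_on S f \<Longrightarrow> f \<in> borel_measurable (restrict_space lborel S)"
  using borel_measurable_continuous_on_restrict[of S f]
  by (simp add: measurable_cong_sets[OF sets_restrict_space_cong[OF sets_lborel] refl])

lemma H_one_ray_integrable: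
  assumes \<phi>: "\<phi> \<in> H_one \<sigma>" and \<sigma>: "\<sigma> \<le> pi" and \<theta>: "\<bar>\<theta>\<bar> < \<sigma>"
  shows "continuous_on {0<..} (\<lambda>t. \<phi> (cis \<theta> * of_real t))"
    and "integrable (restrict_space lborel {0<..}) (\<lambda>t. cmod (\<phi> (cis \<theta> * of_real t)) / t)"
proof -
  have holo: "\<phi> holomorphic_on sector \<sigma>" using \<phi> by (simp add: H_one_def)
  show cont: "continuous_on {0<..} (\<lambda>t. \<phi> (cis \<theta> * of_real t))"
    by (rule continuous_on_compose2[OF holomorphic_on_imp_continuous_on[OF holo]])
      (use cis_ray_in_sector[OF _ \<theta> \<sigma>] in \<open>auto intro!: continuous_intros\<close>)
  have "(\<integral>\<^sup>+ t. ennreal (cmod (\<phi> (cis \<theta> * of_real t)) / t) \<partial>restrict_space lborel {0<..})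
     \<le> (SUP \<nu>\<in>{-\<sigma><..<\<sigma>}. \<integral>\<^sup>+ t. ennreal (cmod (\<phi> (cis \<nu> * of_real t)) / t) \<partial>restrict_space lborel {0<..})"
    by (rule SUP_upper) (use \<theta> in auto)
  also have "\<dots> < \<infinity>" using \<phi> by (simp add: H_one_def)
  finally have fin: "(\<integral>\<^sup>+ t. ennreal (cmod (\<phi> (cis \<theta> * of_real t)) / t) \<partial>restrict_space lborel {0<..}) < \<infinity>" .
  show "integrable (restrict_space lborel {0<..}) (\<lambda>t. cmod (\<phi> (cis \<theta> * of_real t)) / t)"
  proof (rule integrableI_nonneg[OF _ _ fin])
    show "(\<lambda>t. cmod (\<phi> (cis \<theta> * of_real t)) / t) \<in> borel_measurable (restrict_space lborel {0<..})"
      by (rule borel_measurable_lborel_restrict) (auto intro!: continuous_intros cont)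
    show "AE t in restrict_space lborel {0<..}. 0 \<le> cmod (\<phi> (cis \<theta> * of_real t)) / t"
      by (rule AE_I2) (simp add: space_restrict_space)
  qed
qed

lemma tendsto_inverse_Suc_power: "(\<lambda>i. 1 / (real i + 1) ^ 2) \<longlonglongrightarrow> 0"
  by real_asymp

text \<open>Sampling points: \<open>t\<close> is rounded down to a grid of mesh
  \<open>1 / q\<close>. The maximum with \<open>c\<close>, later the left end of \<open>K\<close>,
  keeps the sample inside \<open>K\<close>; the value -1 marks the points off
  \<open>K\<close>.\<close>

lemma simple_function_grid:
  assumes K: "K \<subseteq> {0..b}" "K \<in> sets borel" and q: "0 < (q::real)"
  shows "simple_function (restrict_space lborel S) (\<lambda>t. if t \<in> K then max c (of_int \<lfloor>t * q\<rfloor> / q) else - 1)"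
proof (rule simple_function_borel_measurable)
  have "(\<lambda>t. if t \<in> K then max c (of_int \<lfloor>t * q\<rfloor> / q) else - 1) \<in> borel_measurable lborel"
    using K(2) by measurable
  then show "(\<lambda>t. if t \<in> K then max c (of_int \<lfloor>t * q\<rfloor> / q) else - 1) \<in> borel_measurable (restrict_space lborel S)"
    by (rule measurable_restrict_space1)
  have "(\<lambda>t. if t \<in> K then max c (of_int \<lfloor>t * q\<rfloor> / q) else - 1) ` space (restrict_space lborel S)
      \<subseteq> insert (- 1) (insert c ((\<lambda>j. of_int j / q) ` {0..\<lfloor>b * q\<rfloor>}))"
  proof
    fix y assume "y \<in> (\<lambda>t. if t \<in> K then max c (of_int \<lfloor>t * q\<rfloor> / q) else - 1) ` space (restrict_space lborel S)"
    then obtain t where t: "y = (if t \<in> K then max c (of_int \<lfloor>t * q\<rfloor> / q) else - 1)" by (elim imageE)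
    have "\<lfloor>t * q\<rfloor> \<in> {0..\<lfloor>b * q\<rfloor>}" if "t \<in> K"
      using that K q by (auto intro!: floor_mono mult_right_mono)
    then show "y \<in> insert (- 1) (insert c ((\<lambda>j. of_int j / q) ` {0..\<lfloor>b * q\<rfloor>}))"
      using t by (auto simp: max_def)
  qed
  then show "finite ((\<lambda>t. if t \<in> K then max c (of_int \<lfloor>t * q\<rfloor> / q) else - 1) ` space (restrict_space lborel S))"
    by (rule finite_subset) auto
qed

context diag_space
begin

text \<open>The point is approximation in operator norm, that is uniformly in \<open>k\<close>. On
  the compact interval \<open>K i\<close> the symbols are equicontinuous, so a fine grid gives the
  error \<open>1 / (n i) ^ 2\<close>, whose integral is at most \<open>1 / n i\<close>. Off
  \<open>K i\<close> the approximant is 0, and the error is a tail of the integrable majorant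
  \<open>N t / s\<close>.\<close>

lemma has_ray_integral_diag_op:
  assumes \<phi>: "\<phi> \<in> H_one \<sigma> \<inter> H_infty \<sigma>" and \<theta>: "0 < \<bar>\<theta>\<bar>" "\<bar>\<theta>\<bar> < \<sigma>" "\<sigma> \<le> pi / 2"
  defines "M \<equiv> restrict_space lborel {0<..}"
  defines "m \<equiv> \<lambda>t k. \<phi> (cis \<theta> * complex_of_real t) * cis \<theta> / (cis \<theta> * of_real t - of_nat k)"
  shows "has_ray_integral V diag_op \<theta> \<phi> (Mult (\<lambda>k. \<integral>t. m t k \<partial>M))"
    and "\<exists>B. \<forall>k\<ge>1. cmod (\<integral>t. m t k \<partial>M) \<le> B"
proof -
  define w where "w t = \<phi> (cis \<theta> * complex_of_real t)" for t
  define N where "N t = cmod (w t) / t" for t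
  define s where "s = sin \<bar>\<theta>\<bar>"
  have s: "s > 0" using \<theta> unfolding s_def by (intro sin_gt_zero) auto
  have cont: "continuous_on {0<..} w" and N: "integrable M N"
    using H_one_ray_integrable[of \<phi> \<sigma> \<theta>] \<phi> \<theta> unfolding w_def[abs_def] N_def[abs_def] M_def by auto
  have space_M: "space M = {0<..}" by (simp add: M_def space_restrict_space)
  obtain B where "\<forall>z\<in>sector \<sigma>. cmod (\<phi> z) \<le> B"
    using \<phi> by (auto simp: H_infty_def bounded_iff)
  then have B: "cmod (w t) \<le> B" if "t > 0" for t
    unfolding w_def using that \<theta> by (auto intro!: cis_ray_in_sector)
  have B0: "B \<ge> 0" using order_trans[OF norm_ge_zero B[of 1]] by simp
  have \<theta>': "0 < \<bar>\<theta>\<bar>" "\<bar>\<theta>\<bar> < pi" using \<theta> by auto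
  have ray: "cis \<theta> * complex_of_real t \<noteq> 0" "\<bar>\<theta>\<bar> \<le> \<bar>Arg (cis \<theta> * complex_of_real t)\<bar>" if "t > 0" for t
    using that \<theta> by (auto simp: cis_ray_eq_exp Arg_exp)
  have r: "cmod (1 / (cis \<theta> * of_real t - of_nat k)) \<le> 1 / (s * t)" if "t > 0" for t and k :: nat
    using resolvent_off_sector(1)[OF \<theta>' ray[OF that], of k] that by (simp add: s_def norm_mult)
  have m_le: "cmod (m t k) \<le> N t / s" if "t > 0" for t k
    using mult_left_mono[OF r[OF that, of k], of "cmod (w t)"]
    by (simp add: m_def w_def N_def norm_mult norm_divide mult.commute)
  have F: "(\<phi> (cis \<theta> * of_real t) * cis \<theta>) \<odot>\<^bsub>bounded_ops V V\<^esub> resolvent V diag_op (cis \<theta> * of_real t) = Mult (m t)"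
    if "t > 0" for t
  proof -
    have "resolvent V diag_op (cis \<theta> * of_real t) = Mult (\<lambda>k. 1 / (cis \<theta> * of_real t - of_nat k))"
      by (rule resolvent_off_sector(3)[OF \<theta>' ray[OF that]])
    then show ?thesis
      using Mult_smult[of "\<lambda>k. 1 / (cis \<theta> * of_real t - of_nat k)" "1 / (s * t)", OF r[OF that]]
      by (simp add: m_def)
  qed
  define n where "n i = real i + 1" for i :: nat
  have n: "n i \<ge> 1" "n i > 0" for i by (auto simp: n_def)
  define K where "K i = {1 / n i..n i}" for i
  have Kpos: "t > 0" "1 / t \<le> n i" if "t \<in> K i" for t i
  proof -
    have "0 < 1 / n i" using n by simp
    moreover have "1 / n i \<le> t" using that by (simp add: K_def)
    ultimately show t: "t > 0" by linarith
    then show "1 / t \<le> n i" using \<open>1 / n i \<le> t\<close> n(2)[of i] by (simp add: pos_divide_le_eq mult.commute)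
  qed
  have Ksub: "K i \<subseteq> {0<..}" for i
  proof
    fix t assume "t \<in> K i"
    from Kpos(1)[OF this] show "t \<in> {0<..}" by simp
  qed
  have "\<exists>q>0. \<forall>t\<in>K i. \<forall>u\<in>K i. \<bar>t - u\<bar> \<le> 1 / q \<longrightarrow> (\<forall>k\<ge>1. cmod (m t k - m u k) \<le> 1 / (n i)\<^sup>2)" for i
  proof -
    let ?n = "n i"
    have "compact (K i)" unfolding K_def by (rule compact_Icc)
    then have "uniformly_continuous_on (K i) w"
      by (intro compact_uniformly_continuous continuous_on_subset[OF cont Ksub])
    moreover have "s / (2 * ?n ^ 3) > 0" using s n[of i] by simp
    ultimately obtain \<delta> where \<delta>: "\<delta> > 0"
      "\<And>t u. t \<in> K i \<Longrightarrow> u \<in> K i \<Longrightarrow> dist u t < \<delta> \<Longrightarrow> dist (w u) (w t) < s / (2 * ?n ^ 3)"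
      unfolding uniformly_continuous_on_def by metis
    \<comment> \<open>Chosen, like the modulus for \<open>w\<close>, so that each of the two terms
      in the estimate of \<open>m t k - m u k\<close> is at most half of \<open>1 / ?n ^ 2\<close>.
      The summand 1 in \<open>B + 1\<close> prevents a zero denominator.\<close>
    let ?e = "s\<^sup>2 / (2 * ?n ^ 4 * (B + 1))"
    have e: "?e > 0" using s n[of i] B0 by simp
    obtain j where j: "inverse (real (Suc j)) < min \<delta> ?e"
      using reals_Archimedean[of "min \<delta> ?e"] \<delta>(1) e by auto
    show ?thesis
    proof (intro exI[of _ "real (Suc j)"] conjI ballI impI allI)
      fix t u k assume tu: "t \<in> K i" "u \<in> K i" "\<bar>t - u\<bar> \<le> 1 / real (Suc j)" and k: "1 \<le> (k::nat)"
      let ?z = "\<lambda>t. cis \<theta> * complex_of_real t"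
      have tu': "\<bar>t - u\<bar> < \<delta>" "\<bar>t - u\<bar> \<le> ?e" using tu(3) j by (auto simp: inverse_eq_divide)
      have rr: "cmod (1 / (?z t - of_nat k)) \<le> ?n / s" if "t \<in> K i" for t
      proof -
        have "1 / (s * t) = (1 / t) / s" by simp
        also have "\<dots> \<le> ?n / s" using Kpos[OF that] s by (intro divide_right_mono) auto
        finally show ?thesis using r[OF Kpos(1)[OF that], of k] by linarith
      qed
      have ne: "?z t - of_nat k \<noteq> 0" if "t \<in> K i" for t
      proof -
        have "Im (?z t) \<noteq> 0"
        proof -
          have "sin \<theta> \<noteq> 0" using s by (auto simp: s_def abs_if split: if_splits)
          then show ?thesis using Kpos(1)[OF that] by simp
        qed
        then show ?thesis by (auto simp: complex_eq_iff)
      qed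
      have gen: "a * c / p - b * c / r = c * ((a - b) * (1 / p) + b * (r - p) * (1 / p) * (1 / r))"
        if "p \<noteq> 0" "r \<noteq> 0" for a b c p r :: complex
        using that by (simp add: field_simps)
      have "m t k - m u k = cis \<theta> * ((w t - w u) * (1 / (?z t - of_nat k))
          + w u * (?z u - ?z t) * (1 / (?z t - of_nat k)) * (1 / (?z u - of_nat k)))"
        unfolding m_def w_def[symmetric] gen[OF ne[OF tu(1)] ne[OF tu(2)]] by simp
      also have "cmod \<dots> \<le> cmod (w t - w u) * cmod (1 / (?z t - of_nat k))
          + cmod (w u) * cmod (?z u - ?z t) * cmod (1 / (?z t - of_nat k)) * cmod (1 / (?z u - of_nat k))"
        unfolding norm_mult norm_cis by (simp only: mult_1 norm_mult[symmetric] norm_triangle_ineq)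
      also have "cmod (?z u - ?z t) = \<bar>t - u\<bar>"
        by (simp add: norm_mult abs_minus_commute flip: of_real_diff right_diff_distrib)
      also have "cmod (w t - w u) * cmod (1 / (?z t - of_nat k))
          + cmod (w u) * \<bar>t - u\<bar> * cmod (1 / (?z t - of_nat k)) * cmod (1 / (?z u - of_nat k))
         \<le> s / (2 * ?n ^ 3) * (?n / s) + (B + 1) * ?e * (?n / s) * (?n / s)"
      proof (intro add_mono mult_mono rr tu mult_nonneg_nonneg)
        show "cmod (w t - w u) \<le> s / (2 * ?n ^ 3)"
          using \<delta>(2)[OF tu(1,2)] tu'(1) by (simp add: dist_norm norm_minus_commute abs_minus_commute)
        show "cmod (w u) \<le> B + 1" using B[OF Kpos(1)[OF tu(2)]] by simp
        show "\<bar>t - u\<bar> \<le> ?e" by (rule tu')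
      qed (use s n[of i] B0 e in auto)
      also have "\<dots> = 1 / ?n\<^sup>2"
      proof -
        have "B + 1 > 0" using B0 by simp
        then show ?thesis using s n[of i]
          by (simp add: divide_simps) (simp add: algebra_simps power2_eq_square power3_eq_cube power4_eq_xxxx)
      qed
      finally show "cmod (m t k - m u k) \<le> 1 / ?n\<^sup>2" .
    qed simp
  qed
  then obtain q where q: "\<And>i. q i > 0"
    "\<And>i t u k. t \<in> K i \<Longrightarrow> u \<in> K i \<Longrightarrow> \<bar>t - u\<bar> \<le> 1 / q i \<Longrightarrow> 1 \<le> k \<Longrightarrow> cmod (m t k - m u k) \<le> 1 / (n i)\<^sup>2"
    by metis
  define h where "h i t = (if t \<in> K i then max (1 / n i) (of_int \<lfloor>t * q i\<rfloor> / q i) else - 1)" for i t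
  have hK: "h i t \<in> K i" "\<bar>t - h i t\<bar> \<le> 1 / q i" if t: "t \<in> K i" for i t
  proof -
    have fl: "of_int \<lfloor>t * q i\<rfloor> / q i \<le> t" "t - of_int \<lfloor>t * q i\<rfloor> / q i \<le> 1 / q i"
    proof -
      have "of_int \<lfloor>t * q i\<rfloor> \<le> t * q i" by simp
      then show "of_int \<lfloor>t * q i\<rfloor> / q i \<le> t" using q(1)[of i] by (simp add: pos_divide_le_eq)
      have "t * q i - of_int \<lfloor>t * q i\<rfloor> \<le> 1" by linarith
      then have "(t * q i - of_int \<lfloor>t * q i\<rfloor>) / q i \<le> 1 / q i" using q(1)[of i] by (intro divide_right_mono) auto
      then show "t - of_int \<lfloor>t * q i\<rfloor> / q i \<le> 1 / q i" using q(1)[of i] by (simp add: diff_divide_distrib)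
    qed
    show "h i t \<in> K i" using fl t by (auto simp: h_def K_def)
    have "1 / n i \<le> t" using t by (simp add: K_def)
    moreover have "0 < 1 / q i" using q(1)[of i] by simp
    ultimately show "\<bar>t - h i t\<bar> \<le> 1 / q i" using fl t by (auto simp: h_def max_def abs_if)
  qed
  define ms where "ms i t = (if h i t < 0 then (\<lambda>k. 0) else m (h i t))" for i t
  have hneg: "h i t < 0 \<longleftrightarrow> t \<notin> K i" for i t
  proof (cases "t \<in> K i")
    case True
    then show ?thesis using Kpos(1)[OF hK(1)[OF True]] by simp
  qed (simp add: h_def)
  define d where "d i t = indicator (K i) t * (1 / (n i)\<^sup>2) + indicator (- K i) t * (N t / s)" for i t
  have Ksets: "K i \<in> sets lborel" for i by (simp add: K_def)
  have KM: "K i \<in> sets M" "- K i \<inter> {0<..} \<in> sets M" for i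
    using Ksub[of i] unfolding M_def by (auto simp: sets_restrict_space_iff K_def)
  have eK: "emeasure M (K i) = ennreal (n i - 1 / n i)" for i
  proof -
    have "1 / n i \<le> n i" using n[of i] mult_mono'[OF n(1)[of i] n(1)[of i]] by (simp add: pos_divide_le_eq)
    then show ?thesis unfolding M_def
      by (subst emeasure_restrict_space) (use Ksub[of i] in \<open>auto simp: K_def\<close>)
  qed
  have mK: "measure M (K i) \<le> n i" for i
    using eK[of i] n[of i] by (simp add: measure_def)
  have intK: "integrable M (\<lambda>t. indicator (K i) t * (1 / (n i)\<^sup>2))" for i
    by (intro integrable_mult_left integrable_real_indicator KM) (simp add: eK)
  have intN: "integrable M (\<lambda>t. indicator (- K i) t * (N t / s))" for i
  proof -
    have "integrable M (\<lambda>t. indicator (- K i \<inter> {0<..}) t *\<^sub>R (N t / s))"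
      by (intro integrable_mult_indicator KM integrable_divide N)
    moreover have "integrable M (\<lambda>t. indicator (- K i \<inter> {0<..}) t *\<^sub>R (N t / s))
        \<longleftrightarrow> integrable M (\<lambda>t. indicator (- K i) t * (N t / s))"
      by (intro Bochner_Integration.integrable_cong) (auto simp: space_M indicator_def)
    ultimately show ?thesis by simp
  qed
  have ev: "\<forall>\<^sub>F i in sequentially. t \<in> K i" if "t > 0" for t
  proof -
    have "\<forall>\<^sub>F i in sequentially. real i > max t (1 / t)"
      by (rule eventually_compose_filterlim[OF eventually_gt_at_top filterlim_real_sequentially])
    then show ?thesis
    proof eventually_elim
      case (elim i)
      then have "1 / t \<le> n i" "t \<le> n i" by (auto simp: n_def)
      then show ?case using that n(2)[of i] by (auto simp: K_def field_simps)
    qed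
  qed
  have intd: "(\<lambda>i. \<integral>t. d i t \<partial>M) \<longlonglongrightarrow> 0"
  proof -
    have A: "(\<lambda>i. \<integral>t. indicator (- K i) t * (N t / s) \<partial>M) \<longlonglongrightarrow> (\<integral>t. 0 \<partial>M)"
    proof (rule integral_dominated_convergence)
      show "integrable M (\<lambda>t. N t / s)" using N by simp
      show "AE t in M. (\<lambda>i. indicator (- K i) t * (N t / s)) \<longlonglongrightarrow> 0"
      proof (rule AE_I2)
        fix t assume "t \<in> space M"
        then have "\<forall>\<^sub>F i in sequentially. t \<in> K i" using ev by (simp add: space_M)
        then have "\<forall>\<^sub>F i in sequentially. indicator (- K i) t * (N t / s) = 0"
          by eventually_elim simp
        then show "(\<lambda>i. indicator (- K i) t * (N t / s)) \<longlonglongrightarrow> 0" by (rule tendsto_eventually)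
      qed
      show "AE t in M. norm (indicator (- K i) t * (N t / s)) \<le> N t / s" for i
        using s by (intro AE_I2) (auto simp: space_M N_def indicator_def)
    qed (use intN in auto)
    have Bd: "(\<lambda>i. \<integral>t. indicator (K i) t * (1 / (n i)\<^sup>2) \<partial>M) \<longlonglongrightarrow> 0"
    proof (rule Lim_null_comparison[OF always_eventually])
      show "\<forall>i. norm (\<integral>t. indicator (K i) t * (1 / (n i)\<^sup>2) \<partial>M) \<le> 1 / n i"
      proof
        fix i
        have "(\<integral>t. indicator (K i) t * (1 / (n i)\<^sup>2) \<partial>M) = measure M (K i) * (1 / (n i)\<^sup>2)"
          using KM(1)[of i] by simp
        also have "norm \<dots> \<le> n i * (1 / (n i)\<^sup>2)" using mK[of i] n[of i] by (simp add: abs_mult divide_right_mono)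
        also have "\<dots> = 1 / n i" using n[of i] by (simp add: power2_eq_square)
        finally show "norm (\<integral>t. indicator (K i) t * (1 / (n i)\<^sup>2) \<partial>M) \<le> 1 / n i" .
      qed
      show "(\<lambda>i. 1 / n i) \<longlonglongrightarrow> 0" unfolding n_def by real_asymp
    qed
    show ?thesis unfolding d_def using tendsto_add[OF Bd A] intK intN by simp
  qed
  have int_m: "integrable M (\<lambda>t. m t k)" for k
  proof (rule Bochner_Integration.integrable_bound)
    show "integrable M (\<lambda>t. N t / s)" using N by simp
    have "continuous_on {0<..} (\<lambda>t. w t * cis \<theta> / (cis \<theta> * of_real t - of_nat k))"
    proof (intro continuous_intros cont ballI)
      fix t :: real assume "t \<in> {0<..}"
      moreover have "sin \<theta> \<noteq> 0" using s by (auto simp: s_def abs_if split: if_splits)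
      ultimately show "cis \<theta> * of_real t - of_nat k \<noteq> 0" by (auto simp: complex_eq_iff)
    qed
    then show "(\<lambda>t. m t k) \<in> borel_measurable M"
      unfolding m_def w_def M_def by (rule borel_measurable_lborel_restrict)
    show "AE t in M. norm (m t k) \<le> norm (N t / s)"
    proof (rule AE_I2)
      fix t assume "t \<in> space M"
      then have "norm (m t k) \<le> N t / s" using m_le[of t k] by (simp add: space_M)
      also have "\<dots> \<le> norm (N t / s)" unfolding real_norm_def by (rule abs_ge_self)
      finally show "norm (m t k) \<le> norm (N t / s)" .
    qed
  qed
  have bound: "cmod (\<integral>t. m t k \<partial>M) \<le> (\<integral>t. N t / s \<partial>M)" for k
  proof -
    have "cmod (\<integral>t. m t k \<partial>M) \<le> (\<integral>t. cmod (m t k) \<partial>M)" by (rule integral_norm_bound)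
    also have "\<dots> \<le> (\<integral>t. N t / s \<partial>M)"
      using int_m N m_le by (intro integral_mono) (auto simp: space_M)
    finally show ?thesis .
  qed
  then show "\<exists>B. \<forall>k\<ge>1. cmod (\<integral>t. m t k \<partial>M) \<le> B" by blast
  show "has_ray_integral V diag_op \<theta> \<phi> (Mult (\<lambda>k. \<integral>t. m t k \<partial>M))"
    unfolding has_ray_integral_def M_def[symmetric]
  proof (rule has_bochner_integral_Mult[where n = ms and d = d and c = "\<lambda>t. N t / s" and b = "\<lambda>i t. max 0 (N (h i t) / s)"])
    show "simple_function M (ms i)" for i
    proof -
      have "simple_function M (h i)"
        unfolding h_def M_def by (rule simple_function_grid[of _ "n i"])
          (use q n[of i] Ksub[of i] in \<open>auto simp: K_def intro: order_trans[of 0 "1 / n i"]\<close>)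
      then show ?thesis unfolding ms_def by (rule simple_function_compose1)
    qed
    show "cmod (ms i t k) \<le> max 0 (N (h i t) / s)" for i t k
    proof (cases "t \<in> K i")
      case True
      then show ?thesis using m_le[OF Kpos(1)[OF hK(1)[OF True]], of k] hneg[of i t] by (simp add: ms_def)
    qed (simp add: ms_def hneg)
    show "emeasure M {t \<in> space M. ms i t \<noteq> (\<lambda>k. 0)} \<noteq> \<infinity>" for i
    proof -
      have "emeasure M {t \<in> space M. ms i t \<noteq> (\<lambda>k. 0)} \<le> emeasure M (K i)"
        by (intro emeasure_mono KM) (auto simp: ms_def hneg)
      then show ?thesis unfolding eK by (auto simp: top_unique)
    qed
    show "cmod (m t k - ms i t k) \<le> d i t" if "t \<in> space M" "1 \<le> k" for i t k
    proof (cases "t \<in> K i")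
      case True
      then show ?thesis using q(2)[OF True hK(1)[OF True] hK(2)[OF True] that(2)] hneg[of i t]
        by (simp add: ms_def d_def)
    next
      case False
      then show ?thesis using m_le[of t k] that(1) hneg[of i t] by (simp add: ms_def d_def space_M)
    qed
    show "integrable M (d i)" for i unfolding d_def using intK intN by (rule Bochner_Integration.integrable_add)
    show "AE t in M. (\<lambda>i. d i t) \<longlonglongrightarrow> 0"
    proof (rule AE_I2)
      fix t assume "t \<in> space M"
      then have "\<forall>\<^sub>F i in sequentially. t \<in> K i" using ev by (simp add: space_M)
      then have "\<forall>\<^sub>F i in sequentially. 1 / (n i)\<^sup>2 = d i t" by eventually_elim (simp add: d_def)
      then show "(\<lambda>i. d i t) \<longlonglongrightarrow> 0"
        using tendsto_inverse_Suc_power unfolding n_def by (rule Lim_transform_eventually[rotated])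
    qed
  qed (use F m_le bound int_m intd in \<open>auto simp: space_M\<close>)
qed

text \<open>By Cauchy's formula the operator given by the two ray integrals is multiplication by
  \<open>\<phi> (of_nat k)\<close>, so the calculus is bounded with constant 1. The angles below pi
  / 2, where \<open>cauchy_ray_integrals\<close> applies, suffice to determine the infimum.\<close>

lemma H_infty_angle_diag_op:
  assumes \<sigma>: "0 < \<sigma>" "\<sigma> < pi / 2"
  shows "\<sigma> \<in> H_infty_angles V diag_op"
proof -
  have "\<exists>\<Phi>. has_functional_calculus_value V diag_op \<nu> \<phi> \<Phi> \<and>
        vnorm (bounded_ops V V) \<Phi> \<le> 1 * (SUP z\<in>sector \<sigma>. cmod (\<phi> z))"
    if \<phi>: "\<phi> \<in> H_one \<sigma> \<inter> H_infty \<sigma>" and \<nu>: "0 < \<nu>" "\<nu> < \<sigma>" for \<phi> \<nu>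
  proof -
    define \<mu> where "\<mu> \<theta> k = (\<integral>t. \<phi> (cis \<theta> * complex_of_real t) * cis \<theta> / (cis \<theta> * of_real t - of_nat k)
        \<partial>restrict_space lborel {0<..})" for \<theta> and k :: nat
    have ray: "has_ray_integral V diag_op \<theta> \<phi> (Mult (\<mu> \<theta>))" "\<exists>B. \<forall>k\<ge>1. cmod (\<mu> \<theta> k) \<le> B"
      if "\<theta> = \<nu> \<or> \<theta> = - \<nu>" for \<theta>
      using has_ray_integral_diag_op[OF \<phi>, of \<theta>] that \<nu> \<sigma> unfolding \<mu>_def[abs_def] by auto
    obtain B where B: "\<forall>z\<in>sector \<sigma>. cmod (\<phi> z) \<le> B" using \<phi> by (auto simp: H_infty_def bounded_iff)
    have cauchy: "\<mu> (- \<nu>) k - \<mu> \<nu> k = 2 * pi * \<i> * \<phi> (of_nat k)" if "1 \<le> k" for k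
    proof -
      have "\<mu> \<theta> k = (LINT t:{0<..}|lborel. \<phi> (cis \<theta> * of_real t) * cis \<theta> / (cis \<theta> * of_real t - of_real (real k)))" for \<theta>
        unfolding \<mu>_def by (subst integral_restrict_space) (auto simp: set_lebesgue_integral_def)
      moreover have "set_integrable lborel {0<..} (\<lambda>t. cmod (\<phi> (cis \<theta> * of_real t)) / t)" if "\<theta> = \<nu> \<or> \<theta> = - \<nu>" for \<theta>
      proof -
        have "integrable (restrict_space lborel {0<..}) (\<lambda>t. cmod (\<phi> (cis \<theta> * of_real t)) / t)"
          using \<phi> \<nu> \<sigma> that by (intro H_one_ray_integrable(2)[of \<phi> \<sigma> \<theta>]) auto
        then show ?thesis unfolding set_integrable_def by (simp add: integrable_restrict_space)
      qed
      ultimately show ?thesis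
        using cauchy_ray_integrals[of \<nu> \<sigma> "real k" \<phi> B] \<nu> \<sigma> that \<phi> B by (auto simp: H_infty_def)
    qed
    obtain B1 B2 where B12: "\<And>k. k \<ge> 1 \<Longrightarrow> cmod (\<mu> (- \<nu>) k) \<le> B1" "\<And>k. k \<ge> 1 \<Longrightarrow> cmod (\<mu> \<nu> k) \<le> B2"
      using ray(2)[of \<nu>] ray(2)[of "- \<nu>"] by auto
    have B3: "cmod (\<mu> (- \<nu>) k - \<mu> \<nu> k) \<le> B1 + B2" if "k \<ge> 1" for k
      using norm_triangle_ineq4[of "\<mu> (- \<nu>) k" "\<mu> \<nu> k"] B12[OF that] by linarith
    have "(1 / (2 * of_real pi * \<i>)) \<odot>\<^bsub>bounded_ops V V\<^esub> (Mult (\<mu> (- \<nu>)) \<ominus>\<^bsub>bounded_ops V V\<^esub> Mult (\<mu> \<nu>))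
       = Mult (\<lambda>k. (1 / (2 * of_real pi * \<i>)) * (\<mu> (- \<nu>) k - \<mu> \<nu> k))"
    proof -
      have "Mult (\<mu> (- \<nu>)) \<ominus>\<^bsub>bounded_ops V V\<^esub> Mult (\<mu> \<nu>) = Mult (\<lambda>k. \<mu> (- \<nu>) k - \<mu> \<nu> k)"
        by (rule Mult_minus) (fact B12)+
      moreover have "c \<odot>\<^bsub>bounded_ops V V\<^esub> Mult (\<lambda>k. \<mu> (- \<nu>) k - \<mu> \<nu> k)
          = Mult (\<lambda>k. c * (\<mu> (- \<nu>) k - \<mu> \<nu> k))" for c
        by (rule Mult_smult) (fact B3)
      ultimately show ?thesis by simp
    qed
    also have "\<dots> = Mult (\<lambda>k. \<phi> (of_nat k))"
      by (rule Mult_cong) (simp add: cauchy)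
    finally have eq: "Mult (\<lambda>k. \<phi> (of_nat k)) = (1 / (2 * of_real pi * \<i>)) \<odot>\<^bsub>bounded_ops V V\<^esub>
      (Mult (\<mu> (- \<nu>)) \<ominus>\<^bsub>bounded_ops V V\<^esub> Mult (\<mu> \<nu>))" ..
    have "cmod (\<phi> (of_nat k)) \<le> (SUP z\<in>sector \<sigma>. cmod (\<phi> z))" if "1 \<le> k" for k
    proof (rule cSUP_upper)
      show "of_nat k \<in> sector \<sigma>" using cis_ray_in_sector[of "real k" 0 \<sigma>] that \<sigma> by simp
      show "bdd_above ((\<lambda>z. cmod (\<phi> z)) ` sector \<sigma>)" using B by (auto intro!: bdd_aboveI2)
    qed
    then have "vnorm (bounded_ops V V) (Mult (\<lambda>k. \<phi> (of_nat k))) \<le> (SUP z\<in>sector \<sigma>. cmod (\<phi> z))"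
      by (rule norm_Mult_le)
    then show ?thesis
      unfolding has_functional_calculus_value_def
      using ray(1)[of \<nu>] ray(1)[of "- \<nu>"] eq by (intro exI[of _ "Mult (\<lambda>k. \<phi> (of_nat k))"]) auto
  qed
  then show ?thesis unfolding H_infty_angles_def mem_Collect_eq sectoriality_angle_diag_op
    using \<sigma> by (intro conjI exI[of _ 1] ballI allI impI) auto
qed

lemma H_infty_calculus_diag_op: "has_bounded_H_infty_calculus_of_angle V diag_op 0"
proof -
  let ?S = "H_infty_angles V diag_op"
  have pos: "0 \<le> \<sigma>" if "\<sigma> \<in> ?S" for \<sigma>
    using that by (simp add: H_infty_angles_def sectoriality_angle_diag_op)
  have "pi / 3 \<in> ?S" by (rule H_infty_angle_diag_op) auto
  then have ne: "?S \<noteq> {}" by blast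
  have bdd: "bdd_below ?S" using pos by (rule bdd_belowI)
  have "Inf ?S \<le> 0"
  proof (rule dense_ge)
    fix x :: real assume "0 < x"
    moreover have "min x (pi / 3) \<le> pi / 3" by (rule min.cobounded2)
    moreover have "pi / 3 < pi / 2" by simp
    ultimately have "min x (pi / 3) \<in> ?S"
      by (intro H_infty_angle_diag_op) (simp, linarith)
    then have "Inf ?S \<le> min x (pi / 3)" by (rule cInf_lower[OF _ bdd])
    then show "Inf ?S \<le> x" by simp
  qed
  moreover have "0 \<le> Inf ?S" using ne pos by (rule cInf_greatest)
  ultimately show ?thesis
    unfolding has_bounded_H_infty_calculus_of_angle_def using sectorial_diag_op ne by simp
qed

end

section \<open>The semigroup of a diagonal operator\<close>

lemma sector_Re_pos: "z \<in> sector \<theta> \<Longrightarrow> \<theta> \<le> pi / 2 \<Longrightarrow> 0 < Re z"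
  using Arg_Re_pos[of z] by (auto simp: sector_def)

text \<open>Differentiability of the semigroup in operator norm requires a bound free of
  \<open>k\<close>. The Taylor remainder costs half of the decay of \<open>exp (- z * k)\<close>;
  what is left, \<open>k ^ 2 * exp (- r * k)\<close> with \<open>r = Re z / 2\<close>, is at most
  \<open>2 / r ^ 2\<close>.\<close>

lemma norm_exp_minus_linear_le:
  fixes z w :: complex and k :: nat
  assumes z: "0 < Re z" and w: "cmod (w - z) \<le> Re z / 2" "w \<noteq> z" 
  shows "cmod ((exp (- w * of_nat k) - exp (- z * of_nat k)) / (w - z) + of_nat k * exp (- z * of_nat k))
    \<le> 8 / (Re z)\<^sup>2 * cmod (w - z)"
proof -
  define u where "u = - (w - z) * of_nat k"
  define r where "r = Re z / 2"
  have r: "r > 0" using z by (simp add: r_def)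
  have "cmod (exp u - (\<Sum>i\<le>1. u ^ i / fact i)) \<le> exp \<bar>Re u\<bar> * (cmod u) ^ Suc 1 / fact 1"
    by (rule Taylor_exp)
  then have 1: "cmod (exp u - 1 - u) \<le> exp \<bar>Re u\<bar> * (cmod u)\<^sup>2"
    by (simp add: power2_eq_square algebra_simps)
  have "\<bar>Re u\<bar> \<le> cmod u" by (rule abs_Re_le_cmod)
  also have u: "cmod u = cmod (w - z) * k" by (simp add: u_def norm_mult del: minus_diff_eq)
  also have "\<dots> \<le> r * k" using w by (intro mult_right_mono) (auto simp: r_def)
  finally have 2: "\<bar>Re u\<bar> \<le> r * k" .
  have "exp (- w * of_nat k) = exp (- z * of_nat k) * exp u"
    by (simp add: u_def algebra_simps flip: exp_add)
  then have "(exp (- w * of_nat k) - exp (- z * of_nat k)) / (w - z) + of_nat k * exp (- z * of_nat k)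
      = exp (- z * of_nat k) * (exp u - 1 - u) / (w - z)"
    using w by (simp add: u_def field_simps)
  then have "cmod ((exp (- w * of_nat k) - exp (- z * of_nat k)) / (w - z) + of_nat k * exp (- z * of_nat k))
     = exp (- Re z * k) * cmod (exp u - 1 - u) / cmod (w - z)"
    by (simp add: norm_mult norm_divide)
  also have "\<dots> \<le> exp (- Re z * k) * (exp (r * k) * (cmod u)\<^sup>2) / cmod (w - z)"
  proof -
    have "exp \<bar>Re u\<bar> * (cmod u)\<^sup>2 \<le> exp (r * k) * (cmod u)\<^sup>2"
      using 2 by (intro mult_right_mono) auto
    then show ?thesis using 1 by (intro divide_right_mono mult_left_mono) auto
  qed
  also have "\<dots> = (exp (- (r * k)) * real k ^ 2) * cmod (w - z)"
  proof -
    have "exp (- Re z * k) * exp (r * k) = exp (- (r * k))"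
      by (simp add: r_def algebra_simps flip: exp_add)
    then show ?thesis using w unfolding u
      by (simp add: power2_eq_square mult.assoc[symmetric])
  qed
  also have "\<dots> \<le> 2 / r\<^sup>2 * cmod (w - z)"
  proof (intro mult_right_mono)
    have "(r * k)\<^sup>2 / 2 \<le> exp (r * k)"
    proof -
      have "0 \<le> r * k" using r by simp
      then show ?thesis using exp_lower_Taylor_quadratic[of "r * k"] by linarith
    qed
    then have "exp (- (r * k)) * ((r * k)\<^sup>2 / 2) \<le> exp (- (r * k)) * exp (r * k)"
      by (intro mult_left_mono) auto
    then have "exp (- (r * k)) * ((r * k)\<^sup>2 / 2) \<le> 1" by (simp flip: exp_add)
    then show "exp (- (r * k)) * real k ^ 2 \<le> 2 / r\<^sup>2"
      using r by (simp add: power_mult_distrib field_simps)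
  qed auto
  also have "2 / r\<^sup>2 = 8 / (Re z)\<^sup>2" by (simp add: r_def power_divide)
  finally show ?thesis .
qed

context diag_space
begin

text \<open>For uniformly bounded symbols coordinatewise convergence gives strong convergence: the
  tail of \<open>x\<close> is small independently of \<open>z\<close>, and on the head only finitely
  many symbols matter.\<close>

lemma Mult_tendsto_zero:
  assumes b: "\<forall>\<^sub>F z in F. \<forall>k\<ge>1. cmod (m z k) \<le> c"
    and lim: "\<And>k. 1 \<le> k \<Longrightarrow> ((\<lambda>z. m z k) \<longlongrightarrow> 0) F" and x: "x \<in> carrier V"
  shows "((\<lambda>z. vnorm V (Mult (m z) x)) \<longlongrightarrow> 0) F"
proof (rule tendstoI)
  fix e :: real assume e: "0 < e"
  define c' where "c' = \<bar>c\<bar> + 1"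
  have c': "c' > 0" by (simp add: c'_def)
  obtain K where K: "\<forall>y\<in>carrier V. (\<forall>k. J y k = (if k < K then 0 else J x k)) \<longrightarrow> vnorm V y < e / (2 * c')"
    using J_tail[OF x, of "e / (2 * c')"] e c' by auto
  have t: "(\<lambda>k. if k < K then 0 else J x k) = (\<lambda>k. (if k < K then 0 else 1) * J x k)" by auto
  define y where "y = Mult (\<lambda>k. if k < K then 0 else 1) x"
  have y: "y \<in> carrier V" "J y = (\<lambda>k. if k < K then 0 else J x k)"
    unfolding y_def using Mult_in[of "\<lambda>k. if k < K then 0 else 1" 1] J_Mult[of "\<lambda>k. if k < K then 0 else 1" 1] x
    by (auto simp: fun_eq_iff)
  then have ysmall: "vnorm V y < e / (2 * c')" using K by simp
  have "((\<lambda>z. (\<Sum>k\<in>{1..<K}. cmod (m z k)) * vnorm V x) \<longlongrightarrow> (\<Sum>k\<in>{1..<K}. cmod 0) * vnorm V x) F"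
    by (intro tendsto_intros tendsto_sum lim) auto
  then have "\<forall>\<^sub>F z in F. (\<Sum>k\<in>{1..<K}. cmod (m z k)) * vnorm V x < e / 2"
    using e by (intro order_tendstoD(2)) auto
  with b show "\<forall>\<^sub>F z in F. dist (vnorm V (Mult (m z) x)) 0 < e"
  proof eventually_elim
    case (elim z)
    have m: "cmod (m z k) \<le> c'" if "1 \<le> k" for k using elim(1) that by (auto simp: c'_def)
    define h where "h k = (if k < K then m z k else 0)" for k
    have h: "cmod (h k) \<le> (\<Sum>k\<in>{1..<K}. cmod (m z k))" if "1 \<le> k" for k
      using that member_le_sum[of k "{1..<K}" "\<lambda>k. cmod (m z k)"] by (auto simp: h_def sum_nonneg)
    have "Mult (m z) x = Mult h x \<oplus>\<^bsub>V\<^esub> Mult (m z) y"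
      using x y by (intro J_inj) (auto simp: J_add Mult_in[of "m z", OF m] Mult_in[of h, OF h]
          J_Mult[of "m z", OF m] J_Mult[of h, OF h] h_def fun_eq_iff)
    then have "vnorm V (Mult (m z) x) \<le> vnorm V (Mult h x) + vnorm V (Mult (m z) y)"
      using x y by (simp add: vnorm_triangle Mult_in[of "m z", OF m] Mult_in[of h, OF h])
    also have "\<dots> \<le> (\<Sum>k\<in>{1..<K}. cmod (m z k)) * vnorm V x + c' * vnorm V y"
      using x y by (intro add_mono vnorm_Mult_le[OF h] vnorm_Mult_le[OF m])
    also have "c' * vnorm V y \<le> e / 2" using ysmall c' by (simp add: field_simps)
    finally have "vnorm V (Mult (m z) x) < e" using elim(2) by linarith
    then show ?case using vnorm_nonneg[OF Mult_in[of "m z", OF m x]] by simp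
  qed
qed

definition diag_semigroup :: "complex \<Rightarrow> 'v \<Rightarrow> 'v" where
  "diag_semigroup z = Mult (\<lambda>k. exp (- z * of_nat k))"

lemma diag_semigroup_bound: "0 \<le> Re z \<Longrightarrow> cmod (exp (- z * of_nat k)) \<le> 1"
  by simp

lemma diag_semigroup_carrier: "0 \<le> Re z \<Longrightarrow> diag_semigroup z \<in> carrier (bounded_ops V V)"
  unfolding diag_semigroup_def by (rule Mult_carrier[OF diag_semigroup_bound])

lemma diag_semigroup_in: "0 \<le> Re z \<Longrightarrow> x \<in> carrier V \<Longrightarrow> diag_semigroup z x \<in> carrier V"
  unfolding diag_semigroup_def by (rule Mult_in[OF diag_semigroup_bound])

lemma J_diag_semigroup: "0 \<le> Re z \<Longrightarrow> x \<in> carrier V \<Longrightarrow> J (diag_semigroup z x) = (\<lambda>k. exp (- z * of_nat k) * J x k)"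
  unfolding diag_semigroup_def by (rule J_Mult[OF diag_semigroup_bound])

lemma diag_semigroup_add:
  assumes "0 \<le> Re z" "0 \<le> Re w" "x \<in> carrier V"
  shows "diag_semigroup (z + w) x = diag_semigroup z (diag_semigroup w x)"
proof (rule J_inj)
  have "exp (- (z + w) * of_nat k) = exp (- z * of_nat k) * exp (- w * of_nat k)" for k
    by (simp add: algebra_simps flip: exp_add)
  moreover have "0 \<le> Re (z + w)" using assms by simp
  ultimately show "J (diag_semigroup (z + w) x) = J (diag_semigroup z (diag_semigroup w x))"
    using assms by (simp only: J_diag_semigroup diag_semigroup_in mult.assoc)
qed (use assms in \<open>auto simp: diag_semigroup_in\<close>)

lemma diag_semigroup_minus_id:
  assumes "0 \<le> Re z" "x \<in> carrier V"
  shows "diag_semigroup z x \<ominus>\<^bsub>V\<^esub> x = Mult (\<lambda>k. exp (- z * of_nat k) - 1) x"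
proof -
  define m where "m k = exp (- z * of_nat k) - 1" for k
  have m: "cmod (m k) \<le> 2" for k
    using norm_triangle_ineq4[of "exp (- z * of_nat k)" 1] diag_semigroup_bound[OF assms(1), of k]
    unfolding norm_one m_def by linarith
  have "diag_semigroup z x \<ominus>\<^bsub>V\<^esub> x = Mult m x"
  proof (rule J_inj)
    show "J (diag_semigroup z x \<ominus>\<^bsub>V\<^esub> x) = J (Mult m x)"
      using assms unfolding J_Mult[of m 2, OF m assms(2)]
      by (simp add: J_minus diag_semigroup_in J_diag_semigroup m_def fun_eq_iff left_diff_distrib)
  qed (use assms Mult_in[of m 2, OF m] in \<open>auto simp: diag_semigroup_in\<close>)
  then show ?thesis by (simp add: m_def[abs_def])
qed

text \<open>Stated for a general filter so that it covers both limits in the definitions,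
  \<open>t\<close> tending to 0 from the right and \<open>z\<close> tending to 0 within a
  sector.\<close>

lemma diag_semigroup_strongly_continuous:
  assumes F: "F \<le> nhds 0" "\<forall>\<^sub>F z in F. 0 \<le> Re z" and x: "x \<in> carrier V"
  shows "((\<lambda>z. vnorm V (diag_semigroup z x \<ominus>\<^bsub>V\<^esub> x)) \<longlongrightarrow> 0) F"
proof -
  have "((\<lambda>z. vnorm V (Mult (\<lambda>k. exp (- z * of_nat k) - 1) x)) \<longlongrightarrow> 0) F"
  proof (rule Mult_tendsto_zero[OF _ _ x])
    show "\<forall>\<^sub>F z in F. \<forall>k\<ge>1. cmod (exp (- z * of_nat k) - 1) \<le> 2"
      using F(2)
    proof eventually_elim
      case (elim z)
      show ?case
      proof (intro allI impI)
        fix k :: nat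
        show "cmod (exp (- z * of_nat k) - 1) \<le> 2"
          using norm_triangle_ineq4[of "exp (- z * of_nat k)" 1] diag_semigroup_bound[OF elim, of k]
          unfolding norm_one by linarith
      qed
    qed
    have id: "((\<lambda>z. z) \<longlongrightarrow> 0) F" using F(1) by (simp add: filterlim_def)
    have "((\<lambda>z. exp (- z * of_nat k) - 1) \<longlongrightarrow> exp (- 0 * of_nat k) - 1) F" for k
      by (intro tendsto_intros id)
    then show "((\<lambda>z. exp (- z * of_nat k) - 1) \<longlongrightarrow> 0) F" for k by simp
  qed
  moreover have "\<forall>\<^sub>F z in F. vnorm V (Mult (\<lambda>k. exp (- z * of_nat k) - 1) x)
      = vnorm V (diag_semigroup z x \<ominus>\<^bsub>V\<^esub> x)"
    using F(2) by eventually_elim (simp add: diag_semigroup_minus_id x)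
  ultimately show ?thesis by (rule Lim_transform_eventually)
qed

lemma C0_semigroup_diag: "C0_semigroup V (\<lambda>t. diag_semigroup (of_real t))"
  unfolding C0_semigroup_def
proof (intro conjI allI impI ballI)
  show "diag_semigroup (of_real t) \<in> carrier (bounded_ops V V)" if "0 \<le> t" for t
    using that by (intro diag_semigroup_carrier) simp
  show "diag_semigroup (of_real 0) = (\<lambda>x\<in>carrier V. x)"
    unfolding diag_semigroup_def Mult_def by (rule restrict_ext) (simp add: vec_J)
  fix x assume x: "x \<in> carrier V"
  show "diag_semigroup (of_real (s + t)) x = diag_semigroup (of_real s) (diag_semigroup (of_real t) x)"
    if "0 \<le> s" "0 \<le> t" for s t
    using diag_semigroup_add[of "of_real s" "of_real t" x] that x by simp
  have "((\<lambda>z. vnorm V (diag_semigroup z x \<ominus>\<^bsub>V\<^esub> x)) \<longlongrightarrow> 0) (filtermap of_real (at_right 0))"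
  proof (rule diag_semigroup_strongly_continuous[OF _ _ x])
    have "((\<lambda>t. complex_of_real t) \<longlongrightarrow> of_real 0) (at_right 0)" by (intro tendsto_intros)
    then show "filtermap complex_of_real (at_right 0) \<le> nhds 0" by (simp add: filterlim_def)
    show "\<forall>\<^sub>F z in filtermap complex_of_real (at_right 0). 0 \<le> Re z"
      unfolding eventually_filtermap using eventually_at_right_less[of 0] by eventually_elim simp
  qed
  then show "((\<lambda>t. vnorm V (diag_semigroup (of_real t) x \<ominus>\<^bsub>V\<^esub> x)) \<longlongrightarrow> 0) (at_right 0)"
    by (simp add: filterlim_filtermap)
qed

lemma analytic_C0_semigroup_diag: "analytic_C0_semigroup V (\<lambda>t. diag_semigroup (of_real t))"
  unfolding analytic_C0_semigroup_def
proof (intro conjI exI[of _ "pi / 2"] exI[of _ diag_semigroup] C0_semigroup_diag allI ballI impI)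
  have Re: "0 < Re z" if "z \<in> sector (pi / 2)" for z using sector_Re_pos[OF that] by simp
  interpret BO: cnormed_space "bounded_ops V V" by (rule VV.cnormed_bounded_ops)
  show "holomorphic_into (bounded_ops V V) (sector (pi / 2)) diag_semigroup"
    unfolding holomorphic_into_def
  proof (intro conjI ballI)
    fix z assume "z \<in> sector (pi / 2)"
    then have z: "0 < Re z" by (rule Re)
    then show "diag_semigroup z \<in> carrier (bounded_ops V V)" by (intro diag_semigroup_carrier) simp
    define D where "D k = - of_nat k * exp (- z * of_nat k)" for k
    have D: "cmod (D k) \<le> 1 / Re z" for k
    proof -
      have "Re z * k \<le> exp (Re z * k)" using exp_ge_add_one_self[of "Re z * k"] by linarith
      then have "Re z * k * exp (- (Re z * k)) \<le> exp (Re z * k) * exp (- (Re z * k))"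
        by (intro mult_right_mono) auto
      then have "Re z * (k * exp (- (Re z * k))) \<le> 1" by (simp flip: exp_add add: mult.assoc)
      then show ?thesis using z by (simp add: D_def norm_mult field_simps)
    qed
    show "\<exists>D\<in>carrier (bounded_ops V V).
        ((\<lambda>w. vnorm (bounded_ops V V) ((1 / (w - z)) \<odot>\<^bsub>bounded_ops V V\<^esub>
          (diag_semigroup w \<ominus>\<^bsub>bounded_ops V V\<^esub> diag_semigroup z) \<ominus>\<^bsub>bounded_ops V V\<^esub> D)) \<longlongrightarrow> 0) (at z within sector (pi / 2))"
    proof (intro bexI[of _ "Mult D"])
      show "Mult D \<in> carrier (bounded_ops V V)" by (rule Mult_carrier[OF D])
      show "((\<lambda>w. vnorm (bounded_ops V V) ((1 / (w - z)) \<odot>\<^bsub>bounded_ops V V\<^esub>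
          (diag_semigroup w \<ominus>\<^bsub>bounded_ops V V\<^esub> diag_semigroup z) \<ominus>\<^bsub>bounded_ops V V\<^esub> Mult D)) \<longlongrightarrow> 0) (at z within sector (pi / 2))"
      proof (rule Lim_null_comparison)
        have "((\<lambda>w. 8 / (Re z)\<^sup>2 * cmod (w - z)) \<longlongrightarrow> 8 / (Re z)\<^sup>2 * cmod (z - z)) (at z within sector (pi / 2))"
          by (intro tendsto_intros)
        then show "((\<lambda>w. 8 / (Re z)\<^sup>2 * cmod (w - z)) \<longlongrightarrow> 0) (at z within sector (pi / 2))" by simp
        have "\<forall>\<^sub>F w in at z within sector (pi / 2). cmod (w - z) < Re z / 2"
          unfolding eventually_at using z by (intro exI[of _ "Re z / 2"]) (auto simp: dist_norm)
        moreover have "\<forall>\<^sub>F w in at z within sector (pi / 2). w \<noteq> z \<and> w \<in> sector (pi / 2)"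
          by (auto simp: eventually_at intro: exI[of _ 1])
        ultimately show "\<forall>\<^sub>F w in at z within sector (pi / 2).
          norm (vnorm (bounded_ops V V) ((1 / (w - z)) \<odot>\<^bsub>bounded_ops V V\<^esub>
            (diag_semigroup w \<ominus>\<^bsub>bounded_ops V V\<^esub> diag_semigroup z) \<ominus>\<^bsub>bounded_ops V V\<^esub> Mult D)) \<le> 8 / (Re z)\<^sup>2 * cmod (w - z)"
        proof eventually_elim
          case (elim w)
          then have w: "0 \<le> Re w" "w \<noteq> z" using Re[of w] by auto
          define p where "p k = exp (- w * of_nat k)" for k
          define q where "q k = exp (- z * of_nat k)" for k
          define r where "r k = (1 / (w - z)) * (p k - q k)" for k
          have p: "cmod (p k) \<le> 1" and q: "cmod (q k) \<le> 1" for k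
            using w z by (simp_all add: p_def q_def)
          have pq: "cmod (p k - q k) \<le> 2" for k
            using norm_triangle_ineq4[of "p k" "q k"] p[of k] q[of k] by linarith
          have r: "cmod (r k) \<le> 2 / cmod (w - z)" for k
            using pq[of k] by (simp add: r_def norm_mult norm_divide divide_right_mono)
          have "diag_semigroup w \<ominus>\<^bsub>bounded_ops V V\<^esub> diag_semigroup z = Mult (\<lambda>k. p k - q k)"
            unfolding diag_semigroup_def p_def[symmetric] q_def[symmetric] by (rule Mult_minus[OF p q])
          moreover have "(1 / (w - z)) \<odot>\<^bsub>bounded_ops V V\<^esub> Mult (\<lambda>k. p k - q k) = Mult r"
            unfolding r_def[abs_def] by (rule Mult_smult[OF pq])
          moreover have "Mult r \<ominus>\<^bsub>bounded_ops V V\<^esub> Mult D = Mult (\<lambda>k. r k - D k)"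
            by (rule Mult_minus[OF r D])
          moreover have "cmod (r k - D k) \<le> 8 / (Re z)\<^sup>2 * cmod (w - z)" for k
            using norm_exp_minus_linear_le[of z w k] z w elim by (simp add: r_def p_def q_def D_def)
          then have "vnorm (bounded_ops V V) (Mult (\<lambda>k. r k - D k)) \<le> 8 / (Re z)\<^sup>2 * cmod (w - z)"
            "Mult (\<lambda>k. r k - D k) \<in> carrier (bounded_ops V V)"
            by (auto intro!: norm_Mult_le Mult_carrier)
          ultimately show ?case using BO.vnorm_nonneg by simp
        qed
      qed
    qed
  qed
  fix x assume x: "x \<in> carrier V"
  show "diag_semigroup (z + w) x = diag_semigroup z (diag_semigroup w x)" if "z \<in> sector (pi / 2)" "w \<in> sector (pi / 2)" for z w
    using Re[OF that(1)] Re[OF that(2)] x by (intro diag_semigroup_add) auto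
  fix \<theta> :: real assume \<theta>: "0 < \<theta>" "\<theta> < pi / 2"
  show "((\<lambda>z. vnorm V (diag_semigroup z x \<ominus>\<^bsub>V\<^esub> x)) \<longlongrightarrow> 0) (at 0 within sector \<theta>)"
  proof (rule diag_semigroup_strongly_continuous[OF _ _ x])
    show "at 0 within sector \<theta> \<le> nhds (0 :: complex)" by (simp add: at_within_def)
    show "\<forall>\<^sub>F z in at 0 within sector \<theta>. 0 \<le> Re z"
      using \<theta> sector_Re_pos[of _ \<theta>] by (auto simp: eventually_at intro!: exI[of _ 1] less_imp_le)
  qed
qed auto

text \<open>If \<open>x\<close> is in the domain, the defect of the difference quotient is a
  multiplier applied to \<open>v\<close>, the image of \<open>x\<close> under
  \<open>diag_op\<close>, not to \<open>x\<close>: its symbol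
  \<open>(exp (- t * k) - 1) / (t * k) + 1\<close> is bounded by 2 and tends to 0 for each
  \<open>k\<close>. Conversely, coordinates are continuous, so the generator acts as
  \<open>- k\<close> on each of them.\<close>

lemma generator_diag_semigroup: "generator V (\<lambda>t. diag_semigroup (of_real t)) = neg_op V diag_op"
proof (intro equalityI subrelI)
  fix x y assume "(x, y) \<in> neg_op V diag_op"
  then obtain v where v: "(x, v) \<in> diag_op" "y = \<ominus>\<^bsub>V\<^esub> v" by (auto simp: neg_op_def)
  then have x: "x \<in> carrier V" "v \<in> carrier V" "y \<in> carrier V" "\<And>k. J v k = of_nat k * J x k"
    by (auto simp: diag_op_def)
  define m where "m t k = (exp (- of_real t * of_nat k) - 1) / (of_real t * of_nat k) + (1 :: complex)" for t :: real and k :: nat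
  have m: "cmod (m t k) \<le> 2" if "0 < t" "1 \<le> k" for t k
  proof -
    have "\<bar>exp (- (t * k)) - 1\<bar> \<le> t * k" using exp_ge_add_one_self[of "- (t * k)"] that by (simp add: abs_if)
    then have "\<bar>(exp (- (t * k)) - 1) / (t * k)\<bar> \<le> 1" using that by (simp add: abs_mult pos_divide_le_eq)
    then have "\<bar>(exp (- (t * k)) - 1) / (t * k) + 1\<bar> \<le> 2" by linarith
    moreover have "m t k = of_real ((exp (- (t * k)) - 1) / (t * k) + 1)"
      by (simp add: m_def flip: exp_of_real)
    ultimately show ?thesis by (simp only: norm_of_real)
  qed
  have "((\<lambda>t. vnorm V (Mult (m t) v)) \<longlongrightarrow> 0) (at_right 0)"
  proof (rule Mult_tendsto_zero[OF _ _ x(2)])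
    show "\<forall>\<^sub>F t in at_right 0. \<forall>k\<ge>1. cmod (m t k) \<le> 2"
      using eventually_at_right_less[of 0] by eventually_elim (auto intro: m)
    fix k :: nat assume k: "1 \<le> k"
    then have "((\<lambda>t. (exp (- t * real k) - 1) / (t * real k) + 1) \<longlongrightarrow> 0) (at_right 0)"
      by real_asymp
    then have "((\<lambda>t. complex_of_real ((exp (- t * real k) - 1) / (t * real k) + 1)) \<longlongrightarrow> of_real 0) (at_right 0)"
      by (rule tendsto_of_real)
    then show "((\<lambda>t. m t k) \<longlongrightarrow> 0) (at_right 0)"
      by (simp add: m_def flip: exp_of_real)
  qed
  moreover have "\<forall>\<^sub>F t in at_right 0. vnorm V (Mult (m t) v)
     = vnorm V ((of_real (1 / t) \<odot>\<^bsub>V\<^esub> (diag_semigroup (of_real t) x \<ominus>\<^bsub>V\<^esub> x)) \<ominus>\<^bsub>V\<^esub> y)"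
    using eventually_at_right_less[of 0]
  proof eventually_elim
    case (elim t)
    note m' = m[OF elim]
    have sx: "diag_semigroup (of_real t) x \<in> carrier V" using diag_semigroup_in[of "of_real t" x] x elim by simp
    have "J (Mult (m t) v) k = J ((of_real (1 / t) \<odot>\<^bsub>V\<^esub> (diag_semigroup (of_real t) x \<ominus>\<^bsub>V\<^esub> x)) \<ominus>\<^bsub>V\<^esub> y) k" for k
    proof (cases "k = 0")
      case True
      then show ?thesis using x sx Mult_in[of "m t", OF m'] by (simp add: J_index0)
    next
      case False
      then have "m t k * (of_nat k * J x k) = of_real (1 / t) * (exp (- of_real t * of_nat k) * J x k - J x k) + of_nat k * J x k"
        using elim by (simp add: m_def field_simps)
      then show ?thesis
        using x sx elim v(2) J_diag_semigroup[of "of_real t" x] J_Mult[of "m t", OF m']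
        by (simp add: J_minus J_smult J_neg)
    qed
    then have "Mult (m t) v = (of_real (1 / t) \<odot>\<^bsub>V\<^esub> (diag_semigroup (of_real t) x \<ominus>\<^bsub>V\<^esub> x)) \<ominus>\<^bsub>V\<^esub> y"
      using x sx Mult_in[of "m t", OF m'] by (intro J_inj ext) auto
    then show ?case by simp
  qed
  ultimately have "((\<lambda>t. vnorm V ((of_real (1 / t) \<odot>\<^bsub>V\<^esub> (diag_semigroup (of_real t) x \<ominus>\<^bsub>V\<^esub> x)) \<ominus>\<^bsub>V\<^esub> y)) \<longlongrightarrow> 0) (at_right 0)"
    by (rule Lim_transform_eventually)
  then show "(x, y) \<in> generator V (\<lambda>t. diag_semigroup (of_real t))" using x by (simp add: generator_def)
next
  fix x y assume "(x, y) \<in> generator V (\<lambda>t. diag_semigroup (of_real t))"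
  then have x: "x \<in> carrier V" "y \<in> carrier V" and
    lim: "((\<lambda>t. vnorm V ((of_real (1 / t) \<odot>\<^bsub>V\<^esub> (diag_semigroup (of_real t) x \<ominus>\<^bsub>V\<^esub> x)) \<ominus>\<^bsub>V\<^esub> y)) \<longlongrightarrow> 0) (at_right 0)"
    by (auto simp: generator_def)
  have "J y k = - of_nat k * J x k" for k
  proof (cases "k = 0")
    case False
    obtain c where c: "0 < c" "\<And>x. x \<in> carrier V \<Longrightarrow> cmod (J x k) \<le> c * vnorm V x"
      using J_cmod_le[of k] False by auto
    let ?g = "\<lambda>t. of_real (1 / t) * (exp (- of_real t * of_nat k) * J x k - J x k)"
    have "((\<lambda>t. ?g t - J y k) \<longlongrightarrow> 0) (at_right 0)"
    proof (rule Lim_null_comparison)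
      show "((\<lambda>t. c * vnorm V ((of_real (1 / t) \<odot>\<^bsub>V\<^esub> (diag_semigroup (of_real t) x \<ominus>\<^bsub>V\<^esub> x)) \<ominus>\<^bsub>V\<^esub> y)) \<longlongrightarrow> 0) (at_right 0)"
        using tendsto_mult_right_zero[OF lim, of c] by simp
      show "\<forall>\<^sub>F t in at_right 0. norm (?g t - J y k)
          \<le> c * vnorm V ((of_real (1 / t) \<odot>\<^bsub>V\<^esub> (diag_semigroup (of_real t) x \<ominus>\<^bsub>V\<^esub> x)) \<ominus>\<^bsub>V\<^esub> y)"
        using eventually_at_right_less[of 0]
      proof eventually_elim
        case (elim t)
        have sx: "diag_semigroup (of_real t) x \<in> carrier V" using diag_semigroup_in[of "of_real t" x] x elim by simp
        have "?g t - J y k = J ((of_real (1 / t) \<odot>\<^bsub>V\<^esub> (diag_semigroup (of_real t) x \<ominus>\<^bsub>V\<^esub> x)) \<ominus>\<^bsub>V\<^esub> y) k"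
          using x sx elim J_diag_semigroup[of "of_real t" x] by (simp add: J_minus J_smult)
        then show ?case using c(2)[of "(of_real (1 / t) \<odot>\<^bsub>V\<^esub> (diag_semigroup (of_real t) x \<ominus>\<^bsub>V\<^esub> x)) \<ominus>\<^bsub>V\<^esub> y"] x sx by simp
      qed
    qed
    then have 1: "(?g \<longlongrightarrow> J y k) (at_right 0)" by (simp add: LIM_zero_iff)
    have "((\<lambda>t. (exp (- t * real k) - 1) / t) \<longlongrightarrow> - real k) (at_right 0)" using False by real_asymp
    then have "((\<lambda>t. complex_of_real ((exp (- t * real k) - 1) / t) * J x k) \<longlongrightarrow> of_real (- real k) * J x k) (at_right 0)"
      by (intro tendsto_intros)
    moreover have "(\<lambda>t. complex_of_real ((exp (- t * real k) - 1) / t) * J x k) = ?g"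
      by (rule ext) (simp add: left_diff_distrib diff_divide_distrib flip: exp_of_real)
    ultimately have 2: "(?g \<longlongrightarrow> - of_nat k * J x k) (at_right 0)" by (simp only: of_real_minus of_real_of_nat_eq)
    show ?thesis by (rule tendsto_unique[OF _ 1 2]) simp
  qed (use x in \<open>simp add: J_index0\<close>)
  then have "(x, \<ominus>\<^bsub>V\<^esub> y) \<in> diag_op" using x by (simp add: diag_op_def J_neg)
  then show "(x, y) \<in> neg_op V diag_op"
    unfolding neg_op_def using x by (auto intro!: exI[of _ "\<ominus>\<^bsub>V\<^esub> y"] simp: minus_minus)
qed

lemma neg_generates_analytic_diag_op: "neg_generates_analytic V diag_op (\<lambda>t. diag_semigroup (of_real t))"
  unfolding neg_generates_analytic_def
  using sectorial_diag_op analytic_C0_semigroup_diag generator_diag_semigroup by simp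

end

section \<open>Vector-valued integrals in coordinates\<close>

context diag_space
begin

lemma vnorm_le_sum:
  assumes x: "x \<in> carrier V" and supp: "\<And>k. K \<le> k \<Longrightarrow> J x k = 0"
  shows "vnorm V x \<le> (\<Sum>k\<in>{1..<K}. cmod (J x k) * vnorm V (vec (\<lambda>i. if i = k then 1 else 0)))"
  using assms
proof (induction K arbitrary: x)
  case 0
  then have "x = \<zero>\<^bsub>V\<^esub>" by (intro J_inj) (auto simp: J_zero)
  then show ?case by simp
next
  case (Suc K)
  show ?case
  proof (cases "K = 0")
    case True
    have "J x k = 0" for k using Suc.prems J_index0[of x] True by (cases "k = 0") auto
    then have "x = \<zero>\<^bsub>V\<^esub>" using Suc.prems(1) by (intro J_inj) (auto simp: J_zero)
    then show ?thesis using True by simp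
  next
    case False
    let ?e = "vec (\<lambda>i. if i = K then 1 else 0)"
    have e: "?e \<in> carrier V" "J ?e = (\<lambda>i. if i = K then 1 else 0)"
      using vec_finite[of "\<lambda>i. if i = K then 1 else 0" "Suc K"] False by auto
    let ?y = "x \<ominus>\<^bsub>V\<^esub> J x K \<odot>\<^bsub>V\<^esub> ?e"
    have y: "?y \<in> carrier V" "J ?y = (\<lambda>k. if k = K then 0 else J x k)"
      using Suc.prems(1) e by (auto simp: J_minus J_smult)
    have "vnorm V x \<le> vnorm V ?y + vnorm V (J x K \<odot>\<^bsub>V\<^esub> ?e)"
      using Suc.prems(1) e by (intro vnorm_triangle_sub) auto
    also have "vnorm V ?y \<le> (\<Sum>k\<in>{1..<K}. cmod (J ?y k) * vnorm V (vec (\<lambda>i. if i = k then 1 else 0)))"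
      using y Suc.prems(2) by (intro Suc.IH) auto
    also have "\<dots> = (\<Sum>k\<in>{1..<K}. cmod (J x k) * vnorm V (vec (\<lambda>i. if i = k then 1 else 0)))"
      unfolding y(2) by (intro sum.cong) auto
    also have "vnorm V (J x K \<odot>\<^bsub>V\<^esub> ?e) = cmod (J x K) * vnorm V ?e" using e by (simp add: vnorm_smult)
    finally show ?thesis using False by simp
  qed
qed

text \<open>Coordinates are approximated separately; as only finitely many occur, this yields
  convergence in norm. The values are assembled by induction on the number of coordinates, each step
  combining two simple functions. The bound by twice the coordinate provides the majorant for
  dominated convergence.\<close>

lemma strongly_measurable_vec:
  assumes F: "\<And>t. t \<in> space M \<Longrightarrow> F t \<in> carrier V" "\<And>t k. t \<in> space M \<Longrightarrow> K \<le> k \<Longrightarrow> J (F t) k = 0"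
    and meas: "\<And>k. (\<lambda>t. J (F t) k) \<in> borel_measurable M"
  obtains s where "\<And>i. simple_fun V M (s i)"
    "\<And>i t k. t \<in> space M \<Longrightarrow> K \<le> k \<Longrightarrow> J (s i t) k = 0"
    "\<And>t k. t \<in> space M \<Longrightarrow> (\<lambda>i. J (s i t) k) \<longlonglongrightarrow> J (F t) k"
    "\<And>i t k. t \<in> space M \<Longrightarrow> cmod (J (s i t) k) \<le> 2 * cmod (J (F t) k)"
    "\<And>t. t \<in> space M \<Longrightarrow> (\<lambda>i. vnorm V (s i t \<ominus>\<^bsub>V\<^esub> F t)) \<longlonglongrightarrow> 0"
proof -
  have "\<forall>k. \<exists>a. (\<forall>i. simple_function M (a i)) \<and> (\<forall>t\<in>space M. (\<lambda>i. a i t) \<longlonglongrightarrow> J (F t) k)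
      \<and> (\<forall>i. \<forall>t\<in>space M. cmod (a i t) \<le> 2 * cmod (J (F t) k))"
  proof
    fix k
    show "\<exists>a. (\<forall>i. simple_function M (a i)) \<and> (\<forall>t\<in>space M. (\<lambda>i. a i t) \<longlonglongrightarrow> J (F t) k)
        \<and> (\<forall>i. \<forall>t\<in>space M. cmod (a i t) \<le> 2 * cmod (J (F t) k))"
      using borel_measurable_implies_sequence_metric[OF meas[of k], where z = 0] by simp
  qed
  then obtain a where a: "\<And>k i. simple_function M (a k i)"
    "\<And>k t. t \<in> space M \<Longrightarrow> (\<lambda>i. a k i t) \<longlonglongrightarrow> J (F t) k"
    "\<And>k i t. t \<in> space M \<Longrightarrow> cmod (a k i t) \<le> 2 * cmod (J (F t) k)"
    by metis
  define c where "c L i t k = (if 1 \<le> k \<and> k < L then a k i t else 0)" for L i t k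
  define s where "s i t = vec (c K i t)" for i t
  have c: "vec (c L i t) \<in> carrier V" "J (vec (c L i t)) = c L i t" for L i t
    by (auto simp: c_def intro!: vec_finite[of _ L])
  have sf: "simple_function M (\<lambda>t. vec (c L i t))" for L i
  proof (induction L)
    case 0
    have "c 0 i t = (\<lambda>k. 0)" for t by (auto simp: c_def)
    then show ?case by simp
  next
    case (Suc L)
    have "c (Suc L) i t = (\<lambda>k. if 1 \<le> k \<and> k = L then a L i t else J (vec (c L i t)) k)" for t
      unfolding c(2) by (auto simp: c_def fun_eq_iff less_Suc_eq)
    then show ?case
      using simple_function_compose2[OF Suc a(1)[of L i], of "\<lambda>x b. vec (\<lambda>k. if 1 \<le> k \<and> k = L then b else J x k)"]
      by simp
  qed
  have Js: "J (s i t) k = (if k < K then a k i t else 0)" if "t \<in> space M" for i t k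
    using J_index0[OF F(1)[OF that]] a(3)[OF that, of 0 i] by (cases "k = 0") (auto simp: s_def c c_def)
  have s_simple: "simple_fun V M (s i)" for i
    unfolding simple_fun_def s_def using sf c by auto
  have s_supp: "J (s i t) k = 0" if "t \<in> space M" "K \<le> k" for i t k using Js[OF that(1)] that(2) by simp
  have s_lim: "(\<lambda>i. J (s i t) k) \<longlonglongrightarrow> J (F t) k" if "t \<in> space M" for t k
    using Js[OF that] a(2)[OF that] F(2)[OF that] by (cases "k < K") auto
  have s_bd: "cmod (J (s i t) k) \<le> 2 * cmod (J (F t) k)" if "t \<in> space M" for i t k
    using Js[OF that] a(3)[OF that] by (cases "k < K") auto
  have "(\<lambda>i. vnorm V (s i t \<ominus>\<^bsub>V\<^esub> F t)) \<longlonglongrightarrow> 0" if t: "t \<in> space M" for t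
  proof (rule Lim_null_comparison[OF always_eventually])
    show "\<forall>i. norm (vnorm V (s i t \<ominus>\<^bsub>V\<^esub> F t))
      \<le> (\<Sum>k\<in>{1..<K}. cmod (J (s i t) k - J (F t) k) * vnorm V (vec (\<lambda>i. if i = k then 1 else 0)))"
    proof
      fix i
      have st: "s i t \<in> carrier V" using c by (simp add: s_def)
      then show "norm (vnorm V (s i t \<ominus>\<^bsub>V\<^esub> F t))
        \<le> (\<Sum>k\<in>{1..<K}. cmod (J (s i t) k - J (F t) k) * vnorm V (vec (\<lambda>i. if i = k then 1 else 0)))"
        using vnorm_le_sum[of "s i t \<ominus>\<^bsub>V\<^esub> F t" K] F[OF t] s_supp[OF t] vnorm_nonneg[of "s i t \<ominus>\<^bsub>V\<^esub> F t"]
        by (simp add: J_minus)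
    qed
    have "(\<lambda>i. \<Sum>k\<in>{1..<K}. cmod (J (s i t) k - J (F t) k) * vnorm V (vec (\<lambda>i. if i = k then 1 else 0)))
       \<longlonglongrightarrow> (\<Sum>k\<in>{1..<K}. cmod (J (F t) k - J (F t) k) * vnorm V (vec (\<lambda>i. if i = k then 1 else 0)))"
      by (intro tendsto_intros s_lim t)
    then show "(\<lambda>i. \<Sum>k\<in>{1..<K}. cmod (J (s i t) k - J (F t) k) * vnorm V (vec (\<lambda>i. if i = k then 1 else 0))) \<longlonglongrightarrow> 0"
      by simp
  qed
  then show ?thesis using that[of s] s_simple s_supp s_lim s_bd by blast
qed

lemma has_bochner_integral_vec:
  assumes M: "emeasure M (space M) \<noteq> \<infinity>"
    and F: "\<And>t. t \<in> space M \<Longrightarrow> F t \<in> carrier V" "\<And>t k. t \<in> space M \<Longrightarrow> K \<le> k \<Longrightarrow> J (F t) k = 0"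
    and int: "\<And>k. integrable M (\<lambda>t. J (F t) k)"
  shows "has_bochner_integral_in V M F (vec (\<lambda>k. \<integral>t. J (F t) k \<partial>M))"
    "vec (\<lambda>k. \<integral>t. J (F t) k \<partial>M) \<in> carrier V" "J (vec (\<lambda>k. \<integral>t. J (F t) k \<partial>M)) = (\<lambda>k. \<integral>t. J (F t) k \<partial>M)"
proof -
  have cV: "cnormed_space V" by unfold_locales
  let ?x = "vec (\<lambda>k. \<integral>t. J (F t) k \<partial>M)"
  let ?E = "\<lambda>k. vnorm V (vec (\<lambda>i. if i = k then 1 else 0))"
  have E: "0 \<le> ?E k" if "k \<in> {1..<K}" for k
    using vec_finite(1)[of "\<lambda>i. if i = k then 1 else 0" "Suc k"] that by (intro vnorm_nonneg) auto
  have "(\<integral>t. J (F t) k \<partial>M) = (\<integral>t. 0 \<partial>M)" if "k = 0 \<or> K \<le> k" for k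
    using F J_index0[OF F(1)] that by (intro Bochner_Integration.integral_cong) auto
  then show x: "?x \<in> carrier V" "J ?x = (\<lambda>k. \<integral>t. J (F t) k \<partial>M)" by (auto intro!: vec_finite[of _ K])
  obtain s where s: "\<And>i. simple_fun V M (s i)"
    "\<And>i t k. t \<in> space M \<Longrightarrow> K \<le> k \<Longrightarrow> J (s i t) k = 0"
    "\<And>t k. t \<in> space M \<Longrightarrow> (\<lambda>i. J (s i t) k) \<longlonglongrightarrow> J (F t) k"
    "\<And>i t k. t \<in> space M \<Longrightarrow> cmod (J (s i t) k) \<le> 2 * cmod (J (F t) k)"
    "\<And>t. t \<in> space M \<Longrightarrow> (\<lambda>i. vnorm V (s i t \<ominus>\<^bsub>V\<^esub> F t)) \<longlonglongrightarrow> 0"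
    by (rule strongly_measurable_vec[of M F K])
      (erule F(1), erule (1) F(2), rule borel_measurable_integrable[OF int], (rule that; assumption))
  have st: "s i t \<in> carrier V" if "t \<in> space M" for i t using s(1)[of i] that by (auto simp: simple_fun_def)
  have fin: "emeasure M {t \<in> space M. s i t \<noteq> \<zero>\<^bsub>V\<^esub>} \<noteq> \<infinity>" for i
  proof -
    have "emeasure M {t \<in> space M. s i t \<noteq> \<zero>\<^bsub>V\<^esub>} \<le> emeasure M (space M)"
      by (intro emeasure_mono) auto
    then show ?thesis using M by (auto simp: top_unique)
  qed
  have int_s: "integrable M (\<lambda>t. J (s i t) k)" "J (simple_integral_in V M (s i)) k = (\<integral>t. J (s i t) k \<partial>M)" for i k
    using functional_simple_integral_in[OF cV s(1) fin, of "\<lambda>x. J x k"] by (auto simp: J_add J_smult)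
  define D where "D i = (\<Sum>k\<in>{1..<K}. (\<integral>t. cmod (J (s i t) k - J (F t) k) \<partial>M) * ?E k)" for i
  have Dlim: "D \<longlonglongrightarrow> 0"
  proof -
    have "(\<lambda>i. \<integral>t. cmod (J (s i t) k - J (F t) k) \<partial>M) \<longlonglongrightarrow> (\<integral>t. 0 \<partial>M)" for k
    proof (rule integral_dominated_convergence)
      show "integrable M (\<lambda>t. 3 * cmod (J (F t) k))" using int by simp
      show "AE t in M. (\<lambda>i. cmod (J (s i t) k - J (F t) k)) \<longlonglongrightarrow> 0"
        using s(3) by (intro AE_I2 tendsto_norm_zero) (auto simp: LIM_zero_iff)
      show "AE t in M. norm (cmod (J (s i t) k - J (F t) k)) \<le> 3 * cmod (J (F t) k)" for i
      proof (rule AE_I2)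
        fix t assume "t \<in> space M"
        then show "norm (cmod (J (s i t) k - J (F t) k)) \<le> 3 * cmod (J (F t) k)"
          using s(4)[of t i k] norm_triangle_ineq4[of "J (s i t) k" "J (F t) k"] by simp
      qed
    qed (use int int_s in \<open>auto intro!: borel_measurable_integrable\<close>)
    then have "D \<longlonglongrightarrow> (\<Sum>k\<in>{1..<K}. (\<integral>t. 0 \<partial>M) * ?E k)"
      unfolding D_def by (intro tendsto_sum tendsto_mult_right)
    then show ?thesis by simp
  qed
  show "has_bochner_integral_in V M F ?x"
    unfolding has_bochner_integral_in_def
  proof (intro conjI exI[of _ s] allI x s(1) fin)
    show "strongly_measurable V M F"
      unfolding strongly_measurable_def using F(1) s(1,5) by (intro conjI exI[of _ s] allI AE_I2) auto
    show "(\<lambda>i. \<integral>\<^sup>+ t. ennreal (vnorm V (F t \<ominus>\<^bsub>V\<^esub> s i t)) \<partial>M) \<longlonglongrightarrow> 0"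
    proof (rule tendsto_sandwich[OF always_eventually always_eventually tendsto_const])
      show "\<forall>i. (\<integral>\<^sup>+ t. ennreal (vnorm V (F t \<ominus>\<^bsub>V\<^esub> s i t)) \<partial>M) \<le> ennreal (D i)"
      proof
        fix i
        let ?g = "\<lambda>t. \<Sum>k\<in>{1..<K}. cmod (J (s i t) k - J (F t) k) * ?E k"
        have "(\<integral>\<^sup>+ t. ennreal (vnorm V (F t \<ominus>\<^bsub>V\<^esub> s i t)) \<partial>M) \<le> (\<integral>\<^sup>+ t. ennreal (?g t) \<partial>M)"
        proof (intro nn_integral_mono ennreal_leI)
          fix t assume t: "t \<in> space M"
          have "vnorm V (F t \<ominus>\<^bsub>V\<^esub> s i t) \<le> (\<Sum>k\<in>{1..<K}. cmod (J (F t \<ominus>\<^bsub>V\<^esub> s i t) k) * ?E k)"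
            using F[OF t] st[OF t] s(2)[OF t] by (intro vnorm_le_sum) (auto simp: J_minus)
          then show "vnorm V (F t \<ominus>\<^bsub>V\<^esub> s i t) \<le> ?g t"
            using F(1)[OF t] st[OF t] by (simp add: J_minus norm_minus_commute)
        qed
        also have "\<dots> = ennreal (\<integral>t. ?g t \<partial>M)"
          using int int_s E by (intro nn_integral_eq_integral AE_I2 sum_nonneg) auto
        also have "(\<integral>t. ?g t \<partial>M) = D i"
          unfolding D_def using int int_s by (subst Bochner_Integration.integral_sum) auto
        finally show "(\<integral>\<^sup>+ t. ennreal (vnorm V (F t \<ominus>\<^bsub>V\<^esub> s i t)) \<partial>M) \<le> ennreal (D i)" .
      qed
      show "(\<lambda>i. ennreal (D i)) \<longlonglongrightarrow> 0" using tendsto_ennrealI[OF Dlim] by simp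
    qed auto
    show "(\<lambda>i. vnorm V (simple_integral_in V M (s i) \<ominus>\<^bsub>V\<^esub> ?x)) \<longlonglongrightarrow> 0"
    proof (rule Lim_null_comparison[OF always_eventually Dlim], intro allI)
      fix i
      have si: "simple_integral_in V M (s i) \<in> carrier V" by (rule simple_integral_in_closed[OF cV s(1)])
      have diff: "J (simple_integral_in V M (s i) \<ominus>\<^bsub>V\<^esub> ?x) k = (\<integral>t. J (s i t) k - J (F t) k \<partial>M)" for k
        using si x int int_s by (simp add: J_minus)
      have "J (simple_integral_in V M (s i) \<ominus>\<^bsub>V\<^esub> ?x) k = 0" if "K \<le> k" for k
      proof -
        have "(\<integral>t. J (s i t) k - J (F t) k \<partial>M) = (\<integral>t. 0 \<partial>M)"
          using s(2) F(2) that by (intro Bochner_Integration.integral_cong) auto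
        then show ?thesis unfolding diff by simp
      qed
      then have "vnorm V (simple_integral_in V M (s i) \<ominus>\<^bsub>V\<^esub> ?x)
          \<le> (\<Sum>k\<in>{1..<K}. cmod (J (simple_integral_in V M (s i) \<ominus>\<^bsub>V\<^esub> ?x) k) * ?E k)"
        using si x by (intro vnorm_le_sum) auto
      also have "\<dots> \<le> D i"
        unfolding D_def diff using E by (intro sum_mono mult_right_mono integral_norm_bound) auto
      finally show "norm (vnorm V (simple_integral_in V M (s i) \<ominus>\<^bsub>V\<^esub> ?x)) \<le> D i"
        using si x vnorm_nonneg by simp
    qed
  qed
qed

text \<open>A coordinate is a bounded functional, hence commutes with the limit of simple integrals
  whichever approximating sequence is used. As coordinates determine the vector, this yields
  uniqueness of the integral.\<close>

lemma has_bochner_integral_in_coord: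
  assumes h: "has_bochner_integral_in V M F x" and int: "integrable M (\<lambda>t. J (F t) k)" and k: "1 \<le> k"
  shows "J x k = (\<integral>t. J (F t) k \<partial>M)"
proof -
  have cV: "cnormed_space V" by unfold_locales
  obtain c where c: "0 < c" "\<And>x. x \<in> carrier V \<Longrightarrow> cmod (J x k) \<le> c * vnorm V x"
    using J_cmod_le[OF k] by auto
  obtain s where s: "\<And>i. simple_fun V M (s i)" "\<And>i. emeasure M {t \<in> space M. s i t \<noteq> \<zero>\<^bsub>V\<^esub>} \<noteq> \<infinity>"
    "(\<lambda>i. \<integral>\<^sup>+ t. ennreal (vnorm V (F t \<ominus>\<^bsub>V\<^esub> s i t)) \<partial>M) \<longlonglongrightarrow> 0"
    "(\<lambda>i. vnorm V (simple_integral_in V M (s i) \<ominus>\<^bsub>V\<^esub> x)) \<longlonglongrightarrow> 0"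
    and x: "x \<in> carrier V" and F: "AE t in M. F t \<in> carrier V"
    using h unfolding has_bochner_integral_in_def strongly_measurable_def by blast
  have st: "s i t \<in> carrier V" if "t \<in> space M" for i t using s(1)[of i] that by (auto simp: simple_fun_def)
  have int_s: "integrable M (\<lambda>t. J (s i t) k)" "J (simple_integral_in V M (s i)) k = (\<integral>t. J (s i t) k \<partial>M)" for i
    using functional_simple_integral_in[OF cV s(1,2), of "\<lambda>x. J x k"] by (auto simp: J_add J_smult)
  have "(\<lambda>i. J (simple_integral_in V M (s i)) k - J x k) \<longlonglongrightarrow> 0"
  proof (rule Lim_null_comparison[OF always_eventually])
    show "\<forall>i. norm (J (simple_integral_in V M (s i)) k - J x k) \<le> c * vnorm V (simple_integral_in V M (s i) \<ominus>\<^bsub>V\<^esub> x)"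
    proof
      fix i
      have "simple_integral_in V M (s i) \<in> carrier V" by (rule simple_integral_in_closed[OF cV s(1)])
      then show "norm (J (simple_integral_in V M (s i)) k - J x k) \<le> c * vnorm V (simple_integral_in V M (s i) \<ominus>\<^bsub>V\<^esub> x)"
        using c(2)[of "simple_integral_in V M (s i) \<ominus>\<^bsub>V\<^esub> x"] x by (simp add: J_minus)
    qed
    show "(\<lambda>i. c * vnorm V (simple_integral_in V M (s i) \<ominus>\<^bsub>V\<^esub> x)) \<longlonglongrightarrow> 0"
      using tendsto_mult_right_zero[OF s(4), of c] by simp
  qed
  then have 1: "(\<lambda>i. \<integral>t. J (s i t) k \<partial>M) \<longlonglongrightarrow> J x k" by (simp add: int_s LIM_zero_iff)
  \<comment> \<open>Dividing by \<open>c\<close> leaves on the right exactly the integrals that tend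
    to 0.\<close>
  have le: "ennreal (cmod ((1 / c) * ((\<integral>t. J (F t) k \<partial>M) - (\<integral>t. J (s i t) k \<partial>M))))
     \<le> (\<integral>\<^sup>+ t. ennreal (vnorm V (F t \<ominus>\<^bsub>V\<^esub> s i t)) \<partial>M)" for i
  proof -
    have "(1 / c) * ((\<integral>t. J (F t) k \<partial>M) - (\<integral>t. J (s i t) k \<partial>M)) = (\<integral>t. (1 / c) * (J (F t) k - J (s i t) k) \<partial>M)"
      using int int_s by simp
    also have "ennreal (cmod \<dots>) \<le> (\<integral>\<^sup>+ t. ennreal (cmod ((1 / c) * (J (F t) k - J (s i t) k))) \<partial>M)"
      using int int_s by (intro integral_norm_bound_ennreal) auto
    also have "\<dots> \<le> (\<integral>\<^sup>+ t. ennreal (vnorm V (F t \<ominus>\<^bsub>V\<^esub> s i t)) \<partial>M)"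
    proof (rule nn_integral_mono_AE)
      show "AE t in M. ennreal (cmod ((1 / c) * (J (F t) k - J (s i t) k))) \<le> ennreal (vnorm V (F t \<ominus>\<^bsub>V\<^esub> s i t))"
        using F AE_space
      proof eventually_elim
        case (elim t)
        then have "cmod (J (F t) k - J (s i t) k) \<le> c * vnorm V (F t \<ominus>\<^bsub>V\<^esub> s i t)"
          using c(2)[of "F t \<ominus>\<^bsub>V\<^esub> s i t"] st[of t i] by (simp add: J_minus)
        then show ?case using c(1) by (intro ennreal_leI) (simp add: norm_mult norm_divide field_simps)
      qed
    qed
    finally show ?thesis .
  qed
  have "(\<lambda>i. ennreal (cmod ((1 / c) * ((\<integral>t. J (F t) k \<partial>M) - (\<integral>t. J (s i t) k \<partial>M))))) \<longlonglongrightarrow> 0"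
    by (rule tendsto_sandwich[OF always_eventually always_eventually tendsto_const s(3)]) (use le in auto)
  then have "(\<lambda>i. cmod ((1 / c) * ((\<integral>t. J (F t) k \<partial>M) - (\<integral>t. J (s i t) k \<partial>M)))) \<longlonglongrightarrow> 0"
    by (subst tendsto_ennreal_iff[symmetric]) auto
  then have "(\<lambda>i. (1 / c) * ((\<integral>t. J (F t) k \<partial>M) - (\<integral>t. J (s i t) k \<partial>M))) \<longlonglongrightarrow> 0"
    by (rule tendsto_norm_zero_cancel)
  then have "(\<lambda>i. of_real c * ((1 / c) * ((\<integral>t. J (F t) k \<partial>M) - (\<integral>t. J (s i t) k \<partial>M)))) \<longlonglongrightarrow> 0"
    by (rule tendsto_mult_right_zero)
  then have "(\<lambda>i. (\<integral>t. J (F t) k \<partial>M) - (\<integral>t. J (s i t) k \<partial>M)) \<longlonglongrightarrow> 0" using c(1) by simp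
  then have "(\<lambda>i. (\<integral>t. J (F t) k \<partial>M) - ((\<integral>t. J (F t) k \<partial>M) - (\<integral>t. J (s i t) k \<partial>M))) \<longlonglongrightarrow> (\<integral>t. J (F t) k \<partial>M) - 0"
    by (intro tendsto_intros)
  then have "(\<lambda>i. \<integral>t. J (s i t) k \<partial>M) \<longlonglongrightarrow> (\<integral>t. J (F t) k \<partial>M)" by simp
  then show ?thesis using 1 LIMSEQ_unique by blast
qed

lemma bochner_integral_vec:
  assumes M: "emeasure M (space M) \<noteq> \<infinity>"
    and F: "\<And>t. t \<in> space M \<Longrightarrow> F t \<in> carrier V" "\<And>t k. t \<in> space M \<Longrightarrow> K \<le> k \<Longrightarrow> J (F t) k = 0"
    and int: "\<And>k. integrable M (\<lambda>t. J (F t) k)"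
  shows "bochner_integral_in V M F \<in> carrier V"
    "J (bochner_integral_in V M F) = (\<lambda>k. \<integral>t. J (F t) k \<partial>M)"
proof -
  let ?x = "vec (\<lambda>k. \<integral>t. J (F t) k \<partial>M)"
  have h: "has_bochner_integral_in V M F ?x" "?x \<in> carrier V" "J ?x = (\<lambda>k. \<integral>t. J (F t) k \<partial>M)"
    by (rule has_bochner_integral_vec[of M F K]; use M F int in blast)+
  have "(THE x. has_bochner_integral_in V M F x) = ?x"
  proof (rule the_equality)
    show "has_bochner_integral_in V M F ?x" by (rule h(1))
    fix y assume y: "has_bochner_integral_in V M F y"
    then have "y \<in> carrier V" by (simp add: has_bochner_integral_in_def)
    moreover have "J y k = J ?x k" for k
    proof (cases "k = 0")
      case True
      then show ?thesis using \<open>y \<in> carrier V\<close> h(2) by (simp add: J_index0)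
    next
      case False
      then show ?thesis unfolding h(3) by (intro has_bochner_integral_in_coord[OF y int]) simp
    qed
    ultimately show "y = ?x" using h(2) by (intro J_inj) auto
  qed
  then have "bochner_integral_in V M F = ?x" using h(1) by (auto simp: bochner_integral_in_def)
  then show "bochner_integral_in V M F \<in> carrier V" "J (bochner_integral_in V M F) = (\<lambda>k. \<integral>t. J (F t) k \<partial>M)"
    using h by auto
qed

end

section \<open>Failure of maximal regularity\<close>

text \<open>For \<open>t\<close> between 0 and 1 this is the binary number formed by a leading 1 and
  the first \<open>d\<close> binary digits of \<open>t\<close>.\<close>

definition node :: "nat \<Rightarrow> real \<Rightarrow> nat" where
  "node d t = nat \<lfloor>2 ^ d * (1 + t)\<rfloor>"

lemma measurable_node [measurable]: "node d \<in> borel \<rightarrow>\<^sub>M count_space UNIV"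
  unfolding node_def by measurable

lemma
  assumes "0 \<le> t"
  shows node_le: "real (node d t) \<le> 2 ^ d * (1 + t)" and less_node: "2 ^ d * (1 + t) < real (node d t) + 1"
proof -
  have "0 \<le> 2 ^ d * (1 + t)" using assms by simp
  then have "real (node d t) = of_int \<lfloor>2 ^ d * (1 + t)\<rfloor>" by (simp add: node_def)
  then show "real (node d t) \<le> 2 ^ d * (1 + t)" "2 ^ d * (1 + t) < real (node d t) + 1" by linarith+
qed

lemma node_eqI: "0 \<le> t \<Longrightarrow> real k \<le> 2 ^ d * (1 + t) \<Longrightarrow> 2 ^ d * (1 + t) < real k + 1 \<Longrightarrow> node d t = k"
  using node_le[of t d] less_node[of t d] by linarith

lemma node_bounds:
  assumes "0 \<le> t" "t < 1"
  shows "2 ^ d \<le> node d t" "node d t < 2 ^ Suc d"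
proof -
  have "real (2 ^ d) * 1 \<le> 2 ^ d * (1 + t)" unfolding of_nat_power using assms by (intro mult_mono) auto
  then have "real (2 ^ d) < real (node d t) + 1" using less_node[OF assms(1), of d] by linarith
  then show "2 ^ d \<le> node d t" by linarith
  have "2 ^ d * (1 + t) < 2 ^ d * 2" using assms by (intro mult_strict_left_mono) auto
  moreover have "real (2 ^ Suc d) = 2 ^ d * 2" by simp
  ultimately have "real (node d t) < real (2 ^ Suc d)" using node_le[OF assms(1), of d] by linarith
  then show "node d t < 2 ^ Suc d" by (simp only: of_nat_less_iff)
qed

lemma node_Suc_div: 
  assumes "0 \<le> t"
  shows "node (Suc d) t div 2 = node d t"
proof -
  define k where "k = node (Suc d) t div 2"
  have "node (Suc d) t = 2 * k \<or> node (Suc d) t = 2 * k + 1" unfolding k_def by presburger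
  then have "real (node (Suc d) t) = 2 * real k \<or> real (node (Suc d) t) = 2 * real k + 1" by auto
  then have "node d t = k"
    using node_le[OF assms, of "Suc d"] less_node[OF assms, of "Suc d"] assms by (intro node_eqI) auto
  then show ?thesis by (simp add: k_def)
qed

definition odd_levels :: "nat set \<Rightarrow> real \<Rightarrow> nat set" where
  "odd_levels D t = {d \<in> D. odd (node d t)}"

text \<open>The reflection maps dyadic intervals of level \<open>d > m\<close> to such intervals and
  exchanges left and right children. Irrational \<open>t\<close> avoid the end points, where the
  convention of the floor function breaks the symmetry.\<close>

lemma odd_node_reflect:
  assumes t: "0 < t" "t < (1 / 2) ^ m" "t \<notin> \<rat>" and d: "m < d"
  shows "odd (node d ((1 / 2) ^ m - t)) \<longleftrightarrow> even (node d t)"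
proof -
  define x where "x = 2 ^ d * t"
  have "x \<notin> \<int>"
  proof
    assume "x \<in> \<int>"
    then have "x / 2 ^ d \<in> \<rat>" by (intro Rats_divide Ints_subset_Rats[THEN subsetD]) auto
    then show False using t(3) by (simp add: x_def)
  qed
  then have fl: "\<lfloor>- x\<rfloor> = - \<lfloor>x\<rfloor> - 1"
    by (metis ceiling_altdef ceiling_def floor_of_int Ints_of_int add.inverse_inverse diff_minus_eq_add minus_diff_eq minus_add_distrib uminus_add_conv_diff)
  have pw: "2 ^ d * (1 / 2) ^ m = (2 :: real) ^ (d - m)" using d by (simp add: power_diff power_one_over)
  have 1: "\<lfloor>2 ^ d * (1 + t)\<rfloor> = 2 ^ d + \<lfloor>x\<rfloor>"
  proof -
    have "2 ^ d * (1 + t) = x + of_int (2 ^ d)" by (simp add: x_def algebra_simps)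
    then show ?thesis by (simp only: floor_add_int[symmetric] add.commute)
  qed
  have 2: "\<lfloor>2 ^ d * (1 + ((1 / 2) ^ m - t))\<rfloor> = 2 ^ d + 2 ^ (d - m) - \<lfloor>x\<rfloor> - 1"
  proof -
    have "2 ^ d * (1 + ((1 / 2) ^ m - t)) = - x + of_int (2 ^ d + 2 ^ (d - m))"
      using pw by (simp add: x_def algebra_simps)
    then show ?thesis using fl by (simp only: floor_add_int[symmetric])
  qed
  have "real (node d t) = real_of_int \<lfloor>2 ^ d * (1 + t)\<rfloor>"
    "real (node d ((1 / 2) ^ m - t)) = real_of_int \<lfloor>2 ^ d * (1 + ((1 / 2) ^ m - t))\<rfloor>"
    using t by (auto simp: node_def)
  then have "int (node d t) = 2 ^ d + \<lfloor>x\<rfloor>" "int (node d ((1 / 2) ^ m - t)) = 2 ^ d + 2 ^ (d - m) - \<lfloor>x\<rfloor> - 1"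
    using 1 2 by linarith+
  then have "int (node d t) + int (node d ((1 / 2) ^ m - t)) = 2 * 2 ^ d + 2 ^ (d - m) - 1" by simp
  moreover have "even ((2 :: int) ^ (d - m))" using d by simp
  ultimately have "odd (int (node d t) + int (node d ((1 / 2) ^ m - t)))" by simp
  then show ?thesis by simp
qed

text \<open>At \<open>t\<close> and at its mirror image \<open>b - t\<close> the numbers of odd
  levels add up to \<open>n\<close>, so one of them is at least \<open>n / 2\<close>. Since the
  reflection preserves Lebesgue measure, no law of large numbers is required.\<close>

lemma nn_integral_odd_levels_ge:
  fixes p :: real and n m :: nat
  assumes p: "1 < p"
  defines "D \<equiv> {m<..m + n}" and "b \<equiv> (1 / 2) ^ m"
  shows "ennreal (b * (n / 2) powr p / 2)
    \<le> (\<integral>\<^sup>+ t. ennreal (real (card (odd_levels D t)) powr p) * indicator {0<..<b} t \<partial>lborel)"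
proof -
  define h where "h t = real (card (odd_levels D t))" for t
  have fin: "finite D" by (simp add: D_def)
  have h_sum: "h t = (\<Sum>d\<in>D. if odd (node d t) then 1 else 0)" for t
    unfolding h_def odd_levels_def using fin by (simp add: sum.If_cases Int_def conj_commute)
  have [measurable]: "h \<in> borel_measurable borel" unfolding h_sum[abs_def] by measurable
  let ?f = "\<lambda>t. ennreal (h t powr p) * indicator {0<..<b} t"
  have refl: "(\<integral>\<^sup>+ t. ?f t \<partial>lborel) = (\<integral>\<^sup>+ t. ?f (b - t) \<partial>lborel)"
    using nn_integral_real_affine[of ?f "- 1" b] by simp
  have "AE t in lborel. t \<notin> \<rat>"
    using countable_rat by (intro AE_not_in) (auto intro: countable_imp_null_set_lborel)
  then have ae: "AE t in lborel. ennreal ((n / 2) powr p) * indicator {0<..<b} t \<le> ?f t + ?f (b - t)"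
  proof eventually_elim
    case (elim t)
    show ?case
    proof (cases "t \<in> {0<..<b}")
      case True
      have "h t + h (b - t) = (\<Sum>d\<in>D. (if odd (node d t) then 1 else 0) + (if odd (node d (b - t)) then 1 else 0))"
        by (simp add: h_sum sum.distrib)
      also have "\<dots> = (\<Sum>d\<in>D. 1)"
        by (intro sum.cong) (use odd_node_reflect[of t m] True elim in \<open>auto simp: D_def b_def\<close>)
      also have "\<dots> = n" by (simp add: D_def)
      finally have sum: "h t + h (b - t) = n" .
      have h0: "h t \<ge> 0" "h (b - t) \<ge> 0" by (auto simp: h_def)
      have "(n / 2) powr p \<le> h t powr p + h (b - t) powr p"
      proof (cases "h t \<ge> n / 2")
        case True
        then have "(n / 2) powr p \<le> h t powr p" using p by (intro powr_mono2) auto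
        then show ?thesis by (simp add: add_increasing2)
      next
        case False
        then have "(n / 2) powr p \<le> h (b - t) powr p" using p sum by (intro powr_mono2) auto
        then show ?thesis by (simp add: add_increasing)
      qed
      then have "ennreal ((n / 2) powr p) \<le> ennreal (h t powr p + h (b - t) powr p)"
        by (rule ennreal_leI)
      also have "\<dots> = ennreal (h t powr p) + ennreal (h (b - t) powr p)" by (rule ennreal_plus) auto
      finally have "ennreal ((n / 2) powr p) \<le> ennreal (h t powr p) + ennreal (h (b - t) powr p)" .
      then show ?thesis using True by simp
    qed simp
  qed
  have b: "b > 0" by (simp add: b_def)
  have "ennreal ((n / 2) powr p) * ennreal b = (\<integral>\<^sup>+ t. ennreal ((n / 2) powr p) * indicator {0<..<b} t \<partial>lborel)"
    using b by (subst nn_integral_cmult_indicator) auto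
  also have "\<dots> \<le> (\<integral>\<^sup>+ t. ?f t + ?f (b - t) \<partial>lborel)" by (rule nn_integral_mono_AE[OF ae])
  also have "\<dots> = (\<integral>\<^sup>+ t. ?f t \<partial>lborel) + (\<integral>\<^sup>+ t. ?f (b - t) \<partial>lborel)"
    by (rule nn_integral_add) measurable
  also have "\<dots> = 2 * (\<integral>\<^sup>+ t. ?f t \<partial>lborel)" by (simp add: refl[symmetric] mult_2)
  finally have "ennreal ((n / 2) powr p * b) \<le> 2 * (\<integral>\<^sup>+ t. ?f t \<partial>lborel)" using b by (simp add: ennreal_mult')
  then have "ennreal (1 / 2) * ennreal ((n / 2) powr p * b) \<le> ennreal (1 / 2) * (2 * (\<integral>\<^sup>+ t. ?f t \<partial>lborel))"
    by (rule mult_left_mono) simp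
  also have "\<dots> = (\<integral>\<^sup>+ t. ?f t \<partial>lborel)"
  proof -
    have "ennreal (1 / 2) * ennreal 2 = ennreal (1 / 2 * 2)" by (rule ennreal_mult[symmetric]) auto
    then have "ennreal (1 / 2) * 2 = 1" by simp
    then show ?thesis by (simp add: mult.assoc[symmetric])
  qed
  finally have "ennreal (1 / 2) * ennreal ((n / 2) powr p * b) \<le> (\<integral>\<^sup>+ t. ?f t \<partial>lborel)" .
  moreover have "ennreal (1 / 2) * ennreal ((n / 2) powr p * b) = ennreal (b * (n / 2) powr p / 2)"
    using b by (subst ennreal_mult[symmetric]) (auto simp: mult_ac)
  ultimately show ?thesis by (simp only: h_def)
qed

section \<open>Test functions and the exponential kernel\<close>

lemma exp_decay_le_1: "s \<le> t \<Longrightarrow> exp (- (t - s) * real k) \<le> 1"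
  using mult_nonneg_nonneg[of "t - s" "real k"] by (simp add: algebra_simps)

definition in_coord :: "nat \<Rightarrow> nat set \<Rightarrow> real \<Rightarrow> nat \<Rightarrow> real" where
  "in_coord \<delta> D t k = (if \<exists>d\<in>D. even (node d t) \<and> k = node d t + \<delta> then 1 else 0)"

text \<open>The index \<open>k\<close> that \<open>in_coord\<close> switches on while time runs
  through the interval of the left sibling \<open>node d t - 1\<close>. The form
  \<open>k + 1 = node d t + \<delta>\<close> avoids truncated subtraction.\<close>

definition out_coord :: "nat \<Rightarrow> nat set \<Rightarrow> real \<Rightarrow> nat \<Rightarrow> real" where
  "out_coord \<delta> D t k = (if \<exists>d\<in>D. odd (node d t) \<and> k + 1 = node d t + \<delta> then 1 else 0)"

lemma measurable_in_coord:
  assumes "finite D"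
  shows "(\<lambda>t. in_coord \<delta> D t k) \<in> borel_measurable borel"
proof -
  have "{t. \<exists>d\<in>D. even (node d t) \<and> k = node d t + \<delta>} = (\<Union>d\<in>D. {t \<in> space borel. even (node d t) \<and> k = node d t + \<delta>})"
    by auto
  also have "\<dots> \<in> sets borel" using assms by (intro sets.finite_UN) measurable
  finally show ?thesis unfolding in_coord_def by (intro measurable_If) auto
qed

text \<open>Each exponential kernel carries a fixed amount of mass from the interval of an even node to that
  of its right sibling.\<close>

lemma exp_average_ge_out_coord:
  assumes t: "0 < t" "t < (1 / 2) ^ m" and \<delta>: "\<delta> \<le> 1" and D: "D \<subseteq> {m<..}" "finite D"
  shows "exp (- 4) * out_coord \<delta> D t k
    \<le> real k * (\<integral>s. exp (- (t - s) * k) * in_coord \<delta> D s k \<partial>restrict_space lborel {0<..<t})"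
proof (cases "\<exists>d\<in>D. odd (node d t) \<and> k + 1 = node d t + \<delta>")
  case False
  have "0 \<le> (\<integral>s. exp (- (t - s) * k) * in_coord \<delta> D s k \<partial>restrict_space lborel {0<..<t})"
    by (intro Bochner_Integration.integral_nonneg) (auto simp: in_coord_def)
  moreover have "out_coord \<delta> D t k = 0" using False by (auto simp: out_coord_def)
  ultimately show ?thesis using mult_nonneg_nonneg[OF of_nat_0_le_iff] by simp
next
  case True
  then obtain d where d: "d \<in> D" "odd (node d t)" "k + 1 = node d t + \<delta>" by blast
  have "(1 / 2) ^ m \<le> (1 :: real)" by (rule power_le_one) auto
  then have t1: "t < 1" using t by linarith
  \<comment> \<open>From \<open>a\<close> to \<open>e\<close> is the interval of the left sibling of
    \<open>node d t\<close>.\<close>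
  define a where "a = (real (node d t) - 1) / 2 ^ d - 1"
  define e where "e = real (node d t) / 2 ^ d - 1"
  have md: "m < d" using D(1) d(1) by auto
  \<comment> \<open>Since \<open>d > 0\<close> the first node of the level is even, so the odd node
    has its left sibling on the same level and the interval does not start before 0.\<close>
  have "node d t \<noteq> 2 ^ d" using d(2) md by auto
  then have ge: "2 ^ d + 1 \<le> node d t" using node_bounds(1)[of t d] t t1 by simp
  then have "real (2 ^ d + 1) \<le> real (node d t)" by (simp only: of_nat_le_iff)
  then have a0: "0 \<le> a" by (simp add: a_def field_simps)
  have et: "e \<le> t" using node_le[of t d] t by (simp add: e_def field_simps)
  have ae: "e - a = (1 / 2) ^ d" by (simp add: a_def e_def diff_divide_distrib power_one_over)
  have "1 + t < (real (node d t) + 1) / 2 ^ d"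
    using less_node[of t d] t by (simp add: pos_less_divide_eq mult.commute)
  moreover have "(real (node d t) + 1) / 2 ^ d - (real (node d t) - 1) / 2 ^ d = 2 / 2 ^ d"
    by (simp flip: diff_divide_distrib)
  ultimately have ta: "t - a \<le> 2 / 2 ^ d" unfolding a_def by linarith
  have k1: "real k \<ge> 2 ^ d"
  proof -
    have "2 ^ d \<le> k" using ge d(3) by linarith
    then show ?thesis by (metis of_nat_le_iff of_nat_numeral of_nat_power)
  qed
  have k2: "real k \<le> 2 * 2 ^ d"
  proof -
    have "k \<le> 2 * 2 ^ d" using node_bounds(2)[of t d] t t1 d(3) \<delta> by simp
    then have "real k \<le> real (2 * 2 ^ d)" by (simp only: of_nat_le_iff)
    then show ?thesis by simp
  qed
  have in1: "in_coord \<delta> D s k = 1" if s: "a < s" "s < e" for s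
  proof -
    have "node d s = node d t - 1"
    proof (rule node_eqI)
      have r: "real (node d t - 1) = real (node d t) - 1" using ge by simp
      show "0 \<le> s" using s a0 by simp
      show "real (node d t - 1) \<le> 2 ^ d * (1 + s)" "2 ^ d * (1 + s) < real (node d t - 1) + 1"
        unfolding r using s by (simp_all add: a_def e_def field_simps)
    qed
    then have "even (node d s) \<and> k = node d s + \<delta>" using d ge by auto
    then show ?thesis using d(1) by (auto simp: in_coord_def)
  qed
  let ?M = "restrict_space lborel {0<..<t}"
  let ?g = "\<lambda>s. exp (- (t - s) * k) * in_coord \<delta> D s k"
  have meas: "?g \<in> borel_measurable ?M"
    using measurable_in_coord[OF D(2), of \<delta> k] by (intro measurable_restrict_space1) measurable
  have int_g: "integrable ?M ?g"
  proof (rule integrableI_bounded_set[where A = "space ?M" and B = 1])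
    show "space ?M \<in> sets ?M" by (rule sets.top)
    show "emeasure ?M (space ?M) < \<infinity>" using t by (simp add: space_restrict_space emeasure_restrict_space)
    show "AE s in ?M. s \<in> space ?M \<longrightarrow> norm (?g s) \<le> 1"
    proof (intro AE_I2 impI)
      fix s assume "s \<in> space ?M"
      then have "exp (- (t - s) * k) \<le> 1" by (intro exp_decay_le_1) (simp add: space_restrict_space)
      then show "norm (?g s) \<le> 1" by (simp add: in_coord_def)
    qed
  qed (use meas in auto)
  have sets: "{a<..<e} \<in> sets ?M" using a0 et by (auto simp: sets_restrict_space_iff)
  have "0 < (1 / 2 :: real) ^ d" by simp
  then have "a \<le> e" using ae by linarith
  then have "measure ?M {a<..<e} = e - a"
    using a0 et by (subst measure_restrict_space) auto
  then have mm: "measure ?M {a<..<e} = (1 / 2) ^ d" using ae by simp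
  have em: "emeasure ?M {a<..<e} < \<infinity>"
    using a0 et \<open>a \<le> e\<close> by (subst emeasure_restrict_space) auto
  have "exp (- 4) * (1 / 2 :: real) ^ d = (\<integral>s. exp (- 4) * indicator {a<..<e} s \<partial>?M)"
    by (simp only: integral_mult_right_zero Bochner_Integration.integral_indicator sets.Int_space_eq2[OF sets] mm)
  also have "\<dots> \<le> (\<integral>s. ?g s \<partial>?M)"
  proof (rule integral_mono[OF _ int_g])
    show "integrable ?M (\<lambda>s. exp (- 4 :: real) * indicator {a<..<e} s)"
      using sets em by (intro integrable_mult_right integrable_real_indicator)
    fix s assume "s \<in> space ?M"
    show "exp (- 4) * indicator {a<..<e} s \<le> ?g s"
    proof (cases "s \<in> {a<..<e}")
      case True
      \<comment> \<open>Both siblings together span time \<open>2 / 2 ^ d\<close>, and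
        \<open>k\<close> is at most \<open>2 * 2 ^ d\<close>; their product is the 4 in
        \<open>exp (- 4)\<close>.\<close>
      have "(t - s) * k \<le> 2 / 2 ^ d * (2 * 2 ^ d)"
        using True ta k2 et by (intro mult_mono) auto
      then have "- 4 \<le> - (t - s) * k" by (simp add: left_diff_distrib)
      then have "exp (- 4) \<le> exp (- (t - s) * k)" by (simp only: exp_le_cancel_iff)
      then show ?thesis using True in1[of s] by simp
    qed (simp add: in_coord_def)
  qed
  finally have A: "real k * (exp (- 4) * (1 / 2) ^ d) \<le> real k * (\<integral>s. ?g s \<partial>?M)" by (rule mult_left_mono) simp
  \<comment> \<open>The weight \<open>k \<ge> 2 ^ d\<close> compensates the length
    \<open>(1 / 2) ^ d\<close> of the interval.\<close>
  have B: "exp (- 4) \<le> real k * (exp (- 4) * (1 / 2) ^ d)"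
    using k1 by (simp add: power_one_over field_simps)
  have "out_coord \<delta> D t k = 1" using True by (simp add: out_coord_def)
  then show ?thesis using order_trans[OF B A] by simp
qed

section \<open>The estimate that contradicts maximal regularity\<close>

text \<open>The test functions for the space have \<open>\<delta> = 0\<close>, those for the dual \<open>\<delta> = 1\<close>.\<close>

locale max_reg_test = diag_space +
  fixes \<delta> :: nat and u l :: "nat \<Rightarrow> real"
  assumes \<delta>: "\<delta> \<le> 1"
    and in_bound: "\<And>m n t v. 0 \<le> t \<Longrightarrow> t < 1 \<Longrightarrow> v \<in> carrier V \<Longrightarrow>
      J v = (\<lambda>k. of_real (in_coord \<delta> {m<..m + n} t k)) \<Longrightarrow> vnorm V v \<le> u n"
    and out_bound: "\<And>m n t v. 0 \<le> t \<Longrightarrow> t < 1 \<Longrightarrow> v \<in> carrier V \<Longrightarrow>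
      J v = (\<lambda>k. of_real (out_coord \<delta> {m<..m + n} t k)) \<Longrightarrow>
      real (card (odd_levels {m<..m + n} t)) \<le> l n * vnorm V v"
    and ul: "\<And>n. 1 \<le> n \<Longrightarrow> 0 < u n" "\<And>n. 1 \<le> n \<Longrightarrow> 0 < l n" "\<And>n. 1 \<le> n \<Longrightarrow> u n * l n \<le> real n powr (3 / 4)"
begin

text \<open>The input has norm at most \<open>u n\<close> on an interval of length \<open>b\<close>.
  The output at \<open>t\<close> has norm at least \<open>exp (- 4) / l n\<close> times the number
  of odd levels, and the p-th power of that number has integral at least
  \<open>b * (n / 2) powr p / 2\<close>. The length \<open>b\<close> cancels, so the position
  \<open>m\<close> of the window leaves no trace.\<close>

lemma max_reg_estimate:
  assumes p: "1 < p" and I: "I \<in> sets borel" "{0<..<(1 / 2) ^ m} \<subseteq> I" and n: "1 \<le> n" and C: "0 \<le> C"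
    and reg: "\<And>f. f \<in> Lp V p I \<Longrightarrow> (\<lambda>t. op_apply diag_op (mild_solution V (\<lambda>t. diag_semigroup (of_real t)) f t)) \<in> Lp V p I \<and>
      Lp_norm V p I (\<lambda>t. op_apply diag_op (mild_solution V (\<lambda>t. diag_semigroup (of_real t)) f t)) \<le> C * Lp_norm V p I f"
  shows "real n \<le> 4 * exp 4 * C * real n powr (3 / 4)"
proof -
  define D where "D = {m<..m + n}"
  define b where "b = (1 / 2 :: real) ^ m"
  \<comment> \<open>An index above all that occur, including the shift by \<delta>; it makes every
    vector finitely supported.\<close>
  define K where "K = (2 :: nat) ^ (m + n + 1) + 1"
  let ?M = "restrict_space lborel I"
  have D: "D \<subseteq> {m<..}" "finite D" by (auto simp: D_def)
  have b: "0 < b" "b \<le> 1" by (auto simp: b_def power_le_one)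
  define g where "g t k = (if t \<in> {0<..<b} then in_coord \<delta> D t k else 0)" for t k
  define f where "f t = vec (\<lambda>k. complex_of_real (g t k))" for t
  have node_range: "1 \<le> node d t" "node d t + 1 < K" if "t \<in> {0<..<b}" "d \<in> D" for d t
  proof -
    have t: "0 \<le> t" "t < 1" using that b by auto
    show "1 \<le> node d t" using node_bounds(1)[OF t, of d] by (metis one_le_numeral one_le_power order_trans)
    have "(2 :: nat) ^ Suc d \<le> 2 ^ (m + n + 1)" using that(2) by (intro power_increasing) (auto simp: D_def)
    then show "node d t + 1 < K" using node_bounds(2)[OF t, of d] unfolding K_def by linarith
  qed
  have node0: "0 < node d t" "even (node d t) \<Longrightarrow> node d t + \<delta> < K" "odd (node d t) \<Longrightarrow> 1 < node d t" "node d t + \<delta> < K + 1"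
    if "t \<in> {0<..<b}" "d \<in> D" for d t
  proof -
    show "0 < node d t" "even (node d t) \<Longrightarrow> node d t + \<delta> < K" "node d t + \<delta> < K + 1"
      using node_range[OF that] \<delta> by auto
    assume "odd (node d t)"
    have "2 ^ 1 \<le> (2 :: nat) ^ d" using that(2) by (intro power_increasing) (auto simp: D_def)
    moreover have "0 \<le> t" "t < 1" using that b by auto
    ultimately show "1 < node d t" using node_bounds(1)[of t d] by simp
  qed
  have f: "f t \<in> carrier V" "J (f t) = (\<lambda>k. complex_of_real (g t k))" for t
  proof -
    have "g t k = 0" if "k = 0 \<or> K \<le> k" for k
    proof (rule ccontr)
      assume "g t k \<noteq> 0"
      then obtain d where "t \<in> {0<..<b}" "d \<in> D" "even (node d t)" "k = node d t + \<delta>"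
        by (auto simp: g_def in_coord_def split: if_splits)
      then show False using node0(1,2)[of t d] that by auto
    qed
    then show "f t \<in> carrier V" "J (f t) = (\<lambda>k. complex_of_real (g t k))"
      unfolding f_def by (auto intro!: vec_finite[of _ K])
  qed
  have g_meas [measurable]: "(\<lambda>t. g t k) \<in> borel_measurable borel" for k
    unfolding g_def using measurable_in_coord[OF D(2), of \<delta> k] by measurable
  have gK: "g t k = 0" if "K \<le> k" for t k
  proof (rule ccontr)
    assume "g t k \<noteq> 0"
    then obtain d where "t \<in> {0<..<b}" "d \<in> D" "even (node d t)" "k = node d t + \<delta>"
      by (auto simp: g_def in_coord_def split: if_splits)
    then show False using node0(2)[of t d] that by auto
  qed
  have g01: "0 \<le> g t k" "g t k \<le> 1" for t k by (auto simp: g_def in_coord_def)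
  have f_zero: "f t = \<zero>\<^bsub>V\<^esub>" if "t \<notin> {0<..<b}" for t
    using f that by (intro J_inj) (auto simp: g_def J_zero)
  have f_le: "vnorm V (f t) \<le> u n" if "t \<in> {0<..<b}" for t
    using f[of t] that b by (intro in_bound[of t]) (auto simp: g_def D_def)
  have f_nn: "(\<integral>\<^sup>+ t. ennreal (vnorm V (f t) powr p) \<partial>?M) \<le> ennreal (u n powr p * b)"
  proof -
    have "(\<integral>\<^sup>+ t. ennreal (vnorm V (f t) powr p) \<partial>?M) \<le> (\<integral>\<^sup>+ t. ennreal (u n powr p) * indicator {0<..<b} t \<partial>?M)"
    proof (intro nn_integral_mono)
      fix t
      show "ennreal (vnorm V (f t) powr p) \<le> ennreal (u n powr p) * indicator {0<..<b} t"
      proof (cases "t \<in> {0<..<b}")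
        case True
        then have "vnorm V (f t) powr p \<le> u n powr p"
          using f_le[OF True] vnorm_nonneg[OF f(1)] p by (intro powr_mono2) auto
        then show ?thesis using True by (simp add: ennreal_leI)
      next
        case False
        then show ?thesis using p by (simp add: f_zero)
      qed
    qed
    also have "\<dots> = ennreal (u n powr p) * emeasure ?M {0<..<b}"
      using I b by (intro nn_integral_cmult_indicator) (auto simp: sets_restrict_space_iff b_def)
    also have "emeasure ?M {0<..<b} = ennreal b"
      using I b by (subst emeasure_restrict_space) (auto simp: b_def)
    finally show ?thesis using b by (simp add: ennreal_mult')
  qed
  have f_Lp: "f \<in> Lp V p I"
    unfolding Lp_def mem_Collect_eq
  proof
    show "strongly_measurable V ?M f"
    proof (rule strongly_measurable_vec[of ?M f K])
      show "(\<lambda>t. J (f t) k) \<in> borel_measurable ?M" for k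
        unfolding f using g_meas[of k] by (intro measurable_restrict_space1) measurable
      fix s assume s: "\<And>i. simple_fun V ?M (s i)" "\<And>t. t \<in> space ?M \<Longrightarrow> (\<lambda>i. vnorm V (s i t \<ominus>\<^bsub>V\<^esub> f t)) \<longlonglongrightarrow> 0"
      show "strongly_measurable V ?M f"
        unfolding strongly_measurable_def using f(1) s by (intro conjI exI[of _ s] allI AE_I2) auto
    qed (use f gK in auto)
    show "(\<integral>\<^sup>+ t. ennreal (vnorm V (f t) powr p) \<partial>?M) < \<infinity>"
      using f_nn by (rule order_le_less_trans) simp
  qed
  define U where "U t = mild_solution V (\<lambda>t. diag_semigroup (of_real t)) f t" for t
  define h where "h t = real (card (odd_levels D t))" for t
  have U_le: "h t \<le> exp 4 * l n * vnorm V (op_apply diag_op (U t))" and W_in: "op_apply diag_op (U t) \<in> carrier V"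
    if t: "t \<in> {0<..<b}" for t
  proof -
    let ?N = "restrict_space lborel {0<..<t}"
    let ?F = "\<lambda>s. diag_semigroup (of_real (t - s)) (f s)"
    have F: "?F s \<in> carrier V" "J (?F s) = (\<lambda>k. complex_of_real (exp (- (t - s) * k) * g s k))"
      if "s \<in> space ?N" for s
    proof -
      have "0 \<le> Re (of_real (t - s))" using that by (simp add: space_restrict_space)
      then show "?F s \<in> carrier V" "J (?F s) = (\<lambda>k. complex_of_real (exp (- (t - s) * k) * g s k))"
        using f[of s] by (auto simp: diag_semigroup_in J_diag_semigroup fun_eq_iff simp flip: exp_of_real)
    qed
    have int_r: "integrable ?N (\<lambda>s. exp (- (t - s) * k) * g s k)" for k
    proof (rule integrableI_bounded_set[where A = "space ?N" and B = 1])
      show "space ?N \<in> sets ?N" by (rule sets.top)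
      show "emeasure ?N (space ?N) < \<infinity>" using t by (simp add: space_restrict_space emeasure_restrict_space)
      show "(\<lambda>s. exp (- (t - s) * k) * g s k) \<in> borel_measurable ?N"
        using g_meas[of k] by (intro measurable_restrict_space1) measurable
      show "AE s in ?N. s \<in> space ?N \<longrightarrow> norm (exp (- (t - s) * k) * g s k) \<le> 1"
      proof (intro AE_I2 impI)
        fix s assume "s \<in> space ?N"
        then have "exp (- (t - s) * k) \<le> 1" by (intro exp_decay_le_1) (simp add: space_restrict_space)
        then have "exp (- (t - s) * k) * g s k \<le> 1 * 1" using g01 by (intro mult_mono) auto
        then show "norm (exp (- (t - s) * k) * g s k) \<le> 1" using g01[of s k] by simp
      qed
    qed auto
    have int_F: "integrable ?N (\<lambda>s. J (?F s) k)" "(\<integral>s. J (?F s) k \<partial>?N) = of_real (\<integral>s. exp (- (t - s) * k) * g s k \<partial>?N)" for k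
    proof -
      have "integrable ?N (\<lambda>s. J (?F s) k) \<longleftrightarrow> integrable ?N (\<lambda>s. complex_of_real (exp (- (t - s) * k) * g s k))"
        by (rule Bochner_Integration.integrable_cong) (simp_all only: F)
      then show "integrable ?N (\<lambda>s. J (?F s) k)" using int_r[of k] by (simp only: integrable_of_real)
      have "(\<integral>s. J (?F s) k \<partial>?N) = (\<integral>s. complex_of_real (exp (- (t - s) * k) * g s k) \<partial>?N)"
        by (rule Bochner_Integration.integral_cong) (simp_all only: F)
      then show "(\<integral>s. J (?F s) k \<partial>?N) = of_real (\<integral>s. exp (- (t - s) * k) * g s k \<partial>?N)"
        by (simp only: integral_complex_of_real)
    qed
    have U: "U t \<in> carrier V" "J (U t) = (\<lambda>k. of_real (\<integral>s. exp (- (t - s) * k) * g s k \<partial>?N))"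
    proof -
      have fin: "emeasure ?N (space ?N) \<noteq> \<infinity>" using t by (simp add: space_restrict_space emeasure_restrict_space)
      have *: "J (?F s) k = 0" if "s \<in> space ?N" "K \<le> k" for s k unfolding F(2)[OF that(1)] using gK[OF that(2)] by simp
      have "bochner_integral_in V ?N ?F \<in> carrier V" "J (bochner_integral_in V ?N ?F) = (\<lambda>k. \<integral>s. J (?F s) k \<partial>?N)"
        by (rule bochner_integral_vec[of ?N ?F K]; use fin F(1) * int_F(1) in blast)+
      then show "U t \<in> carrier V" "J (U t) = (\<lambda>k. of_real (\<integral>s. exp (- (t - s) * k) * g s k \<partial>?N))"
        unfolding U_def mild_solution_def int_F(2) by auto
    qed
    have UK: "J (U t) k = 0" if "K \<le> k" for k
      unfolding U(2) using gK[OF that] by simp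
    define w where "w k = of_nat k * J (U t) k" for k
    have w: "vec w \<in> carrier V" "J (vec w) = w" by (auto intro!: vec_finite[of _ K] simp: w_def UK)
    then have "(U t, vec w) \<in> diag_op" using U(1) by (simp add: diag_op_def w_def)
    then have W: "op_apply diag_op (U t) = vec w" by (rule op_apply_diag_op)
    then show "op_apply diag_op (U t) \<in> carrier V" using w by simp
    define v where "v = vec (\<lambda>k. complex_of_real (out_coord \<delta> D t k))"
    have v: "v \<in> carrier V" "J v = (\<lambda>k. complex_of_real (out_coord \<delta> D t k))"
    proof -
      have "out_coord \<delta> D t k = 0" if "k = 0 \<or> K \<le> k" for k
      proof (rule ccontr)
        assume "out_coord \<delta> D t k \<noteq> 0"
        then obtain d where "d \<in> D" "odd (node d t)" "k + 1 = node d t + \<delta>"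
          by (auto simp: out_coord_def split: if_splits)
        then show False using node0(3,4)[OF t, of d] that by auto
      qed
      then show "v \<in> carrier V" "J v = (\<lambda>k. complex_of_real (out_coord \<delta> D t k))"
        unfolding v_def by (auto intro!: vec_finite[of _ K])
    qed
    have "cmod (J (of_real (exp (- 4)) \<odot>\<^bsub>V\<^esub> v) k) \<le> cmod (J (vec w) k)" for k
    proof -
      have "(\<integral>s. exp (- (t - s) * k) * g s k \<partial>?N) = (\<integral>s. exp (- (t - s) * k) * in_coord \<delta> D s k \<partial>?N)"
        using t by (intro Bochner_Integration.integral_cong) (auto simp: g_def space_restrict_space)
      then have *: "exp (- 4) * out_coord \<delta> D t k \<le> real k * (\<integral>s. exp (- (t - s) * k) * g s k \<partial>?N)"
        using exp_average_ge_out_coord[of t m \<delta> D k] t \<delta> D by (simp add: b_def)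
      have o: "0 \<le> out_coord \<delta> D t k" by (simp add: out_coord_def)
      have "cmod (J (of_real (exp (- 4)) \<odot>\<^bsub>V\<^esub> v) k) = exp (- 4) * out_coord \<delta> D t k"
        using v o by (simp add: J_smult norm_mult)
      also have "\<dots> \<le> \<bar>real k * (\<integral>s. exp (- (t - s) * k) * g s k \<partial>?N)\<bar>" using * by linarith
      also have "\<dots> = cmod (J (vec w) k)" unfolding w(2) w_def U(2) by (simp add: norm_mult abs_mult)
      finally show ?thesis .
    qed
    then have "vnorm V (of_real (exp (- 4)) \<odot>\<^bsub>V\<^esub> v) \<le> vnorm V (vec w)"
      using v w by (intro vnorm_mono) auto
    then have "exp (- 4) * vnorm V v \<le> vnorm V (vec w)" using v by (simp add: vnorm_smult)
    then have "vnorm V v \<le> exp 4 * vnorm V (vec w)" by (simp add: exp_minus field_simps)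
    then have "l n * vnorm V v \<le> l n * (exp 4 * vnorm V (vec w))" using ul(2)[OF n] by (intro mult_left_mono) auto
    moreover have "h t \<le> l n * vnorm V v"
      unfolding h_def D_def using t b v by (intro out_bound) (auto simp: D_def)
    ultimately show "h t \<le> exp 4 * l n * vnorm V (op_apply diag_op (U t))" unfolding W by (simp add: mult_ac)
  qed
  let ?A = "\<lambda>t. op_apply diag_op (U t)"
  have A: "?A \<in> Lp V p I" "Lp_norm V p I ?A \<le> C * Lp_norm V p I f"
    using reg[OF f_Lp] unfolding U_def by auto
  define X where "X = enn2real (\<integral>\<^sup>+ t. ennreal (vnorm V (?A t) powr p) \<partial>?M)"
  define Y where "Y = enn2real (\<integral>\<^sup>+ t. ennreal (vnorm V (f t) powr p) \<partial>?M)"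
  have "X powr (1 / p) \<le> C * Y powr (1 / p)" using A(2) by (simp add: Lp_norm_def X_def Y_def)
  then have "(X powr (1 / p)) powr p \<le> (C * Y powr (1 / p)) powr p" using p by (intro powr_mono2) auto
  then have XY: "X \<le> C powr p * Y" using p C by (simp add: powr_powr powr_mult X_def Y_def)
  have Y: "Y \<le> u n powr p * b"
    unfolding Y_def using f_nn b by (intro enn2real_leI) auto
  have Xfin: "(\<integral>\<^sup>+ t. ennreal (vnorm V (?A t) powr p) \<partial>?M) = ennreal X"
    using A(1) unfolding X_def Lp_def by simp
  define c where "c = (1 / (exp 4 * l n)) powr p"
  have c: "c > 0" using ul(2)[OF n] by (simp add: c_def)
  have "ennreal c * ennreal (b * (n / 2) powr p / 2) \<le> ennreal c * (\<integral>\<^sup>+ t. ennreal (h t powr p) * indicator {0<..<b} t \<partial>lborel)"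
    unfolding h_def D_def b_def by (intro mult_left_mono nn_integral_odd_levels_ge p) simp
  also have "\<dots> = (\<integral>\<^sup>+ t. ennreal c * (ennreal (h t powr p) * indicator {0<..<b} t) \<partial>lborel)"
  proof (rule nn_integral_cmult[symmetric])
    have "h t = (\<Sum>d\<in>D. if odd (node d t) then 1 else 0)" for t
      unfolding h_def odd_levels_def using D(2) by (simp add: sum.If_cases Int_def conj_commute)
    then have h_eq: "h = (\<lambda>t. \<Sum>d\<in>D. if odd (node d t) then 1 else 0)" by (rule ext)
    have [measurable]: "h \<in> borel_measurable borel" unfolding h_eq by measurable
    show "(\<lambda>t. ennreal (h t powr p) * indicator {0<..<b} t) \<in> borel_measurable lborel" by measurable
  qed
  also have "\<dots> \<le> (\<integral>\<^sup>+ t. ennreal (vnorm V (?A t) powr p) * indicator I t \<partial>lborel)"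
  proof (rule nn_integral_mono)
    fix t
    show "ennreal c * (ennreal (h t powr p) * indicator {0<..<b} t) \<le> ennreal (vnorm V (?A t) powr p) * indicator I t"
    proof (cases "t \<in> {0<..<b}")
      case True
      have "1 / (exp 4 * l n) * h t \<le> vnorm V (?A t)"
        using U_le[OF True] ul(2)[OF n] by (simp add: field_simps)
      then have "(1 / (exp 4 * l n) * h t) powr p \<le> vnorm V (?A t) powr p"
        using p ul(2)[OF n] by (intro powr_mono2) (auto simp: h_def)
      then have "c * h t powr p \<le> vnorm V (?A t) powr p"
        using ul(2)[OF n] by (simp add: c_def powr_mult h_def powr_divide)
      then have "ennreal c * ennreal (h t powr p) \<le> ennreal (vnorm V (?A t) powr p)"
        using c by (subst ennreal_mult'[symmetric]) (auto intro: ennreal_leI)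
      then show ?thesis using True I(2) by (auto simp: b_def)
    qed simp
  qed
  also have "\<dots> = (\<integral>\<^sup>+ t. ennreal (vnorm V (?A t) powr p) \<partial>?M)"
    using I(1) by (subst nn_integral_restrict_space) auto
  also have "\<dots> = ennreal X" by (rule Xfin)
  finally have "ennreal (c * (b * (n / 2) powr p / 2)) \<le> ennreal X"
    using c b by (subst ennreal_mult) auto
  then have "c * (b * (n / 2) powr p / 2) \<le> X" by (simp add: X_def)
  also have "\<dots> \<le> C powr p * (u n powr p * b)"
    using XY Y mult_left_mono[OF Y, of "C powr p"] by simp
  finally have "c * (n / 2) powr p \<le> 2 * (C powr p * u n powr p)" using b by (simp add: field_simps)
  \<comment> \<open>The factor 2 from the reflection is enlarged so that p-th roots can be taken.
    Together with the 2 of \<open>n / 2\<close> it accounts for the 4 in the conclusion.\<close>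
  also have "\<dots> \<le> 2 powr p * (C powr p * u n powr p)"
    using p powr_mono[of 1 p 2] by (intro mult_right_mono) auto
  also have "\<dots> = (2 * C * u n) powr p" using C ul(1)[OF n] by (simp add: powr_mult)
  finally have "(1 / (exp 4 * l n) * (n / 2)) powr p \<le> (2 * C * u n) powr p"
    using ul(2)[OF n] unfolding c_def by (subst powr_mult) auto
  then have "1 / (exp 4 * l n) * (n / 2) \<le> 2 * C * u n"
    using powr_less_mono2[of p "2 * C * u n" "1 / (exp 4 * l n) * (n / 2)"] p C ul(1)[OF n]
    by (force simp: not_le)
  then have "real n \<le> 4 * exp 4 * C * (u n * l n)" using ul(2)[OF n] by (simp add: field_simps)
  also have "\<dots> \<le> 4 * exp 4 * C * real n powr (3 / 4)"
    using ul(3)[OF n] C by (intro mult_left_mono) auto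
  finally show ?thesis .
qed

theorem not_maximal_regularity:
  assumes p: "1 < p" and I: "I \<in> sets borel" "{0<..<T} \<subseteq> I" "0 < T"
  shows "\<not> maximal_regularity V diag_op p I"
proof
  assume "maximal_regularity V diag_op p I"
  then obtain C where C: "\<And>f. f \<in> Lp V p I \<Longrightarrow>
      (\<lambda>t. op_apply diag_op (mild_solution V (\<lambda>t. diag_semigroup (of_real t)) f t)) \<in> Lp V p I \<and>
      Lp_norm V p I (\<lambda>t. op_apply diag_op (mild_solution V (\<lambda>t. diag_semigroup (of_real t)) f t)) \<le> C * Lp_norm V p I f"
    unfolding maximal_regularity_def using neg_generates_analytic_diag_op by blast
  have "C * Lp_norm V p I f \<le> \<bar>C\<bar> * Lp_norm V p I f" for f
    by (intro mult_right_mono) (auto simp: Lp_norm_def)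
  then have C': "f \<in> Lp V p I \<Longrightarrow>
      (\<lambda>t. op_apply diag_op (mild_solution V (\<lambda>t. diag_semigroup (of_real t)) f t)) \<in> Lp V p I \<and>
      Lp_norm V p I (\<lambda>t. op_apply diag_op (mild_solution V (\<lambda>t. diag_semigroup (of_real t)) f t)) \<le> \<bar>C\<bar> * Lp_norm V p I f" for f
    using C[of f] by (metis order_trans)
  obtain m where m: "(1 / 2) ^ m < T" using real_arch_pow_inv[OF I(3), of "1 / 2"] by auto
  then have sub: "{0<..<(1 / 2) ^ m} \<subseteq> I" using I(2) by auto
  have "real n \<le> 4 * exp 4 * \<bar>C\<bar> * real n powr (3 / 4)" if "1 \<le> n" for n
    by (rule max_reg_estimate[OF p I(1) sub that abs_ge_zero C'])
  moreover have "\<forall>\<^sub>F n in sequentially. 4 * exp 4 * \<bar>C\<bar> * real n powr (3 / 4) < real n" by real_asymp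
  then have "\<forall>\<^sub>F n in sequentially. 1 \<le> n \<and> 4 * exp 4 * \<bar>C\<bar> * real n powr (3 / 4) < real n"
    using eventually_ge_at_top[of 1] by eventually_elim auto
  then obtain n where "1 \<le> n" "4 * exp 4 * \<bar>C\<bar> * real n powr (3 / 4) < real n"
    by (auto dest: eventually_happens)
  ultimately show False by fastforce
qed

end

section \<open>Steinhaus sums\<close>

lemma measurable_cis [measurable]: "cis \<in> borel_measurable borel"
  by (intro borel_measurable_continuous_onI continuous_intros)

lemma measurable_cis_uniform: "cis \<in> borel_measurable (uniform_measure lborel S)"
  using measurable_cis by (simp add: measurable_def)

lemma prob_space_steinhaus: "prob_space steinhaus"
  unfolding steinhaus_def
  by (intro prob_space.prob_space_distr prob_space_uniform_measure measurable_cis_uniform) auto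

lemma sets_steinhaus [simp, measurable_cong]: "sets steinhaus = sets borel"
  and space_steinhaus [simp]: "space steinhaus = UNIV"
  by (simp_all add: steinhaus_def)

lemma AE_steinhaus_norm: "AE z in steinhaus. cmod z = 1"
  unfolding steinhaus_def by (subst AE_distr_iff[OF measurable_cis_uniform]) auto

text \<open>The half-open interval is an exact fundamental domain for the period of
  \<open>cis\<close>, so it can be cut and reassembled without overlaps.\<close>

lemma emeasure_steinhaus:
  assumes "A \<in> sets borel"
  shows "emeasure steinhaus A = emeasure lborel ({0<..2 * pi} \<inter> cis -` A) / emeasure lborel {0..2 * pi}"
proof -
  have B: "cis -` A \<in> sets borel" using measurable_sets[OF measurable_cis assms] by simp
  have "emeasure steinhaus A = emeasure lborel ({0..2 * pi} \<inter> cis -` A) / emeasure lborel {0..2 * pi}"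
    unfolding steinhaus_def using assms B by (subst emeasure_distr[OF measurable_cis_uniform]) auto
  also have "emeasure lborel ({0..2 * pi} \<inter> cis -` A) = emeasure lborel ({0<..2 * pi} \<inter> cis -` A)"
    by (rule emeasure_eq_AE) (use B AE_lborel_singleton[of 0] in \<open>auto elim!: eventually_mono simp: less_le\<close>)
  finally show ?thesis .
qed

text \<open>A rotation by \<open>c\<close> becomes a translation of the fundamental domain; the part
  beyond 2 pi is moved back by one period.\<close>

lemma emeasure_steinhaus_rotate:
  assumes A: "A \<in> sets borel" and c: "0 \<le> c" "c \<le> 2 * pi"
  shows "emeasure steinhaus ((\<lambda>z. cis c * z) -` A) = emeasure steinhaus A"
proof -
  define B where "B = cis -` A"
  have B: "B \<in> sets borel" unfolding B_def using measurable_sets[OF measurable_cis A] by simp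
  have shift: "emeasure lborel {x. x + y \<in> S} = emeasure lborel S" if "S \<in> sets borel" for S and y :: real
  proof -
    have "emeasure lborel S = emeasure (distr lborel borel ((+) y)) S" by (simp add: lborel_distr_plus)
    also have "\<dots> = emeasure lborel ((+) y -` S \<inter> space lborel)" using that by (intro emeasure_distr) auto
    also have "(+) y -` S \<inter> space lborel = {x. x + y \<in> S}" by (auto simp: add.commute)
    finally show ?thesis ..
  qed
  have per: "x + 2 * pi \<in> B \<longleftrightarrow> x \<in> B" for x
    by (simp add: B_def cis.ctr)
  have A': "(\<lambda>z. cis c * z) -` A \<in> sets borel"
    using measurable_sets[of "\<lambda>z. cis c * z" borel borel A] A by simp
  have "{0<..2 * pi} \<inter> cis -` ((\<lambda>z. cis c * z) -` A) = {x. x + c \<in> {c<..2 * pi + c} \<inter> B}"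
    by (auto simp: B_def cis_mult add.commute)
  then have "emeasure lborel ({0<..2 * pi} \<inter> cis -` ((\<lambda>z. cis c * z) -` A)) = emeasure lborel ({c<..2 * pi + c} \<inter> B)"
    using shift[of "{c<..2 * pi + c} \<inter> B" c] B by simp
  also have "{c<..2 * pi + c} \<inter> B = ({c<..2 * pi} \<inter> B) \<union> ({2 * pi<..2 * pi + c} \<inter> B)"
    using c by auto
  also have "emeasure lborel \<dots> = emeasure lborel ({c<..2 * pi} \<inter> B) + emeasure lborel ({2 * pi<..2 * pi + c} \<inter> B)"
    using B by (intro plus_emeasure[symmetric]) auto
  also have "emeasure lborel ({2 * pi<..2 * pi + c} \<inter> B) = emeasure lborel ({0<..c} \<inter> B)"
  proof -
    have "{x. x + 2 * pi \<in> {2 * pi<..2 * pi + c} \<inter> B} = {0<..c} \<inter> B" using per by auto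
    then show ?thesis using shift[of "{2 * pi<..2 * pi + c} \<inter> B" "2 * pi"] B by simp
  qed
  also have "emeasure lborel ({c<..2 * pi} \<inter> B) + emeasure lborel ({0<..c} \<inter> B)
     = emeasure lborel (({c<..2 * pi} \<inter> B) \<union> ({0<..c} \<inter> B))"
    using B by (intro plus_emeasure) auto
  also have "({c<..2 * pi} \<inter> B) \<union> ({0<..c} \<inter> B) = {0<..2 * pi} \<inter> B" using c by auto
  finally show ?thesis using A A' by (simp add: emeasure_steinhaus B_def)
qed

section \<open>The product of Steinhaus measures\<close>

definition steinhaus_seq :: "(nat \<Rightarrow> complex) measure" where
  "steinhaus_seq = (\<Pi>\<^sub>M n\<in>UNIV. steinhaus)"

lemma sets_steinhaus_seq [measurable_cong]: "sets steinhaus_seq = sets borel"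
proof -
  have "sets steinhaus_seq = sets (\<Pi>\<^sub>M n\<in>(UNIV :: nat set). (borel :: complex measure))"
    unfolding steinhaus_seq_def by (intro sets_PiM_cong) auto
  then show ?thesis by (simp add: sets_PiM_equal_borel)
qed

lemma space_steinhaus_seq [simp]: "space steinhaus_seq = UNIV"
  by (simp add: steinhaus_seq_def space_PiM PiE_UNIV_domain)

interpretation steinhaus_product: product_prob_space "\<lambda>n :: nat. steinhaus" UNIV
proof -
  interpret prob_space steinhaus by (rule prob_space_steinhaus)
  show "product_prob_space (\<lambda>n :: nat. steinhaus)" by unfold_locales
qed

interpretation steinhaus_seq: prob_space steinhaus_seq
  unfolding steinhaus_seq_def by unfold_locales

lemma prob_steinhaus_seq: "measure steinhaus_seq UNIV = 1"
  using steinhaus_seq.prob_space by simp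

lemma AE_steinhaus_seq_norm: "AE \<epsilon> in steinhaus_seq. \<forall>n. cmod (\<epsilon> n) = 1"
  unfolding steinhaus_seq_def
  by (subst AE_all_countable, intro allI AE_PiM_component) (auto intro: prob_space_steinhaus AE_steinhaus_norm)

lemma measurable_steinhaus_coord [measurable]: "(\<lambda>\<epsilon>. \<epsilon> n) \<in> borel_measurable steinhaus_seq"
proof -
  have "(\<lambda>\<epsilon>. \<epsilon> n) \<in> measurable steinhaus_seq steinhaus"
    unfolding steinhaus_seq_def by (rule measurable_component_singleton) simp
  then show ?thesis by (simp add: measurable_cong_sets[OF refl sets_steinhaus])
qed

text \<open>Checked on cylinder sets. Invariance under the rotation of a single coordinate is the
  form in which independence enters the computation of moments.\<close>

lemma steinhaus_seq_rotate:
  fixes N :: nat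
  assumes c: "0 \<le> c" "c \<le> 2 * pi"
  defines "T \<equiv> \<lambda>\<epsilon>. \<epsilon>(N := cis c * \<epsilon> N)"
  shows "T \<in> measurable steinhaus_seq steinhaus_seq" "distr steinhaus_seq steinhaus_seq T = steinhaus_seq"
proof -
  show T: "T \<in> measurable steinhaus_seq steinhaus_seq"
  proof -
    have "T \<in> measurable steinhaus_seq (\<Pi>\<^sub>M n\<in>(UNIV :: nat set). steinhaus)"
    proof (rule measurable_PiM_single')
      show "(\<lambda>\<epsilon>. T \<epsilon> n) \<in> measurable steinhaus_seq steinhaus" for n
      proof -
        have "(\<lambda>\<epsilon>. T \<epsilon> n) \<in> borel_measurable steinhaus_seq"
          by (cases "n = N") (simp_all add: T_def)
        then show ?thesis by (simp add: measurable_cong_sets[OF refl sets_steinhaus])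
      qed
    qed (auto simp: space_PiM)
    then show ?thesis by (simp add: steinhaus_seq_def)
  qed
  show "distr steinhaus_seq steinhaus_seq T = steinhaus_seq"
    unfolding steinhaus_seq_def
  proof (rule steinhaus_product.PiM_eq)
    fix J and F :: "nat \<Rightarrow> complex set"
    assume J: "finite J" "J \<subseteq> UNIV" "\<And>j. j \<in> J \<Longrightarrow> F j \<in> sets steinhaus"
    define F' where "F' j = (if j = N then (\<lambda>z. cis c * z) -` F j else F j)" for j
    have F': "F' j \<in> sets steinhaus" if "j \<in> J" for j
      using J(3)[OF that] measurable_sets[of "\<lambda>z. cis c * z" borel borel "F j"] by (auto simp: F'_def)
    have vim: "T -` (prod_emb UNIV (\<lambda>n. steinhaus) J (\<Pi>\<^sub>E j\<in>J. F j)) \<inter> space steinhaus_seq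
       = prod_emb UNIV (\<lambda>n. steinhaus) J (\<Pi>\<^sub>E j\<in>J. F' j)"
      by (auto simp: prod_emb_def T_def F'_def PiE_iff space_PiM split: if_splits)
    have "emeasure (distr steinhaus_seq steinhaus_seq T) (prod_emb UNIV (\<lambda>n. steinhaus) J (\<Pi>\<^sub>E j\<in>J. F j))
       = emeasure steinhaus_seq (T -` (prod_emb UNIV (\<lambda>n. steinhaus) J (\<Pi>\<^sub>E j\<in>J. F j)) \<inter> space steinhaus_seq)"
      by (rule emeasure_distr[OF T]) (use J in \<open>auto simp: steinhaus_seq_def intro!: sets_PiM_I\<close>)
    also have "\<dots> = (\<Prod>j\<in>J. emeasure steinhaus (F' j))"
      unfolding vim unfolding steinhaus_seq_def using J F' by (intro steinhaus_product.emeasure_PiM_emb) auto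
    also have "\<dots> = (\<Prod>j\<in>J. emeasure steinhaus (F j))"
      using J(3) emeasure_steinhaus_rotate[OF _ c] by (intro prod.cong) (auto simp: F'_def)
    finally show "emeasure (distr (\<Pi>\<^sub>M n\<in>UNIV. steinhaus) (\<Pi>\<^sub>M n\<in>UNIV. steinhaus) T) (prod_emb UNIV (\<lambda>n. steinhaus) J (\<Pi>\<^sub>E j\<in>J. F j))
       = (\<Prod>j\<in>J. emeasure steinhaus (F j))" by (simp add: steinhaus_seq_def)
  qed simp
qed

lemma integral_steinhaus_seq_rotate:
  fixes f :: "(nat \<Rightarrow> complex) \<Rightarrow> real"
  assumes c: "0 \<le> c" "c \<le> 2 * pi" and f: "f \<in> borel_measurable steinhaus_seq"
  shows "(\<integral>\<epsilon>. f (\<epsilon>(N := cis c * \<epsilon> N)) \<partial>steinhaus_seq) = (\<integral>\<epsilon>. f \<epsilon> \<partial>steinhaus_seq)"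
  using integral_distr[OF steinhaus_seq_rotate(1)[OF c, of N] f] by (simp add: steinhaus_seq_rotate(2)[OF c])

section \<open>Moments of Steinhaus sums\<close>

definition rad_sum :: "nat \<Rightarrow> (nat \<Rightarrow> complex) \<Rightarrow> (nat \<Rightarrow> complex) \<Rightarrow> complex" where
  "rad_sum N c \<epsilon> = (\<Sum>n<N. \<epsilon> n * c n)"

lemma measurable_rad_sum [measurable]: "rad_sum N c \<in> borel_measurable steinhaus_seq"
  unfolding rad_sum_def by measurable

lemma AE_rad_sum_le: "AE \<epsilon> in steinhaus_seq. cmod (rad_sum N c \<epsilon>) \<le> (\<Sum>n<N. cmod (c n))"
  using AE_steinhaus_seq_norm
proof eventually_elim
  case (elim \<epsilon>)
  have "cmod (rad_sum N c \<epsilon>) \<le> (\<Sum>n<N. cmod (\<epsilon> n * c n))" unfolding rad_sum_def by (rule norm_sum)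
  then show ?case using elim by (simp add: norm_mult)
qed

lemma integrable_rad_sum_power: "integrable steinhaus_seq (\<lambda>\<epsilon>. cmod (rad_sum N c \<epsilon>) ^ k)"
proof (rule steinhaus_seq.integrable_const_bound)
  show "AE \<epsilon> in steinhaus_seq. norm (cmod (rad_sum N c \<epsilon>) ^ k) \<le> (\<Sum>n<N. cmod (c n)) ^ k"
    using AE_rad_sum_le[of N c] by eventually_elim (simp add: power_mono)
qed measurable

lemma cmod_rotations_power2:
  "cmod (F + w) ^ 2 + cmod (F + \<i> * w) ^ 2 + cmod (F - w) ^ 2 + cmod (F - \<i> * w) ^ 2
    = 4 * (cmod F ^ 2 + cmod w ^ 2)"
  unfolding cmod_power2 by (simp add: power2_eq_square algebra_simps)

lemma cmod_rotations_power4: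
  "cmod (F + w) ^ 4 + cmod (F + \<i> * w) ^ 4 + cmod (F - w) ^ 4 + cmod (F - \<i> * w) ^ 4
    = 4 * (cmod F ^ 4 + 4 * (cmod F ^ 2 * cmod w ^ 2) + cmod w ^ 4)"
proof -
  have "cmod z ^ 4 = ((Re z)\<^sup>2 + (Im z)\<^sup>2)\<^sup>2" for z
    unfolding cmod_power2[symmetric] by (simp flip: power_mult)
  then show ?thesis unfolding cmod_power2 by (simp add: power2_eq_square algebra_simps)
qed

text \<open>The expectation is unchanged when the last coordinate is rotated by a fourth root of
  unity, so it equals the average over the four. For second and fourth powers the mixed terms have
  frequency at most 2 in the angle, and the average removes them.\<close>

lemma rad_sum_rotation_average:
  assumes g: "\<And>F w. g (F + w) + g (F + \<i> * w) + g (F - w) + g (F - \<i> * w) = (4 :: real) * G F w"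
    and int: "\<And>c. integrable steinhaus_seq (\<lambda>\<epsilon>. g (rad_sum (Suc N) c \<epsilon>))"
  shows "(\<integral>\<epsilon>. g (rad_sum (Suc N) c \<epsilon>) \<partial>steinhaus_seq) = (\<integral>\<epsilon>. G (rad_sum N c \<epsilon>) (\<epsilon> N * c N) \<partial>steinhaus_seq)"
proof -
  let ?I = "\<integral>\<epsilon>. g (rad_sum (Suc N) c \<epsilon>) \<partial>steinhaus_seq"
  have rot: "rad_sum (Suc N) c (\<epsilon>(N := z * \<epsilon> N)) = rad_sum (Suc N) (c(N := z * c N)) \<epsilon>"
    "rad_sum (Suc N) (c(N := z * c N)) \<epsilon> = rad_sum N c \<epsilon> + z * (\<epsilon> N * c N)" for z \<epsilon>
    by (auto simp: rad_sum_def intro!: sum.cong)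
  have rot_int: "(\<integral>\<epsilon>. g (rad_sum N c \<epsilon> + z * (\<epsilon> N * c N)) \<partial>steinhaus_seq) = ?I"
    "integrable steinhaus_seq (\<lambda>\<epsilon>. g (rad_sum N c \<epsilon> + z * (\<epsilon> N * c N)))"
    if "z = cis a" "0 \<le> a" "a \<le> 2 * pi" for z a
  proof -
    show "integrable steinhaus_seq (\<lambda>\<epsilon>. g (rad_sum N c \<epsilon> + z * (\<epsilon> N * c N)))"
      using int[of "c(N := z * c N)"] by (simp add: rot(2))
    show "(\<integral>\<epsilon>. g (rad_sum N c \<epsilon> + z * (\<epsilon> N * c N)) \<partial>steinhaus_seq) = ?I"
      using integral_steinhaus_seq_rotate[OF that(2,3) borel_measurable_integrable[OF int[of c]], of N]
      by (simp only: that(1)[symmetric] rot)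
  qed
  have "cis (3 * pi / 2) = cis pi * cis (pi / 2)"
    unfolding cis_mult by (rule arg_cong[of _ _ cis]) simp
  then have cis: "(1 :: complex) = cis 0" "\<i> = cis (pi / 2)" "- 1 = cis pi" "- \<i> = cis (3 * pi / 2)"
    by simp_all
  note r0 = rot_int[OF cis(1)] and r1 = rot_int[OF cis(2)] and r2 = rot_int[OF cis(3)] and r3 = rot_int[OF cis(4)]
  have "4 * ?I = (\<integral>\<epsilon>. g (rad_sum N c \<epsilon> + 1 * (\<epsilon> N * c N)) \<partial>steinhaus_seq)
      + (\<integral>\<epsilon>. g (rad_sum N c \<epsilon> + \<i> * (\<epsilon> N * c N)) \<partial>steinhaus_seq)
      + (\<integral>\<epsilon>. g (rad_sum N c \<epsilon> + - 1 * (\<epsilon> N * c N)) \<partial>steinhaus_seq)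
      + (\<integral>\<epsilon>. g (rad_sum N c \<epsilon> + - \<i> * (\<epsilon> N * c N)) \<partial>steinhaus_seq)"
    using r0(1) r1(1) r2(1) r3(1) by simp
  also have "\<dots> = (\<integral>\<epsilon>. g (rad_sum N c \<epsilon> + 1 * (\<epsilon> N * c N)) + g (rad_sum N c \<epsilon> + \<i> * (\<epsilon> N * c N))
      + g (rad_sum N c \<epsilon> + - 1 * (\<epsilon> N * c N)) + g (rad_sum N c \<epsilon> + - \<i> * (\<epsilon> N * c N)) \<partial>steinhaus_seq)"
    using r0(2) r1(2) r2(2) r3(2) by (simp add: Bochner_Integration.integral_add Bochner_Integration.integrable_add)
  also have "\<dots> = (\<integral>\<epsilon>. 4 * G (rad_sum N c \<epsilon>) (\<epsilon> N * c N) \<partial>steinhaus_seq)"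
    by (simp add: g)
  finally show ?thesis by simp
qed

text \<open>With \<open>S\<close> the sum so far and \<open>a\<close> the new square, the fourth
  moment grows by \<open>4 * S * a + a ^ 2\<close>. The constant 2 survives the induction because
  \<open>2 * S ^ 2 + 4 * S * a + a ^ 2\<close> is at most \<open>2 * (S + a) ^ 2\<close>.\<close>

lemma rad_sum_moments:
  "(\<integral>\<epsilon>. cmod (rad_sum N c \<epsilon>) ^ 2 \<partial>steinhaus_seq) = (\<Sum>n<N. cmod (c n) ^ 2)"
  "(\<integral>\<epsilon>. cmod (rad_sum N c \<epsilon>) ^ 4 \<partial>steinhaus_seq) \<le> 2 * (\<Sum>n<N. cmod (c n) ^ 2) ^ 2"
proof (induction N)
  case 0
  { case 1 then show ?case by (simp add: rad_sum_def) }
  { case 2 then show ?case by (simp add: rad_sum_def) }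
next
  case (Suc N)
  let ?F = "rad_sum N c" and ?a = "cmod (c N) ^ 2" and ?S = "\<Sum>n<N. cmod (c n) ^ 2"
  have nrm: "AE \<epsilon> in steinhaus_seq. cmod (\<epsilon> N * c N) = cmod (c N)"
    using AE_steinhaus_seq_norm by eventually_elim (simp add: norm_mult)
  have int2: "integrable steinhaus_seq (\<lambda>\<epsilon>. cmod (?F \<epsilon>) ^ 2)" and int4: "integrable steinhaus_seq (\<lambda>\<epsilon>. cmod (?F \<epsilon>) ^ 4)"
    by (rule integrable_rad_sum_power)+
  {
    case 1
    have "(\<integral>\<epsilon>. cmod (rad_sum (Suc N) c \<epsilon>) ^ 2 \<partial>steinhaus_seq)
        = (\<integral>\<epsilon>. cmod (?F \<epsilon>) ^ 2 + cmod (\<epsilon> N * c N) ^ 2 \<partial>steinhaus_seq)"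
      by (rule rad_sum_rotation_average[OF cmod_rotations_power2 integrable_rad_sum_power])
    also have "\<dots> = (\<integral>\<epsilon>. cmod (?F \<epsilon>) ^ 2 + ?a \<partial>steinhaus_seq)"
      by (rule integral_cong_AE) (use nrm in \<open>auto elim: eventually_mono\<close>)
    also have "\<dots> = ?S + ?a" using int2 Suc(1) by (simp add: prob_steinhaus_seq)
    finally show ?case by simp
  next
    case 2
    have "(\<integral>\<epsilon>. cmod (rad_sum (Suc N) c \<epsilon>) ^ 4 \<partial>steinhaus_seq)
        = (\<integral>\<epsilon>. cmod (?F \<epsilon>) ^ 4 + 4 * (cmod (?F \<epsilon>) ^ 2 * cmod (\<epsilon> N * c N) ^ 2) + cmod (\<epsilon> N * c N) ^ 4 \<partial>steinhaus_seq)"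
      by (rule rad_sum_rotation_average[OF cmod_rotations_power4 integrable_rad_sum_power])
    also have "\<dots> = (\<integral>\<epsilon>. cmod (?F \<epsilon>) ^ 4 + 4 * (cmod (?F \<epsilon>) ^ 2 * ?a) + cmod (c N) ^ 4 \<partial>steinhaus_seq)"
      by (rule integral_cong_AE) (use nrm in \<open>auto elim: eventually_mono\<close>)
    also have "\<dots> = (\<integral>\<epsilon>. cmod (?F \<epsilon>) ^ 4 \<partial>steinhaus_seq) + 4 * (?S * ?a) + cmod (c N) ^ 4"
      using int2 int4 Suc(1) by (simp add: prob_steinhaus_seq)
    also have "\<dots> \<le> 2 * ?S ^ 2 + 4 * (?S * ?a) + 2 * ?a ^ 2"
    proof -
      have "?a ^ 2 = cmod (c N) ^ 4" by (simp flip: power_mult)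
      moreover have "0 \<le> cmod (c N) ^ 4" by simp
      ultimately show ?thesis using Suc(2) by linarith
    qed
    also have "\<dots> = 2 * (?S + ?a) ^ 2" by (simp add: power2_eq_square algebra_simps)
    finally show ?case by simp
  }
qed

text \<open>Khintchine's inequality between the first and the second moment, from the pointwise bound
  \<open>v \<ge> v\<^sup>2 - v ^ 4 / 4\<close>.\<close>

lemma rad_sum_first_moment:
  "sqrt (\<Sum>n<N. cmod (c n) ^ 2) / 2 \<le> (\<integral>\<epsilon>. cmod (rad_sum N c \<epsilon>) \<partial>steinhaus_seq)"
proof -
  define s where "s = sqrt (\<Sum>n<N. cmod (c n) ^ 2)"
  have s2: "s ^ 2 = (\<Sum>n<N. cmod (c n) ^ 2)" by (simp add: s_def sum_nonneg)
  have int: "integrable steinhaus_seq (\<lambda>\<epsilon>. cmod (rad_sum N c \<epsilon>) ^ k)" for k by (rule integrable_rad_sum_power)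
  show ?thesis
  proof (cases "s = 0")
    case False
    then have s: "s > 0" by (simp add: s_def less_le sum_nonneg)
    have pt: "y ^ 2 / s - y ^ 4 / (4 * s ^ 3) \<le> y" if "y \<ge> 0" for y
    proof -
      define v where "v = y / s"
      have v: "v \<ge> 0" "y = v * s" using that s by (auto simp: v_def)
      have "v ^ 3 - 4 * v + 4 \<ge> 0"
      proof (cases "v \<le> 2")
        case True
        have "v ^ 3 - 4 * v + 4 = (v - 1) ^ 2 * (v + 2) + (2 - v)" by (simp add: power2_eq_square power3_eq_cube algebra_simps)
        moreover have "0 \<le> (v - 1) ^ 2 * (v + 2)" using v by simp
        ultimately show ?thesis using True by linarith
      next
        case False
        then have "v * 4 \<le> v * (v * v)" using mult_mono[of 2 v 2 v] by (intro mult_left_mono) auto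
        then show ?thesis by (simp add: power3_eq_cube)
      qed
      then have "v * s * (v ^ 3 - 4 * v + 4) \<ge> 0" using v s by simp
      moreover have "v * s * (v ^ 3 - 4 * v + 4) = 4 * (y - (y ^ 2 / s - y ^ 4 / (4 * s ^ 3)))"
        unfolding v(2) using s by (simp add: field_simps power2_eq_square power3_eq_cube power4_eq_xxxx)
      ultimately show ?thesis by simp
    qed
    \<comment> \<open>The second moment is \<open>s ^ 2\<close> and the fourth at most
      \<open>2 * s ^ 4\<close>, so the pointwise bound leaves \<open>s - s / 2\<close>.\<close>
    have "s / 2 = s ^ 2 / s - 2 * (s ^ 2) ^ 2 / (4 * s ^ 3)"
      using s by (simp add: power2_eq_square power3_eq_cube)
    also have "\<dots> \<le> (\<integral>\<epsilon>. cmod (rad_sum N c \<epsilon>) ^ 2 \<partial>steinhaus_seq) / s - (\<integral>\<epsilon>. cmod (rad_sum N c \<epsilon>) ^ 4 \<partial>steinhaus_seq) / (4 * s ^ 3)"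
      using rad_sum_moments[where N = N and c = c] s unfolding s2 by (intro diff_mono divide_right_mono) auto
    also have "\<dots> = (\<integral>\<epsilon>. cmod (rad_sum N c \<epsilon>) ^ 2 / s - cmod (rad_sum N c \<epsilon>) ^ 4 / (4 * s ^ 3) \<partial>steinhaus_seq)"
      using int by simp
    also have "\<dots> \<le> (\<integral>\<epsilon>. cmod (rad_sum N c \<epsilon>) \<partial>steinhaus_seq)"
      using int[of 1] int by (intro integral_mono pt) auto
    finally show ?thesis by (simp add: s_def)
  qed (simp add: s_def[symmetric])
qed

section \<open>Square function estimates\<close>

text \<open>Cauchy-Schwarz by the discriminant of a nonnegative quadratic. It is stated with upper
  bounds \<open>p\<close> and \<open>q\<close> because the induction hypothesis for the gauge offers
  only bounds on the second moments.\<close>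

lemma integral_mult_le:
  fixes u v :: "'a \<Rightarrow> real"
  assumes int: "integrable M (\<lambda>x. (u x)\<^sup>2)" "integrable M (\<lambda>x. (v x)\<^sup>2)" "integrable M (\<lambda>x. u x * v x)"
    and pq: "(\<integral>x. (u x)\<^sup>2 \<partial>M) \<le> p\<^sup>2" "(\<integral>x. (v x)\<^sup>2 \<partial>M) \<le> q\<^sup>2" "0 \<le> p" "0 \<le> q"
  shows "(\<integral>x. u x * v x \<partial>M) \<le> p * q"
proof -
  define U where "U = (\<integral>x. (u x)\<^sup>2 \<partial>M)"
  define W where "W = (\<integral>x. u x * v x \<partial>M)"
  define Z where "Z = (\<integral>x. (v x)\<^sup>2 \<partial>M)"
  have quad: "0 \<le> t\<^sup>2 * U - 2 * t * W + Z" for t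
  proof -
    have "0 \<le> (\<integral>x. (t * u x - v x)\<^sup>2 \<partial>M)" by (rule Bochner_Integration.integral_nonneg) simp
    also have "(\<lambda>x. (t * u x - v x)\<^sup>2) = (\<lambda>x. t\<^sup>2 * (u x)\<^sup>2 - 2 * t * (u x * v x) + (v x)\<^sup>2)"
      by (simp add: power2_eq_square algebra_simps)
    finally show ?thesis using int by (simp add: U_def W_def Z_def)
  qed
  have UZ: "0 \<le> U" "0 \<le> Z" by (simp_all add: U_def Z_def)
  have "W\<^sup>2 \<le> U * Z \<or> W \<le> 0"
  proof (cases "U = 0")
    case True
    have "\<not> W > 0"
    proof
      assume "W > 0"
      \<comment> \<open>For \<open>U = 0\<close> the quadratic is affine in \<open>t\<close>, and at
        this \<open>t\<close> its value is -1.\<close>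
      then show False using quad[of "(Z + 1) / (2 * W)"] True UZ by simp
    qed
    then show ?thesis by simp
  next
    case False
    then have "U > 0" using UZ by simp
    then show ?thesis using quad[of "W / U"] by (simp add: field_simps power2_eq_square)
  qed
  then show ?thesis
  proof
    assume "W\<^sup>2 \<le> U * Z"
    also have "\<dots> \<le> p\<^sup>2 * q\<^sup>2" using pq UZ by (intro mult_mono) (auto simp: U_def Z_def)
    finally have "W\<^sup>2 \<le> (p * q)\<^sup>2" by (simp add: power_mult_distrib)
    then show ?thesis using pq by (simp add: W_def abs_le_square_iff[symmetric])
  next
    assume "W \<le> 0"
    also have "0 \<le> p * q" using pq by simp
    finally show ?thesis by (simp add: W_def)
  qed
qed

text \<open>The triangle inequality for the integral of the complex function with real part
  \<open>X\<close> and imaginary part \<open>Y\<close>.\<close>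

lemma sqrt_integral_le:
  fixes X Y :: "'a \<Rightarrow> real"
  assumes "integrable M X" "integrable M Y"
  shows "sqrt ((\<integral>x. X x \<partial>M)\<^sup>2 + (\<integral>x. Y x \<partial>M)\<^sup>2) \<le> (\<integral>x. sqrt ((X x)\<^sup>2 + (Y x)\<^sup>2) \<partial>M)"
proof -
  have "(\<integral>x. complex_of_real (X x) + \<i> * of_real (Y x) \<partial>M) = of_real (\<integral>x. X x \<partial>M) + \<i> * of_real (\<integral>x. Y x \<partial>M)"
    using assms by simp
  moreover have "cmod (\<integral>x. complex_of_real (X x) + \<i> * of_real (Y x) \<partial>M) \<le> (\<integral>x. cmod (complex_of_real (X x) + \<i> * of_real (Y x)) \<partial>M)"
    by (rule integral_norm_bound)
  ultimately show ?thesis by (simp add: cmod_def)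
qed

text \<open>Jensen's inequality for a concave function, from its linear majorant
  \<open>A / c + B / s\<close> touching at the point of means. If one mean vanishes there is no such
  majorant, but then that function is zero almost everywhere.\<close>

lemma (in finite_measure) integral_cogauge2_le:
  assumes int: "integrable M A" "integrable M B" and nn: "\<And>x. 0 \<le> A x" "\<And>x. 0 \<le> B x"
    and int_G: "integrable M (\<lambda>x. cogauge2 (A x) (B x))"
  shows "(\<integral>x. cogauge2 (A x) (B x) \<partial>M) \<le> cogauge2 (\<integral>x. A x \<partial>M) (\<integral>x. B x \<partial>M)"
proof -
  have nn': "0 \<le> (\<integral>x. A x \<partial>M)" "0 \<le> (\<integral>x. B x \<partial>M)" using nn by simp_all
  then consider "(\<integral>x. A x \<partial>M) = 0" | "(\<integral>x. B x \<partial>M) = 0" | "(\<integral>x. A x \<partial>M) > 0" "(\<integral>x. B x \<partial>M) > 0"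
    by linarith
  then show ?thesis
  proof cases
    case 1
    then have "AE x in M. A x = 0" using int nn by (subst (asm) integral_nonneg_eq_0_iff_AE) auto
    then have "(\<integral>x. cogauge2 (A x) (B x) \<partial>M) = (\<integral>x. B x \<partial>M)"
      using int int_G nn by (intro integral_cong_AE) (auto elim!: eventually_mono)
    then show ?thesis using 1 nn' by simp
  next
    case 2
    then have "AE x in M. B x = 0" using int nn by (subst (asm) integral_nonneg_eq_0_iff_AE) auto
    then have "(\<integral>x. cogauge2 (A x) (B x) \<partial>M) = (\<integral>x. A x \<partial>M)"
      using int int_G nn by (intro integral_cong_AE) (auto elim!: eventually_mono)
    then show ?thesis using 2 nn' by simp
  next
    case 3
    then obtain c s where c: "0 < c" "0 < s" "c\<^sup>2 + s\<^sup>2 = 1"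
      "cogauge2 (\<integral>x. A x \<partial>M) (\<integral>x. B x \<partial>M) = (\<integral>x. A x \<partial>M) / c + (\<integral>x. B x \<partial>M) / s"
      using cogauge2_attained by metis
    have "(\<integral>x. cogauge2 (A x) (B x) \<partial>M) \<le> (\<integral>x. A x / c + B x / s \<partial>M)"
      using int int_G nn c by (intro integral_mono cogauge2_le) auto
    also have "\<dots> = (\<integral>x. A x \<partial>M) / c + (\<integral>x. B x \<partial>M) / s" using int by simp
    finally show ?thesis using c(4) by simp
  qed
qed

section \<open>Random sums and square functions measured by the gauges\<close>

definition rad_sq :: "nat \<Rightarrow> (nat \<Rightarrow> nat \<Rightarrow> complex) \<Rightarrow> (nat \<Rightarrow> complex) \<Rightarrow> nat \<Rightarrow> real" where
  "rad_sq N x \<epsilon> k = cmod (rad_sum N (\<lambda>n. x n k) \<epsilon>) ^ 2"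

definition sq_fun :: "nat \<Rightarrow> (nat \<Rightarrow> nat \<Rightarrow> complex) \<Rightarrow> nat \<Rightarrow> real" where
  "sq_fun N x k = (\<Sum>n<N. cmod (x n k) ^ 2)"

lemma rad_sq_nonneg [simp]: "0 \<le> rad_sq N x \<epsilon> k"
  by (simp add: rad_sq_def)

lemma sq_fun_nonneg [simp]: "0 \<le> sq_fun N x k"
  by (simp add: sq_fun_def sum_nonneg)

lemma measurable_rad_sq [measurable]: "(\<lambda>\<epsilon>. rad_sq N x \<epsilon> k) \<in> borel_measurable steinhaus_seq"
  unfolding rad_sq_def by measurable

lemma AE_rad_sq_le: "AE \<epsilon> in steinhaus_seq. \<forall>k. rad_sq N x \<epsilon> k \<le> (\<Sum>n<N. cmod (x n k)) ^ 2"
  unfolding AE_all_countable rad_sq_def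
proof
  fix k
  show "AE \<epsilon> in steinhaus_seq. (cmod (rad_sum N (\<lambda>n. x n k) \<epsilon>))\<^sup>2 \<le> (\<Sum>n<N. cmod (x n k))\<^sup>2"
    using AE_rad_sum_le[of N "\<lambda>n. x n k"] by eventually_elim (simp add: power_mono)
qed

lemma integrable_rad_sq: "integrable steinhaus_seq (\<lambda>\<epsilon>. rad_sq N x \<epsilon> k)"
  unfolding rad_sq_def by (rule integrable_rad_sum_power)

lemma integral_rad_sq: "(\<integral>\<epsilon>. rad_sq N x \<epsilon> k \<partial>steinhaus_seq) = sq_fun N x k"
  unfolding rad_sq_def sq_fun_def by (rule rad_sum_moments)

lemma integrable_rad_sq_sq: "integrable steinhaus_seq (\<lambda>\<epsilon>. (rad_sq N x \<epsilon> k)\<^sup>2)"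
  and integral_rad_sq_sq: "(\<integral>\<epsilon>. (rad_sq N x \<epsilon> k)\<^sup>2 \<partial>steinhaus_seq) \<le> 2 * (sq_fun N x k)\<^sup>2"
  using integrable_rad_sum_power[of N "\<lambda>n. x n k" 4] rad_sum_moments(2)[of N "\<lambda>n. x n k"]
  by (simp_all add: rad_sq_def sq_fun_def flip: power_mult)

lemma measurable_tree_gauge [measurable (raw)]:
  "(\<And>k. (\<lambda>\<omega>. a \<omega> k) \<in> borel_measurable M) \<Longrightarrow> (\<lambda>\<omega>. tree_gauge d (a \<omega>) h) \<in> borel_measurable M"
  by (induction d arbitrary: h) auto

lemma measurable_tree_cogauge [measurable (raw)]:
  assumes "\<And>k. (\<lambda>\<omega>. a \<omega> k) \<in> borel_measurable M"
  shows "(\<lambda>\<omega>. tree_cogauge d (a \<omega>) h) \<in> borel_measurable M"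
proof (induction d arbitrary: h)
  case (Suc d)
  have root [measurable]: "root 3 \<in> borel_measurable borel"
    by (intro borel_measurable_continuous_onI continuous_on_real_root continuous_on_id)
  note [measurable] = Suc assms
  show ?case unfolding tree_cogauge.simps cogauge2_def by measurable
qed simp

lemma integrable_rad_gauge:
  assumes meas: "(\<lambda>\<epsilon>. Q (rad_sq N x \<epsilon>)) \<in> borel_measurable steinhaus_seq"
    and nn: "\<And>a. 0 \<le> Q a" and mono: "\<And>a b. (\<And>k. 0 \<le> a k) \<Longrightarrow> (\<And>k. a k \<le> b k) \<Longrightarrow> Q a \<le> (Q b :: real)"
  shows "integrable steinhaus_seq (\<lambda>\<epsilon>. Q (rad_sq N x \<epsilon>))"
proof (rule steinhaus_seq.integrable_const_bound[OF _ meas])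
  show "AE \<epsilon> in steinhaus_seq. norm (Q (rad_sq N x \<epsilon>)) \<le> Q (\<lambda>k. (\<Sum>n<N. cmod (x n k)) ^ 2)"
    using AE_rad_sq_le[of N x] by eventually_elim (use nn mono in \<open>auto simp: abs_of_nonneg\<close>)
qed

lemma integrable_tree_gauge: "integrable steinhaus_seq (\<lambda>\<epsilon>. tree_gauge d (rad_sq N x \<epsilon>) h)"
  by (rule integrable_rad_gauge) (auto intro: tree_gauge_mono)

lemma integrable_tree_gauge_mult:
  "integrable steinhaus_seq (\<lambda>\<epsilon>. tree_gauge d (rad_sq N x \<epsilon>) h * tree_gauge d (rad_sq N x \<epsilon>) h')"
proof (rule integrable_rad_gauge)
  fix a b :: "nat \<Rightarrow> real" assume ab: "\<And>k. 0 \<le> a k" "\<And>k. a k \<le> b k"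
  show "tree_gauge d a h * tree_gauge d a h' \<le> tree_gauge d b h * tree_gauge d b h'"
    by (intro mult_mono tree_gauge_mono ab) simp_all
qed auto

lemma integrable_tree_cogauge: "integrable steinhaus_seq (\<lambda>\<epsilon>. tree_cogauge d (rad_sq N x \<epsilon>) h)"
  by (rule integrable_rad_gauge) (auto intro: tree_cogauge_mono)

text \<open>Jensen's inequality for the convex gauge, level by level; the mean of
  \<open>rad_sq\<close> is \<open>sq_fun\<close>.\<close>

lemma tree_gauge_sq_fun_le: "tree_gauge d (sq_fun N x) h \<le> (\<integral>\<epsilon>. tree_gauge d (rad_sq N x \<epsilon>) h \<partial>steinhaus_seq)"
proof (induction d arbitrary: h)
  case (Suc d)
  let ?P = "\<lambda>\<epsilon>. tree_gauge d (rad_sq N x \<epsilon>) (2 * h) + tree_gauge d (rad_sq N x \<epsilon>) (2 * h + 1)"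
  have "tree_gauge d (sq_fun N x) (2 * h) + tree_gauge d (sq_fun N x) (2 * h + 1) \<le> (\<integral>\<epsilon>. ?P \<epsilon> \<partial>steinhaus_seq)"
    using Suc.IH[of "2 * h"] Suc.IH[of "2 * h + 1"] integrable_tree_gauge[of d N x] by simp
  then have "tree_gauge (Suc d) (sq_fun N x) h
      \<le> sqrt ((\<integral>\<epsilon>. rad_sq N x \<epsilon> h \<partial>steinhaus_seq)\<^sup>2 + (\<integral>\<epsilon>. ?P \<epsilon> \<partial>steinhaus_seq)\<^sup>2)"
    unfolding tree_gauge.simps integral_rad_sq
    by (intro real_sqrt_le_mono add_left_mono power_mono) auto
  also have "\<dots> \<le> (\<integral>\<epsilon>. sqrt ((rad_sq N x \<epsilon> h)\<^sup>2 + (?P \<epsilon>)\<^sup>2) \<partial>steinhaus_seq)"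
    by (intro sqrt_integral_le Bochner_Integration.integrable_add integrable_rad_sq integrable_tree_gauge)
  finally show ?case by simp
qed simp

text \<open>The induction runs over second moments. Expanding the squared sum of the children
  produces mixed products, which Cauchy-Schwarz reduces to the second moments of the children. All
  of them carry the same factor 2, hence the constant does not grow with the depth.\<close>

lemma integral_tree_gauge_le:
  "(\<integral>\<epsilon>. tree_gauge d (rad_sq N x \<epsilon>) h \<partial>steinhaus_seq) \<le> sqrt 2 * tree_gauge d (sq_fun N x) h"
proof -
  have "(\<integral>\<epsilon>. (tree_gauge d (rad_sq N x \<epsilon>) h)\<^sup>2 \<partial>steinhaus_seq) \<le> (sqrt 2 * tree_gauge d (sq_fun N x) h)\<^sup>2"
  proof (induction d arbitrary: h)
    case (Suc d)
    let ?P = "\<lambda>h \<epsilon>. tree_gauge d (rad_sq N x \<epsilon>) h" and ?S = "\<lambda>h. tree_gauge d (sq_fun N x) h"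
    have "(\<integral>\<epsilon>. (tree_gauge (Suc d) (rad_sq N x \<epsilon>) h)\<^sup>2 \<partial>steinhaus_seq)
       = (\<integral>\<epsilon>. (rad_sq N x \<epsilon> h)\<^sup>2 + (?P (2 * h) \<epsilon> * ?P (2 * h) \<epsilon> + 2 * (?P (2 * h) \<epsilon> * ?P (2 * h + 1) \<epsilon>)
          + ?P (2 * h + 1) \<epsilon> * ?P (2 * h + 1) \<epsilon>) \<partial>steinhaus_seq)"
      by (simp add: power2_eq_square algebra_simps)
    also have "\<dots> = (\<integral>\<epsilon>. (rad_sq N x \<epsilon> h)\<^sup>2 \<partial>steinhaus_seq)
       + ((\<integral>\<epsilon>. ?P (2 * h) \<epsilon> * ?P (2 * h) \<epsilon> \<partial>steinhaus_seq) + 2 * (\<integral>\<epsilon>. ?P (2 * h) \<epsilon> * ?P (2 * h + 1) \<epsilon> \<partial>steinhaus_seq)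
          + (\<integral>\<epsilon>. ?P (2 * h + 1) \<epsilon> * ?P (2 * h + 1) \<epsilon> \<partial>steinhaus_seq))"
      using integrable_tree_gauge_mult[of d N x] integrable_rad_sq_sq[of N x h] by simp
    also have "\<dots> \<le> 2 * (sq_fun N x h)\<^sup>2 + ((sqrt 2 * ?S (2 * h))\<^sup>2 + 2 * ((sqrt 2 * ?S (2 * h)) * (sqrt 2 * ?S (2 * h + 1)))
          + (sqrt 2 * ?S (2 * h + 1))\<^sup>2)"
      using Suc.IH[of "2 * h"] Suc.IH[of "2 * h + 1"] integrable_tree_gauge_mult[of d N x]
      by (intro add_mono integral_rad_sq_sq mult_left_mono integral_mult_le) (simp_all add: power2_eq_square)
    also have "\<dots> = 2 * ((sq_fun N x h)\<^sup>2 + (?S (2 * h) + ?S (2 * h + 1))\<^sup>2)"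
      by (simp add: power_mult_distrib) (simp add: power2_eq_square algebra_simps)
    also have "\<dots> = (sqrt 2 * tree_gauge (Suc d) (sq_fun N x) h)\<^sup>2"
      by (simp add: power_mult_distrib)
    finally show ?case .
  qed simp
  \<comment> \<open>From the second moment to the first by Cauchy-Schwarz against the constant
    1.\<close>
  then have "(\<integral>\<epsilon>. 1 * tree_gauge d (rad_sq N x \<epsilon>) h \<partial>steinhaus_seq) \<le> 1 * (sqrt 2 * tree_gauge d (sq_fun N x) h)"
    using integrable_tree_gauge[of d N x h] integrable_tree_gauge_mult[of d N x h h]
    by (intro integral_mult_le) (auto simp: power2_eq_square prob_steinhaus_seq)
  then show ?thesis by simp
qed

text \<open>The cogauge is concave, so Jensen's inequality gives the upper bound, whereas for the
  gauge it gives the lower one.\<close>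

lemma integral_tree_cogauge_le:
  "(\<integral>\<epsilon>. tree_cogauge d (rad_sq N x \<epsilon>) h \<partial>steinhaus_seq) \<le> tree_cogauge d (sq_fun N x) h"
proof (induction d arbitrary: h)
  case (Suc d)
  let ?D = "\<lambda>\<epsilon>. tree_cogauge d (rad_sq N x \<epsilon>) (2 * h) + tree_cogauge d (rad_sq N x \<epsilon>) (2 * h + 1)"
  have "(\<integral>\<epsilon>. tree_cogauge (Suc d) (rad_sq N x \<epsilon>) h \<partial>steinhaus_seq)
     \<le> cogauge2 (\<integral>\<epsilon>. rad_sq N x \<epsilon> h \<partial>steinhaus_seq) (\<integral>\<epsilon>. ?D \<epsilon> \<partial>steinhaus_seq)"
    unfolding tree_cogauge.simps
    using integrable_rad_sq[of N x h] integrable_tree_cogauge[of d N x] integrable_tree_cogauge[of "Suc d" N x h]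
    by (intro steinhaus_seq.integral_cogauge2_le) auto
  also have "\<dots> \<le> tree_cogauge (Suc d) (sq_fun N x) h"
    unfolding tree_cogauge.simps integral_rad_sq
    using Suc.IH[of "2 * h"] Suc.IH[of "2 * h + 1"] integrable_tree_cogauge[of d N x]
    by (intro cogauge2_mono) auto
  finally show ?case .
qed simp

text \<open>Concavity is of no help in this direction, so the cogauge is linearised by its norming
  vector \<open>y\<close>: Khintchine's inequality applies coordinatewise to first moments, and
  \<open>tree_sum_sqrt_le\<close> applies for each \<epsilon>. The constant 4 is the square of the
  constant 2 in \<open>rad_sum_first_moment\<close>.\<close>

lemma tree_cogauge_sq_fun_le:
  "tree_cogauge d (sq_fun N x) 1 \<le> 4 * (\<integral>\<epsilon>. tree_cogauge d (rad_sq N x \<epsilon>) 1 \<partial>steinhaus_seq)"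
proof -
  let ?D = "tree_cogauge d (sq_fun N x) 1" and ?E = "\<lambda>\<epsilon>. tree_cogauge d (rad_sq N x \<epsilon>) 1"
  obtain y where y: "\<And>k. 0 \<le> y k" "tree_sum d (\<lambda>k. y k * sqrt (sq_fun N x k)) 1 = ?D"
    "tree_gauge d (\<lambda>k. (y k)\<^sup>2) 1 = ?D"
    using tree_cogauge_extremal[of "sq_fun N x" 1 d] by auto
  have int1: "integrable steinhaus_seq (\<lambda>\<epsilon>. sqrt (rad_sq N x \<epsilon> k))" for k
    using integrable_rad_sum_power[of N "\<lambda>n. x n k" 1] by (simp add: rad_sq_def)
  have intE: "integrable steinhaus_seq (\<lambda>\<epsilon>. sqrt (?E \<epsilon>))"
    by (rule integrable_rad_gauge) (auto intro: tree_cogauge_mono)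
  have "?D = (\<Sum>k\<in>{1..<2 ^ d}. y k * sqrt (sq_fun N x k))" using y(2) by (simp only: tree_sum_root)
  also have "\<dots> \<le> (\<Sum>k\<in>{1..<2 ^ d}. y k * (2 * (\<integral>\<epsilon>. sqrt (rad_sq N x \<epsilon> k) \<partial>steinhaus_seq)))"
  proof (intro sum_mono mult_left_mono y)
    fix k
    show "sqrt (sq_fun N x k) \<le> 2 * (\<integral>\<epsilon>. sqrt (rad_sq N x \<epsilon> k) \<partial>steinhaus_seq)"
      using rad_sum_first_moment[where N = N and c = "\<lambda>n. x n k"] by (simp add: sq_fun_def rad_sq_def)
  qed
  also have "\<dots> = 2 * (\<integral>\<epsilon>. (\<Sum>k\<in>{1..<2 ^ d}. y k * sqrt (rad_sq N x \<epsilon> k)) \<partial>steinhaus_seq)"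
    using int1 by (simp add: sum_distrib_left mult_ac)
  also have "\<dots> \<le> 2 * (\<integral>\<epsilon>. sqrt ?D * sqrt (?E \<epsilon>) \<partial>steinhaus_seq)"
  proof (intro mult_left_mono integral_mono)
    fix \<epsilon>
    have "(\<Sum>k\<in>{1..<2 ^ d}. y k * sqrt (rad_sq N x \<epsilon> k)) = tree_sum d (\<lambda>k. sqrt ((y k)\<^sup>2 * rad_sq N x \<epsilon> k)) 1"
      using y(1) by (simp add: tree_sum_root[simplified] real_sqrt_mult)
    also have "\<dots> \<le> sqrt (tree_gauge d (\<lambda>k. (y k)\<^sup>2) 1 * ?E \<epsilon>)" by (rule tree_sum_sqrt_le) auto
    also have "\<dots> = sqrt ?D * sqrt (?E \<epsilon>)" unfolding y(3) by (simp add: real_sqrt_mult)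
    finally show "(\<Sum>k\<in>{1..<2 ^ d}. y k * sqrt (rad_sq N x \<epsilon> k)) \<le> sqrt ?D * sqrt (?E \<epsilon>)" .
  qed (use int1 intE in auto)
  also have "\<dots> = 2 * sqrt ?D * (\<integral>\<epsilon>. sqrt (?E \<epsilon>) \<partial>steinhaus_seq)" using intE by simp
  finally have 1: "?D \<le> 2 * sqrt ?D * (\<integral>\<epsilon>. sqrt (?E \<epsilon>) \<partial>steinhaus_seq)" .
  have "(\<integral>\<epsilon>. 1 * sqrt (?E \<epsilon>) \<partial>steinhaus_seq) \<le> 1 * sqrt (\<integral>\<epsilon>. ?E \<epsilon> \<partial>steinhaus_seq)"
    using intE integrable_tree_cogauge[of d N x 1]
    by (intro integral_mult_le) (auto simp: prob_steinhaus_seq)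
  then have 2: "(\<integral>\<epsilon>. sqrt (?E \<epsilon>) \<partial>steinhaus_seq) \<le> sqrt (\<integral>\<epsilon>. ?E \<epsilon> \<partial>steinhaus_seq)" by simp
  show ?thesis
  proof (cases "?D = 0")
    case False
    then have D: "sqrt ?D > 0" using tree_cogauge_nonneg[of d "sq_fun N x" 1] by (simp add: less_le)
    have "sqrt ?D * sqrt ?D \<le> sqrt ?D * (2 * (\<integral>\<epsilon>. sqrt (?E \<epsilon>) \<partial>steinhaus_seq))" using 1 by (simp add: mult_ac)
    then have "sqrt ?D \<le> 2 * (\<integral>\<epsilon>. sqrt (?E \<epsilon>) \<partial>steinhaus_seq)" using D by (simp only: mult_le_cancel_left_pos)
    also have "\<dots> \<le> sqrt (4 * (\<integral>\<epsilon>. ?E \<epsilon> \<partial>steinhaus_seq))" using 2 by (simp add: real_sqrt_mult)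
    finally show ?thesis by simp
  qed (simp add: Bochner_Integration.integral_nonneg)
qed

text \<open>The squared Rademacher norm is a limit of expectations of \<open>Q d\<close>, which are
  comparable, uniformly in \<open>d\<close> and \<open>N\<close>, to \<open>Q d\<close> of the
  square function; and the latter is monotone in the moduli of the coordinates. The limit also
  yields measurability of the norm of the random sum. \<open>Q\<close> stands for the gauge or the
  cogauge at the root.\<close>

lemma (in coord_space) rademacher_domination:
  assumes lim: "\<And>x. x \<in> carrier V \<Longrightarrow> (\<lambda>d. Q d (\<lambda>k. cmod (J x k) ^ 2)) \<longlonglongrightarrow> (vnorm V x)\<^sup>2"
    and le: "\<And>x d. x \<in> carrier V \<Longrightarrow> Q d (\<lambda>k. cmod (J x k) ^ 2) \<le> (vnorm V x)\<^sup>2"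
    and nn: "\<And>d a. 0 \<le> Q d a"
    and mono: "\<And>d a b. (\<And>k. 0 \<le> a k) \<Longrightarrow> (\<And>k. a k \<le> b k) \<Longrightarrow> Q d a \<le> Q d b"
    and int: "\<And>d N x. integrable steinhaus_seq (\<lambda>\<epsilon>. Q d (rad_sq N x \<epsilon>))"
    and upper: "\<And>d N x. (\<integral>\<epsilon>. Q d (rad_sq N x \<epsilon>) \<partial>steinhaus_seq) \<le> c * Q d (sq_fun N x)"
    and lower: "\<And>d N x. Q d (sq_fun N x) \<le> c' * (\<integral>\<epsilon>. Q d (rad_sq N x \<epsilon>) \<partial>steinhaus_seq)"
    and c: "0 \<le> c" "0 \<le> c'"
  shows "\<exists>C. \<forall>N x y. (\<forall>n<N. x n \<in> carrier V \<and> y n \<in> carrier V \<and> (\<forall>k. cmod (J (y n) k) \<le> cmod (J (x n) k))) \<longrightarrow>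
    rademacher_norm V N y \<le> C * rademacher_norm V N x"
proof (intro exI allI impI)
  fix N :: nat and x y :: "nat \<Rightarrow> 'v"
  assume xy: "\<forall>n<N. x n \<in> carrier V \<and> y n \<in> carrier V \<and> (\<forall>k. cmod (J (y n) k) \<le> cmod (J (x n) k))"
  define S where "S z \<epsilon> = finsum V (\<lambda>n. \<epsilon> n \<odot>\<^bsub>V\<^esub> z n) {..<N}" for z :: "nat \<Rightarrow> 'v" and \<epsilon> :: "nat \<Rightarrow> complex"
  define v where "v z = (\<lambda>\<epsilon>. (vnorm V (S z \<epsilon>))\<^sup>2)" for z
  define q where "q z d = (\<lambda>\<epsilon>. Q d (rad_sq N (\<lambda>n. J (z n)) \<epsilon>))" for z d
  have *: "integrable steinhaus_seq (v z)" "(\<lambda>d. \<integral>\<epsilon>. q z d \<epsilon> \<partial>steinhaus_seq) \<longlonglongrightarrow> (\<integral>\<epsilon>. v z \<epsilon> \<partial>steinhaus_seq)"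
    "(\<integral>\<epsilon>. q z d \<epsilon> \<partial>steinhaus_seq) \<le> (\<integral>\<epsilon>. v z \<epsilon> \<partial>steinhaus_seq)"
    if z: "\<And>n. n < N \<Longrightarrow> z n \<in> carrier V" for z d
  proof -
    have S: "S z \<epsilon> \<in> carrier V" for \<epsilon> unfolding S_def using z by (intro finsum_closed) auto
    have JS: "(\<lambda>k. cmod (J (S z \<epsilon>) k) ^ 2) = rad_sq N (\<lambda>n. J (z n)) \<epsilon>" for \<epsilon>
      unfolding S_def rad_sq_def rad_sum_def using z by (subst J_finsum) (auto simp: J_smult)
    have lim_q: "(\<lambda>d. q z d \<epsilon>) \<longlonglongrightarrow> v z \<epsilon>" for \<epsilon>
      using lim[OF S, of \<epsilon>] unfolding JS by (simp add: q_def v_def)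
    have int_q: "integrable steinhaus_seq (q z d)" for d unfolding q_def by (rule int)
    have meas: "v z \<in> borel_measurable steinhaus_seq"
      by (rule borel_measurable_LIMSEQ_real[where u = "q z"]) (use lim_q int_q in auto)
    define B where "B = (\<Sum>n<N. vnorm V (z n))"
    have finsum_le: "vnorm V (finsum V f {..<m}) \<le> (\<Sum>n<m. vnorm V (f n))" if "\<And>n. n < m \<Longrightarrow> f n \<in> carrier V" for f and m :: nat
      using that
    proof (induction m)
      case (Suc m)
      have "finsum V f {..<Suc m} = f m \<oplus>\<^bsub>V\<^esub> finsum V f {..<m}"
        using Suc.prems by (subst lessThan_Suc, subst finsum_insert) auto
      moreover have "finsum V f {..<m} \<in> carrier V" using Suc.prems by (intro finsum_closed) auto
      ultimately show ?case using vnorm_triangle[of "f m" "finsum V f {..<m}"] Suc by fastforce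
    qed simp
    have bound: "AE \<epsilon> in steinhaus_seq. norm (v z \<epsilon>) \<le> B\<^sup>2"
      using AE_steinhaus_seq_norm
    proof eventually_elim
      case (elim \<epsilon>)
      have "vnorm V (S z \<epsilon>) \<le> (\<Sum>n<N. vnorm V (\<epsilon> n \<odot>\<^bsub>V\<^esub> z n))" unfolding S_def using z by (intro finsum_le) auto
      also have "\<dots> = B" unfolding B_def using z elim by (intro sum.cong) (auto simp: vnorm_smult)
      finally show ?case using vnorm_nonneg[OF S] by (simp add: v_def power_mono)
    qed
    show int_v: "integrable steinhaus_seq (v z)"
      by (rule steinhaus_seq.integrable_const_bound[OF bound meas])
    have q_le: "q z d \<epsilon> \<le> v z \<epsilon>" for d \<epsilon>
      using le[OF S, of d \<epsilon>] unfolding JS by (simp add: q_def v_def)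
    show "(\<integral>\<epsilon>. q z d \<epsilon> \<partial>steinhaus_seq) \<le> (\<integral>\<epsilon>. v z \<epsilon> \<partial>steinhaus_seq)"
      by (intro integral_mono int_q int_v q_le)
    show "(\<lambda>d. \<integral>\<epsilon>. q z d \<epsilon> \<partial>steinhaus_seq) \<longlonglongrightarrow> (\<integral>\<epsilon>. v z \<epsilon> \<partial>steinhaus_seq)"
    proof (rule integral_dominated_convergence[OF meas _ int_v])
      show "AE \<epsilon> in steinhaus_seq. norm (q z d \<epsilon>) \<le> v z \<epsilon>" for d
        using q_le nn by (intro AE_I2) (auto simp: q_def)
    qed (use int_q lim_q in auto)
  qed
  have sq: "sq_fun N (\<lambda>n. J (y n)) k \<le> sq_fun N (\<lambda>n. J (x n)) k" for k
    unfolding sq_fun_def using xy by (intro sum_mono power_mono) auto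
  have x: "\<And>n. n < N \<Longrightarrow> x n \<in> carrier V" and y: "\<And>n. n < N \<Longrightarrow> y n \<in> carrier V" using xy by auto
  have "(\<integral>\<epsilon>. q y d \<epsilon> \<partial>steinhaus_seq) \<le> c * c' * (\<integral>\<epsilon>. v x \<epsilon> \<partial>steinhaus_seq)" for d
  proof -
    have "(\<integral>\<epsilon>. q y d \<epsilon> \<partial>steinhaus_seq) \<le> c * Q d (sq_fun N (\<lambda>n. J (y n)))" unfolding q_def by (rule upper)
    also have "\<dots> \<le> c * Q d (sq_fun N (\<lambda>n. J (x n)))" using sq c by (intro mult_left_mono mono) auto
    also have "\<dots> \<le> c * (c' * (\<integral>\<epsilon>. q x d \<epsilon> \<partial>steinhaus_seq))"
      unfolding q_def using c by (intro mult_left_mono lower)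
    also have "\<dots> \<le> c * (c' * (\<integral>\<epsilon>. v x \<epsilon> \<partial>steinhaus_seq))" using c *(3)[OF x] by (intro mult_left_mono) auto
    finally show ?thesis by simp
  qed
  then have "(\<integral>\<epsilon>. v y \<epsilon> \<partial>steinhaus_seq) \<le> c * c' * (\<integral>\<epsilon>. v x \<epsilon> \<partial>steinhaus_seq)"
    by (intro LIMSEQ_le_const2[OF *(2)[OF y]]) auto
  then have "sqrt (\<integral>\<epsilon>. v y \<epsilon> \<partial>steinhaus_seq) \<le> sqrt (c * c') * sqrt (\<integral>\<epsilon>. v x \<epsilon> \<partial>steinhaus_seq)"
    by (simp flip: real_sqrt_mult)
  then show "rademacher_norm V N y \<le> sqrt (c * c') * rademacher_norm V N x"
    by (simp add: rademacher_norm_def v_def S_def steinhaus_seq_def)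
qed

section \<open>The tree space\<close>

lemma tendsto_tree_gauge:
  "(\<And>k. ((\<lambda>n. a n k) \<longlongrightarrow> b k) F) \<Longrightarrow> ((\<lambda>n. tree_gauge d (a n) h) \<longlongrightarrow> tree_gauge d b h) F"
  by (induction d arbitrary: h) (auto intro!: tendsto_intros)

definition abs_sq :: "(nat \<Rightarrow> complex) \<Rightarrow> nat \<Rightarrow> real" where
  "abs_sq x k = (cmod (x k))\<^sup>2"

lemma abs_sq_nonneg [simp]: "0 \<le> abs_sq x k"
  by (simp add: abs_sq_def)

definition tree_seq :: "(nat \<Rightarrow> complex) set" where
  "tree_seq = {x. x 0 = 0 \<and> bdd_above (range (\<lambda>d. tree_gauge d (abs_sq x) 1))}"

definition tree_norm :: "(nat \<Rightarrow> complex) \<Rightarrow> real" where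
  "tree_norm x = sqrt (SUP d. tree_gauge d (abs_sq x) 1)"

lemma tree_norm_sq:
  assumes "x \<in> tree_seq"
  shows "(tree_norm x)\<^sup>2 = (SUP d. tree_gauge d (abs_sq x) 1)"
proof -
  have "tree_gauge 0 (abs_sq x) 1 \<le> (SUP d. tree_gauge d (abs_sq x) 1)"
    using assms unfolding tree_seq_def by (intro cSUP_upper) auto
  then show ?thesis by (simp add: tree_norm_def)
qed

lemma tree_norm_nonneg: "x \<in> tree_seq \<Longrightarrow> 0 \<le> tree_norm x"
proof -
  assume "x \<in> tree_seq"
  then have "tree_gauge 0 (abs_sq x) 1 \<le> (SUP d. tree_gauge d (abs_sq x) 1)"
    unfolding tree_seq_def by (intro cSUP_upper) auto
  then show ?thesis by (simp add: tree_norm_def)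
qed

lemma tree_gauge_le_tree_norm: "x \<in> tree_seq \<Longrightarrow> tree_gauge d (abs_sq x) 1 \<le> (tree_norm x)\<^sup>2"
  using cSUP_upper[of d UNIV "\<lambda>d. tree_gauge d (abs_sq x) 1"] by (simp add: tree_norm_sq) (simp add: tree_seq_def)

lemma tree_norm_leI:
  assumes "x 0 = 0" "\<And>d. tree_gauge d (abs_sq x) 1 \<le> B\<^sup>2" "0 \<le> B"
  shows "x \<in> tree_seq" "tree_norm x \<le> B"
proof -
  show "x \<in> tree_seq"
    unfolding tree_seq_def mem_Collect_eq by (intro conjI bdd_aboveI2[of _ _ "B\<^sup>2"] assms)
  have "(SUP d. tree_gauge d (abs_sq x) 1) \<le> B\<^sup>2" using assms by (intro cSUP_least) auto
  then show "tree_norm x \<le> B" using assms(3) unfolding tree_norm_def by (intro real_le_lsqrt) 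
qed

lemma LIMSEQ_tree_norm:
  assumes "x \<in> tree_seq"
  shows "(\<lambda>d. tree_gauge d (abs_sq x) 1) \<longlonglongrightarrow> (tree_norm x)\<^sup>2"
  using assms unfolding tree_norm_sq[OF assms]
  by (intro LIMSEQ_incseq_SUP incseq_SucI tree_gauge_depth_mono) (simp add: tree_seq_def)

lemma cmod_le_tree_norm:
  assumes "x \<in> tree_seq"
  shows "cmod (x k) \<le> tree_norm x"
proof (cases "k = 0")
  case True
  then show ?thesis using assms tree_norm_nonneg[OF assms] by (simp add: tree_seq_def)
next
  case False
  have "abs_sq x k \<le> tree_gauge k (abs_sq x) 1" using False by (intro tree_gauge_ge_coord) auto
  also note tree_gauge_le_tree_norm[OF assms]
  finally show ?thesis using tree_norm_nonneg[OF assms] by (simp add: abs_sq_def power2_le_iff_abs_le)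
qed

lemma tree_seq_zero: "(\<lambda>k. 0) \<in> tree_seq" and tree_norm_zero: "tree_norm (\<lambda>k. 0) = 0"
proof -
  have *: "tree_gauge d (abs_sq (\<lambda>k. 0)) 1 \<le> 0\<^sup>2" for d by (simp add: tree_gauge_eq_0 abs_sq_def)
  show "(\<lambda>k. 0) \<in> tree_seq" by (rule tree_norm_leI(1)[OF _ *]) auto
  moreover have "tree_norm (\<lambda>k. 0) \<le> 0" by (rule tree_norm_leI(2)[OF _ *]) auto
  ultimately show "tree_norm (\<lambda>k. 0) = 0" using tree_norm_nonneg by fastforce
qed

lemma tree_norm_eq_0: "x \<in> tree_seq \<Longrightarrow> tree_norm x = 0 \<longleftrightarrow> x = (\<lambda>k. 0)"
  using cmod_le_tree_norm[of x] tree_norm_zero by auto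

text \<open>The triangle inequality for the root of a gauge of squares. The weighted inequality
  \<open>2 * a * b \<le> B / A * a ^ 2 + A / B * b ^ 2\<close> separates the two sequences, and with
  weights adapted to the bounds the gauges recombine to \<open>(A + B) ^ 2\<close>.\<close>

lemma tree_gauge_add_le:
  assumes "0 < A" "0 < B" "tree_gauge d (abs_sq x) h \<le> A\<^sup>2" "tree_gauge d (abs_sq y) h \<le> B\<^sup>2"
  shows "tree_gauge d (abs_sq (\<lambda>k. x k + y k)) h \<le> (A + B)\<^sup>2"
proof -
  have pt: "abs_sq (\<lambda>k. x k + y k) k \<le> (1 + B / A) * abs_sq x k + (1 + A / B) * abs_sq y k" for k
  proof -
    define a b where "a = cmod (x k)" and "b = cmod (y k)"
    have "abs_sq (\<lambda>k. x k + y k) k \<le> (a + b)\<^sup>2"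
      unfolding abs_sq_def a_def b_def by (intro power_mono norm_triangle_ineq) auto
    moreover have "2 * a * b \<le> B / A * a\<^sup>2 + A / B * b\<^sup>2"
    proof -
      have "0 \<le> (B * a - A * b)\<^sup>2 / (A * B)" using assms(1,2) by (intro divide_nonneg_pos) auto
      also have "(B * a - A * b)\<^sup>2 / (A * B) = B / A * a\<^sup>2 + A / B * b\<^sup>2 - 2 * a * b"
        using assms(1,2) by (simp add: field_simps power2_eq_square)
      finally show ?thesis by simp
    qed
    ultimately show ?thesis
      by (simp add: abs_sq_def power2_sum distrib_right flip: a_def b_def)
  qed
  have "tree_gauge d (abs_sq (\<lambda>k. x k + y k)) h
      \<le> tree_gauge d (\<lambda>k. (1 + B / A) * abs_sq x k + (1 + A / B) * abs_sq y k) h"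
    by (intro tree_gauge_mono pt) simp
  also have "\<dots> \<le> (1 + B / A) * tree_gauge d (abs_sq x) h + (1 + A / B) * tree_gauge d (abs_sq y) h"
    using assms(1,2) tree_gauge_subadditive[of "\<lambda>k. (1 + B / A) * abs_sq x k" "\<lambda>k. (1 + A / B) * abs_sq y k" d h]
    by (simp add: tree_gauge_scale)
  also have "\<dots> \<le> (1 + B / A) * A\<^sup>2 + (1 + A / B) * B\<^sup>2"
    using assms by (intro add_mono mult_left_mono) auto
  also have "\<dots> = (A + B)\<^sup>2" using assms(1,2) by (simp add: field_simps power2_eq_square)
  finally show ?thesis .
qed

lemma
  assumes x: "x \<in> tree_seq" and y: "y \<in> tree_seq"
  shows tree_seq_add: "(\<lambda>k. x k + y k) \<in> tree_seq"
    and tree_norm_triangle: "tree_norm (\<lambda>k. x k + y k) \<le> tree_norm x + tree_norm y"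
proof -
  have nn: "0 \<le> tree_norm x" "0 \<le> tree_norm y" using x y by (auto intro: tree_norm_nonneg)
  have 0: "(\<lambda>k. x k + y k) 0 = 0" using x y by (simp add: tree_seq_def)
  \<comment> \<open>The slack \<open>e\<close> makes both bounds positive, as the weights in
    \<open>tree_gauge_add_le\<close> require.\<close>
  have *: "tree_gauge d (abs_sq (\<lambda>k. x k + y k)) 1 \<le> (tree_norm x + tree_norm y + e)\<^sup>2" if "0 < e" for d e
  proof -
    have "tree_gauge d (abs_sq (\<lambda>k. x k + y k)) 1 \<le> ((tree_norm x + e / 2) + (tree_norm y + e / 2))\<^sup>2"
    proof (rule tree_gauge_add_le)
      show "tree_gauge d (abs_sq x) 1 \<le> (tree_norm x + e / 2)\<^sup>2"
        using nn that by (intro order_trans[OF tree_gauge_le_tree_norm[OF x]] power_mono) auto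
      show "tree_gauge d (abs_sq y) 1 \<le> (tree_norm y + e / 2)\<^sup>2"
        using nn that by (intro order_trans[OF tree_gauge_le_tree_norm[OF y]] power_mono) auto
    qed (use nn that in auto)
    then show ?thesis by (simp add: algebra_simps)
  qed
  show "(\<lambda>k. x k + y k) \<in> tree_seq" by (rule tree_norm_leI(1)[OF 0 *[of 1]]) (use nn in auto)
  show "tree_norm (\<lambda>k. x k + y k) \<le> tree_norm x + tree_norm y"
  proof (rule field_le_epsilon)
    fix e :: real assume e: "0 < e"
    show "tree_norm (\<lambda>k. x k + y k) \<le> tree_norm x + tree_norm y + e"
      by (rule tree_norm_leI(2)[OF 0 *[OF e]]) (use nn e in auto)
  qed
qed

lemma
  assumes x: "x \<in> tree_seq" and g: "\<And>k. cmod (g k) \<le> cmod (x k)"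
  shows tree_seq_solid: "g \<in> tree_seq" and tree_norm_mono: "tree_norm g \<le> tree_norm x"
proof -
  have "g 0 = 0" using g[of 0] x by (simp add: tree_seq_def)
  moreover have "tree_gauge d (abs_sq g) 1 \<le> (tree_norm x)\<^sup>2" for d
    using g by (intro order_trans[OF tree_gauge_mono tree_gauge_le_tree_norm[OF x]]) (auto simp: abs_sq_def intro!: power_mono)
  ultimately show "g \<in> tree_seq" "tree_norm g \<le> tree_norm x"
    using tree_norm_leI[of g] tree_norm_nonneg[OF x] by auto
qed

lemma
  assumes x: "x \<in> tree_seq"
  shows tree_seq_scale: "(\<lambda>k. c * x k) \<in> tree_seq"
    and tree_norm_scale: "tree_norm (\<lambda>k. c * x k) = cmod c * tree_norm x"
proof -
  have eq: "tree_gauge d (abs_sq (\<lambda>k. c * x k)) 1 = (cmod c)\<^sup>2 * tree_gauge d (abs_sq x) 1" for d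
  proof -
    have "abs_sq (\<lambda>k. c * x k) = (\<lambda>k. (cmod c)\<^sup>2 * abs_sq x k)"
      by (simp add: abs_sq_def fun_eq_iff norm_mult power_mult_distrib)
    then show ?thesis by (simp only: tree_gauge_scale[OF zero_le_power2])
  qed
  show c: "(\<lambda>k. c * x k) \<in> tree_seq"
  proof (rule tree_norm_leI(1)[where B = "cmod c * tree_norm x"])
    show "tree_gauge d (abs_sq (\<lambda>k. c * x k)) 1 \<le> (cmod c * tree_norm x)\<^sup>2" for d
      unfolding eq power_mult_distrib using tree_gauge_le_tree_norm[OF x] by (intro mult_left_mono) auto
  qed (use x tree_norm_nonneg[OF x] in \<open>auto simp: tree_seq_def\<close>)
  have "(\<lambda>d. (cmod c)\<^sup>2 * tree_gauge d (abs_sq x) 1) \<longlonglongrightarrow> (tree_norm (\<lambda>k. c * x k))\<^sup>2"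
    using LIMSEQ_tree_norm[OF c] unfolding eq .
  moreover have "(\<lambda>d. (cmod c)\<^sup>2 * tree_gauge d (abs_sq x) 1) \<longlonglongrightarrow> (cmod c)\<^sup>2 * (tree_norm x)\<^sup>2"
    by (intro tendsto_mult_left LIMSEQ_tree_norm x)
  ultimately have "(tree_norm (\<lambda>k. c * x k))\<^sup>2 = (cmod c * tree_norm x)\<^sup>2"
    unfolding power_mult_distrib by (rule LIMSEQ_unique)
  then show "tree_norm (\<lambda>k. c * x k) = cmod c * tree_norm x"
    by (rule power2_eq_imp_eq) (simp_all add: tree_norm_nonneg x c)
qed

lemma tree_seq_finite_support:
  assumes "x 0 = 0" "\<And>k. 2 ^ K \<le> k \<Longrightarrow> x k = 0"
  shows "x \<in> tree_seq" "(tree_norm x)\<^sup>2 = tree_gauge K (abs_sq x) 1"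
proof -
  have eq: "tree_gauge (K + j) (abs_sq x) 1 = tree_gauge K (abs_sq x) 1" for j
    using assms(2) by (intro tree_gauge_depth_stable) (auto simp: abs_sq_def)
  have inc: "incseq (\<lambda>d. tree_gauge d (abs_sq x) 1)" by (intro incseq_SucI tree_gauge_depth_mono)
  have le: "tree_gauge d (abs_sq x) 1 \<le> (sqrt (tree_gauge K (abs_sq x) 1))\<^sup>2" for d
    using incseqD[OF inc, of d "K + d"] eq[of d] by simp
  show x: "x \<in> tree_seq" by (rule tree_norm_leI(1)[OF assms(1) le]) simp
  have "(tree_norm x)\<^sup>2 \<le> (sqrt (tree_gauge K (abs_sq x) 1))\<^sup>2"
    by (intro power_mono tree_norm_leI(2)[OF assms(1) le] tree_norm_nonneg[OF x]) simp
  then show "(tree_norm x)\<^sup>2 = tree_gauge K (abs_sq x) 1"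
    using tree_gauge_le_tree_norm[OF x, of K] by simp
qed

text \<open>A Fatou argument: the limit is taken coordinatewise, and each gauge of finite depth is
  continuous in the coordinates, so Cauchy bounds pass to the limit at every depth.\<close>

lemma tree_seq_complete:
  assumes u: "\<And>n. u n \<in> tree_seq"
    and cauchy: "\<And>e. 0 < e \<Longrightarrow> \<exists>N. \<forall>m\<ge>N. \<forall>n\<ge>N. tree_norm (\<lambda>k. u m k - u n k) < e"
  shows "\<exists>l\<in>tree_seq. (\<lambda>n. tree_norm (\<lambda>k. u n k - l k)) \<longlonglongrightarrow> 0"
proof -
  have diff: "(\<lambda>k. x k - y k) \<in> tree_seq" if "x \<in> tree_seq" "y \<in> tree_seq" for x y
    using tree_seq_add[OF that(1) tree_seq_scale[OF that(2), of "- 1"]] by simp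
  have "Cauchy (\<lambda>n. u n k)" for k
  proof (rule metric_CauchyI)
    fix e :: real assume "0 < e"
    then obtain N where N: "\<forall>m\<ge>N. \<forall>n\<ge>N. tree_norm (\<lambda>k. u m k - u n k) < e" using cauchy by blast
    show "\<exists>N. \<forall>m\<ge>N. \<forall>n\<ge>N. dist (u m k) (u n k) < e"
    proof (intro exI allI impI)
      fix m n assume "N \<le> m" "N \<le> n"
      then have "tree_norm (\<lambda>k. u m k - u n k) < e" using N by blast
      then show "dist (u m k) (u n k) < e"
        using cmod_le_tree_norm[OF diff[OF u[of m] u[of n]], of k] by (simp add: dist_norm)
    qed
  qed
  then have "\<forall>k. \<exists>l. (\<lambda>n. u n k) \<longlonglongrightarrow> l" using Cauchy_convergent convergent_def by blast
  then obtain l where l: "(\<lambda>n. u n k) \<longlonglongrightarrow> l k" for k by metis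
  have l0: "l 0 = 0" using l[of 0] u by (simp add: tree_seq_def LIMSEQ_const_iff)
  have near: "\<exists>N. \<forall>n\<ge>N. (\<lambda>k. u n k - l k) \<in> tree_seq \<and> tree_norm (\<lambda>k. u n k - l k) \<le> e" if e: "0 < e" for e
  proof -
    obtain N where N: "\<forall>m\<ge>N. \<forall>n\<ge>N. tree_norm (\<lambda>k. u m k - u n k) < e" using cauchy[OF e] by blast
    have "(\<lambda>k. u n k - l k) \<in> tree_seq \<and> tree_norm (\<lambda>k. u n k - l k) \<le> e" if n: "N \<le> n" for n
    proof -
      have le: "tree_gauge d (abs_sq (\<lambda>k. u n k - l k)) 1 \<le> e\<^sup>2" for d
      proof (rule LIMSEQ_le_const2)
        show "(\<lambda>m. tree_gauge d (abs_sq (\<lambda>k. u n k - u m k)) 1) \<longlonglongrightarrow> tree_gauge d (abs_sq (\<lambda>k. u n k - l k)) 1"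
          unfolding abs_sq_def[abs_def] by (intro tendsto_tree_gauge tendsto_intros l)
        have "tree_gauge d (abs_sq (\<lambda>k. u n k - u m k)) 1 \<le> e\<^sup>2" if "N \<le> m" for m
        proof (rule order_trans[OF tree_gauge_le_tree_norm[OF diff[OF u u]] power_mono])
          show "tree_norm (\<lambda>k. u n k - u m k) \<le> e" using N n that by (intro less_imp_le) blast
        qed (rule tree_norm_nonneg[OF diff[OF u u]])
        then show "\<exists>N. \<forall>m\<ge>N. tree_gauge d (abs_sq (\<lambda>k. u n k - u m k)) 1 \<le> e\<^sup>2" by blast
      qed
      have "u n 0 - l 0 = 0" using u[of n] l0 by (simp add: tree_seq_def)
      then show ?thesis using tree_norm_leI[of "\<lambda>k. u n k - l k", OF _ le] e by simp
    qed
    then show ?thesis by blast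
  qed
  obtain N where "(\<lambda>k. u N k - l k) \<in> tree_seq" using near[of 1] by auto
  then have "l \<in> tree_seq" using diff[OF u[of N], of "\<lambda>k. u N k - l k"] by simp
  moreover have "(\<lambda>n. tree_norm (\<lambda>k. u n k - l k)) \<longlonglongrightarrow> 0"
  proof (rule LIMSEQ_I)
    fix r :: real assume r: "0 < r"
    obtain N where N: "\<forall>n\<ge>N. (\<lambda>k. u n k - l k) \<in> tree_seq \<and> tree_norm (\<lambda>k. u n k - l k) \<le> r / 2"
      using near[of "r / 2"] r by auto
    show "\<exists>N. \<forall>n\<ge>N. norm (tree_norm (\<lambda>k. u n k - l k) - 0) < r"
    proof (intro exI allI impI)
      fix n assume "N \<le> n"
      then have "(\<lambda>k. u n k - l k) \<in> tree_seq" "tree_norm (\<lambda>k. u n k - l k) \<le> r / 2" using N by blast+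
      then show "norm (tree_norm (\<lambda>k. u n k - l k) - 0) < r" using tree_norm_nonneg r by fastforce
    qed
  qed
  ultimately show ?thesis by blast
qed

text \<open>Once the head of \<open>x\<close> has a gauge close to the limit \<open>L\<close>,
  \<open>tree_gauge_sq_superadditive\<close> leaves for the tail only the difference of the
  squares.\<close>

lemma tree_norm_tail:
  assumes x: "x \<in> tree_seq" and e: "0 < e"
  shows "\<exists>K. tree_norm (\<lambda>k. if k < K then 0 else x k) < e"
proof -
  define L where "L = (tree_norm x)\<^sup>2"
  have lim: "(\<lambda>d. (tree_gauge d (abs_sq x) 1)\<^sup>2) \<longlonglongrightarrow> L\<^sup>2"
    unfolding L_def by (intro tendsto_power LIMSEQ_tree_norm x)
  \<comment> \<open>The gauge is already a squared norm and the lower estimate squares it again,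
    hence the fourth power of \<open>e / 2\<close>.\<close>
  have "eventually (\<lambda>d. L\<^sup>2 - ((e / 2)\<^sup>2)\<^sup>2 < (tree_gauge d (abs_sq x) 1)\<^sup>2) sequentially"
    by (rule order_tendstoD(1)[OF lim]) (use e in simp)
  then obtain d where d: "L\<^sup>2 - ((e / 2)\<^sup>2)\<^sup>2 < (tree_gauge d (abs_sq x) 1)\<^sup>2"
    by (meson eventually_sequentially order_refl)
  define t where "t = (\<lambda>k. if k < 2 ^ d then 0 else x k)"
  define s where "s = (\<lambda>k. if k < 2 ^ d then x k else 0)"
  have t0: "t 0 = 0" by (simp add: t_def)
  have inc: "incseq (\<lambda>d. tree_gauge d a 1)" for a by (intro incseq_SucI tree_gauge_depth_mono)
  have "tree_gauge j (abs_sq t) 1 \<le> (e / 2)\<^sup>2" for j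
  proof -
    let ?j = "d + j"
    have "(tree_gauge ?j (abs_sq s) 1)\<^sup>2 + (tree_gauge ?j (abs_sq t) 1)\<^sup>2
        \<le> (tree_gauge ?j (\<lambda>k. abs_sq s k + abs_sq t k) 1)\<^sup>2"
      by (rule tree_gauge_sq_superadditive) simp_all
    also have "(\<lambda>k. abs_sq s k + abs_sq t k) = abs_sq x" by (auto simp: s_def t_def abs_sq_def)
    also have "(tree_gauge ?j (abs_sq x) 1)\<^sup>2 \<le> L\<^sup>2"
      unfolding L_def by (intro power_mono tree_gauge_le_tree_norm x) simp
    finally have 1: "(tree_gauge ?j (abs_sq s) 1)\<^sup>2 + (tree_gauge ?j (abs_sq t) 1)\<^sup>2 \<le> L\<^sup>2" .
    have "tree_gauge d (abs_sq x) 1 = tree_gauge d (abs_sq s) 1"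
      by (rule tree_gauge_cong_root) (simp add: s_def abs_sq_def)
    also have "\<dots> \<le> tree_gauge ?j (abs_sq s) 1" by (rule incseqD[OF inc]) simp
    finally have "(tree_gauge d (abs_sq x) 1)\<^sup>2 \<le> (tree_gauge ?j (abs_sq s) 1)\<^sup>2" by (rule power_mono) simp
    then have "(tree_gauge ?j (abs_sq t) 1)\<^sup>2 \<le> ((e / 2)\<^sup>2)\<^sup>2" using 1 d by linarith
    then have "tree_gauge ?j (abs_sq t) 1 \<le> (e / 2)\<^sup>2" by (rule power2_le_imp_le) simp
    moreover have "tree_gauge j (abs_sq t) 1 \<le> tree_gauge ?j (abs_sq t) 1" by (rule incseqD[OF inc]) simp
    ultimately show ?thesis by linarith
  qed
  then have "tree_norm t \<le> e / 2" using e by (intro tree_norm_leI(2) t0) auto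
  then show ?thesis using e unfolding t_def by (intro exI[of _ "2 ^ d"]) linarith
qed

section \<open>Realisation as a Banach function space\<close>

text \<open>The nodes are encoded as real numbers to fit the type of the measure in the theorem.
  Every subset is measurable and every point is an atom, so a class is determined by its values at
  the positive integers.\<close>

definition node_measure :: "real measure" where
  "node_measure = count_space (real ` {1..})"

definition seq_class :: "(nat \<Rightarrow> complex) \<Rightarrow> (real \<Rightarrow> complex) set" where
  "seq_class x = ae_class node_measure (\<lambda>s. x (nat \<lfloor>s\<rfloor>))"

text \<open>The choice of a representative is harmless since every point of \<open>node_measure\<close> is an atom.\<close>

definition class_coord :: "(real \<Rightarrow> complex) set \<Rightarrow> nat \<Rightarrow> complex" where
  "class_coord c k = (if k = 0 then 0 else (SOME g. g \<in> c) (real k))"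

lemma ae_class_node_measure: "ae_class node_measure f = {g. \<forall>k\<ge>1. g (real k) = f (real k)}"
  by (auto simp: ae_class_def node_measure_def AE_count_space)

lemma class_coord_ae_class:
  "class_coord (ae_class node_measure f) = (\<lambda>k. if k = 0 then 0 else f (real k))"
proof -
  have "(SOME g. g \<in> ae_class node_measure f) \<in> ae_class node_measure f"
    by (rule someI[of _ f]) (simp add: ae_class_node_measure)
  then show ?thesis by (auto simp: ae_class_node_measure class_coord_def)
qed

lemma seq_class_class_coord: "seq_class (class_coord (ae_class node_measure f)) = ae_class node_measure f"
  unfolding class_coord_ae_class by (simp add: seq_class_def ae_class_node_measure)

lemma class_coord_seq_class: "x 0 = 0 \<Longrightarrow> class_coord (seq_class x) = x"
  unfolding seq_class_def class_coord_ae_class by auto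

definition tree_space :: "(real \<Rightarrow> complex) set cnormed" where
  "tree_space = \<lparr>carrier = seq_class ` tree_seq, monoid.mult = undefined, one = undefined,
     ring.zero = seq_class (\<lambda>k. 0), add = (\<lambda>c d. seq_class (\<lambda>k. class_coord c k + class_coord d k)),
     smult = (\<lambda>a c. seq_class (\<lambda>k. a * class_coord c k)), vnorm = (\<lambda>c. tree_norm (class_coord c))\<rparr>"

lemma tree_space_simps:
  "carrier tree_space = seq_class ` tree_seq" "\<zero>\<^bsub>tree_space\<^esub> = seq_class (\<lambda>k. 0)"
  "c \<oplus>\<^bsub>tree_space\<^esub> d = seq_class (\<lambda>k. class_coord c k + class_coord d k)"
  "a \<odot>\<^bsub>tree_space\<^esub> c = seq_class (\<lambda>k. a * class_coord c k)"
  "vnorm tree_space c = tree_norm (class_coord c)"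
  by (simp_all add: tree_space_def)

lemma tree_seq_0: "x \<in> tree_seq \<Longrightarrow> x 0 = 0"
  by (simp add: tree_seq_def)

lemma class_coord_seq_class' [simp]: "x \<in> tree_seq \<Longrightarrow> class_coord (seq_class x) = x"
  by (rule class_coord_seq_class[OF tree_seq_0])

lemma cnormed_tree_space: "cnormed_space tree_space"
proof (rule cnormed_space.intro)
  have "abelian_group tree_space"
  proof (rule abelian_groupI)
    fix c assume "c \<in> carrier tree_space"
    then obtain x where x: "x \<in> tree_seq" "c = seq_class x" by (auto simp: tree_space_simps)
    show "\<exists>d\<in>carrier tree_space. d \<oplus>\<^bsub>tree_space\<^esub> c = \<zero>\<^bsub>tree_space\<^esub>"
      using x tree_seq_scale[OF x(1), of "- 1"]
      by (intro bexI[of _ "seq_class (\<lambda>k. - 1 * x k)"]) (auto simp: tree_space_simps)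
  qed (auto simp: tree_space_simps tree_seq_zero tree_seq_add ac_simps)
  then show "module complex_field tree_space"
    by (intro moduleI cring_complex_field)
      (auto simp: tree_space_simps tree_seq_add tree_seq_scale algebra_simps)
  show "cnormed_space_axioms tree_space"
  proof
    fix c assume "c \<in> carrier tree_space"
    then obtain x where x: "x \<in> tree_seq" "c = seq_class x" by (auto simp: tree_space_simps)
    show "vnorm tree_space c = 0 \<longleftrightarrow> c = \<zero>\<^bsub>tree_space\<^esub>"
      using tree_norm_eq_0[OF x(1)] class_coord_seq_class'[OF x(1)] class_coord_seq_class'[OF tree_seq_zero]
      unfolding x(2) tree_space_simps by metis
  qed (auto simp: tree_space_simps tree_norm_nonneg tree_seq_add tree_norm_triangle tree_seq_scale tree_norm_scale)
qed

lemma cbanach_tree_space: "cbanach_space tree_space"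
proof -
  interpret X: cnormed_space tree_space by (rule cnormed_tree_space)
  show ?thesis
  proof
    fix u :: "nat \<Rightarrow> (real \<Rightarrow> complex) set"
    assume u: "\<And>n. u n \<in> carrier tree_space"
      and cauchy: "\<And>e. 0 < e \<Longrightarrow> \<exists>N. \<forall>m\<ge>N. \<forall>n\<ge>N. vnorm tree_space (u m \<ominus>\<^bsub>tree_space\<^esub> u n) < e"
    have "\<exists>x\<in>tree_seq. u n = seq_class x" for n using u[of n] by (auto simp: tree_space_simps)
    then obtain x where x: "\<And>n. x n \<in> tree_seq" "\<And>n. u n = seq_class (x n)" by metis
    have minus: "vnorm tree_space (seq_class y \<ominus>\<^bsub>tree_space\<^esub> seq_class z) = tree_norm (\<lambda>k. y k - z k)"
      if "y \<in> tree_seq" "z \<in> tree_seq" for y z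
    proof -
      have "seq_class y \<ominus>\<^bsub>tree_space\<^esub> seq_class z = seq_class y \<oplus>\<^bsub>tree_space\<^esub> (- 1) \<odot>\<^bsub>tree_space\<^esub> seq_class z"
        using that by (simp add: a_minus_def X.neg_eq_smult tree_space_simps(1))
      then show ?thesis
        using that tree_seq_scale[OF that(2), of "- 1"] tree_seq_add[OF that(1) tree_seq_scale[OF that(2), of "- 1"]]
        by (simp add: tree_space_simps)
    qed
    obtain l where l: "l \<in> tree_seq" "(\<lambda>n. tree_norm (\<lambda>k. x n k - l k)) \<longlonglongrightarrow> 0"
      using tree_seq_complete[of x, OF x(1) cauchy[unfolded x(2) minus[OF x(1) x(1)]]] by blast
    then show "\<exists>l\<in>carrier tree_space. (\<lambda>n. vnorm tree_space (u n \<ominus>\<^bsub>tree_space\<^esub> l)) \<longlonglongrightarrow> 0"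
      by (intro bexI[of _ "seq_class l"]) (simp_all add: x minus tree_space_simps(1))
  qed
qed

lemma ae_class_in_tree_space:
  "ae_class node_measure f \<in> carrier tree_space \<longleftrightarrow> (\<lambda>k. if k = 0 then 0 else f (real k)) \<in> tree_seq"
proof
  assume "ae_class node_measure f \<in> carrier tree_space"
  then obtain x where x: "x \<in> tree_seq" "ae_class node_measure f = seq_class x" by (auto simp: tree_space_simps)
  then have "class_coord (ae_class node_measure f) \<in> tree_seq" by simp
  then show "(\<lambda>k. if k = 0 then 0 else f (real k)) \<in> tree_seq" by (simp only: class_coord_ae_class)
next
  assume "(\<lambda>k. if k = 0 then 0 else f (real k)) \<in> tree_seq"
  then have "class_coord (ae_class node_measure f) \<in> tree_seq" by (simp only: class_coord_ae_class)
  then have "seq_class (class_coord (ae_class node_measure f)) \<in> carrier tree_space" by (simp add: tree_space_simps)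
  then show "ae_class node_measure f \<in> carrier tree_space" by (simp only: seq_class_class_coord)
qed

lemma banach_function_space_tree_space: "banach_function_space node_measure tree_space"
  unfolding banach_function_space_def
proof (intro conjI ballI allI impI)
  show "sigma_finite_measure node_measure"
    unfolding node_measure_def by (intro sigma_finite_measure_count_space_countable) simp
  show "cbanach_space tree_space" by (rule cbanach_tree_space)
  show "carrier tree_space \<subseteq> ae_class node_measure ` borel_measurable node_measure"
    by (auto simp: tree_space_simps seq_class_def node_measure_def)
next
  fix f g
  show "ae_class node_measure f \<oplus>\<^bsub>tree_space\<^esub> ae_class node_measure g = ae_class node_measure (\<lambda>s. f s + g s)"
    unfolding tree_space_simps class_coord_ae_class by (simp add: seq_class_def ae_class_node_measure)
next
  fix c f
  show "c \<odot>\<^bsub>tree_space\<^esub> ae_class node_measure f = ae_class node_measure (\<lambda>s. c * f s)"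
    unfolding tree_space_simps class_coord_ae_class by (simp add: seq_class_def ae_class_node_measure)
next
  fix f g
  assume f: "ae_class node_measure f \<in> carrier tree_space" and le: "AE s in node_measure. cmod (g s) \<le> cmod (f s)"
  have le': "cmod (if k = 0 then 0 else g (real k)) \<le> cmod (if k = 0 then 0 else f (real k))" for k
    using le[unfolded node_measure_def AE_count_space] by (cases "k = 0") auto
  have f': "(\<lambda>k. if k = 0 then 0 else f (real k)) \<in> tree_seq" using f by (simp add: ae_class_in_tree_space)
  show "ae_class node_measure g \<in> carrier tree_space"
    unfolding ae_class_in_tree_space by (rule tree_seq_solid[OF f' le'])
  show "vnorm tree_space (ae_class node_measure g) \<le> vnorm tree_space (ae_class node_measure f)"
    unfolding tree_space_simps class_coord_ae_class by (rule tree_norm_mono[OF f' le'])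
next
  fix E assume E: "E \<in> sets node_measure" "emeasure node_measure E > 0"
  then have "E \<noteq> {}" by auto
  then obtain k where k: "real k \<in> E" "1 \<le> k" using E(1) by (auto simp: node_measure_def)
  have "ae_class node_measure (indicator {real k}) \<in> carrier tree_space"
    unfolding ae_class_in_tree_space
  proof (rule tree_seq_finite_support(1)[of _ k])
    fix i :: nat assume "2 ^ k \<le> i"
    then have "k < i" using less_exp[of k] by (rule less_le_trans[rotated])
    then show "(if i = 0 then 0 else indicator {real k} (real i)) = (0 :: complex)" by simp
  qed simp
  moreover have "{real k} \<in> sets node_measure" "emeasure node_measure {real k} > 0"
    using k by (auto simp: node_measure_def emeasure_count_space)
  ultimately show "\<exists>F\<in>sets node_measure. F \<subseteq> E \<and> emeasure node_measure F > 0 \<and>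
      ae_class node_measure (indicator F) \<in> carrier tree_space"
    using k(1) by (intro bexI[of _ "{real k}"]) auto
qed

lemma coord_space_tree_space: "coord_space tree_space class_coord"
proof -
  interpret cnormed_space tree_space by (rule cnormed_tree_space)
  show ?thesis by unfold_locales (auto simp: tree_space_simps tree_seq_add tree_seq_scale)
qed

lemma carrier_tree_spaceE:
  assumes "c \<in> carrier tree_space"
  obtains "class_coord c \<in> tree_seq" "c = seq_class (class_coord c)" "vnorm tree_space c = tree_norm (class_coord c)"
  using assms by (auto simp: tree_space_simps)

lemma diag_space_tree_space: "diag_space tree_space class_coord"
proof -
  interpret coord_space tree_space class_coord by (rule coord_space_tree_space)
  show ?thesis
  proof
    fix c d assume "c \<in> carrier tree_space" "d \<in> carrier tree_space" "class_coord c = class_coord d"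
    then show "c = d" by (metis carrier_tree_spaceE)
  next
    fix c assume "c \<in> carrier tree_space"
    then show "class_coord c 0 = 0" by (simp add: class_coord_def)
  next
    fix c g assume c: "c \<in> carrier tree_space" and g: "\<And>k. cmod (g k) \<le> cmod (class_coord c k)"
    have c': "class_coord c \<in> tree_seq" by (rule carrier_tree_spaceE[OF c])
    show "\<exists>d\<in>carrier tree_space. class_coord d = g \<and> vnorm tree_space d \<le> vnorm tree_space c"
      using tree_seq_solid[OF c' g] tree_norm_mono[OF c' g]
      by (intro bexI[of _ "seq_class g"]) (auto simp: tree_space_simps)
  next
    fix k :: nat assume k: "1 \<le> k"
    have "(\<lambda>i. if i = k then 1 else 0) \<in> tree_seq"
    proof (rule tree_seq_finite_support(1)[of _ k])
      fix i :: nat assume "2 ^ k \<le> i"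
      then have "k < i" using less_exp[of k] by (rule less_le_trans[rotated])
      then show "(if i = k then 1 else 0) = (0 :: complex)" by simp
    qed (use k in simp)
    then show "\<exists>e\<in>carrier tree_space. class_coord e = (\<lambda>i. if i = k then 1 else 0)"
      by (intro bexI[of _ "seq_class (\<lambda>i. if i = k then 1 else 0)"]) (auto simp: tree_space_simps)
  next
    fix c and e :: real assume c: "c \<in> carrier tree_space" and e: "0 < e"
    have c': "class_coord c \<in> tree_seq" by (rule carrier_tree_spaceE[OF c])
    obtain K where K: "tree_norm (\<lambda>k. if k < K then 0 else class_coord c k) < e" using tree_norm_tail[OF c' e] by blast
    show "\<exists>K. \<forall>y\<in>carrier tree_space. (\<forall>k. class_coord y k = (if k < K then 0 else class_coord c k)) \<longrightarrow> vnorm tree_space y < e"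
    proof (intro exI ballI impI)
      fix y assume "\<forall>k. class_coord y k = (if k < K then 0 else class_coord c k)"
      then have "class_coord y = (\<lambda>k. if k < K then 0 else class_coord c k)" by blast
      then show "vnorm tree_space y < e" using K by (simp add: tree_space_simps)
    qed
  next
    show "\<exists>C. \<forall>N x y. (\<forall>n<N. x n \<in> carrier tree_space \<and> y n \<in> carrier tree_space \<and>
        (\<forall>k. cmod (class_coord (y n) k) \<le> cmod (class_coord (x n) k))) \<longrightarrow>
      rademacher_norm tree_space N y \<le> C * rademacher_norm tree_space N x"
    proof (rule rademacher_domination[where Q = "\<lambda>d a. tree_gauge d a 1" and c = "sqrt 2" and c' = 1])
      fix c assume c: "c \<in> carrier tree_space"
      have c': "class_coord c \<in> tree_seq" by (rule carrier_tree_spaceE[OF c])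
      show "(\<lambda>d. tree_gauge d (\<lambda>k. cmod (class_coord c k) ^ 2) 1) \<longlonglongrightarrow> (vnorm tree_space c)\<^sup>2"
        using LIMSEQ_tree_norm[OF c'] by (simp add: abs_sq_def[abs_def] tree_space_simps)
      show "tree_gauge d (\<lambda>k. cmod (class_coord c k) ^ 2) 1 \<le> (vnorm tree_space c)\<^sup>2" for d
        using tree_gauge_le_tree_norm[OF c', of d] by (simp add: abs_sq_def[abs_def] tree_space_simps)
    next
      show "tree_gauge d (sq_fun N x) 1 \<le> 1 * (\<integral>\<epsilon>. tree_gauge d (rad_sq N x \<epsilon>) 1 \<partial>steinhaus_seq)" for d N x
        using tree_gauge_sq_fun_le[of d N x 1] by simp
    qed (rule tree_gauge_nonneg integrable_tree_gauge integral_tree_gauge_le | simp add: tree_gauge_mono)+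
  qed
qed

section \<open>Norms of the test functions in the tree space\<close>

lemma node_inj:
  assumes t: "0 \<le> t" "t < 1" and eq: "node i t = node j t"
  shows "i = j"
proof -
  have "\<not> i < j" if "node i t = node j t" for i j
  proof
    assume "i < j"
    then have "(2 :: nat) ^ Suc i \<le> 2 ^ j" by (intro power_increasing) auto
    then show False using node_bounds(2)[OF t, of i] node_bounds(1)[OF t, of j] that by linarith
  qed
  then show ?thesis using eq by (metis nat_neq_iff)
qed

text \<open>On a branch only l^2-sums occur, and at most \<open>n\<close> levels carry an entry
  bounded by 1. In the norm of \<open>X\<close> this becomes \<open>n powr (1 / 4)\<close>.\<close>

lemma tree_gauge_chain_le:
  assumes t: "0 \<le> t" "t < 1"
    and a: "\<And>k. 0 \<le> a k" "\<And>k. a k \<le> 1" and supp: "\<And>k. a k \<noteq> 0 \<Longrightarrow> \<exists>i\<in>{m<..m + n}. k = node i t"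
  shows "tree_gauge d a 1 \<le> sqrt n"
proof -
  have n0: "node 0 t = 1" using node_bounds[OF t, of 0] by simp
  have "(tree_gauge d a (node 0 t))\<^sup>2 = (\<Sum>i\<in>{0..<0 + d}. (a (node i t))\<^sup>2)"
  proof (rule tree_gauge_path)
    show "k \<in> range (\<lambda>i. node i t)" if "a k \<noteq> 0" for k using supp[OF that] by blast
  qed (rule node_Suc_div[OF t(1)] node_bounds[OF t])+
  also have "\<dots> \<le> (\<Sum>i\<in>{0..<0 + d}. if i \<in> {m<..m + n} then 1 else 0)"
  proof (rule sum_mono)
    fix i
    show "(a (node i t))\<^sup>2 \<le> (if i \<in> {m<..m + n} then 1 else 0)"
    proof (cases "a (node i t) = 0")
      case False
      then obtain j where j: "j \<in> {m<..m + n}" "node i t = node j t" using supp by blast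
      then have "i \<in> {m<..m + n}" using node_inj[OF t j(2)] by simp
      moreover have "(a (node i t))\<^sup>2 \<le> 1" using a by (intro power_le_one) auto
      ultimately show ?thesis by simp
    qed simp
  qed
  also have "\<dots> = real (card ({0..<0 + d} \<inter> {m<..m + n}))" by (auto simp: sum.If_cases intro!: arg_cong[where f = card])
  also have "\<dots> \<le> real (card {m<..m + n})" by (intro of_nat_mono card_mono) auto
  finally have "(tree_gauge d a 1)\<^sup>2 \<le> real n" by (simp add: n0)
  then show ?thesis by (intro real_le_rsqrt)
qed

lemma card_odd_levels_le: "card (odd_levels {m<..m + n} t) \<le> n"
proof -
  have "card (odd_levels {m<..m + n} t) \<le> card {m<..m + n}"
    by (intro card_mono) (auto simp: odd_levels_def)
  then show ?thesis by simp
qed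

text \<open>Siblings give a count bounded by the square of the norm, whereas
  \<open>max_reg_test\<close> asks for a bound linear in the norm; the trivial bound
  \<open>r \<le> n\<close> mediates.\<close>

lemma card_sq_le:
  assumes "r \<le> n" "real r \<le> x\<^sup>2" "0 \<le> x"
  shows "real r \<le> sqrt n * x"
proof -
  have "sqrt r \<le> x" using assms by (intro real_le_lsqrt) auto
  then have "sqrt r * sqrt r \<le> sqrt n * x" using assms by (intro mult_mono) auto
  then show ?thesis by simp
qed

lemma powr_quarter: "(real n powr (1 / 4))\<^sup>2 = sqrt n" "1 \<le> n \<Longrightarrow> real n powr (1 / 4) * sqrt n = real n powr (3 / 4)"
proof -
  show "(real n powr (1 / 4))\<^sup>2 = sqrt n"
  proof (cases "n = 0")
    case False
    then show ?thesis by (simp add: powr_half_sqrt[symmetric] power2_eq_square flip: powr_add)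
  qed simp
  show "1 \<le> n \<Longrightarrow> real n powr (1 / 4) * sqrt n = real n powr (3 / 4)"
    by (simp add: powr_half_sqrt[symmetric] flip: powr_add)
qed

lemma max_reg_test_tree_space:
  "max_reg_test tree_space class_coord 0 (\<lambda>n. real n powr (1 / 4)) sqrt"
proof -
  interpret diag_space tree_space class_coord by (rule diag_space_tree_space)
  show ?thesis
  proof
    fix m n t v
    assume t: "0 \<le> t" "t < 1" and v: "v \<in> carrier tree_space"
      "class_coord v = (\<lambda>k. of_real (in_coord 0 {m<..m + n} t k))"
    have sq: "abs_sq (class_coord v) = in_coord 0 {m<..m + n} t"
      unfolding v(2) by (auto simp: abs_sq_def in_coord_def)
    have "tree_norm (class_coord v) \<le> real n powr (1 / 4)"
    proof (rule tree_norm_leI(2))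
      show "class_coord v 0 = 0" by (rule J_index0[OF v(1)])
      show "tree_gauge d (abs_sq (class_coord v)) 1 \<le> (real n powr (1 / 4))\<^sup>2" for d
        unfolding sq powr_quarter(1)
        by (rule tree_gauge_chain_le[OF t, where m = m]) (auto simp: in_coord_def split: if_splits)
    qed simp
    then show "vnorm tree_space v \<le> real n powr (1 / 4)" by (simp add: tree_space_simps)
  next
    fix m n t v
    assume t: "0 \<le> t" "t < 1" and v: "v \<in> carrier tree_space"
      "class_coord v = (\<lambda>k. of_real (out_coord 0 {m<..m + n} t k))"
    have v': "class_coord v \<in> tree_seq" by (rule carrier_tree_spaceE[OF v(1)])
    have sq: "abs_sq (class_coord v) = out_coord 0 {m<..m + n} t"
      unfolding v(2) by (auto simp: abs_sq_def out_coord_def)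
    have n0: "node 0 t = 1" using node_bounds[OF t, of 0] by simp
    have "real (card (odd_levels {m<..m + n} t)) = (\<Sum>i\<in>odd_levels {m<..m + n} t. 1)" by simp
    also have "\<dots> \<le> (\<Sum>i\<in>{0<..0 + (m + n)}. out_coord 0 {m<..m + n} t (sibling (node i t)))"
    proof (rule sum_le_included[where i = id])
      show "\<forall>i\<in>odd_levels {m<..m + n} t. \<exists>j\<in>{0<..0 + (m + n)}. id j = i \<and> 1 \<le> out_coord 0 {m<..m + n} t (sibling (node j t))"
      proof
        fix i assume i: "i \<in> odd_levels {m<..m + n} t"
        then have "sibling (node i t) + 1 = node i t + 0" by (auto simp: odd_levels_def sibling_def odd_pos)
        then have "out_coord 0 {m<..m + n} t (sibling (node i t)) = 1"
          using i unfolding out_coord_def odd_levels_def by auto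
        then show "\<exists>j\<in>{0<..0 + (m + n)}. id j = i \<and> 1 \<le> out_coord 0 {m<..m + n} t (sibling (node j t))"
          using i by (intro bexI[of _ i]) (auto simp: odd_levels_def)
      qed
    qed (auto simp: odd_levels_def out_coord_def)
    also have "\<dots> \<le> tree_gauge (Suc (m + n)) (abs_sq (class_coord v)) (node 0 t)"
      unfolding sq by (rule tree_gauge_ge_siblings) (rule node_Suc_div[OF t(1)])
    also have "\<dots> \<le> (tree_norm (class_coord v))\<^sup>2"
      unfolding n0 by (rule tree_gauge_le_tree_norm[OF v'])
    finally show "real (card (odd_levels {m<..m + n} t)) \<le> sqrt (real n) * vnorm tree_space v"
      using tree_norm_nonneg[OF v'] by (intro card_sq_le card_odd_levels_le) (auto simp: tree_space_simps)
  qed (auto simp: powr_quarter)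
qed

section \<open>The dual of the tree space\<close>

interpretation tree_space: diag_space tree_space class_coord
  by (rule diag_space_tree_space)

abbreviation functional_coord :: "((real \<Rightarrow> complex) set \<Rightarrow> complex) \<Rightarrow> nat \<Rightarrow> complex" where
  "functional_coord \<equiv> tree_space.dual_coord"

lemma dual_carrier: "\<phi> \<in> carrier (dual V) \<longleftrightarrow> \<phi> \<in> carrier (bounded_ops V complex_space)"
  by (simp add: dual_def)

lemma dual_norm_nonneg: "\<phi> \<in> carrier (dual tree_space) \<Longrightarrow> 0 \<le> vnorm (dual tree_space) \<phi>"
  using tree_space.functional.op_norm_nonneg by (simp add: dual_def)

lemma functional_seq_class:
  assumes \<phi>: "\<phi> \<in> carrier (dual tree_space)" and y: "y 0 = 0" "\<And>k. 2 ^ K \<le> k \<Longrightarrow> y k = 0"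
  shows "\<phi> (seq_class y) = (\<Sum>k<2 ^ K. functional_coord \<phi> k * y k)"
    and "cmod (\<phi> (seq_class y)) \<le> vnorm (dual tree_space) \<phi> * sqrt (tree_gauge K (abs_sq y) 1)"
proof -
  note fin = tree_seq_finite_support[of y K, OF y]
  have c: "seq_class y \<in> carrier tree_space" using fin(1) by (simp add: tree_space_simps)
  show "\<phi> (seq_class y) = (\<Sum>k<2 ^ K. functional_coord \<phi> k * y k)"
    using tree_space.functional_finite[OF \<phi> c, of "2 ^ K"] y(2) fin(1) by simp
  have "sqrt (tree_gauge K (abs_sq y) 1) = tree_norm y"
    by (rule real_sqrt_unique[OF fin(2) tree_norm_nonneg[OF fin(1)]])
  then have "vnorm tree_space (seq_class y) = sqrt (tree_gauge K (abs_sq y) 1)"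
    using fin(1) by (simp only: tree_space_simps class_coord_seq_class')
  then show "cmod (\<phi> (seq_class y)) \<le> vnorm (dual tree_space) \<phi> * sqrt (tree_gauge K (abs_sq y) 1)"
    using tree_space.functional.op_norm_bound[OF \<phi>[unfolded dual_carrier] c] by (simp add: dual_def)
qed

text \<open>\<phi> is tested on the norming vector of \<open>tree_cogauge_extremal\<close>, equipped
  with the conjugate phases of the coordinates. The pairing is \<open>D\<close> and the norm of the
  vector at most \<open>sqrt D\<close>, so \<open>sqrt D\<close> is at most the norm of
  \<phi>.\<close>

lemma tree_cogauge_le_dual_norm:
  assumes \<phi>: "\<phi> \<in> carrier (dual tree_space)"
  shows "tree_cogauge d (abs_sq (functional_coord \<phi>)) 1 \<le> (vnorm (dual tree_space) \<phi>)\<^sup>2"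
proof -
  define D where "D = tree_cogauge d (abs_sq (functional_coord \<phi>)) 1"
  obtain x where x: "\<And>k. 0 \<le> x k" "tree_sum d (\<lambda>k. x k * sqrt (abs_sq (functional_coord \<phi>) k)) 1 = D"
    "tree_gauge d (\<lambda>k. (x k)\<^sup>2) 1 = D"
    using tree_cogauge_extremal[of "abs_sq (functional_coord \<phi>)" 1 d] unfolding D_def by auto
  define y where "y k = (if k \<in> {1..<2 ^ d} then of_real (x k) * cnj (sgn (functional_coord \<phi> k)) else 0)" for k
  have y: "y 0 = 0" "\<And>k. 2 ^ d \<le> k \<Longrightarrow> y k = 0" by (auto simp: y_def)
  have sgn: "z * cnj (sgn z) = of_real (cmod z)" for z
    by (cases "z = 0") (auto simp: sgn_eq complex_norm_square[symmetric] power2_eq_square)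
  have "\<phi> (seq_class y) = (\<Sum>k<2 ^ d. functional_coord \<phi> k * y k)" by (rule functional_seq_class(1)[of \<phi> y d, OF \<phi> y])
  also have "\<dots> = (\<Sum>k\<in>{1..<2 ^ d}. of_real (x k * sqrt (abs_sq (functional_coord \<phi>) k)))"
  proof (rule sum.mono_neutral_cong_right)
    fix k :: nat assume "k \<in> {1..<2 ^ d}"
    then have "functional_coord \<phi> k * y k = of_real (x k) * (functional_coord \<phi> k * cnj (sgn (functional_coord \<phi> k)))"
      by (simp add: y_def mult_ac)
    then show "functional_coord \<phi> k * y k = of_real (x k * sqrt (abs_sq (functional_coord \<phi>) k))"
      by (simp add: sgn abs_sq_def)
  qed (auto simp: y_def)
  also have "\<dots> = of_real D" using x(2) by (simp only: tree_sum_root of_real_sum[symmetric])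
  finally have "cmod (\<phi> (seq_class y)) = D" by (simp add: D_def)
  moreover have "tree_gauge d (abs_sq y) 1 \<le> D"
  proof -
    have "abs_sq y k \<le> (x k)\<^sup>2" for k
      using x(1)[of k] by (simp add: abs_sq_def y_def norm_mult norm_sgn power_mult_distrib)
    then have "tree_gauge d (abs_sq y) 1 \<le> tree_gauge d (\<lambda>k. (x k)\<^sup>2) 1" by (intro tree_gauge_mono) auto
    then show ?thesis by (simp only: x(3))
  qed
  then have "vnorm (dual tree_space) \<phi> * sqrt (tree_gauge d (abs_sq y) 1) \<le> vnorm (dual tree_space) \<phi> * sqrt D"
    by (intro mult_left_mono real_sqrt_le_mono dual_norm_nonneg \<phi>)
  ultimately have le: "D \<le> vnorm (dual tree_space) \<phi> * sqrt D"
    using functional_seq_class(2)[of \<phi> y d, OF \<phi> y] by linarith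
  have "D \<le> (vnorm (dual tree_space) \<phi>)\<^sup>2"
  proof (cases "D = 0")
    case False
    then have D: "0 < D" unfolding D_def by (simp add: less_le)
    have "sqrt D * sqrt D \<le> vnorm (dual tree_space) \<phi> * sqrt D" using le D by simp
    then have "sqrt D \<le> vnorm (dual tree_space) \<phi>" using D by (simp only: mult_le_cancel_right_pos real_sqrt_gt_zero)
    then show ?thesis using D by (simp add: sqrt_le_D)
  qed simp
  then show ?thesis by (simp add: D_def)
qed

lemma dual_norm_leI:
  assumes \<phi>: "\<phi> \<in> carrier (dual tree_space)"
    and le: "\<And>d. tree_cogauge d (abs_sq (functional_coord \<phi>)) 1 \<le> B\<^sup>2" and B: "0 \<le> B"
  shows "vnorm (dual tree_space) \<phi> \<le> B"
  unfolding dual_def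
proof (rule tree_space.functional.op_norm_le[OF B])
  fix c assume c: "c \<in> carrier tree_space"
  have c': "class_coord c \<in> tree_seq" by (rule carrier_tree_spaceE[OF c])
  \<comment> \<open>Partial sums up to \<open>2 ^ d\<close> run over complete trees of depth
    \<open>d\<close>, to which \<open>tree_sum_sqrt_le\<close> applies.\<close>
  have lim: "(\<lambda>d. cmod (\<Sum>k<2 ^ d. functional_coord \<phi> k * class_coord c k)) \<longlonglongrightarrow> cmod (\<phi> c)"
    using LIMSEQ_subseq_LIMSEQ[OF tree_space.functional_LIMSEQ[OF \<phi> c], of "\<lambda>d. 2 ^ d"]
    by (intro tendsto_norm) (simp add: strict_mono_def o_def)
  have "cmod (\<Sum>k<2 ^ d. functional_coord \<phi> k * class_coord c k) \<le> B * vnorm tree_space c" for d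
  proof -
    have "(\<Sum>k<2 ^ d. functional_coord \<phi> k * class_coord c k) = (\<Sum>k\<in>{1..<2 ^ d}. functional_coord \<phi> k * class_coord c k)"
      by (intro sum.mono_neutral_right) (auto simp: class_coord_def)
    also have "cmod \<dots> \<le> (\<Sum>k\<in>{1..<2 ^ d}. sqrt (abs_sq (class_coord c) k * abs_sq (functional_coord \<phi>) k))"
      by (intro order_trans[OF norm_sum] sum_mono) (simp add: abs_sq_def norm_mult real_sqrt_mult mult_ac)
    also have "\<dots> = tree_sum d (\<lambda>k. sqrt (abs_sq (class_coord c) k * abs_sq (functional_coord \<phi>) k)) 1"
      by (simp only: tree_sum_root)
    also have "\<dots> \<le> sqrt (tree_gauge d (abs_sq (class_coord c)) 1 * tree_cogauge d (abs_sq (functional_coord \<phi>)) 1)"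
      by (rule tree_sum_sqrt_le) simp_all
    also have "\<dots> \<le> sqrt ((tree_norm (class_coord c))\<^sup>2 * B\<^sup>2)"
      by (intro real_sqrt_le_mono mult_mono le tree_gauge_le_tree_norm c') simp_all
    also have "\<dots> = B * vnorm tree_space c"
      using B tree_norm_nonneg[OF c'] by (simp add: real_sqrt_mult tree_space_simps)
    finally show ?thesis .
  qed
  then show "vnorm complex_space (\<phi> c) \<le> B * vnorm tree_space c"
    by (simp, intro LIMSEQ_le_const2[OF lim]) auto
qed

lemma LIMSEQ_tree_cogauge:
  assumes \<phi>: "\<phi> \<in> carrier (dual tree_space)"
  shows "(\<lambda>d. tree_cogauge d (abs_sq (functional_coord \<phi>)) 1) \<longlonglongrightarrow> (vnorm (dual tree_space) \<phi>)\<^sup>2"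
proof -
  let ?D = "\<lambda>d. tree_cogauge d (abs_sq (functional_coord \<phi>)) 1"
  have bdd: "bdd_above (range ?D)" using tree_cogauge_le_dual_norm[OF \<phi>] by (intro bdd_aboveI2)
  have lim: "?D \<longlonglongrightarrow> (SUP d. ?D d)"
    by (intro LIMSEQ_incseq_SUP bdd incseq_SucI tree_cogauge_depth_mono) simp
  have nn: "0 \<le> (SUP d. ?D d)" using cSUP_upper[OF UNIV_I bdd, of 0] by simp
  have "(SUP d. ?D d) \<le> (vnorm (dual tree_space) \<phi>)\<^sup>2"
    by (intro cSUP_least tree_cogauge_le_dual_norm \<phi>) simp
  moreover have "vnorm (dual tree_space) \<phi> \<le> sqrt (SUP d. ?D d)"
  proof (rule dual_norm_leI[OF \<phi>])
    show "?D d \<le> (sqrt (SUP d. ?D d))\<^sup>2" for d using cSUP_upper[OF UNIV_I bdd, of d] nn by simp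
  qed (use nn in simp)
  then have "(vnorm (dual tree_space) \<phi>)\<^sup>2 \<le> (SUP d. ?D d)"
    using nn dual_norm_nonneg[OF \<phi>] by (intro sqrt_ge_absD) simp
  ultimately show ?thesis using lim by simp
qed

text \<open>In the dual the cogauge itself is superadditive, so the argument of
  \<open>tree_norm_tail\<close> works with one squaring less.\<close>

lemma dual_tail:
  assumes \<phi>: "\<phi> \<in> carrier (dual tree_space)" and e: "0 < e"
  shows "\<exists>K. \<forall>\<psi>\<in>carrier (dual tree_space).
    (\<forall>k. functional_coord \<psi> k = (if k < K then 0 else functional_coord \<phi> k)) \<longrightarrow> vnorm (dual tree_space) \<psi> < e"
proof -
  define L where "L = (vnorm (dual tree_space) \<phi>)\<^sup>2"
  have "eventually (\<lambda>d. L - (e / 2)\<^sup>2 < tree_cogauge d (abs_sq (functional_coord \<phi>)) 1) sequentially"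
    by (rule order_tendstoD(1)[OF LIMSEQ_tree_cogauge[OF \<phi>]]) (use e in \<open>simp add: L_def\<close>)
  then obtain d where d: "L - (e / 2)\<^sup>2 < tree_cogauge d (abs_sq (functional_coord \<phi>)) 1"
    by (meson eventually_sequentially order_refl)
  have inc: "incseq (\<lambda>d. tree_cogauge d (abs_sq x) 1)" for x
    by (intro incseq_SucI tree_cogauge_depth_mono) simp
  define s where "s = (\<lambda>k. if k < 2 ^ d then functional_coord \<phi> k else 0)"
  show ?thesis
  proof (intro exI[of _ "2 ^ d"] ballI impI)
    fix \<psi> assume \<psi>: "\<psi> \<in> carrier (dual tree_space)"
      and tail: "\<forall>k. functional_coord \<psi> k = (if k < 2 ^ d then 0 else functional_coord \<phi> k)"
    have "tree_cogauge j (abs_sq (functional_coord \<psi>)) 1 \<le> (e / 2)\<^sup>2" for j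
    proof -
      let ?j = "d + j"
      have "tree_cogauge ?j (abs_sq s) 1 + tree_cogauge ?j (abs_sq (functional_coord \<psi>)) 1
          \<le> tree_cogauge ?j (\<lambda>k. abs_sq s k + abs_sq (functional_coord \<psi>) k) 1"
        by (rule tree_cogauge_superadditive) simp_all
      also have "(\<lambda>k. abs_sq s k + abs_sq (functional_coord \<psi>) k) = abs_sq (functional_coord \<phi>)"
        using tail by (auto simp: s_def abs_sq_def)
      also have "tree_cogauge ?j (abs_sq (functional_coord \<phi>)) 1 \<le> L"
        unfolding L_def by (rule tree_cogauge_le_dual_norm[OF \<phi>])
      finally have "tree_cogauge ?j (abs_sq s) 1 + tree_cogauge ?j (abs_sq (functional_coord \<psi>)) 1 \<le> L" .
      moreover have "tree_cogauge d (abs_sq (functional_coord \<phi>)) 1 = tree_cogauge d (abs_sq s) 1"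
        by (rule tree_cogauge_cong_root) (simp add: s_def abs_sq_def)
      moreover have "tree_cogauge d (abs_sq s) 1 \<le> tree_cogauge ?j (abs_sq s) 1" by (rule incseqD[OF inc]) simp
      moreover have "tree_cogauge j (abs_sq (functional_coord \<psi>)) 1 \<le> tree_cogauge ?j (abs_sq (functional_coord \<psi>)) 1"
        by (rule incseqD[OF inc]) simp
      ultimately show ?thesis using d by linarith
    qed
    then have "vnorm (dual tree_space) \<psi> \<le> e / 2" using e by (intro dual_norm_leI \<psi>) auto
    then show "vnorm (dual tree_space) \<psi> < e" using e by linarith
  qed
qed

lemma diag_space_dual_tree_space: "diag_space (dual tree_space) functional_coord"
proof -
  interpret coord_space "dual tree_space" functional_coord by (rule tree_space.coord_space_dual)
  show ?thesis
  proof
    show "\<exists>C. \<forall>N x y. (\<forall>n<N. x n \<in> carrier (dual tree_space) \<and> y n \<in> carrier (dual tree_space) \<and>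
        (\<forall>k. cmod (functional_coord (y n) k) \<le> cmod (functional_coord (x n) k))) \<longrightarrow>
      rademacher_norm (dual tree_space) N y \<le> C * rademacher_norm (dual tree_space) N x"
    proof (rule rademacher_domination[where Q = "\<lambda>d a. tree_cogauge d a 1" and c = 1 and c' = 4])
      fix \<phi> assume \<phi>: "\<phi> \<in> carrier (dual tree_space)"
      show "(\<lambda>d. tree_cogauge d (\<lambda>k. cmod (functional_coord \<phi> k) ^ 2) 1) \<longlonglongrightarrow> (vnorm (dual tree_space) \<phi>)\<^sup>2"
        using LIMSEQ_tree_cogauge[OF \<phi>] by (simp add: abs_sq_def[abs_def])
      show "tree_cogauge d (\<lambda>k. cmod (functional_coord \<phi> k) ^ 2) 1 \<le> (vnorm (dual tree_space) \<phi>)\<^sup>2" for d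
        using tree_cogauge_le_dual_norm[OF \<phi>, of d] by (simp add: abs_sq_def[abs_def])
    next
      show "(\<integral>\<epsilon>. tree_cogauge d (rad_sq N x \<epsilon>) 1 \<partial>steinhaus_seq) \<le> 1 * tree_cogauge d (sq_fun N x) 1" for d N x
        using integral_tree_cogauge_le[of d N x 1] by simp
    qed (rule tree_cogauge_nonneg integrable_tree_cogauge tree_cogauge_sq_fun_le | simp add: tree_cogauge_mono)+
    show "functional_coord \<phi> 0 = 0" for \<phi> by (simp add: tree_space.dual_coord_def)
  qed (rule tree_space.dual_coord_inj tree_space.dual_solid tree_space.dual_unit dual_tail; assumption)+
qed

lemma max_reg_test_dual_tree_space:
  "max_reg_test (dual tree_space) functional_coord 1 sqrt (\<lambda>n. real n powr (1 / 4))"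
proof -
  interpret diag_space "dual tree_space" functional_coord by (rule diag_space_dual_tree_space)
  show ?thesis
  proof
    fix m n t \<phi>
    assume t: "0 \<le> t" "t < 1" and \<phi>: "\<phi> \<in> carrier (dual tree_space)"
      "functional_coord \<phi> = (\<lambda>k. of_real (in_coord 1 {m<..m + n} t k))"
    define D where "D = {m<..m + n}"
    have n0: "node 0 t = 1" using node_bounds[OF t, of 0] by simp
    show "vnorm (dual tree_space) \<phi> \<le> sqrt (real n)"
      unfolding dual_def
    proof (rule tree_space.functional.op_norm_le)
      fix c assume c: "c \<in> carrier tree_space"
      have c': "class_coord c \<in> tree_seq" by (rule carrier_tree_spaceE[OF c])
      define b where "b i = cmod (class_coord c (sibling (node i t)))" for i
      have "(\<Sum>i\<in>D. (b i)\<^sup>2) \<le> (\<Sum>i\<in>{0<..0 + (m + n)}. abs_sq (class_coord c) (sibling (node i t)))"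
        unfolding b_def abs_sq_def D_def by (intro sum_mono2) auto
      also have "\<dots> \<le> tree_gauge (Suc (m + n)) (abs_sq (class_coord c)) (node 0 t)"
        by (rule tree_gauge_ge_siblings) (rule node_Suc_div[OF t(1)])
      also have "\<dots> \<le> (vnorm tree_space c)\<^sup>2"
        unfolding n0 tree_space_simps by (rule tree_gauge_le_tree_norm[OF c'])
      finally have b: "(\<Sum>i\<in>D. (b i)\<^sup>2) \<le> (vnorm tree_space c)\<^sup>2" .
      \<comment> \<open>The siblings span an l^2-sum in \<open>X\<close>, so a functional with
        coordinates 1 on \<open>n\<close> of them costs the factor \<open>sqrt n\<close> of
        Cauchy-Schwarz.\<close>
      have "(\<Sum>i\<in>D. b i)\<^sup>2 \<le> (\<Sum>i\<in>D. (b i)\<^sup>2) * card D" by (rule sum_squared_le_sum_of_squares)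
      also have "\<dots> \<le> (vnorm tree_space c)\<^sup>2 * card D" using b by (intro mult_right_mono) auto
      also have "\<dots> = (sqrt n * vnorm tree_space c)\<^sup>2" by (simp add: D_def power_mult_distrib)
      finally have b_sq: "(\<Sum>i\<in>D. b i)\<^sup>2 \<le> (sqrt n * vnorm tree_space c)\<^sup>2" .
      have b_sum: "(\<Sum>i\<in>D. b i) \<le> sqrt n * vnorm tree_space c"
        by (rule power2_le_imp_le[OF b_sq]) (simp add: tree_space.vnorm_nonneg[OF c])
      have "cmod (\<Sum>k<K. functional_coord \<phi> k * class_coord c k) \<le> sqrt n * vnorm tree_space c" for K
      proof -
        have "cmod (\<Sum>k<K. functional_coord \<phi> k * class_coord c k) \<le> (\<Sum>k<K. in_coord 1 D t k * cmod (class_coord c k))"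
          unfolding \<phi>(2) D_def[symmetric]
          by (intro order_trans[OF norm_sum] sum_mono) (simp add: norm_mult in_coord_def)
        also have "\<dots> = (\<Sum>k | k < K \<and> in_coord 1 D t k \<noteq> 0. cmod (class_coord c k))"
          by (intro sum.mono_neutral_cong_right) (auto simp: in_coord_def split: if_splits)
        also have "\<dots> \<le> (\<Sum>i\<in>D. b i)"
        proof (rule sum_le_included[where i = "\<lambda>i. sibling (node i t)"])
          show "\<forall>k\<in>{k. k < K \<and> in_coord 1 D t k \<noteq> 0}.
              \<exists>i\<in>D. sibling (node i t) = k \<and> cmod (class_coord c k) \<le> b i"
            by (auto simp: in_coord_def b_def sibling_def split: if_splits)
        qed (auto simp: D_def b_def)
        finally show ?thesis using b_sum by linarith
      qed
      then have "cmod (\<phi> c) \<le> sqrt n * vnorm tree_space c"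
        by (intro LIMSEQ_le_const2[OF tendsto_norm[OF tree_space.functional_LIMSEQ[OF \<phi>(1) c]]]) auto
      then show "vnorm complex_space (\<phi> c) \<le> sqrt (real n) * vnorm tree_space c" by simp
    qed simp
  next
    fix m n t \<phi>
    assume t: "0 \<le> t" "t < 1" and \<phi>: "\<phi> \<in> carrier (dual tree_space)"
      "functional_coord \<phi> = (\<lambda>k. of_real (out_coord 1 {m<..m + n} t k))"
    define D where "D = odd_levels {m<..m + n} t"
    define K where "K = Suc (m + n)"
    define y where "y = (\<lambda>k. complex_of_real (out_coord 1 {m<..m + n} t k))"
    have out: "out_coord (Suc 0) {m<..m + n} t k = (if k \<in> (\<lambda>i. node i t) ` D then 1 else 0)" for k
      by (auto simp: out_coord_def D_def odd_levels_def)
    have range: "1 \<le> node i t \<and> node i t < 2 ^ K" if "i \<in> D" for i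
    proof -
      have "(1 :: nat) \<le> 2 ^ i" "(2 :: nat) ^ Suc i \<le> 2 ^ K"
        using that by (auto simp: K_def D_def odd_levels_def simp del: power_Suc intro!: power_increasing)
      then show ?thesis using node_bounds[OF t, of i] by linarith
    qed
    have y: "y 0 = 0" "\<And>k. 2 ^ K \<le> k \<Longrightarrow> y k = 0"
    proof -
      have "1 \<le> k \<and> k < 2 ^ K" if "k \<in> (\<lambda>i. node i t) ` D" for k using that range by blast
      then have *: "0 \<notin> (\<lambda>i. node i t) ` D" "\<And>k. 2 ^ K \<le> k \<Longrightarrow> k \<notin> (\<lambda>i. node i t) ` D"
        by (metis not_one_le_zero, metis not_less)
      show "y 0 = 0" "\<And>k. 2 ^ K \<le> k \<Longrightarrow> y k = 0" by (simp_all add: y_def out *)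
    qed
    have sub: "(\<lambda>i. node i t) ` D \<subseteq> {..<2 ^ K}" using range by auto
    \<comment> \<open>\<phi> is tested on its own indicator: the pairing counts the odd levels,
      while as a vector of \<open>X\<close> the indicator lies on a branch and has norm at most
      \<open>n powr (1 / 4)\<close>.\<close>
    have "\<phi> (seq_class y) = (\<Sum>k<2 ^ K. functional_coord \<phi> k * y k)" by (rule functional_seq_class(1)[of \<phi> y K, OF \<phi>(1) y])
    also have "\<dots> = (\<Sum>k<2 ^ K. if k \<in> (\<lambda>i. node i t) ` D then 1 else 0)"
      by (intro sum.cong) (auto simp: \<phi>(2) y_def out)
    also have "\<dots> = of_nat (card ({..<2 ^ K} \<inter> (\<lambda>i. node i t) ` D))" by (simp add: sum.If_cases)
    also have "{..<2 ^ K} \<inter> (\<lambda>i. node i t) ` D = (\<lambda>i. node i t) ` D" using sub by blast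
    also have "card \<dots> = card D" by (rule card_image, rule inj_onI, erule node_inj[OF t])
    finally have "cmod (\<phi> (seq_class y)) = card D" by simp
    moreover have "sqrt (tree_gauge K (abs_sq y) 1) \<le> real n powr (1 / 4)"
    proof -
      have "abs_sq y = out_coord 1 {m<..m + n} t" by (auto simp: abs_sq_def y_def out)
      then have "tree_gauge K (abs_sq y) 1 \<le> sqrt n"
        by (simp only:) (rule tree_gauge_chain_le[OF t, where m = m],
          auto simp: out_coord_def split: if_splits)
      also have "sqrt (real n) = (real n powr (1 / 4))\<^sup>2" by (simp only: powr_quarter)
      finally show ?thesis by (intro real_le_lsqrt) auto
    qed
    then have "vnorm (dual tree_space) \<phi> * sqrt (tree_gauge K (abs_sq y) 1) \<le> vnorm (dual tree_space) \<phi> * real n powr (1 / 4)"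
      by (intro mult_left_mono dual_norm_nonneg \<phi>(1))
    ultimately have "real (card D) \<le> vnorm (dual tree_space) \<phi> * real n powr (1 / 4)"
      using functional_seq_class(2)[of \<phi> y K, OF \<phi>(1) y] by linarith
    then show "real (card (odd_levels {m<..m + n} t)) \<le> real n powr (1 / 4) * vnorm (dual tree_space) \<phi>"
      by (simp add: D_def mult.commute)
  next
    show "sqrt (real n) * real n powr (1 / 4) \<le> real n powr (3 / 4)" if "1 \<le> n" for n
      using powr_quarter(2)[OF that] by (simp add: mult.commute)
  qed auto
qed

theorem corollary3p10:
  shows "\<exists>(M :: real measure) (X :: (real \<Rightarrow> complex) set cnormed) A.
    banach_function_space M X \<and>
    sectorial X A \<and>
    R_sectorial X A \<and>
    R_sectorial (dual X) (adjoint_op X A) \<and>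
    has_bounded_H_infty_calculus_of_angle X A 0 \<and>
    has_bounded_H_infty_calculus_of_angle (dual X) (adjoint_op X A) 0 \<and>
    (\<forall>p>1.
      (\<forall>T>0. \<not> maximal_regularity X A p {0<..<T} \<and>
              \<not> maximal_regularity (dual X) (adjoint_op X A) p {0<..<T}) \<and>
      \<not> maximal_regularity X A p {0<..} \<and>
      \<not> maximal_regularity (dual X) (adjoint_op X A) p {0<..})"
proof -
  interpret X: max_reg_test tree_space class_coord 0 "\<lambda>n. real n powr (1 / 4)" sqrt
    by (rule max_reg_test_tree_space)
  interpret X': max_reg_test "dual tree_space" functional_coord 1 sqrt "\<lambda>n. real n powr (1 / 4)"
    by (rule max_reg_test_dual_tree_space)
  \<comment> \<open>Equality of graphs, so all results on diagonal operators transfer verbatim to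
    the adjoint.\<close>
  have adj: "adjoint_op tree_space tree_space.diag_op = X'.diag_op"
    unfolding X'.diag_op_def by (rule tree_space.adjoint_diag_op)
  show ?thesis
  proof (intro exI conjI allI impI)
    show "banach_function_space node_measure tree_space" by (rule banach_function_space_tree_space)
    show "sectorial tree_space tree_space.diag_op" by (rule tree_space.sectorial_diag_op)
    show "R_sectorial tree_space tree_space.diag_op" by (rule tree_space.R_sectorial_diag_op)
    show "R_sectorial (dual tree_space) (adjoint_op tree_space tree_space.diag_op)"
      unfolding adj by (rule X'.R_sectorial_diag_op)
    show "has_bounded_H_infty_calculus_of_angle tree_space tree_space.diag_op 0" by (rule tree_space.H_infty_calculus_diag_op)
    show "has_bounded_H_infty_calculus_of_angle (dual tree_space) (adjoint_op tree_space tree_space.diag_op) 0"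
      unfolding adj by (rule X'.H_infty_calculus_diag_op)
    fix p :: real assume p: "1 < p"
    show "\<not> maximal_regularity tree_space tree_space.diag_op p {0<..<T}" if "0 < T" for T
      by (rule X.not_maximal_regularity[OF p _ order_refl that]) simp
    show "\<not> maximal_regularity (dual tree_space) (adjoint_op tree_space tree_space.diag_op) p {0<..<T}" if "0 < T" for T
      unfolding adj by (rule X'.not_maximal_regularity[OF p _ order_refl that]) simp
    show "\<not> maximal_regularity tree_space tree_space.diag_op p {0<..}"
      by (rule X.not_maximal_regularity[OF p, where T = 1]) auto
    show "\<not> maximal_regularity (dual tree_space) (adjoint_op tree_space tree_space.diag_op) p {0<..}"
      unfolding adj by (rule X'.not_maximal_regularity[OF p, where T = 1]) auto
  qed
qed

end
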